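(* Let $G\rightrightarrows M$ be a Lie groupoid with Lie algebroid $A$, let $V\to M$ be a representation of $G$, and fix (a germ of) a tubular structure for $G$. Let $$\mathrm{VE}_G=\mathsf p\circ(1+\mathsf d\mathsf h)^{-1}\circ\mathsf j\colon\mathsf C^\bullet(G,V)_M\to\mathsf C^\bullet(A,V),\qquad R_G=\mathsf q\circ(1+\delta\mathsf k)^{-1}\circ\mathsf i\colon\mathsf C^\bullet(A,V)\to\mathsf C^\bullet(G,V)_M$$ be the van Est differentiation and integration maps defined in the context. Then $R_G$ is a right inverse to $\mathrm{VE}_G$ at the level of cochains: $$\mathrm{VE}_G\circ R_G=\mathrm{id}_{\mathsf C(A,V)}.$$
   Context: Groupoid notation: $\mathsf s,\mathsf t\colon G\to M$ are source and target; $gh$ is defined when $\mathsf s(g)=\mathsf t(h)$; $u\colon M\to G$ is the inclusion of units and $M$ is identified with $u(M)$. $B_pG$ is the manifold of composable $p$-tuples $(g_1,\ldots,g_p)$, $\mathsf s(g_i)=\mathsf t(g_{i+1})$, with base points $m_0=\mathsf t(g_1)$, $m_i=\mathsf s(g_i)$; $B_0G=M$. $E_pG=B_pG\times_MG=\{(g_1,\ldots,g_p;g): m_p=\mathsf t(g)\}$, with $\pi_p(g_1,\ldots,g_p;g)=\mathsf s(g)$. $M$ sits in $B_pG$ and in $E_pG$ as constant arrows. A subscript $M$ on a space of sections or forms means germs along $M$. Complexes: $A=\ker(T\mathsf t)|_M$, with sections identified with left-invariant vector fields on $G$ (tangent to $\mathsf t$-fibers). $\mathsf C^p(G,V)_M$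 is the space of germs along $M$ of sections $\sigma$ over $B_pG$ with $\sigma(g_1,\ldots,g_p)\in V_{m_p}$, with $(\delta\sigma)(g_1,\ldots,g_{p+1})=\sigma(g_2,\ldots,g_{p+1})+\sum_{i=1}^p(-1)^i\sigma(g_1,\ldots,g_ig_{i+1},\ldots,g_{p+1})+(-1)^{p+1}g_{p+1}^{-1}\cdot\sigma(g_1,\ldots,g_p)$ (for $p=0$: $(\delta\sigma)(g_1)=\sigma(\mathsf s(g_1))-g_1^{-1}\cdot\sigma(\mathsf t(g_1))$). $\mathsf C^q(A,V)=\Gamma(V\otimes\wedge^qA^* )$; each $\alpha\in\mathsf C^q(A,V)$ extends uniquely to a left-invariant $\mathsf t$-fiberwise form $\alpha^L$ on $G$ with values in $\mathsf t^*V$, namely $\alpha^L_g=g\cdot\alpha_{\mathsf s(g)}$ (left translation $A_{\mathsf s(g)}\cong T_g\mathsf t^{-1}(\mathsf t(g))$ and $g\colon V_{\mathsf s(g)}\to V_{\mathsf t(g)}$), and the Chevalley-Eilenberg differential $\mathsf d_{CE}$ corresponds to the $\mathsf t$-fiberwise de Rham differential. Double complex: $\mathsf D^{p,q}(G,V)_M$ is the space of germs along $M\subset E_pG$ of sections $\psi$ of $\pi_p^*(V\otimes\wedge^qA^* )$. Horizontal differential: $(\delta\psi)(g_1,\ldots,g_{p+1};g)=\psi(g_2,\ldots,g_{p+1};g)+\sum_{i=1}^p(-1)^i\psi(g_1,\ldots,g_ig_{i+1},\ldots,g_{p+1};g)+(-1)^{p+1}\psi(g_1,\ldots,g_p;g_{p+1}g)$.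 Form picture: $\psi$ corresponds to the family $\beta$ of forms along the fibers of $E_pG\to B_pG$ given by $\beta(g_1,\ldots,g_p)_g=g\cdot\psi(g_1,\ldots,g_p;g)$, so that $\beta(g_1,\ldots,g_p)$ is a $V_{m_p}$-valued $q$-form on (a part of) $\mathsf t^{-1}(m_p)$. Vertical differential: $\mathsf d=(-1)^p\mathsf d_{Rh}$, where $\mathsf d_{Rh}$ is the de Rham differential of the forms $\beta(g_1,\ldots,g_p)$. Maps for differentiation: $(\mathsf j\sigma)(g_1,\ldots,g_p;g)=g^{-1}\cdot\sigma(g_1,\ldots,g_p)$ in $\mathsf D^{p,0}$; $(\mathsf h\psi)(g_1,\ldots,g_{p-1};g)=(-1)^p\psi(g_1,\ldots,g_{p-1},g;\mathsf s(g))$ for bidegree $(p,q)$, $p>0$, and $\mathsf h=0$ for $p=0$; $\mathsf p(\psi)=u^*\psi\in\Gamma(V\otimes\wedge^qA^* )$ on bidegree $(0,q)$ and $\mathsf p=0$ for $p>0$. Maps for integration: $\mathsf i(\alpha)=\pi_0^*\alpha\in\mathsf D^{0,q}$ (form picture: $\alpha^L$). A tubular structure is a tubular neighborhood embedding $A\to G$ (or germ thereof along $M$) taking fibers of $A\to M$ to $\mathsf t$-fibers, restricting to $u$ on the zero section, with differential along $M$ the identity of $A$. It transports scalar multiplication by $t\in[0,1]$ on $A$ to a germ of a retraction $\lambda_t$ of $G$ along $\mathsf t$-fibers, with $\lambda_1=\mathrm{id}$, $\lambda_0=u\circ\mathsf t$. Let $T\beta=\int_0^1\iota_{\partial_t}(\lambda^*\beta)\,dt$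 be the de Rham homotopy operator on $\mathsf t$-fiberwise forms, and $(\mathsf k\beta)(g_1,\ldots,g_p)=(-1)^pT(\beta(g_1,\ldots,g_p))$. On bidegree $(p,0)$, $(\mathsf q\beta)(g_1,\ldots,g_p)=\beta(g_1,\ldots,g_p)|_{u(m_p)}\in V_{m_p}$; $\mathsf q=0$ on bidegree $(p,q)$ with $q>0$. On degree $p$ elements, $\mathrm{VE}_G=(-1)^p\mathsf p(\mathsf d\mathsf h)^p\mathsf j$ and $R_G=(-1)^p\mathsf q(\delta\mathsf k)^p\mathsf i$. *)

theory Defs
  imports "HOL-Analysis.Analysis"
begin

section \<open>Smooth functions on open subsets of Euclidean space\<close>

text \<open>\<open>Euclidean_space n\<close> is the space of all \<open>x :: nat \<Rightarrow> real\<close> with \<open>x i = 0\<close> for \<open>i \<ge> n\<close>.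
  It is used as the model of n-space because the manifolds of composable tuples require all
  dimensions simultaneously, including dimension 0.\<close>

definition partial :: "nat \<Rightarrow> ((nat \<Rightarrow> real) \<Rightarrow> real) \<Rightarrow> (nat \<Rightarrow> real) \<Rightarrow> real" where
  "partial i f x = deriv (\<lambda>t. f (x(i := t))) (x i)"

definition smooth_real :: "nat \<Rightarrow> (nat \<Rightarrow> real) set \<Rightarrow> ((nat \<Rightarrow> real) \<Rightarrow> real) \<Rightarrow> bool" where
  "smooth_real n S f \<longleftrightarrow> openin (Euclidean_space n) S \<and>
     (\<forall>js. set js \<subseteq> {..<n} \<longrightarrow>
        continuous_map (subtopology (Euclidean_space n) S) euclideanreal (foldr partial js f) \<and>
        (\<forall>x\<in>S. \<forall>i<n. (\<lambda>t. foldr partial js f (x(i := t))) field_differentiable at (x i)))"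

section \<open>Manifolds and tangent vectors\<close>

record 'a manifold =
  mtop :: "'a topology"
  mdim :: nat
  atlas :: "('a set \<times> ('a \<Rightarrow> nat \<Rightarrow> real)) set"

abbreviation pts :: "'a manifold \<Rightarrow> 'a set" where
  "pts X \<equiv> topspace (mtop X)"

text \<open>Neither the Hausdorff property nor second countability is part of this definition.\<close>

definition smooth_manifold :: "'a manifold \<Rightarrow> bool" where
  "smooth_manifold X \<longleftrightarrow>
     pts X = (\<Union>(U, \<phi>)\<in>atlas X. U) \<and>
     (\<forall>(U, \<phi>)\<in>atlas X. openin (mtop X) U \<and> openin (Euclidean_space (mdim X)) (\<phi> ` U) \<and>
        homeomorphic_map (subtopology (mtop X) U)
          (subtopology (Euclidean_space (mdim X)) (\<phi> ` U)) \<phi>) \<and>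
     (\<forall>(U, \<phi>)\<in>atlas X. \<forall>(W, \<psi>)\<in>atlas X. \<forall>i<mdim X.
        smooth_real (mdim X) (\<phi> ` (U \<inter> W)) (\<lambda>y. \<psi> (inv_into U \<phi> y) i))"

definition smooth_fun :: "'a manifold \<Rightarrow> 'a set \<Rightarrow> ('a \<Rightarrow> real) \<Rightarrow> bool" where
  "smooth_fun X S f \<longleftrightarrow> openin (mtop X) S \<and>
     (\<forall>(U, \<phi>)\<in>atlas X. smooth_real (mdim X) (\<phi> ` (U \<inter> S)) (\<lambda>y. f (inv_into U \<phi> y)))"

definition smooth_at :: "'a manifold \<Rightarrow> ('a \<Rightarrow> real) \<Rightarrow> 'a \<Rightarrow> bool" where
  "smooth_at X f x \<longleftrightarrow> (\<exists>S. x \<in> S \<and> smooth_fun X S f)"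

text \<open>Smooth maps from an open subset \<open>S\<close> of n-space into a manifold. Smoothness on the fibre
  products \<open>B\<^sub>pG\<close>, on \<open>A\<close> and on \<open>V\<close> below is expressed by composition with all such maps;
  composing with inverses of charts of these manifolds gives smoothness in charts.\<close>

definition plot :: "'a manifold \<Rightarrow> nat \<Rightarrow> (nat \<Rightarrow> real) set \<Rightarrow> ((nat \<Rightarrow> real) \<Rightarrow> 'a) \<Rightarrow> bool" where
  "plot X n S c \<longleftrightarrow> openin (Euclidean_space n) S \<and> c ` S \<subseteq> pts X \<and>
     (\<forall>(U, \<phi>)\<in>atlas X. openin (Euclidean_space n) {y \<in> S. c y \<in> U} \<and>
        (\<forall>i<mdim X. smooth_real n {y \<in> S. c y \<in> U} (\<lambda>y. \<phi> (c y) i)))"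

definition smooth_map :: "'a manifold \<Rightarrow> 'b manifold \<Rightarrow> ('a \<Rightarrow> 'b) \<Rightarrow> bool" where
  "smooth_map X Y f \<longleftrightarrow> (\<forall>(U, \<phi>)\<in>atlas X. plot Y (mdim X) (\<phi> ` U) (\<lambda>y. f (inv_into U \<phi> y)))"

text \<open>A germ at 0 of a smooth curve.\<close>

definition smooth_curve :: "'a manifold \<Rightarrow> (real \<Rightarrow> 'a) \<Rightarrow> bool" where
  "smooth_curve X c \<longleftrightarrow>
     (\<exists>e>0. plot X 1 {y \<in> topspace (Euclidean_space 1). \<bar>y 0\<bar> < e} (\<lambda>y. c (y 0)))"

text \<open>Tangent vectors are the derivations at a point defined by smooth curves through that point.
  They are normalised to be 0 on functions that are not smooth near the base point; hence zero
  vectors at different points coincide as functionals, and the base point has to be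
  carried along separately.\<close>

type_synonym 'a tvec = "('a \<Rightarrow> real) \<Rightarrow> real"

definition velocity :: "'a manifold \<Rightarrow> (real \<Rightarrow> 'a) \<Rightarrow> 'a tvec" where
  "velocity X c = (\<lambda>f. if smooth_at X f (c 0) then deriv (\<lambda>r. f (c r)) 0 else 0)"

definition tangent_space :: "'a manifold \<Rightarrow> 'a \<Rightarrow> 'a tvec set" where
  "tangent_space X x = {velocity X c | c. smooth_curve X c \<and> c 0 = x}"

definition tv_add :: "'a tvec \<Rightarrow> 'a tvec \<Rightarrow> 'a tvec" where
  "tv_add v w = (\<lambda>f. v f + w f)"

definition tv_scale :: "real \<Rightarrow> 'a tvec \<Rightarrow> 'a tvec" where
  "tv_scale r v = (\<lambda>f. r * v f)"

definition tangent_map :: "'a manifold \<Rightarrow> 'b manifold \<Rightarrow> ('a \<Rightarrow> 'b) \<Rightarrow> 'a \<Rightarrow> 'a tvec \<Rightarrow> 'b tvec" where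
  "tangent_map X Y f x v = (\<lambda>h. if smooth_at Y h (f x) then v (\<lambda>z. h (f z)) else 0)"

definition submersion :: "'a manifold \<Rightarrow> 'b manifold \<Rightarrow> ('a \<Rightarrow> 'b) \<Rightarrow> bool" where
  "submersion X Y f \<longleftrightarrow> smooth_map X Y f \<and>
     (\<forall>x\<in>pts X. tangent_map X Y f x ` tangent_space X x = tangent_space Y (f x))"

section \<open>Lie groupoids\<close>

record ('g, 'm) groupoid =
  arrows :: "'g manifold"
  objects :: "'m manifold"
  src :: "'g \<Rightarrow> 'm"
  tgt :: "'g \<Rightarrow> 'm"
  idt :: "'m \<Rightarrow> 'g"
  mlt :: "'g \<Rightarrow> 'g \<Rightarrow> 'g"
  ivs :: "'g \<Rightarrow> 'g"

abbreviation Arr :: "('g, 'm) groupoid \<Rightarrow> 'g set" where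
  "Arr G \<equiv> pts (arrows G)"

abbreviation Obj :: "('g, 'm) groupoid \<Rightarrow> 'm set" where
  "Obj G \<equiv> pts (objects G)"

definition groupoid_axioms :: "('g, 'm) groupoid \<Rightarrow> bool" where
  "groupoid_axioms G \<longleftrightarrow>
     (\<forall>g\<in>Arr G. src G g \<in> Obj G \<and> tgt G g \<in> Obj G) \<and>
     (\<forall>m\<in>Obj G. idt G m \<in> Arr G \<and> src G (idt G m) = m \<and> tgt G (idt G m) = m) \<and>
     (\<forall>g\<in>Arr G. \<forall>h\<in>Arr G. src G g = tgt G h \<longrightarrow>
        mlt G g h \<in> Arr G \<and> src G (mlt G g h) = src G h \<and> tgt G (mlt G g h) = tgt G g) \<and>
     (\<forall>g\<in>Arr G. \<forall>h\<in>Arr G. \<forall>k\<in>Arr G. src G g = tgt G h \<and> src G h = tgt G k \<longrightarrow>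
        mlt G (mlt G g h) k = mlt G g (mlt G h k)) \<and>
     (\<forall>g\<in>Arr G. mlt G g (idt G (src G g)) = g \<and> mlt G (idt G (tgt G g)) g = g) \<and>
     (\<forall>g\<in>Arr G. ivs G g \<in> Arr G \<and> src G (ivs G g) = tgt G g \<and> tgt G (ivs G g) = src G g \<and>
        mlt G g (ivs G g) = idt G (tgt G g) \<and> mlt G (ivs G g) g = idt G (src G g))"

text \<open>As is customary, the space of arrows is not required to be Hausdorff.\<close>

definition lie_groupoid :: "('g, 'm) groupoid \<Rightarrow> bool" where
  "lie_groupoid G \<longleftrightarrow> groupoid_axioms G \<and>
     smooth_manifold (objects G) \<and> Hausdorff_space (mtop (objects G)) \<and>
       second_countable (mtop (objects G)) \<and>
     smooth_manifold (arrows G) \<and>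
     submersion (arrows G) (objects G) (src G) \<and> submersion (arrows G) (objects G) (tgt G) \<and>
     smooth_map (objects G) (arrows G) (idt G) \<and> smooth_map (arrows G) (arrows G) (ivs G) \<and>
     (\<forall>n S c d. plot (arrows G) n S c \<and> plot (arrows G) n S d \<and> (\<forall>y\<in>S. src G (c y) = tgt G (d y)) \<longrightarrow>
        plot (arrows G) n S (\<lambda>y. mlt G (c y) (d y)))"

section \<open>The Lie algebroid as a vector bundle\<close>

definition algebroid :: "('g, 'm) groupoid \<Rightarrow> 'm \<Rightarrow> 'g tvec set" where
  "algebroid G m = {a \<in> tangent_space (arrows G) (idt G m).
     \<forall>f. tangent_map (arrows G) (objects G) (tgt G) (idt G m) a f = 0}"

text \<open>Smooth maps \<open>y \<mapsto> (\<mu> y, a y)\<close> from an open subset of n-space into the total space of \<open>A\<close>;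
  taking chart coordinates for \<open>f\<close> gives the components of \<open>a\<close>.\<close>

definition algebroid_plot :: "('g, 'm) groupoid \<Rightarrow> nat \<Rightarrow> (nat \<Rightarrow> real) set \<Rightarrow>
    ((nat \<Rightarrow> real) \<Rightarrow> 'm) \<Rightarrow> ((nat \<Rightarrow> real) \<Rightarrow> 'g tvec) \<Rightarrow> bool" where
  "algebroid_plot G n S \<mu> a \<longleftrightarrow> plot (objects G) n S \<mu> \<and> (\<forall>y\<in>S. a y \<in> algebroid G (\<mu> y)) \<and>
     (\<forall>U f. smooth_fun (arrows G) U f \<longrightarrow>
        smooth_real n {y \<in> S. idt G (\<mu> y) \<in> U} (\<lambda>y. a y f))"

text \<open>Tangent vectors along t-fibres and their images under maps defined along t-fibres.\<close>

definition fibre_curve :: "('g, 'm) groupoid \<Rightarrow> (real \<Rightarrow> 'g) \<Rightarrow> bool" where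
  "fibre_curve G c \<longleftrightarrow> smooth_curve (arrows G) c \<and> (\<forall>\<^sub>F r in nhds 0. tgt G (c r) = tgt G (c 0))"

definition push :: "('g, 'm) groupoid \<Rightarrow> ('g \<Rightarrow> 'g) \<Rightarrow> 'g \<Rightarrow> 'g tvec \<Rightarrow> 'g tvec" where
  "push G f g w =
     (let c = (SOME c. fibre_curve G c \<and> c 0 = g \<and> velocity (arrows G) c = w)
      in velocity (arrows G) (\<lambda>r. f (c r)))"

section \<open>Representations\<close>

text \<open>The fibres of \<open>V\<close> are finite-dimensional linear subspaces of one Banach space \<open>'v\<close>. This
  only serves to share one set of vector space operations: any family of finite-dimensional
  vector spaces embeds fibrewise into a Banach space, no relation is required between the
  subspaces for different points, and the smooth structure of \<open>V\<close> is given by local frames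
  alone.\<close>

record ('g, 'm, 'v) rep_bundle =
  fibre :: "'m \<Rightarrow> 'v set"
  rank :: nat
  frames :: "('m set \<times> ('m \<Rightarrow> nat \<Rightarrow> 'v)) set"
  act :: "'g \<Rightarrow> 'v \<Rightarrow> 'v"

definition frame_coeff :: "nat \<Rightarrow> (nat \<Rightarrow> 'v::real_vector) \<Rightarrow> 'v \<Rightarrow> nat \<Rightarrow> real" where
  "frame_coeff r e v i = representation (e ` {..<r}) v (e i)"

definition vector_bundle :: "'m manifold \<Rightarrow> ('g, 'm, 'v::banach) rep_bundle \<Rightarrow> bool" where
  "vector_bundle X V \<longleftrightarrow>
     pts X = (\<Union>(U, e)\<in>frames V. U) \<and>
     (\<forall>(U, e)\<in>frames V. openin (mtop X) U \<and>
        (\<forall>m\<in>U. inj_on (e m) {..<rank V} \<and> independent (e m ` {..<rank V}) \<and>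
           span (e m ` {..<rank V}) = fibre V m)) \<and>
     (\<forall>(U, e)\<in>frames V. \<forall>(U', e')\<in>frames V. \<forall>i<rank V. \<forall>j<rank V.
        smooth_fun X (U \<inter> U') (\<lambda>m. frame_coeff (rank V) (e' m) (e m j) i))"

definition bundle_plot :: "'m manifold \<Rightarrow> ('g, 'm, 'v::banach) rep_bundle \<Rightarrow> nat \<Rightarrow> (nat \<Rightarrow> real) set \<Rightarrow>
    ((nat \<Rightarrow> real) \<Rightarrow> 'm) \<Rightarrow> ((nat \<Rightarrow> real) \<Rightarrow> 'v) \<Rightarrow> bool" where
  "bundle_plot X V n S \<mu> v \<longleftrightarrow> plot X n S \<mu> \<and> (\<forall>y\<in>S. v y \<in> fibre V (\<mu> y)) \<and>
     (\<forall>(U, e)\<in>frames V. \<forall>i<rank V.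
        smooth_real n {y \<in> S. \<mu> y \<in> U} (\<lambda>y. frame_coeff (rank V) (e (\<mu> y)) (v y) i))"

definition lie_representation ::
    "('g, 'm) groupoid \<Rightarrow> ('g, 'm, 'v::banach) rep_bundle \<Rightarrow> bool" where
  "lie_representation G V \<longleftrightarrow> vector_bundle (objects G) V \<and>
     (\<forall>g\<in>Arr G. \<forall>v\<in>fibre V (src G g). act V g v \<in> fibre V (tgt G g) \<and>
        (\<forall>w\<in>fibre V (src G g). act V g (v + w) = act V g v + act V g w) \<and>
        (\<forall>r. act V g (r *\<^sub>R v) = r *\<^sub>R act V g v)) \<and>
     (\<forall>m\<in>Obj G. \<forall>v\<in>fibre V m. act V (idt G m) v = v) \<and>
     (\<forall>g\<in>Arr G. \<forall>h\<in>Arr G. src G g = tgt G h \<longrightarrow>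
        (\<forall>v\<in>fibre V (src G h). act V (mlt G g h) v = act V g (act V h v))) \<and>
     (\<forall>n S c v. plot (arrows G) n S c \<and> bundle_plot (objects G) V n S (\<lambda>y. src G (c y)) v \<longrightarrow>
        bundle_plot (objects G) V n S (\<lambda>y. tgt G (c y)) (\<lambda>y. act V (c y) (v y)))"

section \<open>Cochains\<close>

text \<open>\<open>C\<^sup>q(A,V)\<close>: smooth families of alternating q-linear maps from \<open>A\<^sub>m\<close> to \<open>V\<^sub>m\<close>, extended by 0
  to arguments outside their domain.\<close>

definition algebroid_cochains :: "('g, 'm) groupoid \<Rightarrow> ('g, 'm, 'v::banach) rep_bundle \<Rightarrow> nat \<Rightarrow>
    ('m \<Rightarrow> 'g tvec list \<Rightarrow> 'v) set" where
  "algebroid_cochains G V q = {\<alpha>.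
     (\<forall>m as. \<not> (m \<in> Obj G \<and> length as = q \<and> set as \<subseteq> algebroid G m) \<longrightarrow> \<alpha> m as = 0) \<and>
     (\<forall>m\<in>Obj G. \<forall>as. length as = q \<and> set as \<subseteq> algebroid G m \<longrightarrow>
        \<alpha> m as \<in> fibre V m \<and>
        (\<forall>i<q. \<forall>a\<in>algebroid G m. \<forall>b\<in>algebroid G m. \<forall>r.
           \<alpha> m (as[i := tv_add a b]) = \<alpha> m (as[i := a]) + \<alpha> m (as[i := b]) \<and>
           \<alpha> m (as[i := tv_scale r a]) = r *\<^sub>R \<alpha> m (as[i := a])) \<and>
        (\<forall>i<q. \<forall>j<q. i \<noteq> j \<and> as ! i = as ! j \<longrightarrow> \<alpha> m as = 0)) \<and>
     (\<forall>n S \<mu> as. plot (objects G) n S \<mu> \<and> (\<forall>y\<in>S. length (as y) = q) \<and>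
          (\<forall>i<q. algebroid_plot G n S \<mu> (\<lambda>y. as y ! i)) \<longrightarrow>
        bundle_plot (objects G) V n S \<mu> (\<lambda>y. \<alpha> (\<mu> y) (as y)))}"

text \<open>Points of \<open>B\<^sub>pG\<close> are pairs \<open>(gs, m)\<close> of a composable list \<open>gs\<close> of length \<open>p\<close> and its last base
  point \<open>m = m\<^sub>p\<close>, which is redundant for \<open>p > 0\<close> and is the point of \<open>B\<^sub>0G = M\<close> for \<open>p = 0\<close>.
  \<open>near_units G p Q\<close> is the part of \<open>B\<^sub>pG\<close> in the product neighbourhood of tuples from \<open>Q\<close>.\<close>

definition composable :: "('g, 'm) groupoid \<Rightarrow> nat \<Rightarrow> ('g list \<times> 'm) set" where
  "composable G p = {(gs, m). length gs = p \<and> set gs \<subseteq> Arr G \<and> m \<in> Obj G \<and>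
     (\<forall>i. Suc i < p \<longrightarrow> src G (gs ! i) = tgt G (gs ! Suc i)) \<and>
     (gs \<noteq> [] \<longrightarrow> src G (last gs) = m)}"

definition near_units :: "('g, 'm) groupoid \<Rightarrow> nat \<Rightarrow> 'g set \<Rightarrow> ('g list \<times> 'm) set" where
  "near_units G p Q = {(gs, m) \<in> composable G p. set gs \<subseteq> Q \<and> idt G m \<in> Q}"

definition germ :: "('g, 'm) groupoid \<Rightarrow> nat \<Rightarrow> ('g list \<Rightarrow> 'm \<Rightarrow> 'v) \<Rightarrow> ('g list \<Rightarrow> 'm \<Rightarrow> 'v) set" where
  "germ G p \<sigma> = {\<sigma>'. \<forall>x\<in>Obj G. \<exists>Q. openin (mtop (arrows G)) Q \<and> idt G x \<in> Q \<and>
     (\<forall>(gs, m)\<in>near_units G p Q. \<sigma>' gs m = \<sigma> gs m)}"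

definition smooth_near_units :: "('g, 'm) groupoid \<Rightarrow> ('g, 'm, 'v::banach) rep_bundle \<Rightarrow> nat \<Rightarrow>
    ('g list \<Rightarrow> 'm \<Rightarrow> 'v) \<Rightarrow> bool" where
  "smooth_near_units G V p \<sigma> \<longleftrightarrow>
     (\<forall>x\<in>Obj G. \<exists>Q. openin (mtop (arrows G)) Q \<and> idt G x \<in> Q \<and>
        (\<forall>n S gs m. plot (objects G) n S m \<and> (\<forall>i<p. plot (arrows G) n S (\<lambda>y. gs y ! i)) \<and>
             (\<forall>y\<in>S. (gs y, m y) \<in> near_units G p Q) \<longrightarrow>
           bundle_plot (objects G) V n S m (\<lambda>y. \<sigma> (gs y) (m y))))"

definition groupoid_cochains :: "('g, 'm) groupoid \<Rightarrow> ('g, 'm, 'v::banach) rep_bundle \<Rightarrow> nat \<Rightarrow>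
    ('g list \<Rightarrow> 'm \<Rightarrow> 'v) set set" where
  "groupoid_cochains G V p = {germ G p \<sigma> | \<sigma>. smooth_near_units G V p \<sigma>}"

section \<open>Tubular structures\<close>

text \<open>A representative of a germ of a tubular structure: a diffeomorphism \<open>\<tau>\<close> from an open
  neighbourhood \<open>W\<close> of the zero section of \<open>A\<close>, star-shaped in each fibre, onto an open subset
  of \<open>G\<close>. A subset of \<open>A\<close> is open iff its preimages under smooth maps into \<open>A\<close> are.\<close>

definition tubular_structure ::
    "('g, 'm) groupoid \<Rightarrow> ('m \<times> 'g tvec) set \<Rightarrow> ('m \<times> 'g tvec \<Rightarrow> 'g) \<Rightarrow> bool" where
  "tubular_structure G W \<tau> \<longleftrightarrow>
     W \<subseteq> {(m, a). m \<in> Obj G \<and> a \<in> algebroid G m} \<and>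
     (\<forall>n S \<mu> a. algebroid_plot G n S \<mu> a \<longrightarrow> openin (Euclidean_space n) {y \<in> S. (\<mu> y, a y) \<in> W}) \<and>
     (\<forall>m\<in>Obj G. (m, \<lambda>f. 0) \<in> W) \<and>
     (\<forall>(m, a)\<in>W. \<forall>r\<in>{0..1}. (m, tv_scale r a) \<in> W) \<and>
     inj_on \<tau> W \<and> openin (mtop (arrows G)) (\<tau> ` W) \<and>
     (\<forall>n S \<mu> a. algebroid_plot G n S \<mu> a \<and> (\<forall>y\<in>S. (\<mu> y, a y) \<in> W) \<longrightarrow>
        plot (arrows G) n S (\<lambda>y. \<tau> (\<mu> y, a y))) \<and>
     (\<forall>n S c. plot (arrows G) n S c \<and> c ` S \<subseteq> \<tau> ` W \<longrightarrow>
        algebroid_plot G n S (\<lambda>y. fst (inv_into W \<tau> (c y))) (\<lambda>y. snd (inv_into W \<tau> (c y)))) \<and>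
     (\<forall>(m, a)\<in>W. tgt G (\<tau> (m, a)) = m) \<and>
     (\<forall>m\<in>Obj G. \<tau> (m, \<lambda>f. 0) = idt G m) \<and>
     (\<forall>m\<in>Obj G. \<forall>a\<in>algebroid G m. velocity (arrows G) (\<lambda>r. \<tau> (m, tv_scale r a)) = a)"

definition retraction :: "('m \<times> 'g tvec) set \<Rightarrow> ('m \<times> 'g tvec \<Rightarrow> 'g) \<Rightarrow> real \<Rightarrow> 'g \<Rightarrow> 'g" where
  "retraction W \<tau> r g = (case inv_into W \<tau> g of (m, a) \<Rightarrow> \<tau> (m, tv_scale r a))"

section \<open>The double complex and its operators\<close>

text \<open>The operators act on representatives \<open>\<psi> gs g as\<close> of elements of the double complex: \<open>(gs; g)\<close> is
  a point of \<open>E\<^sub>pG\<close> and \<open>as\<close> a list of \<open>q\<close> vectors in \<open>A\<close> at \<open>src g\<close>, so that the bidegree of a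
  component is \<open>(length gs, length as)\<close>. Components of target bidegree with no source component
  are 0; in particular an operator vanishes where it would leave the first quadrant.\<close>

type_synonym ('g, 'v) dcochain = "'g list \<Rightarrow> 'g \<Rightarrow> 'g tvec list \<Rightarrow> 'v"

text \<open>The form picture: a form along t-fibres takes a point \<open>g\<close> and a list of vectors tangent at \<open>g\<close>
  to the t-fibre.\<close>

type_synonym ('g, 'v) fform = "'g \<Rightarrow> 'g tvec list \<Rightarrow> 'v"

definition to_form :: "('g, 'm) groupoid \<Rightarrow> ('g, 'm, 'v) rep_bundle \<Rightarrow>
    ('g, 'v) dcochain \<Rightarrow> 'g list \<Rightarrow> ('g, 'v) fform" where
  "to_form G V \<psi> gs g ws = act V g (\<psi> gs g (map (push G (mlt G (ivs G g)) g) ws))"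

definition from_form :: "('g, 'm) groupoid \<Rightarrow> ('g, 'm, 'v) rep_bundle \<Rightarrow>
    ('g list \<Rightarrow> ('g, 'v) fform) \<Rightarrow> ('g, 'v) dcochain" where
  "from_form G V \<beta> gs g as =
     act V (ivs G g) (\<beta> gs g (map (push G (mlt G g) (idt G (src G g))) as))"

text \<open>The de Rham differential along the t-fibre. To evaluate it at \<open>g\<close> on \<open>ws = (w\<^sub>0, \<dots>, w\<^sub>q)\<close>, the form
  is pulled back under a smooth map \<open>F\<close> from a neighbourhood of 0 in (q+1)-space to the
  t-fibre through \<open>g\<close> whose k-th partial derivative at 0 is \<open>w\<^sub>k\<close> (such as the inverse of a chart of the
  fibre composed with an affine map); the differential on (q+1)-space is given
  by the usual coordinate formula.\<close>

definition axis_pt :: "nat \<Rightarrow> real \<Rightarrow> nat \<Rightarrow> real" where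
  "axis_pt k r = (\<lambda>i. if i = k then r else 0)"

definition coord_velocity :: "'a manifold \<Rightarrow> ((nat \<Rightarrow> real) \<Rightarrow> 'a) \<Rightarrow> (nat \<Rightarrow> real) \<Rightarrow> nat \<Rightarrow> 'a tvec" where
  "coord_velocity X F y j = velocity X (\<lambda>r. F (y(j := y j + r)))"

definition fibre_map_through ::
    "('g, 'm) groupoid \<Rightarrow> 'g \<Rightarrow> 'g tvec list \<Rightarrow> ((nat \<Rightarrow> real) \<Rightarrow> 'g) \<Rightarrow> bool" where
  "fibre_map_through G g ws F \<longleftrightarrow>
     (\<exists>S. (\<lambda>_. 0) \<in> S \<and> plot (arrows G) (length ws) S F \<and> (\<forall>y\<in>S. tgt G (F y) = tgt G g)) \<and>
     F (\<lambda>_. 0) = g \<and> (\<forall>k<length ws. coord_velocity (arrows G) F (\<lambda>_. 0) k = ws ! k)"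

definition d_Rh :: "('g, 'm) groupoid \<Rightarrow> ('g, 'v::banach) fform \<Rightarrow> ('g, 'v) fform" where
  "d_Rh G \<omega> g ws = (let F = (SOME F. fibre_map_through G g ws F) in
     \<Sum>k<length ws. (-1) ^ k *\<^sub>R
       vector_derivative
         (\<lambda>r. \<omega> (F (axis_pt k r))
                (map (coord_velocity (arrows G) F (axis_pt k r)) ([0..<k] @ [Suc k..<length ws])))
         (at 0))"

text \<open>The de Rham homotopy operator \<open>\<integral>\<^sub>0\<^sup>1 \<iota>(\<partial>\<^sub>t) \<lambda>\<^sup>* dt\<close>, with contraction in the first argument.\<close>

definition T_Rh :: "('g, 'm) groupoid \<Rightarrow> ('m \<times> 'g tvec) set \<Rightarrow> ('m \<times> 'g tvec \<Rightarrow> 'g) \<Rightarrow>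
    ('g, 'v::banach) fform \<Rightarrow> ('g, 'v) fform" where
  "T_Rh G W \<tau> \<omega> g ws = integral {0..1} (\<lambda>t.
     \<omega> (retraction W \<tau> t g)
       (velocity (arrows G) (\<lambda>r. retraction W \<tau> (t + r) g) # map (push G (retraction W \<tau> t) g) ws))"

definition op_d :: "('g, 'm) groupoid \<Rightarrow> ('g, 'm, 'v::banach) rep_bundle \<Rightarrow>
    ('g, 'v) dcochain \<Rightarrow> ('g, 'v) dcochain" where
  "op_d G V \<psi> = from_form G V (\<lambda>gs g ws. (-1) ^ length gs *\<^sub>R d_Rh G (to_form G V \<psi> gs) g ws)"

definition op_k :: "('g, 'm) groupoid \<Rightarrow> ('g, 'm, 'v::banach) rep_bundle \<Rightarrow>
    ('m \<times> 'g tvec) set \<Rightarrow> ('m \<times> 'g tvec \<Rightarrow> 'g) \<Rightarrow> ('g, 'v) dcochain \<Rightarrow> ('g, 'v) dcochain" where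
  "op_k G V W \<tau> \<psi> =
     from_form G V (\<lambda>gs g ws. (-1) ^ length gs *\<^sub>R T_Rh G W \<tau> (to_form G V \<psi> gs) g ws)"

text \<open>\<open>merge G i (g\<^sub>1, \<dots>, g\<^sub>n) = (g\<^sub>1, \<dots>, g\<^sub>i g\<^sub>i\<^sub>+\<^sub>1, \<dots>, g\<^sub>n)\<close> for \<open>1 \<le> i < n\<close>.\<close>

definition merge :: "('g, 'm) groupoid \<Rightarrow> nat \<Rightarrow> 'g list \<Rightarrow> 'g list" where
  "merge G i gs = take (i - 1) gs @ [mlt G (gs ! (i - 1)) (gs ! i)] @ drop (i + 1) gs"

definition op_delta :: "('g, 'm) groupoid \<Rightarrow> ('g, 'v::real_vector) dcochain \<Rightarrow> ('g, 'v) dcochain" where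
  "op_delta G \<psi> gs g as = (if gs = [] then 0 else
     \<psi> (tl gs) g as + (\<Sum>i = 1..<length gs. (-1) ^ i *\<^sub>R \<psi> (merge G i gs) g as) +
     (-1) ^ length gs *\<^sub>R \<psi> (butlast gs) (mlt G (last gs) g) as)"

definition op_h :: "('g, 'm) groupoid \<Rightarrow> ('g, 'v::real_vector) dcochain \<Rightarrow> ('g, 'v) dcochain" where
  "op_h G \<psi> gs g as = (-1) ^ Suc (length gs) *\<^sub>R \<psi> (gs @ [g]) (idt G (src G g)) as"

definition op_j :: "('g, 'm) groupoid \<Rightarrow> ('g, 'm, 'v::zero) rep_bundle \<Rightarrow>
    ('g list \<Rightarrow> 'm \<Rightarrow> 'v) \<Rightarrow> ('g, 'v) dcochain" where
  "op_j G V \<sigma> gs g as = (if as = [] then act V (ivs G g) (\<sigma> gs (tgt G g)) else 0)"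

definition op_p :: "('g, 'm) groupoid \<Rightarrow> ('g, 'v) dcochain \<Rightarrow> 'm \<Rightarrow> 'g tvec list \<Rightarrow> 'v" where
  "op_p G \<psi> m as = \<psi> [] (idt G m) as"

definition op_i :: "('g, 'm) groupoid \<Rightarrow> ('m \<Rightarrow> 'g tvec list \<Rightarrow> 'v::zero) \<Rightarrow> ('g, 'v) dcochain" where
  "op_i G \<alpha> gs g as = (if gs = [] then \<alpha> (src G g) as else 0)"

definition op_q :: "('g, 'm) groupoid \<Rightarrow> ('g, 'm, 'v) rep_bundle \<Rightarrow>
    ('g, 'v) dcochain \<Rightarrow> 'g list \<Rightarrow> 'm \<Rightarrow> 'v" where
  "op_q G V \<psi> gs m = to_form G V \<psi> gs (idt G m) []"

section \<open>Differentiation and integration\<close>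

text \<open>Each application of \<open>dh\<close> changes the bidegree by \<open>(-1, 1)\<close> and each application of \<open>\<delta>k\<close> by
  \<open>(1, -1)\<close>. Since \<open>op_j\<close> takes a degree \<open>p\<close> cochain to bidegree \<open>(p, 0)\<close> and \<open>op_p\<close> only sees
  bidegrees \<open>(0, q)\<close>, exactly the p-th term of the terminating geometric series for \<open>(1 + dh)\<^sup>-\<^sup>1\<close>
  contributes to \<open>VE\<close>; similarly for \<open>RG\<close>. Elements of the groupoid complex are germs, represented
  as equivalence classes; \<open>VE\<close> is computed from an arbitrary representative.\<close>

definition VE :: "('g, 'm) groupoid \<Rightarrow> ('g, 'm, 'v::banach) rep_bundle \<Rightarrow> nat \<Rightarrow>
    ('g list \<Rightarrow> 'm \<Rightarrow> 'v) set \<Rightarrow> 'm \<Rightarrow> 'g tvec list \<Rightarrow> 'v" where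
  "VE G V p s m as = (let \<sigma> = (SOME \<sigma>. \<sigma> \<in> s) in
     if m \<in> Obj G \<and> length as = p \<and> set as \<subseteq> algebroid G m
     then (-1) ^ p *\<^sub>R op_p G (((op_d G V \<circ> op_h G) ^^ p) (op_j G V \<sigma>)) m as
     else 0)"

definition RG :: "('g, 'm) groupoid \<Rightarrow> ('g, 'm, 'v::banach) rep_bundle \<Rightarrow>
    ('m \<times> 'g tvec) set \<Rightarrow> ('m \<times> 'g tvec \<Rightarrow> 'g) \<Rightarrow> nat \<Rightarrow>
    ('m \<Rightarrow> 'g tvec list \<Rightarrow> 'v) \<Rightarrow> ('g list \<Rightarrow> 'm \<Rightarrow> 'v) set" where
  "RG G V W \<tau> p \<alpha> = germ G p (\<lambda>gs m.
     (-1) ^ p *\<^sub>R op_q G V (((op_delta G \<circ> op_k G V W \<tau>) ^^ p) (op_i G \<alpha>)) gs m)"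

end

theory Submission
  imports Defs
begin

text \<open>Put \<open>z\<^sub>n = (\<delta> k)\<^sup>n i \<alpha>\<close>, so that \<open>R\<^sub>G \<alpha> = \<plusminus> q z\<^sub>r\<close> for \<open>\<alpha>\<close> of degree \<open>r\<close>, and
  \<open>VE\<^sub>G R\<^sub>G \<alpha> = p (d h)\<^sup>r j q z\<^sub>r\<close>. The operator \<open>h\<close>
  restricts the last argument to the units, where the retraction \<open>\<lambda>\<^sub>t\<close> does not move in \<open>t\<close>. Hence
  \<open>k \<psi>\<close> vanishes at the units, and of the terms of \<open>h \<delta> k \<psi>\<close> only \<open>k \<psi>\<close> survives: \<open>h \<delta> k = k\<close>. Clearly
  \<open>h j q = h\<close> in bidegree \<open>(s, 0)\<close>. Finally \<open>h d k = h\<close> and \<open>p d k = p\<close>, for which the Poincare lemma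
  is needed at the units only: there, the derivative of \<open>T \<beta>\<close> only sees the first order
  part of the contracted vector \<open>\<partial>\<^sub>t \<lambda>\<^sub>t\<close>, and the factor \<open>\<integral>\<^sub>0\<^sup>1 t\<^sup>s dt = 1/(s + 1)\<close> is cancelled by the \<open>s + 1\<close> equal
  terms of the alternating sum. So \<open>d h\<close> turns \<open>z\<^sub>n\<close> into \<open>d k z\<^sub>n\<^sub>-\<^sub>1\<close>, and \<open>p (d h)\<^sup>r z\<^sub>r = p d k z\<^sub>0 = p i \<alpha> = \<alpha>\<close>.

  That \<open>z\<^sub>n\<close> is smooth near the units follows from smoothness of integrals with respect to parameters
  once tangent vectors along \<open>t\<close>-fibres have been put into coordinates. Given a chart \<open>\<phi>\<close> of \<open>G\<close>
  around a unit, the vectors \<open>e\<^sub>i = \<partial>\<^sub>i - T(u \<circ> t) \<partial>\<^sub>i\<close> at nearby units lie in \<open>A\<close>, and every \<open>a \<in> A\<close> is equal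
  to \<open>\<Sum>\<^sub>i a(\<phi>\<^sub>i) e\<^sub>i\<close>; so the inverse of \<open>\<tau>\<close>, followed by evaluation at the \<open>\<phi>\<^sub>i\<close>, gives functions on \<open>G\<close> which
  determine a point in its \<open>t\<close>-fibre. No inverse function theorem is needed.\<close>

section \<open>Calculus of smooth functions\<close>

text \<open>Away from the units \<open>d k\<close> is not the identity: the homotopy formula
  contains the further term \<open>k d\<close>, and \<open>z\<^sub>n\<close> is in general not
  closed along the fibres. What saves the argument is that \<open>h\<close> evaluates at units in
  the last argument, where \<open>k d\<close> vanishes. An identity along the units of
  \<open>E\<^sub>pG\<close> thereby becomes one on a neighbourhood of the units in
  \<open>E\<^sub>p\<^sub>-\<^sub>1G\<close>, which the next \<open>d\<close> can differentiate.
  Accordingly, equality of cochains is tracked on neighbourhoods (\<open>agree\<close>), but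
  equality after \<open>d\<close> only over units (\<open>op_d_at_units\<close>).

  Hilbert choice enters through the curve in \<open>push\<close>, the map in \<open>d_Rh\<close> and
  the representative in \<open>VE\<close>; the computations are therefore made for every admissible
  choice.

  Neither the \<open>t\<close>-fibres nor the spaces of composable tuples are turned into manifolds.
  Smoothness is tested on maps from open subsets of n-space, and each further real parameter, such
  as the time of the retraction or the parameter of a curve, is stored as an additional last
  coordinate.\<close>

abbreviation eucl :: "nat \<Rightarrow> (nat \<Rightarrow> real) set" where
  "eucl n \<equiv> topspace (Euclidean_space n)"

section \<open>Euclidean n-space as a subspace of a function space\<close>

lemma mem_eucl: "x \<in> eucl n \<longleftrightarrow> (\<forall>i\<ge>n. x i = 0)"
  by (simp add: topspace_Euclidean_space)

text \<open>Makes the type class notions \<open>open\<close> and \<open>continuous_on\<close> for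
  \<open>nat \<Rightarrow> real\<close> available in place of the abstract topology.\<close>

lemma Euclidean_space_top_of_set: "Euclidean_space n = top_of_set (eucl n)"
proof -
  have "top_of_set {x. \<forall>i\<ge>n. x i = 0} = Euclidean_space n"
    by (simp only: Euclidean_space_def euclidean_product_topology)
  then show ?thesis by (simp only: topspace_Euclidean_space)
qed

lemma openin_eucl: "openin (Euclidean_space n) S \<longleftrightarrow> openin (top_of_set (eucl n)) S"
  by (metis Euclidean_space_top_of_set)

lemma continuous_map_Euclidean_subspace:
  "S \<subseteq> eucl n \<Longrightarrow> continuous_map (subtopology (Euclidean_space n) S) euclideanreal f \<longleftrightarrow> continuous_on S f"
  by (subst Euclidean_space_top_of_set) (simp add: subtopology_subtopology inf.absorb2 del: subtopology_topspace)

lemma openin_eucl_subset: "openin (Euclidean_space n) S \<Longrightarrow> S \<subseteq> eucl n"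
  by (rule openin_subset)

lemma continuous_on_coord: "continuous_on S (\<lambda>x. x (i::nat) :: real)"
  by (rule continuous_on_product_then_coordinatewise) (rule continuous_on_id)

lemma continuous_on_fun_upd [continuous_intros]:
  fixes f :: "'a::topological_space \<Rightarrow> nat \<Rightarrow> real"
  assumes "continuous_on S f" "continuous_on S g"
  shows "continuous_on S (\<lambda>x. (f x)(i := g x))"
proof (rule continuous_on_coordinatewise_then_product)
  fix j show "continuous_on S (\<lambda>x. ((f x)(i := g x)) j)"
    using assms continuous_on_product_then_coordinatewise[OF assms(1)] by (cases "j = i") auto
qed

lemma openin_preimage_eucl:
  assumes "openin (Euclidean_space N) T" "continuous_on S x" "openin (Euclidean_space n) S"
    and "\<And>y. y \<in> S \<Longrightarrow> x y \<in> eucl N"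
  shows "openin (Euclidean_space n) {y \<in> S. x y \<in> T}"
proof -
  have "openin (top_of_set S) (S \<inter> x -` T)"
    by (intro continuous_openin_preimage[OF assms(2) _ assms(1)[unfolded openin_eucl]] Pi_I) (rule assms(4))
  then have "openin (top_of_set (eucl n)) (S \<inter> x -` T)"
    by (rule openin_trans) (use assms(3) openin_eucl in blast)
  moreover have "S \<inter> x -` T = {y \<in> S. x y \<in> T}" by auto
  ultimately show ?thesis by (simp only: openin_eucl)
qed

lemma openin_eucl_fun_upd_line:
  assumes S: "openin (Euclidean_space n) S" and x: "x \<in> S" and i: "i < n"
  shows "\<exists>d>0. \<forall>t. \<bar>t - x i\<bar> < d \<longrightarrow> x(i := t) \<in> S"
proof -
  obtain T where T: "open T" "S = eucl n \<inter> T"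
    using S by (auto simp: openin_eucl openin_open)
  have c: "continuous_on UNIV (\<lambda>t. x(i := t))" by (intro continuous_intros)
  have "open ((\<lambda>t. x(i := t)) -` T)" using T(1) c by (rule open_vimage)
  moreover have "x i \<in> (\<lambda>t. x(i := t)) -` T" using x T by simp
  ultimately obtain d where "d > 0" "\<And>t. dist t (x i) < d \<Longrightarrow> x(i := t) \<in> T"
    unfolding open_dist by blast
  moreover have "x(i := t) \<in> eucl n" for t
    using x T i by (auto simp: mem_eucl)
  ultimately show ?thesis using T by (auto simp: dist_real_def)
qed

lemma eventually_fun_upd_mem:
  assumes S: "openin (Euclidean_space n) S" and x: "x \<in> S" and i: "i < n"
  shows "\<forall>\<^sub>F t in nhds (x i). x(i := t) \<in> S"
  using openin_eucl_fun_upd_line[OF assms] by (auto simp: eventually_nhds_metric dist_real_def)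

text \<open>A basic open set of the product topology restricts finitely many coordinates, possibly
  some of index at least \<open>n\<close>; but there \<open>x\<close> and \<open>y\<close> are both
  0. Hence the radii of the first \<open>n\<close> coordinates decide.\<close>

lemma eucl_box:
  assumes S: "openin (Euclidean_space n) S" and x: "x \<in> S"
  shows "\<exists>d>0. \<forall>y\<in>eucl n. (\<forall>i<n. \<bar>y i - x i\<bar> < d) \<longrightarrow> y \<in> S"
proof -
  obtain T where T: "open T" "S = eucl n \<inter> T"
    using S by (auto simp: openin_eucl openin_open)
  have "\<exists>U. x \<in> Pi\<^sub>E UNIV U \<and> (\<forall>i. open (U i)) \<and> finite {i. U i \<noteq> UNIV} \<and> Pi\<^sub>E UNIV U \<subseteq> T"
    using product_topology_open_contains_basis[of "\<lambda>_. euclidean" UNIV T x] T x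
    unfolding open_fun_def by simp
  then obtain U where U: "x \<in> Pi\<^sub>E UNIV U" "\<And>i. open (U i)" "Pi\<^sub>E UNIV U \<subseteq> T" by blast
  have "\<exists>d>0. \<forall>t. \<bar>t - x i\<bar> < d \<longrightarrow> t \<in> U i" for i
    using U(1) U(2)[of i] by (auto simp: open_dist dist_real_def PiE_def)
  then obtain D where D: "\<And>i. D i > 0" "\<And>i t. \<bar>t - x i\<bar> < D i \<Longrightarrow> t \<in> U i" by metis
  \<comment> \<open>The 1 keeps the set nonempty for \<open>n = 0\<close>.\<close>
  define d where "d = Min (insert 1 (D ` {..<n}))"
  have d: "d > 0" "\<And>i. i < n \<Longrightarrow> d \<le> D i" using D(1) by (auto simp: d_def)
  have "y \<in> S" if y: "y \<in> eucl n" "\<forall>i<n. \<bar>y i - x i\<bar> < d" for y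
  proof -
    have "y i \<in> U i" for i
    proof (cases "i < n")
      case True then show ?thesis using y d D(2) by (meson less_le_trans)
    next
      case False
      then have "y i = x i" using y x T by (auto simp: mem_eucl)
      then show ?thesis using U(1) by (auto simp: PiE_def)
    qed
    then have "y \<in> T" using U(3) by (auto simp: PiE_def)
    then show ?thesis using y T by auto
  qed
  then show ?thesis using d(1) by blast
qed

subsection \<open>Functions with continuous partial derivatives up to a given order\<close>

text \<open>The class \<open>C\<^sup>k\<close>, stratified so that closure properties can be proved
  by induction on the order. \<open>smooth_real\<close> quantifies over lists of derivatives all at
  once and offers no such induction.\<close>

primrec cdiff :: "nat \<Rightarrow> nat \<Rightarrow> (nat \<Rightarrow> real) set \<Rightarrow> ((nat \<Rightarrow> real) \<Rightarrow> real) \<Rightarrow> bool" where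
  "cdiff n 0 S f \<longleftrightarrow> continuous_on S f"
| "cdiff n (Suc k) S f \<longleftrightarrow> continuous_on S f \<and>
     (\<forall>i<n. (\<forall>x\<in>S. (\<lambda>t. f (x(i := t))) field_differentiable at (x i)) \<and> cdiff n k S (partial i f))"

lemma cdiff_continuous: "cdiff n k S f \<Longrightarrow> continuous_on S f"
  by (cases k) auto

lemma cdiff_decrease: "cdiff n (Suc k) S f \<Longrightarrow> cdiff n k S f"
  by (induction k arbitrary: f) auto

lemma cdiff_foldr:
  assumes "\<And>k. cdiff n k S f" "set js \<subseteq> {..<n}"
  shows "cdiff n k S (foldr partial js f)"
  using assms(2)
proof (induction js arbitrary: k)
  case (Cons j js)
  then have "cdiff n (Suc k) S (foldr partial js f)" by (intro Cons.IH) simp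
  then show ?case using Cons.prems by simp
qed (use assms in simp)

lemma smooth_real_cdiff:
  "smooth_real n S f \<longleftrightarrow> openin (Euclidean_space n) S \<and> (\<forall>k. cdiff n k S f)" (is "?L \<longleftrightarrow> ?R")
proof
  assume L: ?L
  then have S: "S \<subseteq> eucl n" by (auto simp: smooth_real_def dest: openin_eucl_subset)
  have "cdiff n k S (foldr partial js f)" if "set js \<subseteq> {..<n}" for k js
    using that
  proof (induction k arbitrary: js)
    case 0 then show ?case using L S
      by (simp add: smooth_real_def continuous_map_Euclidean_subspace)
  next
    case (Suc k)
    have "cdiff n k S (partial i (foldr partial js f))" if "i < n" for i
      using Suc.IH[of "i # js"] Suc.prems that by simp
    then show ?case using L S Suc.prems
      by (simp add: smooth_real_def continuous_map_Euclidean_subspace)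
  qed
  from this[of "[]"] L show ?R by (simp add: smooth_real_def)
next
  assume R: ?R
  then have S: "S \<subseteq> eucl n" by (auto dest: openin_eucl_subset)
  have "cdiff n (Suc 0) S (foldr partial js f)" if "set js \<subseteq> {..<n}" for js
    using R that by (intro cdiff_foldr) auto
  then show ?L using R S
    by (auto simp add: smooth_real_def continuous_map_Euclidean_subspace)
qed

lemma partial_cong_open:
  assumes S: "openin (Euclidean_space n) S" and fg: "\<And>x. x \<in> S \<Longrightarrow> f x = g x" and i: "i < n" and x: "x \<in> S"
  shows "partial i f x = partial i g x"
    and "(\<lambda>t. f (x(i := t))) field_differentiable at (x i) \<longleftrightarrow>
      (\<lambda>t. g (x(i := t))) field_differentiable at (x i)"
proof -
  have ev: "\<forall>\<^sub>F t in nhds (x i). f (x(i := t)) = g (x(i := t))"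
    using eventually_fun_upd_mem[OF S x i] by eventually_elim (rule fg)
  show "partial i f x = partial i g x"
    unfolding partial_def by (rule deriv_cong_ev[OF ev refl])
  show "(\<lambda>t. f (x(i := t))) field_differentiable at (x i) \<longleftrightarrow>
      (\<lambda>t. g (x(i := t))) field_differentiable at (x i)"
    unfolding field_differentiable_def using DERIV_cong_ev[OF refl ev refl] by simp
qed

lemma cdiff_cong:
  assumes S: "openin (Euclidean_space n) S"
  shows "(\<And>x. x \<in> S \<Longrightarrow> f x = g x) \<Longrightarrow> cdiff n k S f \<Longrightarrow> cdiff n k S g"
proof (induction k arbitrary: f g)
  case 0 then show ?case using continuous_on_cong[of S S f g] by auto
next
  case (Suc k)
  have "continuous_on S g" using Suc.prems continuous_on_cong[of S S f g] by auto
  moreover have "cdiff n k S (partial i g)" if "i < n" for i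
    by (rule Suc.IH[of "partial i f"]) (use Suc.prems partial_cong_open[OF S, of f g] that in auto)
  moreover have "\<forall>x\<in>S. (\<lambda>t. g (x(i := t))) field_differentiable at (x i)" if "i < n" for i
    using partial_cong_open(2)[OF S, of f g i] Suc.prems that by auto
  ultimately show ?case by simp
qed

lemma cdiff_subset: "cdiff n k S f \<Longrightarrow> T \<subseteq> S \<Longrightarrow> cdiff n k T f"
  by (induction k arbitrary: f) (auto intro: continuous_on_subset)

text \<open>Lets the partial derivatives be given by any formula \<open>g\<close> that is valid on
  \<open>S\<close>, so that sum, product and chain rule can be inserted directly.\<close>

lemma cdiff_SucI:
  assumes S: "openin (Euclidean_space n) S" and c: "continuous_on S f"
    and g: "\<And>i. i < n \<Longrightarrow> cdiff n k S (g i)"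
    and d: "\<And>i x. i < n \<Longrightarrow> x \<in> S \<Longrightarrow> ((\<lambda>t. f (x(i := t))) has_real_derivative g i x) (at (x i))"
  shows "cdiff n (Suc k) S f"
proof -
  have "cdiff n k S (partial i f)" if "i < n" for i
    by (rule cdiff_cong[OF S _ g[OF that]]) (metis DERIV_imp_deriv d partial_def that)
  then show ?thesis using c d by (auto simp: field_differentiable_def)
qed

lemma cdiff_Suc_D:
  assumes "cdiff n (Suc k) S f" "i < n" "x \<in> S"
  shows "((\<lambda>t. f (x(i := t))) has_real_derivative partial i f x) (at (x i))"
  using assms unfolding partial_def by (auto intro: DERIV_deriv_iff_field_differentiable[THEN iffD2])

lemma cdiff_const: "cdiff n k S (\<lambda>x. c)"
proof (induction k arbitrary: c)
  case (Suc k)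
  have "partial i (\<lambda>x. c) = (\<lambda>x. 0)" for i by (auto simp: partial_def)
  then show ?case using Suc by simp
qed simp

lemma cdiff_coord:
  assumes S: "openin (Euclidean_space n) S"
  shows "cdiff n k S (\<lambda>x. x j)"
proof (cases k)
  case 0 then show ?thesis by (simp add: continuous_on_coord)
next
  case (Suc k')
  show ?thesis unfolding Suc
  proof (rule cdiff_SucI[OF S continuous_on_coord cdiff_const])
    fix i x assume "i < n" "x \<in> S"
    show "((\<lambda>t. (x(i := t)) j) has_real_derivative (if i = j then 1 else 0)) (at (x i))"
      by (cases "i = j") auto
  qed
qed

lemma cdiff_add:
  assumes S: "openin (Euclidean_space n) S"
  shows "cdiff n k S f \<Longrightarrow> cdiff n k S g \<Longrightarrow> cdiff n k S (\<lambda>x. f x + g x)"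
proof (induction k arbitrary: f g)
  case (Suc k)
  show ?case
  proof (rule cdiff_SucI[OF S, where g = "\<lambda>i x. partial i f x + partial i g x"])
    show "continuous_on S (\<lambda>x. f x + g x)" using Suc.prems by (auto intro: continuous_on_add)
    fix i assume i: "i < n"
    show "cdiff n k S (\<lambda>x. partial i f x + partial i g x)"
      using Suc.prems i by (intro Suc.IH) auto
    fix x assume x: "x \<in> S"
    show "((\<lambda>t. f (x(i := t)) + g (x(i := t))) has_real_derivative partial i f x + partial i g x) (at (x i))"
      using DERIV_add[OF cdiff_Suc_D[OF Suc.prems(1) i x] cdiff_Suc_D[OF Suc.prems(2) i x]] .
  qed
qed (auto intro: continuous_on_add)

lemma cdiff_mult:
  assumes S: "openin (Euclidean_space n) S"
  shows "cdiff n k S f \<Longrightarrow> cdiff n k S g \<Longrightarrow> cdiff n k S (\<lambda>x. f x * g x)"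
proof (induction k arbitrary: f g)
  case (Suc k)
  show ?case
  proof (rule cdiff_SucI[OF S, where g = "\<lambda>i x. partial i f x * g x + partial i g x * f x"])
    show "continuous_on S (\<lambda>x. f x * g x)" using Suc.prems by (auto intro: continuous_on_mult)
    fix i assume i: "i < n"
    show "cdiff n k S (\<lambda>x. partial i f x * g x + partial i g x * f x)"
      using Suc.prems i cdiff_decrease[OF Suc.prems(1)] cdiff_decrease[OF Suc.prems(2)]
      by (intro cdiff_add[OF S] Suc.IH) auto
    fix x assume x: "x \<in> S"
    show "((\<lambda>t. f (x(i := t)) * g (x(i := t))) has_real_derivative
        partial i f x * g x + partial i g x * f x) (at (x i))"
      using DERIV_mult[OF cdiff_Suc_D[OF Suc.prems(1) i x] cdiff_Suc_D[OF Suc.prems(2) i x]] by (simp only: fun_upd_triv)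
  qed
qed (auto intro: continuous_on_mult)

lemma cdiff_sum:
  assumes S: "openin (Euclidean_space n) S" and "\<And>i. i \<in> I \<Longrightarrow> cdiff n k S (f i)"
  shows "cdiff n k S (\<lambda>x. \<Sum>i\<in>I. f i x)"
  using assms(2)
  by (induction I rule: infinite_finite_induct) (simp_all add: cdiff_const cdiff_add[OF S])

subsection \<open>The chain rule\<close>

text \<open>The points \<open>h k t\<close> and \<open>h (Suc k) t\<close> differ in coordinate
  \<open>k\<close> only. The mean value theorem in this one variable and continuity of
  \<open>partial k f\<close> give the limit of the difference quotient; no total derivative is
  involved.\<close>

lemma chain_rule_term:
  fixes x :: "real \<Rightarrow> nat \<Rightarrow> real"
  assumes S: "openin (Euclidean_space N) S" and k: "k < N"
    and df: "\<And>z. z \<in> S \<Longrightarrow> (\<lambda>t. f (z(k := t))) field_differentiable at (z k)"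
    and cf: "continuous_on S (partial k f)"
    and ev: "\<forall>\<^sub>F t in nhds t0. x t \<in> eucl N" and x0: "x t0 \<in> S"
    and dx: "\<And>i. i < N \<Longrightarrow> ((\<lambda>t. x t i) has_real_derivative x' i) (at t0)"
  defines "h \<equiv> \<lambda>k t i. if i < k then x t i else x t0 i"
  shows "((\<lambda>t. f (h (Suc k) t) - f (h k t)) has_real_derivative partial k f (x t0) * x' k) (at t0)"
proof -
  define a where "a = x t0"
  have aE: "a \<in> eucl N" using x0 openin_eucl_subset[OF S] by (auto simp: a_def)
  have hE: "h j t \<in> eucl N" if "x t \<in> eucl N" for j t
    using that aE by (auto simp: h_def mem_eucl a_def)
  have hS: "h (Suc k) t = (h k t)(k := x t k)" for t by (auto simp: h_def)
  have hkk: "h k t k = a k" for t by (auto simp: h_def a_def)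
  define D where "D t = (if x t k \<noteq> a k then (f (h (Suc k) t) - f (h k t)) / (x t k - a k)
     else partial k f a)" for t
  have fD: "f (h (Suc k) t) - f (h k t) = (x t k - a k) * D t" for t
  proof (cases "x t k = a k")
    case True
    then have "h (Suc k) t = h k t" using hS[of t] hkk[of t] by (metis fun_upd_triv)
    then show ?thesis using True by simp
  qed (simp add: D_def)
  obtain d0 where d0: "d0 > 0" "\<And>y. y \<in> eucl N \<Longrightarrow> (\<And>i. i < N \<Longrightarrow> \<bar>y i - a i\<bar> < d0) \<Longrightarrow> y \<in> S"
    using eucl_box[OF S x0] unfolding a_def by blast
  have Dlim: "(D \<longlongrightarrow> partial k f a) (at t0)"
  proof (rule tendstoI)
    fix e :: real assume e: "e > 0"
    have op: "openin (Euclidean_space N) {y \<in> S. partial k f y \<in> ball (partial k f a) e}"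
    proof -
      have "openin (top_of_set S) (S \<inter> partial k f -` ball (partial k f a) e)"
        using cf by (intro continuous_openin_preimage_gen) auto
      moreover have "S \<inter> partial k f -` ball (partial k f a) e = {y \<in> S. partial k f y \<in> ball (partial k f a) e}"
        by auto
      ultimately show ?thesis using S by (metis openin_eucl openin_trans)
    qed
    obtain d where d: "d > 0"
      "\<And>y. y \<in> eucl N \<Longrightarrow> (\<And>i. i < N \<Longrightarrow> \<bar>y i - a i\<bar> < d) \<Longrightarrow> y \<in> S \<and> dist (partial k f a) (partial k f y) < e"
      using eucl_box[OF op, of a] x0 e unfolding a_def by auto
    have near: "\<forall>\<^sub>F t in nhds t0. \<forall>i\<in>{..<N}. \<bar>x t i - a i\<bar> < d"
    proof (rule eventually_ball_finite)
      show "\<forall>i\<in>{..<N}. \<forall>\<^sub>F t in nhds t0. \<bar>x t i - a i\<bar> < d"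
      proof
        fix i assume "i \<in> {..<N}"
        then have "((\<lambda>t. x t i) \<longlongrightarrow> x t0 i) (at t0)"
          using DERIV_isCont[OF dx[of i]] by (simp add: isCont_def)
        then have "\<forall>\<^sub>F t in at t0. dist (x t i) (a i) < d"
          using d(1) unfolding a_def by (rule tendstoD)
        then have "\<forall>\<^sub>F t in at t0. \<bar>x t i - a i\<bar> < d" by (simp add: dist_real_def)
        moreover have "\<bar>x t0 i - a i\<bar> < d" using d(1) by (simp add: a_def)
        ultimately show "\<forall>\<^sub>F t in nhds t0. \<bar>x t i - a i\<bar> < d"
          unfolding eventually_nhds_conv_at by simp
      qed
    qed simp
    have imp: "dist (D t) (partial k f a) < e"
      if t: "\<forall>i\<in>{..<N}. \<bar>x t i - a i\<bar> < d" "x t \<in> eucl N" for t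
    proof (cases "x t k = a k")
      case True then show ?thesis using e by (simp add: D_def)
    next
      case False
      let ?g = "\<lambda>s. f ((h k t)(k := s))"
      have inS: "(h k t)(k := s) \<in> S \<and> dist (partial k f a) (partial k f ((h k t)(k := s))) < e"
        if "\<bar>s - a k\<bar> \<le> \<bar>x t k - a k\<bar>" for s
      proof (rule d(2))
        show "(h k t)(k := s) \<in> eucl N" using hE[OF t(2), of k] k by (auto simp: mem_eucl)
        fix i assume i: "i < N"
        show "\<bar>((h k t)(k := s)) i - a i\<bar> < d"
        proof (cases "i = k")
          case True
          have "\<bar>x t k - a k\<bar> < d" using t(1) k by blast
          then show ?thesis using that True by simp
        next
          case False
          then show ?thesis using t(1) d(1) i by (auto simp: h_def a_def)
        qed
      qed
      have der: "(?g has_real_derivative partial k f ((h k t)(k := s))) (at s)"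
        if "\<bar>s - a k\<bar> \<le> \<bar>x t k - a k\<bar>" for s
      proof -
        have "(\<lambda>u. f (((h k t)(k := s))(k := u))) field_differentiable at (((h k t)(k := s)) k)"
          by (rule df) (use inS[OF that] in auto)
        then show ?thesis
          using DERIV_deriv_iff_field_differentiable by (fastforce simp: partial_def)
      qed
      have "\<exists>s. \<bar>s - a k\<bar> \<le> \<bar>x t k - a k\<bar> \<and>
         ?g (x t k) - ?g (a k) = (x t k - a k) * partial k f ((h k t)(k := s))"
      proof (cases "a k < x t k")
        case True
        then obtain s where "a k < s" "s < x t k"
          "?g (x t k) - ?g (a k) = (x t k - a k) * partial k f ((h k t)(k := s))"
          using MVT2[OF True, of ?g "\<lambda>s. partial k f ((h k t)(k := s))"] der by auto
        then show ?thesis by (intro exI[of _ s]) auto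
      next
        case F: False
        then have lt: "x t k < a k" using False by simp
        then obtain s where "x t k < s" "s < a k"
          "?g (a k) - ?g (x t k) = (a k - x t k) * partial k f ((h k t)(k := s))"
          using MVT2[OF lt, of ?g "\<lambda>s. partial k f ((h k t)(k := s))"] der by auto
        then show ?thesis by (intro exI[of _ s]) (auto simp: algebra_simps)
      qed
      then obtain s where s: "\<bar>s - a k\<bar> \<le> \<bar>x t k - a k\<bar>"
         "?g (x t k) - ?g (a k) = (x t k - a k) * partial k f ((h k t)(k := s))" by blast
      have "?g (a k) = f (h k t)" using hkk[of t] by (metis fun_upd_triv)
      then have "D t = partial k f ((h k t)(k := s))"
        using s(2) False by (simp add: D_def hS)
      then show ?thesis using inS[OF s(1)] by (simp add: dist_commute)
    qed
    have "\<forall>\<^sub>F t in nhds t0. dist (D t) (partial k f a) < e"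
      using near ev by eventually_elim (rule imp)
    then show "\<forall>\<^sub>F t in at t0. dist (D t) (partial k f a) < e"
      by (simp add: eventually_nhds_conv_at)
  qed
  have "((\<lambda>t. (x t k - a k) / (t - t0)) \<longlongrightarrow> x' k) (at t0)"
    using dx[OF k] by (simp add: has_field_derivative_iff a_def)
  from tendsto_mult[OF this Dlim]
  have "((\<lambda>t. (f (h (Suc k) t) - f (h k t)) / (t - t0)) \<longlongrightarrow> x' k * partial k f a) (at t0)"
    by (simp add: fD field_simps)
  moreover have "f (h (Suc k) t0) - f (h k t0) = 0" using fD[of t0] by (simp add: a_def)
  ultimately show ?thesis by (simp add: has_field_derivative_iff a_def mult.commute)
qed

text \<open>Telescopes from \<open>x t0\<close>, which is \<open>h 0 t\<close>, to
  \<open>x t\<close>, which is \<open>h N t\<close> because both points vanish beyond coordinate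
  \<open>N\<close>.\<close>

lemma chain_rule_curve:
  fixes x :: "real \<Rightarrow> nat \<Rightarrow> real"
  assumes S: "openin (Euclidean_space N) S" and f: "cdiff N (Suc 0) S f"
    and ev: "\<forall>\<^sub>F t in nhds t0. x t \<in> eucl N" and x0: "x t0 \<in> S"
    and dx: "\<And>i. i < N \<Longrightarrow> ((\<lambda>t. x t i) has_real_derivative x' i) (at t0)"
  shows "((\<lambda>t. f (x t)) has_real_derivative (\<Sum>k<N. partial k f (x t0) * x' k)) (at t0)"
proof -
  define h where "h = (\<lambda>k t i. if i < k then x t i else x t0 i)"
  have "((\<lambda>t. \<Sum>k<N. f (h (Suc k) t) - f (h k t)) has_real_derivative
      (\<Sum>k<N. partial k f (x t0) * x' k)) (at t0)"
    unfolding h_def by (intro DERIV_sum chain_rule_term[OF S _ _ _ ev x0 dx]) (use f in auto)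
  then have d: "((\<lambda>t. f (h N t) - f (h 0 t)) has_real_derivative
      (\<Sum>k<N. partial k f (x t0) * x' k)) (at t0)"
    unfolding sum_lessThan_telescope[of "\<lambda>k. f (h k _)"] .
  have x0E: "x t0 \<in> eucl N" using x0 openin_eucl_subset[OF S] by auto
  have "\<forall>\<^sub>F t in nhds t0. h N t = x t"
    using ev by eventually_elim (use x0E in \<open>auto simp: h_def mem_eucl fun_eq_iff\<close>)
  then have "\<forall>\<^sub>F t in nhds t0. f (x t) = f (h N t) - f (h 0 t) + f (x t0)"
    by eventually_elim (auto simp: h_def)
  from DERIV_cong_ev[OF refl this refl] show ?thesis
    using DERIV_add[OF d DERIV_const[of "f (x t0)"]] by simp
qed

text \<open>The derivative in direction \<open>j\<close> is a sum of products of
  \<open>partial i f\<close>, composed with \<open>x\<close>, and derivatives of \<open>x\<close>.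
  Therefore the induction on the order keeps \<open>x\<close> fixed and lets \<open>f\<close>
  vary.\<close>

lemma cdiff_compose:
  assumes S: "openin (Euclidean_space N) S" and T: "openin (Euclidean_space n) T"
    and xS: "\<And>y. y \<in> T \<Longrightarrow> x y \<in> S"
  shows "cdiff N k S f \<Longrightarrow> (\<And>i. i < N \<Longrightarrow> cdiff n k T (\<lambda>y. x y i)) \<Longrightarrow> cdiff n k T (\<lambda>y. f (x y))"
proof (induction k arbitrary: f)
  case 0
  have "continuous_on T x"
  proof (rule continuous_on_coordinatewise_then_product)
    fix i show "continuous_on T (\<lambda>y. x y i)"
    proof (cases "i < N")
      case False
      then have "y \<in> T \<Longrightarrow> x y i = 0" for y
        using xS openin_eucl_subset[OF S] by (force simp: mem_eucl)
      then show ?thesis by (simp cong: continuous_on_cong)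
    qed (use 0 in auto)
  qed
  then show ?case using 0 xS continuous_on_compose2[of S f T x] by auto
next
  case (Suc k)
  have x1: "cdiff n k T (\<lambda>y. x y i)" if "i < N" for i
    using Suc.prems(2)[OF that] by (rule cdiff_decrease)
  show ?case
  proof (rule cdiff_SucI[OF T, where g = "\<lambda>j y. \<Sum>i<N. partial i f (x y) * partial j (\<lambda>y. x y i) y"])
    have "cdiff n k T (\<lambda>y. f (x y))"
      using Suc.IH[OF cdiff_decrease[OF Suc.prems(1)]] x1 by blast
    then show "continuous_on T (\<lambda>y. f (x y))" by (rule cdiff_continuous)
    fix j assume j: "j < n"
    show "cdiff n k T (\<lambda>y. \<Sum>i<N. partial i f (x y) * partial j (\<lambda>y. x y i) y)"
    proof (intro cdiff_sum[OF T] cdiff_mult[OF T])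
      fix i assume "i \<in> {..<N}"
      then have i: "i < N" by simp
      have "cdiff N k S (partial i f)" using Suc.prems(1) i by simp
      then show "cdiff n k T (\<lambda>y. partial i f (x y))" by (rule Suc.IH) (rule x1)
      show "cdiff n k T (partial j (\<lambda>y. x y i))" using Suc.prems(2)[OF i] j by simp
    qed
    fix y assume y: "y \<in> T"
    have "((\<lambda>t. f (x (y(j := t)))) has_real_derivative
      (\<Sum>i<N. partial i f (x (y(j := y j))) * partial j (\<lambda>y. x y i) y)) (at (y j))"
    proof (rule chain_rule_curve[OF S])
      show "cdiff N (Suc 0) S f" using Suc.prems(1)
        by (induction k) (auto dest: cdiff_decrease cdiff_continuous)
      show "\<forall>\<^sub>F t in nhds (y j). x (y(j := t)) \<in> eucl N"
        using eventually_fun_upd_mem[OF T y j]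
        by eventually_elim (use xS openin_eucl_subset[OF S] in blast)
      show "x (y(j := y j)) \<in> S" using y xS by simp
      fix i assume "i < N"
      from cdiff_Suc_D[OF Suc.prems(2)[OF this] j y]
      show "((\<lambda>t. x (y(j := t)) i) has_real_derivative partial j (\<lambda>y. x y i) y) (at (y j))" .
    qed
    then show "((\<lambda>t. f (x (y(j := t)))) has_real_derivative
      (\<Sum>i<N. partial i f (x y) * partial j (\<lambda>y. x y i) y)) (at (y j))" by simp
  qed
qed

subsection \<open>Integrals depending on a parameter\<close>

text \<open>The convention for parameters: a family over n-space depending on a real number
  \<open>t\<close> is a function on (n+1)-space, evaluated at \<open>y(n := t)\<close>.\<close>

lemma eucl_upd: "y \<in> eucl n \<Longrightarrow> y(n := t) \<in> eucl (Suc n)"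
  by (auto simp: mem_eucl)

lemma openin_tube:
  assumes O: "openin (Euclidean_space (Suc n)) \<Omega>" and y: "y \<in> eucl n"
    and K: "compact K" "\<And>t. t \<in> K \<Longrightarrow> y(n := t) \<in> \<Omega>"
  shows "\<exists>Y. openin (Euclidean_space n) Y \<and> y \<in> Y \<and> (\<forall>z\<in>Y. \<forall>t\<in>K. z(n := t) \<in> \<Omega>)"
proof -
  obtain T where T: "open T" "\<Omega> = eucl (Suc n) \<inter> T"
    using O by (auto simp: openin_eucl openin_open)
  define P where "P = (\<lambda>(z, t). z(n := t) :: nat \<Rightarrow> real) -` T"
  have "continuous_on UNIV (\<lambda>p :: (nat \<Rightarrow> real) \<times> real. (fst p)(n := snd p))"
    by (intro continuous_intros)
  then have "open P" unfolding P_def using T(1) by (simp add: case_prod_unfold open_vimage)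
  moreover have "{y} \<times> K \<subseteq> P" using K(2) T by (auto simp: P_def)
  ultimately obtain X where X: "y \<in> X" "open X" "X \<times> K \<subseteq> P"
    using Elementary_Topology.tube_lemma[OF K(1) \<open>open P\<close> \<open>{y} \<times> K \<subseteq> P\<close>] by auto
  have "z(n := t) \<in> \<Omega>" if "z \<in> eucl n" "z \<in> X" "t \<in> K" for z t
  proof -
    have "(z, t) \<in> P" using X that by auto
    then show ?thesis using T eucl_upd[OF that(1)] by (auto simp: P_def)
  qed
  moreover have "openin (Euclidean_space n) (eucl n \<inter> X)"
    using X(2) by (auto simp: openin_eucl openin_open)
  ultimately show ?thesis using X(1) y by (intro exI[of _ "eucl n \<inter> X"]) auto
qed

text \<open>Iterated differentiation under the integral sign. The integrand lives on an open set
  \<open>\<Omega>\<close> that contains \<open>S \<times> {0..1}\<close> in the sense of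
  \<open>sub\<close>, because smoothness is only defined on open sets and the end points of the
  interval must be interior.\<close>

lemma cdiff_integral:
  assumes O: "openin (Euclidean_space (Suc n)) \<Omega>" and S: "openin (Euclidean_space n) S"
    and sub: "\<And>y t. y \<in> S \<Longrightarrow> t \<in> {0..1::real} \<Longrightarrow> y(n := t) \<in> \<Omega>"
  shows "cdiff (Suc n) k \<Omega> f \<Longrightarrow> cdiff n k S (\<lambda>y. integral {0..1} (\<lambda>t. f (y(n := t))))"
proof (induction k arbitrary: f)
  case 0
  have "continuous_on (S \<times> cbox 0 (1::real)) (\<lambda>p. f ((fst p)(n := snd p)))"
  proof (rule continuous_on_compose2[of \<Omega> f])
    show "continuous_on (S \<times> cbox 0 1) (\<lambda>p. (fst p)(n := snd p))" by (intro continuous_intros)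
  qed (use 0 sub in auto)
  then have "continuous_on (S \<times> cbox 0 (1::real)) (\<lambda>(y, t). f (y(n := t)))"
    by (simp add: case_prod_unfold)
  then show ?case using integral_continuous_on_param[of S "0::real" 1 "\<lambda>y t. f (y(n := t))"] by (simp only: box_real cdiff.simps True_implies_equals)
next
  case (Suc k)
  show ?case
  proof (rule cdiff_SucI[OF S, where g = "\<lambda>i y. integral {0..1} (\<lambda>t. partial i f (y(n := t)))"])
    have "cdiff n k S (\<lambda>y. integral {0..1} (\<lambda>t. f (y(n := t))))"
      using Suc.IH[OF cdiff_decrease[OF Suc.prems]] .
    then show "continuous_on S (\<lambda>y. integral {0..1} (\<lambda>t. f (y(n := t))))" by (rule cdiff_continuous)
    fix i assume i: "i < n"
    show "cdiff n k S (\<lambda>y. integral {0..1} (\<lambda>t. partial i f (y(n := t))))"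
      using Suc.prems i by (intro Suc.IH) simp
    fix y assume y: "y \<in> S"
    obtain d where d: "d > 0" "\<And>s. \<bar>s - y i\<bar> < d \<Longrightarrow> y(i := s) \<in> S"
      using openin_eucl_fun_upd_line[OF S y i] by blast
    \<comment> \<open>A ball, since the Leibniz rule asks for a convex domain.\<close>
    define U where "U = ball (y i) d"
    have U: "y(i := s) \<in> S" if "s \<in> U" for s
      using d(2)[of s] that by (auto simp: U_def dist_real_def abs_minus_commute)
    have cont: "continuous_on (U \<times> cbox 0 (1::real)) (\<lambda>(s, t). g ((y(i := s))(n := t)))"
      if g: "continuous_on \<Omega> g" for g :: "(nat \<Rightarrow> real) \<Rightarrow> real"
    proof -
      have "continuous_on (U \<times> cbox 0 (1::real)) (\<lambda>p. g ((y(i := fst p))(n := snd p)))"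
      proof (rule continuous_on_compose2[OF g])
        show "continuous_on (U \<times> cbox 0 1) (\<lambda>p. (y(i := fst p))(n := snd p))" by (intro continuous_intros)
      qed (use sub U in auto)
      then show ?thesis by (simp add: case_prod_unfold)
    qed
    have "((\<lambda>s. integral (cbox 0 1) (\<lambda>t. f ((y(i := s))(n := t)))) has_field_derivative
       integral (cbox 0 1) (\<lambda>t. partial i f ((y(i := y i))(n := t)))) (at (y i) within U)"
    proof (rule leibniz_rule_field_derivative)
      fix s t assume st: "s \<in> U" "t \<in> cbox 0 (1::real)"
      have "(y(i := s))(n := t) \<in> \<Omega>" using sub U st by auto
      moreover have "((y(i := s))(n := t)) i = s" using i by simp
      ultimately have "((\<lambda>s'. f (((y(i := s))(n := t))(i := s'))) has_real_derivative
          partial i f ((y(i := s))(n := t))) (at s)"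
        using cdiff_Suc_D[OF Suc.prems, of i "(y(i := s))(n := t)"] i by (metis less_SucI)
      moreover have "((y(i := s))(n := t))(i := s') = (y(i := s'))(n := t)" for s'
        using i by (auto simp: fun_eq_iff)
      ultimately show "((\<lambda>s. f ((y(i := s))(n := t))) has_real_derivative
          partial i f ((y(i := s))(n := t))) (at s within U)"
        by (simp add: has_field_derivative_at_within)
    next
      fix s assume s: "s \<in> U"
      have "continuous_on (cbox 0 1) (\<lambda>t. f ((y(i := s))(n := t)))"
      proof (rule continuous_on_compose2[OF cdiff_continuous[OF Suc.prems]])
        show "continuous_on (cbox 0 1) (\<lambda>t. (y(i := s))(n := t))" by (intro continuous_intros)
        show "(\<lambda>t. (y(i := s))(n := t)) ` cbox 0 1 \<subseteq> \<Omega>"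
          unfolding box_real by (intro image_subsetI sub U s)
      qed
      then show "(\<lambda>t. f ((y(i := s))(n := t))) integrable_on cbox 0 1" by (rule integrable_continuous)
    next
      show "continuous_on (U \<times> cbox 0 1) (\<lambda>(s, t). partial i f ((y(i := s))(n := t)))"
        using Suc.prems i by (intro cont cdiff_continuous[of "Suc n" k]) simp
    qed (use d in \<open>auto simp: U_def\<close>)
    moreover have "open U" "y i \<in> U" using d by (auto simp: U_def)
    ultimately show "((\<lambda>s. integral {0..1} (\<lambda>t. f ((y(i := s))(n := t)))) has_real_derivative
       integral {0..1} (\<lambda>t. partial i f (y(n := t)))) (at (y i))"
      by (simp add: at_within_open[OF _ \<open>open U\<close>])
  qed
qed

subsection \<open>Closure properties of smooth functions\<close>

lemma smooth_real_openin: "smooth_real n S f \<Longrightarrow> openin (Euclidean_space n) S"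
  by (simp add: smooth_real_def)

lemma smooth_real_continuous: "smooth_real n S f \<Longrightarrow> continuous_on S f"
  using cdiff_continuous smooth_real_cdiff by blast

lemma smooth_real_cong: "smooth_real n S f \<Longrightarrow> (\<And>x. x \<in> S \<Longrightarrow> f x = g x) \<Longrightarrow> smooth_real n S g"
  unfolding smooth_real_cdiff using cdiff_cong by blast

lemma smooth_real_subset:
  "smooth_real n S f \<Longrightarrow> openin (Euclidean_space n) T \<Longrightarrow> T \<subseteq> S \<Longrightarrow> smooth_real n T f"
  unfolding smooth_real_cdiff using cdiff_subset by blast

lemma smooth_real_const: "openin (Euclidean_space n) S \<Longrightarrow> smooth_real n S (\<lambda>x. c)"
  by (simp add: smooth_real_cdiff cdiff_const)

lemma smooth_real_coord: "openin (Euclidean_space n) S \<Longrightarrow> smooth_real n S (\<lambda>x. x i)"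
  by (simp add: smooth_real_cdiff cdiff_coord)

lemma smooth_real_add: "smooth_real n S f \<Longrightarrow> smooth_real n S g \<Longrightarrow> smooth_real n S (\<lambda>x. f x + g x)"
  by (simp add: smooth_real_cdiff cdiff_add)

lemma smooth_real_mult: "smooth_real n S f \<Longrightarrow> smooth_real n S g \<Longrightarrow> smooth_real n S (\<lambda>x. f x * g x)"
  by (simp add: smooth_real_cdiff cdiff_mult)

lemma smooth_real_diff: "smooth_real n S f \<Longrightarrow> smooth_real n S g \<Longrightarrow> smooth_real n S (\<lambda>x. f x - g x)"
  using smooth_real_add[OF _ smooth_real_mult[OF smooth_real_const[of n S "-1"], of g], of f]
  by (simp add: smooth_real_openin)

lemma smooth_real_sum:
  "openin (Euclidean_space n) S \<Longrightarrow> (\<And>i. i \<in> I \<Longrightarrow> smooth_real n S (f i)) \<Longrightarrow>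
    smooth_real n S (\<lambda>x. \<Sum>i\<in>I. f i x)"
  by (simp add: smooth_real_cdiff cdiff_sum)

lemma smooth_real_compose:
  "smooth_real N S f \<Longrightarrow> openin (Euclidean_space n) T \<Longrightarrow> (\<And>i. i < N \<Longrightarrow> smooth_real n T (\<lambda>y. x y i)) \<Longrightarrow>
    (\<And>y. y \<in> T \<Longrightarrow> x y \<in> S) \<Longrightarrow> smooth_real n T (\<lambda>y. f (x y))"
  unfolding smooth_real_cdiff using cdiff_compose[of N S n T x _ f] by blast

lemma smooth_real_partial: "smooth_real n S f \<Longrightarrow> i < n \<Longrightarrow> smooth_real n S (partial i f)"
  unfolding smooth_real_cdiff by (meson cdiff.simps(2))

lemma smooth_real_integral:
  "smooth_real (Suc n) \<Omega> f \<Longrightarrow> openin (Euclidean_space n) S \<Longrightarrow>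
    (\<And>y t. y \<in> S \<Longrightarrow> t \<in> {0..1::real} \<Longrightarrow> y(n := t) \<in> \<Omega>) \<Longrightarrow>
    smooth_real n S (\<lambda>y. integral {0..1} (\<lambda>t. f (y(n := t))))"
  unfolding smooth_real_cdiff using cdiff_integral[of n \<Omega> S _ f] by blast

lemma smooth_real_DERIV:
  "smooth_real n S f \<Longrightarrow> i < n \<Longrightarrow> x \<in> S \<Longrightarrow>
    ((\<lambda>t. f (x(i := t))) has_real_derivative partial i f x) (at (x i))"
  unfolding smooth_real_cdiff using cdiff_Suc_D by blast

section \<open>Locality of continuity and smoothness\<close>

lemma continuous_on_eucl_local:
  assumes S: "openin (Euclidean_space n) S"
    and loc: "\<And>x. x \<in> S \<Longrightarrow> \<exists>T. openin (Euclidean_space n) T \<and> x \<in> T \<and> continuous_on T f"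
  shows "continuous_on S f"
  unfolding continuous_on_eq_continuous_within
proof
  fix x assume x: "x \<in> S"
  obtain T where T: "openin (Euclidean_space n) T" "x \<in> T" "continuous_on T f" using loc[OF x] by blast
  obtain P where P: "open P" "T = eucl n \<inter> P" using T(1) by (auto simp: openin_eucl openin_open)
  have "S \<subseteq> eucl n" using S by (rule openin_eucl_subset)
  then have "S \<inter> P \<subseteq> T" using P by auto
  then have "continuous (at x within (S \<inter> P)) f"
    using T by (meson continuous_on_eq_continuous_within continuous_within_subset)
  moreover have "at x within (S \<inter> P) = at x within S"
    by (rule at_within_nhd[of x P]) (use P T in auto)
  ultimately show "continuous (at x within S) f" by simp
qed

lemma cdiff_local:
  assumes S: "openin (Euclidean_space n) S"
  shows "(\<And>x. x \<in> S \<Longrightarrow> \<exists>T. openin (Euclidean_space n) T \<and> x \<in> T \<and> cdiff n k T f) \<Longrightarrow> cdiff n k S f"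
proof (induction k arbitrary: f)
  case 0
  then show ?case using continuous_on_eucl_local[OF S, of f] by simp
next
  case (Suc k)
  have "continuous_on S f"
  proof (rule continuous_on_eucl_local[OF S])
    fix x assume "x \<in> S"
    then show "\<exists>T. openin (Euclidean_space n) T \<and> x \<in> T \<and> continuous_on T f"
      using Suc.prems[of x] by auto
  qed
  moreover have "cdiff n k S (partial i f)" if i: "i < n" for i
  proof (rule Suc.IH)
    fix x assume "x \<in> S"
    then show "\<exists>T. openin (Euclidean_space n) T \<and> x \<in> T \<and> cdiff n k T (partial i f)"
      using Suc.prems[of x] i by auto
  qed
  moreover have "(\<lambda>t. f (x(i := t))) field_differentiable at (x i)" if i: "i < n" and x: "x \<in> S" for i x
    using Suc.prems[OF x] i by auto
  ultimately show ?case by simp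
qed

lemma smooth_real_local:
  assumes S: "openin (Euclidean_space n) S"
    and "\<And>x. x \<in> S \<Longrightarrow> \<exists>T. x \<in> T \<and> smooth_real n T f"
  shows "smooth_real n S f"
  unfolding smooth_real_cdiff using S assms(2) unfolding smooth_real_cdiff by (meson cdiff_local)

section \<open>Calculus on manifolds\<close>

context
  fixes X :: "'a manifold"
  assumes X: "smooth_manifold X"
begin

section \<open>Charts\<close>

lemma chart_open: "(U, \<phi>) \<in> atlas X \<Longrightarrow> openin (mtop X) U"
  and chart_image_open: "(U, \<phi>) \<in> atlas X \<Longrightarrow> openin (Euclidean_space (mdim X)) (\<phi> ` U)"
  and chart_homeomorphic: "(U, \<phi>) \<in> atlas X \<Longrightarrow> homeomorphic_map (subtopology (mtop X) U)
          (subtopology (Euclidean_space (mdim X)) (\<phi> ` U)) \<phi>"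
  using X by (auto simp: smooth_manifold_def)

lemma chart_transition:
  assumes "(U, \<phi>) \<in> atlas X" "(W, \<psi>) \<in> atlas X" "i < mdim X"
  shows "smooth_real (mdim X) (\<phi> ` (U \<inter> W)) (\<lambda>y. \<psi> (inv_into U \<phi> y) i)"
proof -
  have "\<forall>(U, \<phi>)\<in>atlas X. \<forall>(W, \<psi>)\<in>atlas X. \<forall>i<mdim X.
        smooth_real (mdim X) (\<phi> ` (U \<inter> W)) (\<lambda>y. \<psi> (inv_into U \<phi> y) i)"
    using X unfolding smooth_manifold_def by (elim conjE)
  from bspec[OF this assms(1)] have "\<forall>(W, \<psi>)\<in>atlas X. \<forall>i<mdim X.
        smooth_real (mdim X) (\<phi> ` (U \<inter> W)) (\<lambda>y. \<psi> (inv_into U \<phi> y) i)" by simp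
  from bspec[OF this assms(2)] show ?thesis using assms(3) by simp
qed

lemma chart_subset: "(U, \<phi>) \<in> atlas X \<Longrightarrow> U \<subseteq> pts X"
  by (rule openin_subset) (rule chart_open)

lemma chart_inj: assumes "(U, \<phi>) \<in> atlas X" shows "inj_on \<phi> U"
proof -
  have "topspace (subtopology (mtop X) U) = U"
    using chart_subset[OF assms] by auto
  then show ?thesis
    using homeomorphic_imp_injective_map[OF chart_homeomorphic[OF assms]] by simp
qed

lemma chart_eucl: "(U, \<phi>) \<in> atlas X \<Longrightarrow> x \<in> U \<Longrightarrow> \<phi> x \<in> eucl (mdim X)"
  using chart_image_open openin_eucl_subset by blast

lemma chart_inverse: "(U, \<phi>) \<in> atlas X \<Longrightarrow> x \<in> U \<Longrightarrow> inv_into U \<phi> (\<phi> x) = x"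
  using chart_inj by simp

lemma chart_at: "x \<in> pts X \<Longrightarrow> \<exists>U \<phi>. (U, \<phi>) \<in> atlas X \<and> x \<in> U"
  using X by (auto simp: smooth_manifold_def)

lemma chart_image_Int_open:
  assumes c: "(U, \<phi>) \<in> atlas X" and Q: "openin (mtop X) Q"
  shows "openin (Euclidean_space (mdim X)) (\<phi> ` (U \<inter> Q))"
proof -
  have "openin (subtopology (mtop X) U) (U \<inter> Q)"
    using Q by (auto simp: openin_subtopology_Int2)
  then have "openin (subtopology (Euclidean_space (mdim X)) (\<phi> ` U)) (\<phi> ` (U \<inter> Q))"
    using homeomorphic_imp_open_map[OF chart_homeomorphic[OF c]] by (simp add: open_map_def)
  then show ?thesis using chart_image_open[OF c] openin_trans_full by blast
qed

lemma chart_vimage_open: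
  assumes c: "(U, \<phi>) \<in> atlas X" and T: "openin (Euclidean_space (mdim X)) T"
  shows "openin (mtop X) {x \<in> U. \<phi> x \<in> T}"
proof -
  have U: "topspace (subtopology (mtop X) U) = U" using chart_subset[OF c] by auto
  have "continuous_map (subtopology (mtop X) U) (Euclidean_space (mdim X)) \<phi>"
    using homeomorphic_imp_continuous_map[OF chart_homeomorphic[OF c]] continuous_map_in_subtopology by blast
  from openin_continuous_map_preimage[OF this T]
  show ?thesis using chart_open[OF c] openin_trans_full U by fastforce
qed

section \<open>Plots\<close>

lemma plot_openin: "plot X n S c \<Longrightarrow> openin (Euclidean_space n) S"
  and plot_pts: "plot X n S c \<Longrightarrow> y \<in> S \<Longrightarrow> c y \<in> pts X"
  by (auto simp: plot_def)

lemma plot_chart_continuous: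
  assumes "plot X n S c" and ch: "(U, \<phi>) \<in> atlas X"
  shows "continuous_on {y \<in> S. c y \<in> U} (\<lambda>y. \<phi> (c y))"
proof (rule continuous_on_coordinatewise_then_product)
  fix i show "continuous_on {y \<in> S. c y \<in> U} (\<lambda>y. \<phi> (c y) i)"
  proof (cases "i < mdim X")
    case True
    then have "smooth_real n {y \<in> S. c y \<in> U} (\<lambda>y. \<phi> (c y) i)"
      using assms by (auto simp: plot_def)
    then show ?thesis by (rule smooth_real_continuous)
  next
    case False
    then have "\<phi> (c y) i = 0" if "y \<in> {y \<in> S. c y \<in> U}" for y
      using chart_eucl[OF ch] that by (simp add: mem_eucl)
    then show ?thesis by (intro continuous_on_eq[OF continuous_on_const[of _ 0]]) simp
  qed
qed

lemma plot_chart_openin: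
  "plot X n S c \<Longrightarrow> (U, \<phi>) \<in> atlas X \<Longrightarrow> openin (Euclidean_space n) {y \<in> S. c y \<in> U}"
  by (auto simp: plot_def)

text \<open>By definition a plot pulls back only chart domains to open sets. For general
  \<open>Q\<close> one works near each point inside a chart, where the plot is continuous in
  coordinates and the image of \<open>Q\<close> is open.\<close>

lemma plot_vimage_open:
  assumes p: "plot X n S c" and Q: "openin (mtop X) Q"
  shows "openin (Euclidean_space n) {y \<in> S. c y \<in> Q}"
proof (subst openin_subopen, rule ballI)
  fix y assume y: "y \<in> {y \<in> S. c y \<in> Q}"
  then obtain U \<phi> where ch: "(U, \<phi>) \<in> atlas X" "c y \<in> U"
    using chart_at[of "c y"] plot_pts[OF p] by auto
  have "openin (Euclidean_space n) {y \<in> {y \<in> S. c y \<in> U}. \<phi> (c y) \<in> \<phi> ` (U \<inter> Q)}"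
    by (rule openin_preimage_eucl[OF chart_image_Int_open[OF ch(1) Q] plot_chart_continuous[OF p ch(1)]
          plot_chart_openin[OF p ch(1)]]) (use chart_eucl[OF ch(1)] in auto)
  moreover have "{y \<in> {y \<in> S. c y \<in> U}. \<phi> (c y) \<in> \<phi> ` (U \<inter> Q)} \<subseteq> {y \<in> S. c y \<in> Q}"
    using chart_inj[OF ch(1)] by (auto dest: inj_onD)
  ultimately show "\<exists>T. openin (Euclidean_space n) T \<and> y \<in> T \<and> T \<subseteq> {y \<in> S. c y \<in> Q}"
    using y ch by blast
qed

lemma plot_cong: "plot X n S c \<Longrightarrow> (\<And>y. y \<in> S \<Longrightarrow> c y = d y) \<Longrightarrow> plot X n S d"
proof -
  assume p: "plot X n S c" and eq: "\<And>y. y \<in> S \<Longrightarrow> c y = d y"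
  have sets: "{y \<in> S. d y \<in> U} = {y \<in> S. c y \<in> U}" for U using eq by auto
  have "smooth_real n {y \<in> S. c y \<in> U} (\<lambda>y. \<phi> (d y) i)"
    if "(U, \<phi>) \<in> atlas X" "i < mdim X" for U \<phi> i
  proof (rule smooth_real_cong)
    show "smooth_real n {y \<in> S. c y \<in> U} (\<lambda>y. \<phi> (c y) i)" using p that by (auto simp: plot_def)
  qed (use eq in auto)
  moreover have "d ` S \<subseteq> pts X" using p eq by (auto simp: plot_def)
  ultimately show ?thesis using p unfolding plot_def sets by blast
qed

lemma plot_compose:
  assumes p: "plot X N S d" and T: "openin (Euclidean_space n) T"
    and x: "\<And>i. i < N \<Longrightarrow> smooth_real n T (\<lambda>y. x y i)" and xS: "\<And>y. y \<in> T \<Longrightarrow> x y \<in> S"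
  shows "plot X n T (\<lambda>y. d (x y))"
proof -
  have SE: "S \<subseteq> eucl N" using plot_openin[OF p] by (rule openin_eucl_subset)
  have cx: "continuous_on T x"
  proof (rule continuous_on_coordinatewise_then_product)
    fix i show "continuous_on T (\<lambda>y. x y i)"
    proof (cases "i < N")
      case False
      then have "x y i = 0" if "y \<in> T" for y using xS[OF that] SE by (auto simp: mem_eucl)
      then show ?thesis by (intro continuous_on_eq[OF continuous_on_const[of _ 0]]) simp
    qed (use x smooth_real_continuous in auto)
  qed
  have "openin (Euclidean_space n) {y \<in> T. d (x y) \<in> U} \<and>
      (\<forall>i<mdim X. smooth_real n {y \<in> T. d (x y) \<in> U} (\<lambda>y. \<phi> (d (x y)) i))"
    if ch: "(U, \<phi>) \<in> atlas X" for U \<phi>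
  proof -
    have "openin (Euclidean_space n) {y \<in> T. x y \<in> {z \<in> S. d z \<in> U}}"
      by (rule openin_preimage_eucl[OF plot_chart_openin[OF p ch] cx T]) (use xS SE in auto)
    moreover have eq: "{y \<in> T. x y \<in> {z \<in> S. d z \<in> U}} = {y \<in> T. d (x y) \<in> U}" using xS by auto
    ultimately have op: "openin (Euclidean_space n) {y \<in> T. d (x y) \<in> U}" by simp
    have "smooth_real n {y \<in> T. d (x y) \<in> U} (\<lambda>y. \<phi> (d (x y)) i)" if "i < mdim X" for i
    proof (rule smooth_real_compose[where f = "\<lambda>z. \<phi> (d z) i", OF _ op])
      show "smooth_real N {z \<in> S. d z \<in> U} (\<lambda>z. \<phi> (d z) i)" using p ch that by (auto simp: plot_def)
      show "smooth_real n {y \<in> T. d (x y) \<in> U} (\<lambda>y. x y i)" if "i < N" for i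
        using x[OF that] by (rule smooth_real_subset) (use op in auto)
    qed (use xS in auto)
    then show ?thesis using op by blast
  qed
  moreover have "(\<lambda>y. d (x y)) ` T \<subseteq> pts X" using xS plot_pts[OF p] by auto
  ultimately show ?thesis using T unfolding plot_def by blast
qed

lemma plot_subset:
  assumes "plot X n S c" "openin (Euclidean_space n) T" "T \<subseteq> S"
  shows "plot X n T c"
  using plot_compose[OF assms(1,2), of "\<lambda>y. y"] assms by (auto intro: smooth_real_coord)

lemma plot_vimage: "plot X n S c \<Longrightarrow> openin (mtop X) Q \<Longrightarrow> plot X n {y \<in> S. c y \<in> Q} c"
  by (rule plot_subset) (auto intro: plot_vimage_open)

lemma plot_local:
  assumes S: "openin (Euclidean_space n) S"
    and loc: "\<And>y. y \<in> S \<Longrightarrow> \<exists>T. y \<in> T \<and> plot X n T c"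
  shows "plot X n S c"
proof -
  have loc': "\<exists>T. y \<in> T \<and> T \<subseteq> S \<and> plot X n T c" if y: "y \<in> S" for y
  proof -
    obtain T where T: "y \<in> T" "plot X n T c" using loc[OF y] by blast
    have "plot X n (S \<inter> T) c" by (rule plot_subset[OF T(2)]) (use S plot_openin[OF T(2)] in auto)
    then show ?thesis using T y by (intro exI[of _ "S \<inter> T"]) simp
  qed
  have "openin (Euclidean_space n) {y \<in> S. c y \<in> U} \<and>
      (\<forall>i<mdim X. smooth_real n {y \<in> S. c y \<in> U} (\<lambda>y. \<phi> (c y) i))"
    if ch: "(U, \<phi>) \<in> atlas X" for U \<phi>
  proof -
    have op: "openin (Euclidean_space n) {y \<in> S. c y \<in> U}"
    proof (subst openin_subopen, rule ballI)
      fix y assume y: "y \<in> {y \<in> S. c y \<in> U}"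
      then obtain T where T: "y \<in> T" "T \<subseteq> S" "plot X n T c" using loc' by blast
      then show "\<exists>T. openin (Euclidean_space n) T \<and> y \<in> T \<and> T \<subseteq> {y \<in> S. c y \<in> U}"
        by (intro exI[of _ "{y \<in> T. c y \<in> U}"] conjI plot_chart_openin[OF T(3) ch]) (use y in auto)
    qed
    have "smooth_real n {y \<in> S. c y \<in> U} (\<lambda>y. \<phi> (c y) i)" if i: "i < mdim X" for i
    proof (rule smooth_real_local[OF op])
      fix y assume y: "y \<in> {y \<in> S. c y \<in> U}"
      then obtain T where T: "y \<in> T" "T \<subseteq> S" "plot X n T c" using loc' by blast
      then show "\<exists>T. y \<in> T \<and> smooth_real n T (\<lambda>y. \<phi> (c y) i)"
        using y i ch by (intro exI[of _ "{y \<in> T. c y \<in> U}"]) (auto simp: plot_def)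
    qed
    then show ?thesis using op by blast
  qed
  moreover have "c ` S \<subseteq> pts X" using loc plot_pts by blast
  ultimately show ?thesis using S unfolding plot_def by blast
qed

lemma plot_const: "x \<in> pts X \<Longrightarrow> openin (Euclidean_space n) S \<Longrightarrow> plot X n S (\<lambda>y. x)"
proof -
  assume x: "x \<in> pts X" and S: "openin (Euclidean_space n) S"
  have "openin (Euclidean_space n) {y \<in> S. x \<in> U}" for U using S by (cases "x \<in> U") auto
  then show ?thesis using x S by (auto simp: plot_def intro: smooth_real_const)
qed

lemma chart_inverse_plot:
  assumes ch: "(U, \<phi>) \<in> atlas X"
  shows "plot X (mdim X) (\<phi> ` U) (inv_into U \<phi>)"
proof -
  have eq: "{y \<in> \<phi> ` U. inv_into U \<phi> y \<in> U'} = \<phi> ` (U \<inter> U')" for U'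
    using chart_inverse[OF ch] by (auto simp: image_iff)
  have "openin (Euclidean_space (mdim X)) (\<phi> ` (U \<inter> U')) \<and> (\<forall>i<mdim X.
      smooth_real (mdim X) (\<phi> ` (U \<inter> U')) (\<lambda>y. \<phi>' (inv_into U \<phi> y) i))"
    if ch': "(U', \<phi>') \<in> atlas X" for U' \<phi>'
    using chart_transition[OF ch ch'] chart_image_Int_open[OF ch chart_open[OF ch']] by blast
  moreover have "inv_into U \<phi> ` (\<phi> ` U) \<subseteq> pts X" using chart_subset[OF ch] chart_inverse[OF ch] by auto
  ultimately show ?thesis using chart_image_open[OF ch] unfolding plot_def eq by blast
qed

section \<open>Open sets and smooth functions tested on plots\<close>

lemma smooth_fun_openin: "smooth_fun X Q f \<Longrightarrow> openin (mtop X) Q"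
  by (simp add: smooth_fun_def)

lemma smooth_fun_plot:
  assumes f: "smooth_fun X Q f" and p: "plot X n S c"
  shows "smooth_real n {y \<in> S. c y \<in> Q} (\<lambda>y. f (c y))"
proof (rule smooth_real_local)
  show "openin (Euclidean_space n) {y \<in> S. c y \<in> Q}"
    using plot_vimage_open[OF p smooth_fun_openin[OF f]] .
  fix y assume y: "y \<in> {y \<in> S. c y \<in> Q}"
  then obtain U \<phi> where ch: "(U, \<phi>) \<in> atlas X" "c y \<in> U"
    using chart_at[of "c y"] plot_pts[OF p] by auto
  let ?T = "{y \<in> S. c y \<in> U \<inter> Q}"
  have T: "openin (Euclidean_space n) ?T"
    by (rule plot_vimage_open[OF p]) (use chart_open[OF ch(1)] smooth_fun_openin[OF f] in auto)
  have "smooth_real n ?T (\<lambda>y. f (inv_into U \<phi> (\<phi> (c y))))"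
  proof (rule smooth_real_compose[where f = "\<lambda>z. f (inv_into U \<phi> z)", OF _ T])
    show "smooth_real (mdim X) (\<phi> ` (U \<inter> Q)) (\<lambda>z. f (inv_into U \<phi> z))"
      using f ch(1) by (auto simp: smooth_fun_def)
    fix i assume "i < mdim X"
    then have "smooth_real n {y \<in> S. c y \<in> U} (\<lambda>y. \<phi> (c y) i)" using p ch(1) by (auto simp: plot_def)
    then show "smooth_real n ?T (\<lambda>y. \<phi> (c y) i)" by (rule smooth_real_subset[OF _ T]) auto
  qed auto
  then have "smooth_real n ?T (\<lambda>y. f (c y))"
    by (rule smooth_real_cong) (use chart_inverse[OF ch(1)] in auto)
  then show "\<exists>T. y \<in> T \<and> smooth_real n T (\<lambda>y. f (c y))" using y ch by (intro exI[of _ ?T]) simp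
qed

text \<open>Converse of \<open>plot_vimage_open\<close>: inverses of charts are plots, so plots
  detect openness, and the question moves to n-space.\<close>

lemma openin_plotI:
  assumes Q: "Q \<subseteq> pts X"
    and pl: "\<And>n S c. plot X n S c \<Longrightarrow> openin (Euclidean_space n) {y \<in> S. c y \<in> Q}"
  shows "openin (mtop X) Q"
proof (subst openin_subopen, rule ballI)
  fix x assume x: "x \<in> Q"
  then obtain U \<phi> where ch: "(U, \<phi>) \<in> atlas X" "x \<in> U" using chart_at Q by blast
  have "openin (mtop X) {x \<in> U. \<phi> x \<in> {y \<in> \<phi> ` U. inv_into U \<phi> y \<in> Q}}"
    by (intro chart_vimage_open ch pl chart_inverse_plot)
  moreover have "{x \<in> U. \<phi> x \<in> {y \<in> \<phi> ` U. inv_into U \<phi> y \<in> Q}} = U \<inter> Q"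
    using chart_inverse[OF ch(1)] by (auto dest: inj_onD[OF chart_inj[OF ch(1)]])
  ultimately show "\<exists>T. openin (mtop X) T \<and> x \<in> T \<and> T \<subseteq> Q" using x ch by (intro exI[of _ "U \<inter> Q"]) auto
qed

lemma smooth_funI:
  assumes Q: "openin (mtop X) Q"
    and pl: "\<And>n S c. plot X n S c \<Longrightarrow> c ` S \<subseteq> Q \<Longrightarrow> smooth_real n S (\<lambda>y. f (c y))"
  shows "smooth_fun X Q f"
proof -
  have "smooth_real (mdim X) (\<phi> ` (U \<inter> Q)) (\<lambda>y. f (inv_into U \<phi> y))" if ch: "(U, \<phi>) \<in> atlas X" for U \<phi>
  proof (rule pl)
    show "plot X (mdim X) (\<phi> ` (U \<inter> Q)) (inv_into U \<phi>)"
      by (rule plot_subset[OF chart_inverse_plot[OF ch] chart_image_Int_open[OF ch Q]]) auto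
    show "inv_into U \<phi> ` (\<phi> ` (U \<inter> Q)) \<subseteq> Q" using chart_inverse[OF ch] by auto
  qed
  then show ?thesis using Q by (auto simp: smooth_fun_def)
qed

lemma chart_coord_smooth_fun: "(U, \<phi>) \<in> atlas X \<Longrightarrow> i < mdim X \<Longrightarrow> smooth_fun X U (\<lambda>x. \<phi> x i)"
  unfolding smooth_fun_def by (auto intro: chart_open chart_transition)

lemma smooth_fun_vimage_open:
  assumes f: "smooth_fun X Q f" and T: "open T"
  shows "openin (mtop X) {x \<in> Q. f x \<in> T}"
proof (rule openin_plotI)
  show "{x \<in> Q. f x \<in> T} \<subseteq> pts X" using openin_subset[OF smooth_fun_openin[OF f]] by auto
  fix n S c assume p: "plot X n S c"
  have s: "smooth_real n {y \<in> S. c y \<in> Q} (\<lambda>y. f (c y))" by (rule smooth_fun_plot[OF f p])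
  have "openin (top_of_set {y \<in> S. c y \<in> Q}) ({y \<in> S. c y \<in> Q} \<inter> (\<lambda>y. f (c y)) -` T)"
    by (rule continuous_openin_preimage_gen[OF smooth_real_continuous[OF s] T])
  then have "openin (top_of_set (eucl n)) ({y \<in> S. c y \<in> Q} \<inter> (\<lambda>y. f (c y)) -` T)"
    by (rule openin_trans) (use smooth_real_openin[OF s] openin_eucl in blast)
  moreover have "{y \<in> S. c y \<in> Q} \<inter> (\<lambda>y. f (c y)) -` T = {y \<in> S. c y \<in> {x \<in> Q. f x \<in> T}}" by auto
  ultimately show "openin (Euclidean_space n) {y \<in> S. c y \<in> {x \<in> Q. f x \<in> T}}"
    by (simp only: openin_eucl)
qed

end

section \<open>Smooth maps between manifolds\<close>

lemma smooth_map_plot: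
  assumes X: "smooth_manifold X" and Y: "smooth_manifold Y"
    and f: "smooth_map X Y f" and p: "plot X n S c"
  shows "plot Y n S (\<lambda>y. f (c y))"
proof (rule plot_local[OF Y plot_openin[OF X p]])
  fix y assume y: "y \<in> S"
  then obtain U \<phi> where ch: "(U, \<phi>) \<in> atlas X" "c y \<in> U"
    using chart_at[OF X, of "c y"] plot_pts[OF X p] by auto
  let ?T = "{y \<in> S. c y \<in> U}"
  have "plot Y n ?T (\<lambda>y. f (inv_into U \<phi> (\<phi> (c y))))"
  proof (rule plot_compose[OF Y _ plot_chart_openin[OF X p ch(1)], where d = "\<lambda>z. f (inv_into U \<phi> z)"])
    show "plot Y (mdim X) (\<phi> ` U) (\<lambda>z. f (inv_into U \<phi> z))" using f ch(1) by (auto simp: smooth_map_def)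
  qed (use p ch(1) in \<open>auto simp: plot_def\<close>)
  then have "plot Y n ?T (\<lambda>y. f (c y))"
    by (rule plot_cong[OF Y]) (use chart_inverse[OF X ch(1)] in auto)
  then show "\<exists>T. y \<in> T \<and> plot Y n T (\<lambda>y. f (c y))" using y ch by (intro exI[of _ ?T]) simp
qed

lemma smooth_map_vimage_open:
  assumes X: "smooth_manifold X" and Y: "smooth_manifold Y"
    and f: "smooth_map X Y f" and Q: "openin (mtop Y) Q"
  shows "openin (mtop X) {x \<in> pts X. f x \<in> Q}"
proof (rule openin_plotI[OF X])
  fix n S c assume p: "plot X n S c"
  have "{y \<in> S. c y \<in> {x \<in> pts X. f x \<in> Q}} = {y \<in> S. f (c y) \<in> Q}" using plot_pts[OF X p] by auto
  then show "openin (Euclidean_space n) {y \<in> S. c y \<in> {x \<in> pts X. f x \<in> Q}}"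
    using plot_vimage_open[OF Y smooth_map_plot[OF X Y f p] Q] by simp
qed auto

lemma smooth_fun_smooth_map:
  assumes X: "smooth_manifold X" and Y: "smooth_manifold Y"
    and f: "smooth_map X Y f" and h: "smooth_fun Y Q h"
  shows "smooth_fun X {x \<in> pts X. f x \<in> Q} (\<lambda>x. h (f x))"
proof (rule smooth_funI[OF X smooth_map_vimage_open[OF X Y f smooth_fun_openin[OF Y h]]])
  fix n S c assume p: "plot X n S c" "c ` S \<subseteq> {x \<in> pts X. f x \<in> Q}"
  then have "{y \<in> S. f (c y) \<in> Q} = S" by auto
  then show "smooth_real n S (\<lambda>y. h (f (c y)))"
    using smooth_fun_plot[OF Y h smooth_map_plot[OF X Y f p(1)]] by simp
qed

section \<open>Tangent vectors\<close>

lemma zero_eucl [simp]: "(\<lambda>_. 0) \<in> eucl n"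
  by (simp add: mem_eucl)

lemma openin_eucl_interval: "openin (Euclidean_space 1) {y \<in> eucl 1. \<bar>y 0\<bar> < e}"
proof -
  have "open {y :: nat \<Rightarrow> real. \<bar>y 0\<bar> < e}"
    by (intro open_Collect_less continuous_intros continuous_on_coord)
  moreover have "{y \<in> eucl 1. \<bar>y 0\<bar> < e} = eucl 1 \<inter> {y. \<bar>y 0\<bar> < e}" by auto
  ultimately show ?thesis unfolding openin_eucl openin_open by blast
qed

text \<open>Replaces the symmetric interval by any open set around 0 in 1-space, which is what
  preimages under plots provide.\<close>

lemma smooth_curve_iff:
  assumes X: "smooth_manifold X"
  shows "smooth_curve X c \<longleftrightarrow> (\<exists>T. (\<lambda>_. 0) \<in> T \<and> plot X 1 T (\<lambda>y. c (y 0)))"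
proof
  assume "smooth_curve X c"
  then obtain e where "e > 0" "plot X 1 {y \<in> eucl 1. \<bar>y 0\<bar> < e} (\<lambda>y. c (y 0))"
    unfolding smooth_curve_def by blast
  then show "\<exists>T. (\<lambda>_. 0) \<in> T \<and> plot X 1 T (\<lambda>y. c (y 0))"
    by (intro exI[of _ "{y \<in> eucl 1. \<bar>y 0\<bar> < e}"]) auto
next
  assume "\<exists>T. (\<lambda>_. 0) \<in> T \<and> plot X 1 T (\<lambda>y. c (y 0))"
  then obtain T where T: "(\<lambda>_. 0) \<in> T" "plot X 1 T (\<lambda>y. c (y 0))" by blast
  obtain e where e: "e > 0" "\<And>y. y \<in> eucl 1 \<Longrightarrow> \<forall>i<1. \<bar>y i - 0\<bar> < e \<Longrightarrow> y \<in> T"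
    using eucl_box[OF plot_openin[OF X T(2)] T(1)] by blast
  have "plot X 1 {y \<in> eucl 1. \<bar>y 0\<bar> < e} (\<lambda>y. c (y 0))"
    by (rule plot_subset[OF X T(2) openin_eucl_interval]) (use e in auto)
  then show "smooth_curve X c" unfolding smooth_curve_def using e(1) by blast
qed

lemma eventually_line_mem:
  assumes "openin (Euclidean_space 1) T" "(\<lambda>_. 0) \<in> T"
  shows "\<forall>\<^sub>F r in nhds 0. (\<lambda>_. 0)(0 := r) \<in> T"
  using eventually_fun_upd_mem[OF assms, of 0] by simp

lemma smooth_curve_pts: "smooth_manifold X \<Longrightarrow> smooth_curve X c \<Longrightarrow> c 0 \<in> pts X"
  unfolding smooth_curve_iff using plot_pts[of X 1] by fastforce

lemma smooth_curve_eventually: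
  assumes X: "smooth_manifold X" and c: "smooth_curve X c" and Q: "openin (mtop X) Q" "c 0 \<in> Q"
  shows "\<forall>\<^sub>F r in nhds 0. c r \<in> Q"
proof -
  obtain T where T: "(\<lambda>_. 0) \<in> T" "plot X 1 T (\<lambda>y. c (y 0))" using c smooth_curve_iff[OF X] by blast
  have "\<forall>\<^sub>F r in nhds 0. (\<lambda>_. 0)(0 := r) \<in> {y \<in> T. c (y 0) \<in> Q}"
    by (rule eventually_line_mem[OF plot_vimage_open[OF X T(2) Q(1)]]) (use T Q in auto)
  then show ?thesis by eventually_elim simp
qed

lemma velocity_cong:
  assumes "\<forall>\<^sub>F r in nhds 0. c r = d r"
  shows "velocity X c = velocity X d"
proof -
  have "c 0 = d 0" using eventually_nhds_x_imp_x[OF assms] .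
  moreover have "deriv (\<lambda>r. f (c r)) 0 = deriv (\<lambda>r. f (d r)) 0" for f :: "'a \<Rightarrow> real"
    by (rule deriv_cong_ev[OF _ refl]) (use assms in eventually_elim, simp)
  ultimately show ?thesis by (simp add: velocity_def fun_eq_iff)
qed

lemma velocity_const: "velocity X (\<lambda>r. x) = (\<lambda>f. 0)"
  by (simp add: velocity_def fun_eq_iff)

lemma plot_smooth_at:
  assumes X: "smooth_manifold X" and d: "plot X n S d" "y \<in> S" and f: "smooth_at X f (d y)"
  shows "\<exists>T. y \<in> T \<and> T \<subseteq> S \<and> smooth_real n T (\<lambda>z. f (d z))"
proof -
  obtain Q where Q: "d y \<in> Q" "smooth_fun X Q f" using f by (auto simp: smooth_at_def)
  show ?thesis using smooth_fun_plot[OF X Q(2) d(1)] d Q by (intro exI[of _ "{z \<in> S. d z \<in> Q}"]) auto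
qed

lemma coord_velocity_DERIV:
  assumes X: "smooth_manifold X" and d: "plot X N S d" "a \<in> S" and i: "i < N" and f: "smooth_at X f (d a)"
  shows "((\<lambda>r. f (d (a(i := a i + r)))) has_real_derivative coord_velocity X d a i f) (at 0)"
    and "coord_velocity X d a i f = partial i (\<lambda>z. f (d z)) a"
proof -
  obtain T where T: "a \<in> T" "smooth_real N T (\<lambda>z. f (d z))" using plot_smooth_at[OF X d f] by blast
  have "((\<lambda>t. f (d (a(i := t)))) has_real_derivative partial i (\<lambda>z. f (d z)) a) (at (0 + a i))"
    using smooth_real_DERIV[OF T(2) i T(1)] by simp
  then have "((\<lambda>r. f (d (a(i := r + a i)))) has_real_derivative partial i (\<lambda>z. f (d z)) a) (at 0)"
    by (simp only: DERIV_shift)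
  then have D: "((\<lambda>r. f (d (a(i := a i + r)))) has_real_derivative partial i (\<lambda>z. f (d z)) a) (at 0)"
    by (simp only: add.commute)
  have "smooth_at X f (d (a(i := a i + 0)))" using f by simp
  then show eq: "coord_velocity X d a i f = partial i (\<lambda>z. f (d z)) a"
    unfolding coord_velocity_def velocity_def using DERIV_imp_deriv[OF D] by simp
  show "((\<lambda>r. f (d (a(i := a i + r)))) has_real_derivative coord_velocity X d a i f) (at 0)"
    using D eq by simp
qed

lemma coord_velocity_not_smooth: "\<not> smooth_at X f (d a) \<Longrightarrow> coord_velocity X d a i f = 0"
  by (simp add: coord_velocity_def velocity_def)

text \<open>An equality of functionals on all functions \<open>f\<close>: where \<open>f\<close> is
  not smooth at the base point, both sides are 0 by the normalisation of
  \<open>velocity\<close>.\<close>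

lemma velocity_compose:
  assumes X: "smooth_manifold X" and d: "plot X N S d" and x0: "x 0 \<in> S"
    and ev: "\<forall>\<^sub>F r in nhds 0. x r \<in> eucl N"
    and dx: "\<And>i. i < N \<Longrightarrow> ((\<lambda>r. x r i) has_real_derivative x' i) (at 0)"
  shows "velocity X (\<lambda>r. d (x r)) = (\<lambda>f. \<Sum>i<N. x' i * coord_velocity X d (x 0) i f)"
proof
  fix f
  show "velocity X (\<lambda>r. d (x r)) f = (\<Sum>i<N. x' i * coord_velocity X d (x 0) i f)"
  proof (cases "smooth_at X f (d (x 0))")
    case True
    obtain T where T: "x 0 \<in> T" "smooth_real N T (\<lambda>z. f (d z))"
      using plot_smooth_at[OF X d x0 True] by blast
    have "((\<lambda>r. f (d (x r))) has_real_derivative (\<Sum>k<N. partial k (\<lambda>z. f (d z)) (x 0) * x' k)) (at 0)"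
      by (rule chain_rule_curve[OF smooth_real_openin[OF T(2)] _ ev T(1) dx])
        (use T(2) smooth_real_cdiff in blast)
    then show ?thesis using True coord_velocity_DERIV(2)[OF X d x0 _ True]
      by (simp add: velocity_def DERIV_imp_deriv mult.commute)
  qed (simp add: coord_velocity_not_smooth velocity_def)
qed

lemma smooth_curve_affine:
  assumes X: "smooth_manifold X" and d: "plot X N S d" and a: "a \<in> S" and b: "b \<in> eucl N"
  shows "smooth_curve X (\<lambda>r. d (\<lambda>i. a i + r * b i))"
proof -
  have S: "openin (Euclidean_space N) S" using plot_openin[OF X d] .
  have aE: "a \<in> eucl N" using a openin_eucl_subset[OF S] by auto
  have E: "openin (Euclidean_space 1) (eucl 1)" by simp
  let ?T = "{y \<in> eucl 1. (\<lambda>i. a i + y 0 * b i) \<in> S}"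
  have "openin (Euclidean_space 1) ?T"
  proof (rule openin_preimage_eucl[OF S _ E])
    show "continuous_on (eucl 1) (\<lambda>y i. a i + y 0 * b i)"
      by (intro continuous_on_coordinatewise_then_product continuous_intros continuous_on_coord)
  qed (use aE b in \<open>auto simp: mem_eucl\<close>)
  then have "plot X 1 ?T (\<lambda>y. d (\<lambda>i. a i + y 0 * b i))"
    by (intro plot_compose[OF X d] smooth_real_add smooth_real_mult smooth_real_const smooth_real_coord) auto
  then show ?thesis unfolding smooth_curve_iff[OF X] using a by (intro exI[of _ ?T]) auto
qed

lemma smooth_curve_coord:
  assumes X: "smooth_manifold X" and d: "plot X N S d" and a: "a \<in> S" and j: "j < N"
  shows "smooth_curve X (\<lambda>r. d (a(j := a j + r)))"
proof -
  have "(\<lambda>i. a i + r * axis_pt j 1 i) = a(j := a j + r)" for r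
    by (auto simp: axis_pt_def fun_eq_iff)
  moreover have "axis_pt j 1 \<in> eucl N" using j by (auto simp: axis_pt_def mem_eucl)
  ultimately show ?thesis using smooth_curve_affine[OF X d a, of "axis_pt j 1"] by simp
qed

lemma smooth_curve_DERIV:
  assumes X: "smooth_manifold X" and c: "smooth_curve X c" and f: "smooth_at X f (c 0)"
  shows "((\<lambda>r. f (c r)) has_real_derivative velocity X c f) (at 0)"
proof -
  obtain T where T: "(\<lambda>_. 0) \<in> T" "plot X 1 T (\<lambda>y. c (y 0))" using c smooth_curve_iff[OF X] by blast
  from coord_velocity_DERIV(1)[OF X T(2,1) _ f, of 0] show ?thesis by (simp add: coord_velocity_def)
qed

lemma velocity_map:
  assumes "smooth_at Y h (f (c 0))" "smooth_at X (\<lambda>z. h (f z)) (c 0)"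
  shows "velocity Y (\<lambda>r. f (c r)) h = velocity X c (\<lambda>z. h (f z))"
  using assms by (simp add: velocity_def)

section \<open>Tangent spaces in a chart\<close>

lemma tangent_chart_expansion:
  assumes X: "smooth_manifold X" and ch: "(U, \<phi>) \<in> atlas X" and x: "x \<in> U" and v: "v \<in> tangent_space X x"
  shows "v = (\<lambda>f. \<Sum>i<mdim X. v (\<lambda>z. \<phi> z i) * coord_velocity X (inv_into U \<phi>) (\<phi> x) i f)"
proof -
  obtain c where c: "smooth_curve X c" "c 0 = x" "v = velocity X c" using v by (auto simp: tangent_space_def)
  have U: "\<forall>\<^sub>F r in nhds 0. c r \<in> U"
    using smooth_curve_eventually[OF X c(1) chart_open[OF X ch]] c(2) x by simp
  have "\<forall>\<^sub>F r in nhds 0. c r = inv_into U \<phi> (\<phi> (c r))"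
    using U by eventually_elim (simp add: chart_inverse[OF X ch])
  then have "velocity X c = velocity X (\<lambda>r. inv_into U \<phi> (\<phi> (c r)))" by (rule velocity_cong)
  also have "\<dots> = (\<lambda>f. \<Sum>i<mdim X. v (\<lambda>z. \<phi> z i) * coord_velocity X (inv_into U \<phi>) (\<phi> (c 0)) i f)"
  proof (rule velocity_compose[OF X chart_inverse_plot[OF X ch]])
    show "\<forall>\<^sub>F r in nhds 0. \<phi> (c r) \<in> eucl (mdim X)"
      using U by eventually_elim (rule chart_eucl[OF X ch])
    fix i assume "i < mdim X"
    then have "smooth_at X (\<lambda>z. \<phi> z i) (c 0)"
      using chart_coord_smooth_fun[OF X ch] c(2) x unfolding smooth_at_def by blast
    from smooth_curve_DERIV[OF X c(1) this]
    show "((\<lambda>r. \<phi> (c r) i) has_real_derivative v (\<lambda>z. \<phi> z i)) (at 0)" by (simp add: c(3))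
  qed (use c x in auto)
  finally show ?thesis using c by simp
qed

text \<open>The required curve is a straight line in the chart.\<close>

lemma tangent_space_chart_combination:
  assumes X: "smooth_manifold X" and ch: "(U, \<phi>) \<in> atlas X" and x: "x \<in> U"
  shows "(\<lambda>f. \<Sum>i<mdim X. \<kappa> i * coord_velocity X (inv_into U \<phi>) (\<phi> x) i f) \<in> tangent_space X x"
proof -
  define b where "b i = (if i < mdim X then \<kappa> i else 0)" for i
  have b: "b \<in> eucl (mdim X)" by (auto simp: b_def mem_eucl)
  have pE: "\<phi> x \<in> eucl (mdim X)" using chart_eucl[OF X ch x] .
  let ?c = "\<lambda>r. inv_into U \<phi> (\<lambda>i. \<phi> x i + r * b i)"
  have "smooth_curve X ?c"
    by (rule smooth_curve_affine[OF X chart_inverse_plot[OF X ch] _ b]) (use x in auto)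
  moreover have "?c 0 = x" using chart_inverse[OF X ch x] by simp
  moreover have "velocity X ?c = (\<lambda>f. \<Sum>i<mdim X. b i * coord_velocity X (inv_into U \<phi>) (\<lambda>i. \<phi> x i + 0 * b i) i f)"
  proof (rule velocity_compose[OF X chart_inverse_plot[OF X ch]])
    show "\<forall>\<^sub>F r in nhds 0. (\<lambda>i. \<phi> x i + r * b i) \<in> eucl (mdim X)"
      using b pE by (intro always_eventually) (auto simp: mem_eucl)
  qed (use x in \<open>auto intro!: derivative_eq_intros\<close>)
  moreover have "\<dots> = (\<lambda>f. \<Sum>i<mdim X. \<kappa> i * coord_velocity X (inv_into U \<phi>) (\<phi> x) i f)"
    by (auto simp: b_def)
  ultimately show ?thesis unfolding tangent_space_def by (intro CollectI exI[of _ ?c]) simp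
qed

text \<open>Curves in a manifold cannot be added, but the chart expansions of their velocities can,
  since the coefficients \<open>v (\<lambda>z. \<phi> z i)\<close> are linear in
  \<open>v\<close>.\<close>

lemma tangent_space_linear:
  assumes X: "smooth_manifold X" and x: "x \<in> pts X" and v: "\<And>j. j \<in> J \<Longrightarrow> v j \<in> tangent_space X x"
  shows "(\<lambda>f. \<Sum>j\<in>J. r j * v j f) \<in> tangent_space X x"
proof -
  obtain U \<phi> where ch: "(U, \<phi>) \<in> atlas X" "x \<in> U" using chart_at[OF X x] by blast
  let ?D = "\<lambda>i f. coord_velocity X (inv_into U \<phi>) (\<phi> x) i f"
  have "(\<Sum>j\<in>J. r j * v j f) = (\<Sum>i<mdim X. (\<Sum>j\<in>J. r j * v j (\<lambda>z. \<phi> z i)) * ?D i f)" for f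
  proof -
    have "(\<Sum>j\<in>J. r j * v j f) = (\<Sum>j\<in>J. r j * (\<Sum>i<mdim X. v j (\<lambda>z. \<phi> z i) * ?D i f))"
    proof (rule sum.cong[OF refl])
      fix j assume "j \<in> J"
      from fun_cong[OF tangent_chart_expansion[OF X ch v[OF this]], of f]
      show "r j * v j f = r j * (\<Sum>i<mdim X. v j (\<lambda>z. \<phi> z i) * ?D i f)" by simp
    qed
    also have "\<dots> = (\<Sum>i<mdim X. \<Sum>j\<in>J. r j * v j (\<lambda>z. \<phi> z i) * ?D i f)"
      by (simp add: sum_distrib_left mult.assoc sum.swap[of _ J])
    finally show ?thesis by (simp add: sum_distrib_right)
  qed
  then have eq: "(\<lambda>f. \<Sum>j\<in>J. r j * v j f) =
      (\<lambda>f. \<Sum>i<mdim X. (\<Sum>j\<in>J. r j * v j (\<lambda>z. \<phi> z i)) * ?D i f)" by (rule ext)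
  show ?thesis
    by (rule ssubst[OF eq, where P = "\<lambda>v. v \<in> tangent_space X x"])
      (rule tangent_space_chart_combination[OF X ch])
qed

lemma coord_velocity_in_tangent_space:
  assumes X: "smooth_manifold X" and d: "plot X N S d" "a \<in> S" and i: "i < N"
  shows "coord_velocity X d a i \<in> tangent_space X (d a)"
  unfolding tangent_space_def coord_velocity_def
  using smooth_curve_coord[OF X d i] by (intro CollectI exI[of _ "\<lambda>r. d (a(i := a i + r))"]) simp

text \<open>Velocities of coordinate lines of a plot are partial derivatives, and these are again
  smooth. All smooth families of tangent vectors below are obtained in this way.\<close>

lemma smooth_real_coord_velocity:
  assumes X: "smooth_manifold X" and d: "plot X N D d" and T: "openin (Euclidean_space n) T"
    and x: "\<And>i. i < N \<Longrightarrow> smooth_real n T (\<lambda>y. x y i)" "\<And>y. y \<in> T \<Longrightarrow> x y \<in> D"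
    and f: "smooth_fun X U f" "\<And>y. y \<in> T \<Longrightarrow> d (x y) \<in> U" and i: "i < N"
  shows "smooth_real n T (\<lambda>y. coord_velocity X d (x y) i f)"
proof -
  have s: "smooth_real N {z \<in> D. d z \<in> U} (\<lambda>z. f (d z))" by (rule smooth_fun_plot[OF X f(1) d])
  have "smooth_real n T (\<lambda>y. partial i (\<lambda>z. f (d z)) (x y))"
    by (rule smooth_real_compose[OF smooth_real_partial[OF s i] T x(1)]) (use x f in auto)
  then show ?thesis
  proof (rule smooth_real_cong)
    fix y assume y: "y \<in> T"
    have "smooth_at X f (d (x y))" using f y by (auto simp: smooth_at_def)
    from coord_velocity_DERIV(2)[OF X d x(2)[OF y] i this]
    show "partial i (\<lambda>z. f (d z)) (x y) = coord_velocity X d (x y) i f" by simp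
  qed
qed

lemma tangent_map_velocity:
  assumes X: "smooth_manifold X" and Y: "smooth_manifold Y" and f: "smooth_map X Y f"
    and c: "smooth_curve X c"
  shows "tangent_map X Y f (c 0) (velocity X c) = velocity Y (\<lambda>r. f (c r))"
proof
  fix h
  show "tangent_map X Y f (c 0) (velocity X c) h = velocity Y (\<lambda>r. f (c r)) h"
  proof (cases "smooth_at Y h (f (c 0))")
    case True
    then obtain Q where Q: "f (c 0) \<in> Q" "smooth_fun Y Q h" by (auto simp: smooth_at_def)
    have "smooth_at X (\<lambda>z. h (f z)) (c 0)"
      unfolding smooth_at_def
      by (intro exI conjI) (rule CollectI, rule conjI, rule smooth_curve_pts[OF X c], rule Q(1),
          rule smooth_fun_smooth_map[OF X Y f Q(2)])
    then show ?thesis using True velocity_map[of Y h f c X] by (simp add: tangent_map_def)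
  qed (simp add: tangent_map_def velocity_def)
qed

section \<open>Lie groupoids and their algebroids\<close>

locale lie_gpd =
  fixes G :: "('g, 'm) groupoid"
  assumes lie: "lie_groupoid G"
begin

section \<open>Structure maps and groupoid identities\<close>

lemma arrows_manifold: "smooth_manifold (arrows G)"
  and objects_manifold: "smooth_manifold (objects G)"
  and src_smooth_map: "smooth_map (arrows G) (objects G) (src G)"
  and tgt_smooth_map: "smooth_map (arrows G) (objects G) (tgt G)"
  and idt_smooth_map: "smooth_map (objects G) (arrows G) (idt G)"
  and ivs_smooth_map: "smooth_map (arrows G) (arrows G) (ivs G)"
  using lie by (auto simp: lie_groupoid_def submersion_def)

lemma gpd: "groupoid_axioms G"
  using lie by (simp add: lie_groupoid_def)

lemma src_Obj [simp]: "g \<in> Arr G \<Longrightarrow> src G g \<in> Obj G"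
  and tgt_Obj [simp]: "g \<in> Arr G \<Longrightarrow> tgt G g \<in> Obj G"
  and idt_Arr [simp]: "m \<in> Obj G \<Longrightarrow> idt G m \<in> Arr G"
  and src_idt [simp]: "m \<in> Obj G \<Longrightarrow> src G (idt G m) = m"
  and tgt_idt [simp]: "m \<in> Obj G \<Longrightarrow> tgt G (idt G m) = m"
  and mlt_Arr [simp]: "g \<in> Arr G \<Longrightarrow> h \<in> Arr G \<Longrightarrow> src G g = tgt G h \<Longrightarrow> mlt G g h \<in> Arr G"
  and src_mlt [simp]: "g \<in> Arr G \<Longrightarrow> h \<in> Arr G \<Longrightarrow> src G g = tgt G h \<Longrightarrow> src G (mlt G g h) = src G h"
  and tgt_mlt [simp]: "g \<in> Arr G \<Longrightarrow> h \<in> Arr G \<Longrightarrow> src G g = tgt G h \<Longrightarrow> tgt G (mlt G g h) = tgt G g"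
  and mlt_idt_right [simp]: "g \<in> Arr G \<Longrightarrow> mlt G g (idt G (src G g)) = g"
  and mlt_idt_left [simp]: "g \<in> Arr G \<Longrightarrow> mlt G (idt G (tgt G g)) g = g"
  and ivs_Arr [simp]: "g \<in> Arr G \<Longrightarrow> ivs G g \<in> Arr G"
  and src_ivs [simp]: "g \<in> Arr G \<Longrightarrow> src G (ivs G g) = tgt G g"
  and tgt_ivs [simp]: "g \<in> Arr G \<Longrightarrow> tgt G (ivs G g) = src G g"
  and mlt_ivs_right [simp]: "g \<in> Arr G \<Longrightarrow> mlt G g (ivs G g) = idt G (tgt G g)"
  and mlt_ivs_left [simp]: "g \<in> Arr G \<Longrightarrow> mlt G (ivs G g) g = idt G (src G g)"
  using gpd by (auto simp: groupoid_axioms_def)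

lemma ivs_idt [simp]: assumes m: "m \<in> Obj G" shows "ivs G (idt G m) = idt G m"
proof -
  have "mlt G (idt G (tgt G (ivs G (idt G m)))) (ivs G (idt G m)) = ivs G (idt G m)"
    by (rule mlt_idt_left) (use m in simp)
  also have "tgt G (ivs G (idt G m)) = m" using m by simp
  also have "mlt G (idt G m) (ivs G (idt G m)) = idt G m" using mlt_ivs_right[of "idt G m"] m by simp
  finally show ?thesis by simp
qed

lemma mlt_idt_idt [simp]: "m \<in> Obj G \<Longrightarrow> mlt G (idt G m) (idt G m) = idt G m"
  using mlt_idt_right[of "idt G m"] by simp

lemmas plot_src = smooth_map_plot[OF arrows_manifold objects_manifold src_smooth_map]
  and plot_tgt = smooth_map_plot[OF arrows_manifold objects_manifold tgt_smooth_map]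
  and plot_idt = smooth_map_plot[OF objects_manifold arrows_manifold idt_smooth_map]
  and plot_ivs = smooth_map_plot[OF arrows_manifold arrows_manifold ivs_smooth_map]

lemma plot_mlt:
  "plot (arrows G) n S c \<Longrightarrow> plot (arrows G) n S d \<Longrightarrow> (\<And>y. y \<in> S \<Longrightarrow> src G (c y) = tgt G (d y)) \<Longrightarrow>
    plot (arrows G) n S (\<lambda>y. mlt G (c y) (d y))"
  using lie unfolding lie_groupoid_def by blast

lemma Arr_openin: "openin (mtop (arrows G)) (Arr G)"
  by simp

section \<open>The fibres of the algebroid as vector spaces\<close>

lemma algebroid_tangent: "a \<in> algebroid G m \<Longrightarrow> a \<in> tangent_space (arrows G) (idt G m)"
  by (simp add: algebroid_def)

lemma algebroid_tgt:
  assumes "a \<in> algebroid G m" "m \<in> Obj G" "smooth_at (objects G) h m"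
  shows "a (\<lambda>z. h (tgt G z)) = 0"
proof -
  have "tangent_map (arrows G) (objects G) (tgt G) (idt G m) a h = 0"
    using assms(1) by (auto simp: algebroid_def)
  then show ?thesis using assms by (simp add: tangent_map_def)
qed

lemma algebroid_linear:
  assumes m: "m \<in> Obj G" and a: "\<And>j. j \<in> J \<Longrightarrow> a j \<in> algebroid G m"
  shows "(\<lambda>f. \<Sum>j\<in>J. x j * a j f) \<in> algebroid G m"
proof -
  have "(\<lambda>f. \<Sum>j\<in>J. x j * a j f) \<in> tangent_space (arrows G) (idt G m)"
    using m by (intro tangent_space_linear arrows_manifold algebroid_tangent a) auto
  moreover have "tangent_map (arrows G) (objects G) (tgt G) (idt G m) (\<lambda>f. \<Sum>j\<in>J. x j * a j f) h = 0" for h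
    using algebroid_tgt[OF a m, of _ h] m by (simp add: tangent_map_def)
  ultimately show ?thesis by (simp add: algebroid_def)
qed

lemma algebroid_zero: "m \<in> Obj G \<Longrightarrow> (\<lambda>f. 0) \<in> algebroid G m"
  using algebroid_linear[of m "{}" "\<lambda>_ _. 0" "\<lambda>_. 0"] by simp

lemma algebroid_scale: "m \<in> Obj G \<Longrightarrow> a \<in> algebroid G m \<Longrightarrow> tv_scale r a \<in> algebroid G m"
  using algebroid_linear[of m "{0::nat}" "\<lambda>_. a" "\<lambda>_. r"] by (simp add: tv_scale_def)

lemma algebroid_add:
  assumes "m \<in> Obj G" "a \<in> algebroid G m" "b \<in> algebroid G m"
  shows "tv_add a b \<in> algebroid G m"
proof -
  have "(\<lambda>f. \<Sum>j\<in>{True, False}. 1 * (if j then a else b) f) \<in> algebroid G m"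
    by (rule algebroid_linear) (use assms in auto)
  then show ?thesis by (simp add: tv_add_def)
qed

lemma velocity_in_algebroid:
  assumes m: "m \<in> Obj G" and c: "smooth_curve (arrows G) c" "c 0 = idt G m"
    and t: "\<forall>\<^sub>F r in nhds 0. tgt G (c r) = m"
  shows "velocity (arrows G) c \<in> algebroid G m"
proof -
  have "tangent_map (arrows G) (objects G) (tgt G) (c 0) (velocity (arrows G) c)
      = velocity (objects G) (\<lambda>r. tgt G (c r))"
    by (rule tangent_map_velocity[OF arrows_manifold objects_manifold tgt_smooth_map c(1)])
  also have "\<dots> = velocity (objects G) (\<lambda>r. m)" by (rule velocity_cong) (rule t)
  finally show ?thesis using c by (auto simp: algebroid_def tangent_space_def velocity_const)
qed

section \<open>Smooth families of algebroid vectors\<close>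

lemma algebroid_plot_plot: "algebroid_plot G n S \<mu> a \<Longrightarrow> plot (objects G) n S \<mu>"
  and algebroid_plot_mem: "algebroid_plot G n S \<mu> a \<Longrightarrow> y \<in> S \<Longrightarrow> a y \<in> algebroid G (\<mu> y)"
  and algebroid_plot_smooth: "algebroid_plot G n S \<mu> a \<Longrightarrow> smooth_fun (arrows G) U f \<Longrightarrow>
    smooth_real n {y \<in> S. idt G (\<mu> y) \<in> U} (\<lambda>y. a y f)"
  by (auto simp: algebroid_plot_def)

lemma algebroid_plot_cong:
  assumes "algebroid_plot G n S \<mu> a" "\<And>y. y \<in> S \<Longrightarrow> \<mu> y = \<mu>' y" "\<And>y. y \<in> S \<Longrightarrow> a y = a' y"
  shows "algebroid_plot G n S \<mu>' a'"
proof -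
  have sets: "{y \<in> S. idt G (\<mu>' y) \<in> U} = {y \<in> S. idt G (\<mu> y) \<in> U}" for U using assms(2) by auto
  show ?thesis unfolding algebroid_plot_def sets
    using plot_cong[OF objects_manifold algebroid_plot_plot[OF assms(1)] assms(2)]
      algebroid_plot_mem[OF assms(1)] assms(2,3)
    by (auto intro!: smooth_real_cong[OF algebroid_plot_smooth[OF assms(1)]])
qed

lemma algebroid_plot_compose:
  assumes a: "algebroid_plot G N D \<mu> a" and T: "openin (Euclidean_space n) T"
    and x: "\<And>i. i < N \<Longrightarrow> smooth_real n T (\<lambda>y. x y i)" "\<And>y. y \<in> T \<Longrightarrow> x y \<in> D"
  shows "algebroid_plot G n T (\<lambda>y. \<mu> (x y)) (\<lambda>y. a (x y))"
proof -
  have p: "plot (objects G) n T (\<lambda>y. \<mu> (x y))"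
    by (rule plot_compose[OF objects_manifold algebroid_plot_plot[OF a] T x])
  have "smooth_real n {y \<in> T. idt G (\<mu> (x y)) \<in> U} (\<lambda>y. a (x y) f)"
    if f: "smooth_fun (arrows G) U f" for U f
  proof (rule smooth_real_compose[OF algebroid_plot_smooth[OF a f]])
    show op: "openin (Euclidean_space n) {y \<in> T. idt G (\<mu> (x y)) \<in> U}"
      by (rule plot_vimage_open[OF arrows_manifold plot_idt[OF p] smooth_fun_openin[OF arrows_manifold f]])
    show "smooth_real n {y \<in> T. idt G (\<mu> (x y)) \<in> U} (\<lambda>y. x y i)" if "i < N" for i
      by (rule smooth_real_subset[OF x(1)[OF that] op]) auto
  qed (use x in auto)
  then show ?thesis using p algebroid_plot_mem[OF a] x(2) by (simp add: algebroid_plot_def)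
qed

lemma algebroid_plot_subset:
  "algebroid_plot G n S \<mu> a \<Longrightarrow> openin (Euclidean_space n) T \<Longrightarrow> T \<subseteq> S \<Longrightarrow> algebroid_plot G n T \<mu> a"
  using algebroid_plot_compose[of n S \<mu> a n T "\<lambda>y. y"] by (auto intro: smooth_real_coord)

lemma algebroid_plot_linear:
  assumes p: "plot (objects G) n S \<mu>" and x: "\<And>j. j \<in> J \<Longrightarrow> smooth_real n S (x j)"
    and a: "\<And>j. j \<in> J \<Longrightarrow> algebroid_plot G n S \<mu> (a j)"
  shows "algebroid_plot G n S \<mu> (\<lambda>y f. \<Sum>j\<in>J. x j y * a j y f)"
proof -
  have "smooth_real n {y \<in> S. idt G (\<mu> y) \<in> U} (\<lambda>y. \<Sum>j\<in>J. x j y * a j y f)"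
    if f: "smooth_fun (arrows G) U f" for U f
  proof -
    have op: "openin (Euclidean_space n) {y \<in> S. idt G (\<mu> y) \<in> U}"
      by (rule plot_vimage_open[OF arrows_manifold plot_idt[OF p] smooth_fun_openin[OF arrows_manifold f]])
    show ?thesis
      by (intro smooth_real_sum op smooth_real_mult smooth_real_subset[OF x] algebroid_plot_smooth[OF a f]) auto
  qed
  moreover have "(\<lambda>f. \<Sum>j\<in>J. x j y * a j y f) \<in> algebroid G (\<mu> y)" if "y \<in> S" for y
    by (intro algebroid_linear plot_pts[OF objects_manifold p] algebroid_plot_mem[OF a] that)
  ultimately show ?thesis using p by (simp add: algebroid_plot_def)
qed

lemma algebroid_plot_scale:
  assumes x: "smooth_real n S x" and a: "algebroid_plot G n S \<mu> a"
  shows "algebroid_plot G n S \<mu> (\<lambda>y. tv_scale (x y) (a y))"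
  using algebroid_plot_linear[OF algebroid_plot_plot[OF a], of "{0::nat}" "\<lambda>_. x" "\<lambda>_. a"] x a
  by (simp add: tv_scale_def)

lemma algebroid_plot_const:
  assumes m: "m \<in> Obj G" and a: "a \<in> algebroid G m" and S: "openin (Euclidean_space n) S"
  shows "algebroid_plot G n S (\<lambda>y. m) (\<lambda>y. a)"
proof -
  have "openin (Euclidean_space n) {y \<in> S. idt G m \<in> U}" for U using S by (cases "idt G m \<in> U") auto
  then show ?thesis using assms plot_const[OF objects_manifold m S]
    by (auto simp: algebroid_plot_def intro: smooth_real_const)
qed

text \<open>All curves share the extra coordinate \<open>n\<close> of \<open>\<Omega>\<close> as
  their parameter, so that their velocities are partial derivatives of the single map
  \<open>H\<close> and vary smoothly. A point \<open>y\<close> of \<open>S\<close> satisfies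
  \<open>y n = 0\<close> and is thus itself the start of its curve.\<close>

lemma algebroid_plot_velocity:
  assumes H: "plot (arrows G) (Suc n) \<Omega> H" and \<mu>: "plot (objects G) n S \<mu>"
    and S: "\<And>y. y \<in> S \<Longrightarrow> y \<in> \<Omega>" and H0: "\<And>y. y \<in> S \<Longrightarrow> H y = idt G (\<mu> y)"
    and t: "\<And>y r. y \<in> S \<Longrightarrow> y(n := r) \<in> \<Omega> \<Longrightarrow> tgt G (H (y(n := r))) = \<mu> y"
  shows "algebroid_plot G n S \<mu> (\<lambda>y. velocity (arrows G) (\<lambda>r. H (y(n := r))))"
proof -
  have SE: "y \<in> eucl n" if "y \<in> S" for y
    using plot_openin[OF objects_manifold \<mu>] that openin_eucl_subset by blast
  have yn: "y n = 0" "y(n := 0) = y" if "y \<in> S" for y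
    using SE[OF that] by (auto simp: mem_eucl fun_eq_iff)
  have cv: "velocity (arrows G) (\<lambda>r. H (y(n := r))) = coord_velocity (arrows G) H y n" if "y \<in> S" for y
    using yn[OF that] by (simp add: coord_velocity_def)
  have "velocity (arrows G) (\<lambda>r. H (y(n := r))) \<in> algebroid G (\<mu> y)" if y: "y \<in> S" for y
  proof (rule velocity_in_algebroid)
    show "\<mu> y \<in> Obj G" using plot_pts[OF objects_manifold \<mu> y] .
    show "smooth_curve (arrows G) (\<lambda>r. H (y(n := r)))"
      using smooth_curve_coord[OF arrows_manifold H S[OF y], of n] yn[OF y] by simp
    show "H (y(n := 0)) = idt G (\<mu> y)" using H0 y yn by simp
    have "\<forall>\<^sub>F r in nhds (y n). y(n := r) \<in> \<Omega>"
      by (rule eventually_fun_upd_mem[OF plot_openin[OF arrows_manifold H] S[OF y]]) simp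
    then show "\<forall>\<^sub>F r in nhds 0. tgt G (H (y(n := r))) = \<mu> y"
      unfolding yn(1)[OF y] by eventually_elim (rule t[OF y])
  qed
  moreover have "smooth_real n {y \<in> S. idt G (\<mu> y) \<in> U} (\<lambda>y. velocity (arrows G) (\<lambda>r. H (y(n := r))) f)"
    if f: "smooth_fun (arrows G) U f" for U f
  proof -
    have op: "openin (Euclidean_space n) {y \<in> S. idt G (\<mu> y) \<in> U}"
      by (rule plot_vimage_open[OF arrows_manifold plot_idt[OF \<mu>] smooth_fun_openin[OF arrows_manifold f]])
    have "smooth_real n {y \<in> S. idt G (\<mu> y) \<in> U} (\<lambda>y. coord_velocity (arrows G) H y n f)"
    proof (rule smooth_real_coord_velocity[OF arrows_manifold H op _ _ f])
      show "smooth_real n {y \<in> S. idt G (\<mu> y) \<in> U} (\<lambda>y. y i)" for i by (rule smooth_real_coord[OF op])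
    qed (use S H0 in auto)
    then show ?thesis by (rule smooth_real_cong) (use cv in auto)
  qed
  ultimately show ?thesis using \<mu> by (simp add: algebroid_plot_def)
qed

text \<open>The vectors \<open>e\<^sub>i\<close> of the overview: images of the coordinate vectors
  at a unit under the projection \<open>1 - T(u t)\<close> onto \<open>A\<close>. They span the
  fibre of \<open>A\<close> but are in general linearly dependent.\<close>

definition frame :: "'g set \<Rightarrow> ('g \<Rightarrow> nat \<Rightarrow> real) \<Rightarrow> 'm \<Rightarrow> nat \<Rightarrow> 'g tvec" where
  "frame U \<phi> m i = (\<lambda>f. coord_velocity (arrows G) (inv_into U \<phi>) (\<phi> (idt G m)) i f -
     coord_velocity (arrows G) (\<lambda>y. idt G (tgt G (inv_into U \<phi> y))) (\<phi> (idt G m)) i f)"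

lemma idt_tgt_chart_plot:
  "(U, \<phi>) \<in> atlas (arrows G) \<Longrightarrow>
    plot (arrows G) (mdim (arrows G)) (\<phi> ` U) (\<lambda>y. idt G (tgt G (inv_into U \<phi> y)))"
  by (intro plot_idt plot_tgt chart_inverse_plot arrows_manifold)

text \<open>Since \<open>t u t = t\<close>, the two coordinate velocities agree on functions pulled
  back along \<open>t\<close>.\<close>

lemma frame_algebroid:
  assumes ch: "(U, \<phi>) \<in> atlas (arrows G)" and m: "m \<in> Obj G" "idt G m \<in> U" and i: "i < mdim (arrows G)"
  shows "frame U \<phi> m i \<in> algebroid G m"
proof -
  let ?a = "\<phi> (idt G m)" let ?d = "inv_into U \<phi>" let ?e = "\<lambda>y. idt G (tgt G (inv_into U \<phi> y))"
  have a: "?a \<in> \<phi> ` U" using m by simp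
  have d: "?d ?a = idt G m" using chart_inverse[OF arrows_manifold ch m(2)] .
  have e: "?e ?a = idt G m" using d m by simp
  have pd: "plot (arrows G) (mdim (arrows G)) (\<phi> ` U) ?d" by (rule chart_inverse_plot[OF arrows_manifold ch])
  note pe = idt_tgt_chart_plot[OF ch]
  define v where "v j = (if j then coord_velocity (arrows G) ?d ?a i else coord_velocity (arrows G) ?e ?a i)" for j
  have v: "v j \<in> tangent_space (arrows G) (idt G m)" for j
    using coord_velocity_in_tangent_space[OF arrows_manifold pd a i]
      coord_velocity_in_tangent_space[OF arrows_manifold pe a i] d e by (auto simp: v_def)
  have fr: "frame U \<phi> m i = (\<lambda>f. \<Sum>j\<in>{True, False}. (if j then 1 else - 1) * v j f)"
    by (auto simp: frame_def v_def)
  have "frame U \<phi> m i \<in> tangent_space (arrows G) (idt G m)"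
    unfolding fr using m v by (intro tangent_space_linear arrows_manifold) auto
  moreover have "tangent_map (arrows G) (objects G) (tgt G) (idt G m) (frame U \<phi> m i) h = 0" for h
  proof (cases "smooth_at (objects G) h m")
    case True
    let ?h = "\<lambda>z. h (tgt G z)"
    obtain Q where Q: "m \<in> Q" "smooth_fun (objects G) Q h" using True by (auto simp: smooth_at_def)
    have sh: "smooth_at (arrows G) ?h (idt G m)"
      using smooth_fun_smooth_map[OF arrows_manifold objects_manifold tgt_smooth_map Q(2)] Q(1) m
      unfolding smooth_at_def by (intro exI conjI) auto
    have "coord_velocity (arrows G) ?d ?a i ?h = partial i (\<lambda>z. ?h (?d z)) ?a"
      by (rule coord_velocity_DERIV(2)[OF arrows_manifold pd a i]) (simp add: d sh)
    also have "\<dots> = partial i (\<lambda>z. ?h (?e z)) ?a"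
    proof (rule partial_cong_open(1)[OF chart_image_open[OF arrows_manifold ch] _ i a])
      fix x assume "x \<in> \<phi> ` U"
      then have "?d x \<in> Arr G" using plot_pts[OF arrows_manifold pd] by simp
      then show "?h (?d x) = ?h (?e x)" by simp
    qed
    also have "\<dots> = coord_velocity (arrows G) ?e ?a i ?h"
      by (rule coord_velocity_DERIV(2)[OF arrows_manifold pe a i, symmetric]) (simp add: e sh)
    finally show ?thesis by (simp add: tangent_map_def frame_def)
  qed (use m in \<open>simp add: tangent_map_def\<close>)
  ultimately show ?thesis by (simp add: algebroid_def)
qed

text \<open>Apply \<open>1 - T(u t)\<close> to the chart expansion of \<open>a\<close>. This fixes
  \<open>a\<close>, which is killed by \<open>T t\<close>, and turns the coordinate vectors into the
  frame.\<close>

lemma frame_expansion: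
  assumes ch: "(U, \<phi>) \<in> atlas (arrows G)" and m: "m \<in> Obj G" "idt G m \<in> U" and a: "a \<in> algebroid G m"
  shows "a = (\<lambda>f. \<Sum>i<mdim (arrows G). a (\<lambda>z. \<phi> z i) * frame U \<phi> m i f)"
proof
  fix f
  let ?N = "mdim (arrows G)" let ?p = "\<phi> (idt G m)"
  let ?d = "inv_into U \<phi>" let ?e = "\<lambda>y. idt G (tgt G (inv_into U \<phi> y))"
  note ta = algebroid_tangent[OF a]
  have exp: "a g = (\<Sum>i<?N. a (\<lambda>z. \<phi> z i) * coord_velocity (arrows G) ?d ?p i g)" for g
    using tangent_chart_expansion[OF arrows_manifold ch m(2) ta] by (rule fun_cong)
  have p: "?p \<in> \<phi> ` U" using m by simp
  have d: "?d ?p = idt G m" using chart_inverse[OF arrows_manifold ch m(2)] .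
  have e: "?e ?p = idt G m" using d m by simp
  have pd: "plot (arrows G) ?N (\<phi> ` U) ?d" by (rule chart_inverse_plot[OF arrows_manifold ch])
  note pe = idt_tgt_chart_plot[OF ch]
  \<comment> \<open>The sum is \<open>T(u t) a\<close> evaluated at \<open>f\<close>, that is,
    \<open>a\<close> evaluated at a function pulled back along \<open>t\<close>.\<close>
  have "(\<Sum>i<?N. a (\<lambda>z. \<phi> z i) * coord_velocity (arrows G) ?e ?p i f) = 0"
  proof (cases "smooth_at (arrows G) f (idt G m)")
    case True
    obtain Q where Q: "idt G m \<in> Q" "smooth_fun (arrows G) Q f" using True by (auto simp: smooth_at_def)
    have s1: "smooth_fun (objects G) {x \<in> Obj G. idt G x \<in> Q} (\<lambda>x. f (idt G x))"
      by (rule smooth_fun_smooth_map[OF objects_manifold arrows_manifold idt_smooth_map Q(2)])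
    have sh: "smooth_at (objects G) (\<lambda>x. f (idt G x)) m"
      using s1 Q(1) m unfolding smooth_at_def by (intro exI conjI) auto
    have "smooth_at (arrows G) (\<lambda>z. f (idt G (tgt G z))) (idt G m)"
      using smooth_fun_smooth_map[OF arrows_manifold objects_manifold tgt_smooth_map s1] Q(1) m
      unfolding smooth_at_def by (intro exI conjI) auto
    then have "coord_velocity (arrows G) ?d ?p i (\<lambda>z. f (idt G (tgt G z))) =
        coord_velocity (arrows G) ?e ?p i f" if "i < ?N" for i
      using coord_velocity_DERIV(2)[OF arrows_manifold pd p that, of "\<lambda>z. f (idt G (tgt G z))"]
        coord_velocity_DERIV(2)[OF arrows_manifold pe p that, of f] True d e m by simp
    then show ?thesis
      using exp[of "\<lambda>z. f (idt G (tgt G z))"] algebroid_tgt[OF a m(1) sh] by simp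
  next
    case False
    then have "coord_velocity (arrows G) ?e ?p i f = 0" for i
      by (intro coord_velocity_not_smooth) (simp add: e)
    then show ?thesis by simp
  qed
  then show "a f = (\<Sum>i<?N. a (\<lambda>z. \<phi> z i) * frame U \<phi> m i f)"
    using exp[of f] by (simp add: frame_def right_diff_distrib sum_subtractf)
qed

lemma frame_plot:
  assumes ch: "(U, \<phi>) \<in> atlas (arrows G)" and p: "plot (objects G) n S \<mu>"
    and U: "\<And>y. y \<in> S \<Longrightarrow> idt G (\<mu> y) \<in> U" and i: "i < mdim (arrows G)"
  shows "algebroid_plot G n S \<mu> (\<lambda>y. frame U \<phi> (\<mu> y) i)"
proof -
  let ?d = "inv_into U \<phi>" let ?e = "\<lambda>y. idt G (tgt G (inv_into U \<phi> y))"
  have O: "\<mu> y \<in> Obj G" if "y \<in> S" for y using plot_pts[OF objects_manifold p that] .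
  have d: "?d (\<phi> (idt G (\<mu> y))) = idt G (\<mu> y)" if "y \<in> S" for y
    using chart_inverse[OF arrows_manifold ch U[OF that]] .
  have "smooth_real n {y \<in> S. idt G (\<mu> y) \<in> Q} (\<lambda>y. frame U \<phi> (\<mu> y) i f)"
    if f: "smooth_fun (arrows G) Q f" for Q f
  proof -
    let ?T = "{y \<in> S. idt G (\<mu> y) \<in> Q}"
    have op: "openin (Euclidean_space n) ?T"
      by (rule plot_vimage_open[OF arrows_manifold plot_idt[OF p] smooth_fun_openin[OF arrows_manifold f]])
    have x: "smooth_real n ?T (\<lambda>y. \<phi> (idt G (\<mu> y)) j)" if "j < mdim (arrows G)" for j
    proof (rule smooth_real_subset[OF _ op])
      show "smooth_real n {y \<in> S. idt G (\<mu> y) \<in> U} (\<lambda>y. \<phi> (idt G (\<mu> y)) j)"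
        using smooth_fun_plot[OF arrows_manifold chart_coord_smooth_fun[OF arrows_manifold ch that] plot_idt[OF p]] .
    qed (use U in auto)
    show ?thesis unfolding frame_def
      by (intro smooth_real_diff
          smooth_real_coord_velocity[OF arrows_manifold chart_inverse_plot[OF arrows_manifold ch] op x _ f _ i]
          smooth_real_coord_velocity[OF arrows_manifold idt_tgt_chart_plot[OF ch] op x _ f _ i])
        (use U d O in auto)
  qed
  then show ?thesis using p frame_algebroid[OF ch O U i] by (simp add: algebroid_plot_def)
qed

section \<open>Curves and maps along the t-fibres\<close>

lemma fibre_curveI:
  "smooth_curve (arrows G) c \<Longrightarrow> \<forall>\<^sub>F r in nhds 0. tgt G (c r) = m \<Longrightarrow> fibre_curve G c"
  unfolding fibre_curve_def using eventually_nhds_x_imp_x[of "\<lambda>r. tgt G (c r) = m" 0] by auto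

text \<open>The \<open>t\<close>-fibres carry no atlas, so smoothness of a map along the fibre
  through \<open>g\<close> is tested on plots into that fibre. Left multiplication by a fixed arrow
  is defined on such a fibre only.\<close>

definition fibre_smooth_at :: "'g \<Rightarrow> ('g \<Rightarrow> 'g) \<Rightarrow> bool" where
  "fibre_smooth_at g f \<longleftrightarrow> (\<forall>n S d y0. plot (arrows G) n S d \<and> (\<forall>y\<in>S. tgt G (d y) = tgt G g) \<and>
     y0 \<in> S \<and> d y0 = g \<longrightarrow> (\<exists>T. y0 \<in> T \<and> T \<subseteq> S \<and> plot (arrows G) n T (\<lambda>y. f (d y))))"

lemma fibre_smooth_at_mlt:
  assumes "h \<in> Arr G" "src G h = tgt G g"
  shows "fibre_smooth_at g (mlt G h)"
  unfolding fibre_smooth_at_def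
proof (intro allI impI, elim conjE)
  fix n S d y0
  assume d: "plot (arrows G) n S d" "\<forall>y\<in>S. tgt G (d y) = tgt G g" "y0 \<in> S" "d y0 = g"
  have "plot (arrows G) n S (\<lambda>y. mlt G h (d y))"
    using d assms plot_openin[OF arrows_manifold d(1)]
    by (intro plot_mlt plot_const[OF arrows_manifold]) auto
  then show "\<exists>T. y0 \<in> T \<and> T \<subseteq> S \<and> plot (arrows G) n T (\<lambda>y. mlt G h (d y))" using d by blast
qed

lemma fibre_smooth_at_curve:
  assumes f: "fibre_smooth_at g f" and c: "fibre_curve G c" "c 0 = g"
  shows "smooth_curve (arrows G) (\<lambda>r. f (c r))"
proof -
  obtain T where T: "(\<lambda>_. 0) \<in> T" "plot (arrows G) 1 T (\<lambda>y. c (y 0))"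
    using c smooth_curve_iff[OF arrows_manifold] by (auto simp: fibre_curve_def)
  have "\<forall>\<^sub>F r in nhds 0. tgt G (c r) = tgt G g" using c by (auto simp: fibre_curve_def)
  then obtain e where e: "e > 0" "\<And>r. \<bar>r\<bar> < e \<Longrightarrow> tgt G (c r) = tgt G g"
    by (auto simp: eventually_nhds_metric dist_real_def)
  let ?S = "T \<inter> {y \<in> eucl 1. \<bar>y 0\<bar> < e}"
  have S: "plot (arrows G) 1 ?S (\<lambda>y. c (y 0))"
    by (rule plot_subset[OF arrows_manifold T(2)])
      (intro openin_Int plot_openin[OF arrows_manifold T(2)] openin_eucl_interval, simp)
  have "\<exists>T. (\<lambda>_. 0) \<in> T \<and> T \<subseteq> ?S \<and> plot (arrows G) 1 T (\<lambda>y. f (c (y 0)))"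
    using f[unfolded fibre_smooth_at_def, rule_format, of 1 ?S "\<lambda>y. c (y 0)" "\<lambda>_. 0"] S e T c by auto
  then show ?thesis unfolding smooth_curve_iff[OF arrows_manifold] by blast
qed

end

section \<open>Fibre coordinates from a tubular structure\<close>

locale tubular = lie_gpd G
  for G :: "('g, 'm) groupoid" +
  fixes W :: "('m \<times> 'g tvec) set" and \<tau> :: "'m \<times> 'g tvec \<Rightarrow> 'g"
  assumes tub: "tubular_structure G W \<tau>"
begin

text \<open>The fibre component of the inverse of the tubular embedding; the base component is
  \<open>tgt\<close> by \<open>inv_tau\<close>.\<close>

definition xi :: "'g \<Rightarrow> 'g tvec" where
  "xi g = snd (inv_into W \<tau> g)"

lemma W_mem: "(m, a) \<in> W \<Longrightarrow> m \<in> Obj G" "(m, a) \<in> W \<Longrightarrow> a \<in> algebroid G m"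
  using tub by (auto simp: tubular_structure_def)

lemma W_open: "algebroid_plot G n S \<mu> a \<Longrightarrow> openin (Euclidean_space n) {y \<in> S. (\<mu> y, a y) \<in> W}"
  using tub by (auto simp: tubular_structure_def)

lemma W_zero: "m \<in> Obj G \<Longrightarrow> (m, \<lambda>f. 0) \<in> W"
  using tub by (auto simp: tubular_structure_def)

lemma W_scale: "(m, a) \<in> W \<Longrightarrow> r \<in> {0..1} \<Longrightarrow> (m, tv_scale r a) \<in> W"
  using tub by (fastforce simp: tubular_structure_def)

lemma tau_inj: "inj_on \<tau> W" and tau_open: "openin (mtop (arrows G)) (\<tau> ` W)"
  using tub by (auto simp: tubular_structure_def)

lemma plot_tau: "algebroid_plot G n S \<mu> a \<Longrightarrow> (\<And>y. y \<in> S \<Longrightarrow> (\<mu> y, a y) \<in> W) \<Longrightarrow>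
    plot (arrows G) n S (\<lambda>y. \<tau> (\<mu> y, a y))"
  using tub by (auto simp: tubular_structure_def)

lemma tau_tgt: "(m, a) \<in> W \<Longrightarrow> tgt G (\<tau> (m, a)) = m"
  and tau_zero: "m \<in> Obj G \<Longrightarrow> \<tau> (m, \<lambda>f. 0) = idt G m"
  and velocity_tau: "m \<in> Obj G \<Longrightarrow> a \<in> algebroid G m \<Longrightarrow> velocity (arrows G) (\<lambda>r. \<tau> (m, tv_scale r a)) = a"
  using tub by (auto simp: tubular_structure_def)

lemma tau_Arr: "g \<in> \<tau> ` W \<Longrightarrow> g \<in> Arr G"
  using openin_subset[OF tau_open] by auto

lemma inv_tau: assumes g: "g \<in> \<tau> ` W" shows "inv_into W \<tau> g = (tgt G g, xi g)"
proof -
  obtain m a where ma: "(m, a) \<in> W" "g = \<tau> (m, a)" using g by auto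
  then have "inv_into W \<tau> g = (m, a)" using tau_inj by simp
  then show ?thesis using tau_tgt[OF ma(1)] ma by (simp add: xi_def)
qed

lemma xi_W: "g \<in> \<tau> ` W \<Longrightarrow> (tgt G g, xi g) \<in> W"
  using inv_tau inv_into_into by metis

lemma tau_xi: "g \<in> \<tau> ` W \<Longrightarrow> \<tau> (tgt G g, xi g) = g"
  using inv_tau f_inv_into_f by metis

lemma xi_tau: "(m, a) \<in> W \<Longrightarrow> xi (\<tau> (m, a)) = a"
  using tau_inj by (simp add: xi_def)

lemma xi_algebroid: "g \<in> \<tau> ` W \<Longrightarrow> xi g \<in> algebroid G (tgt G g)"
  using W_mem(2)[OF xi_W] .

lemma idt_tau: "m \<in> Obj G \<Longrightarrow> idt G m \<in> \<tau> ` W"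
  using W_zero[of m] tau_zero[of m] by (metis image_eqI)

lemma xi_idt: "m \<in> Obj G \<Longrightarrow> xi (idt G m) = (\<lambda>f. 0)"
  using xi_tau[OF W_zero] tau_zero by simp

lemma retraction_eq: "g \<in> \<tau> ` W \<Longrightarrow> retraction W \<tau> r g = \<tau> (tgt G g, tv_scale r (xi g))"
  by (simp add: retraction_def inv_tau)

lemma retraction_idt: "m \<in> Obj G \<Longrightarrow> retraction W \<tau> r (idt G m) = idt G m"
  by (simp add: retraction_eq idt_tau xi_idt tau_zero tv_scale_def)

lemma algebroid_plot_xi:
  assumes p: "plot (arrows G) n S c" and sub: "\<And>y. y \<in> S \<Longrightarrow> c y \<in> \<tau> ` W"
  shows "algebroid_plot G n S (\<lambda>y. tgt G (c y)) (\<lambda>y. xi (c y))"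
proof -
  have "algebroid_plot G n S (\<lambda>y. fst (inv_into W \<tau> (c y))) (\<lambda>y. snd (inv_into W \<tau> (c y)))"
  proof -
    have "\<forall>n S c. plot (arrows G) n S c \<and> c ` S \<subseteq> \<tau> ` W \<longrightarrow>
        algebroid_plot G n S (\<lambda>y. fst (inv_into W \<tau> (c y))) (\<lambda>y. snd (inv_into W \<tau> (c y)))"
      using tub unfolding tubular_structure_def by (elim conjE)
    moreover have "c ` S \<subseteq> \<tau> ` W" using sub by (rule image_subsetI)
    ultimately show ?thesis using p by simp
  qed
  then show ?thesis by (rule algebroid_plot_cong) (use inv_tau[OF sub] in auto)
qed

lemma scale_1 [simp]: "tv_scale 1 a = a" and scale_0: "tv_scale 0 a = (\<lambda>f. 0)"
  and scale_scale: "tv_scale r (tv_scale s a) = tv_scale (r * s) a"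
  by (auto simp: tv_scale_def)

text \<open>Covers times \<open>r\<close> outside \<open>{0..1}\<close>, provided the rescaled
  vector still lies in \<open>W\<close>. Derivatives in the time at 0 and 1 need such times; inside
  \<open>{0..1}\<close> star-shapedness suffices, see \<open>retraction_01\<close>.\<close>

lemma retraction_W:
  assumes "g \<in> \<tau> ` W" "(tgt G g, tv_scale r (xi g)) \<in> W"
  shows "retraction W \<tau> r g \<in> \<tau> ` W" "tgt G (retraction W \<tau> r g) = tgt G g"
    "retraction W \<tau> r g \<in> Arr G"
  using assms by (auto simp: retraction_eq tau_tgt intro: tau_Arr)

lemma retraction_01:
  assumes "g \<in> \<tau> ` W" "r \<in> {0..1}"
  shows "retraction W \<tau> r g \<in> \<tau> ` W" "tgt G (retraction W \<tau> r g) = tgt G g"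
    "retraction W \<tau> r g \<in> Arr G" "(tgt G g, tv_scale r (xi g)) \<in> W"
  using retraction_W[OF assms(1) W_scale[OF xi_W[OF assms(1)] assms(2)]] W_scale[OF xi_W[OF assms(1)] assms(2)]
  by auto

lemma retraction_domain_open:
  assumes p: "plot (arrows G) n S c" and sub: "\<And>y. y \<in> S \<Longrightarrow> c y \<in> \<tau> ` W" and t: "smooth_real n S t"
  shows "openin (Euclidean_space n) {y \<in> S. (tgt G (c y), tv_scale (t y) (xi (c y))) \<in> W}"
  by (rule W_open[OF algebroid_plot_scale[OF t algebroid_plot_xi[OF p sub]]])

lemma plot_retraction:
  assumes p: "plot (arrows G) n S c" and sub: "\<And>y. y \<in> S \<Longrightarrow> c y \<in> \<tau> ` W" and t: "smooth_real n S t"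
    and W: "\<And>y. y \<in> S \<Longrightarrow> (tgt G (c y), tv_scale (t y) (xi (c y))) \<in> W"
  shows "plot (arrows G) n S (\<lambda>y. retraction W \<tau> (t y) (c y))"
proof -
  have "plot (arrows G) n S (\<lambda>y. \<tau> (tgt G (c y), tv_scale (t y) (xi (c y))))"
    by (rule plot_tau[OF algebroid_plot_scale[OF t algebroid_plot_xi[OF p sub]] W])
  then show ?thesis by (rule plot_cong[OF arrows_manifold]) (simp add: retraction_eq sub)
qed

text \<open>Evaluating the vector \<open>xi g\<close> on a fixed function produces an ordinary
  smooth function of \<open>g\<close>. With the chart coordinates for \<open>f\<close> one obtains
  the components of \<open>fcoord\<close>.\<close>

lemma smooth_fun_xi:
  assumes f: "smooth_fun (arrows G) U f"
  shows "smooth_fun (arrows G) {g \<in> \<tau> ` W. idt G (tgt G g) \<in> U} (\<lambda>g. xi g f)"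
proof (rule smooth_funI[OF arrows_manifold])
  have "openin (mtop (arrows G)) {g \<in> Arr G. tgt G g \<in> {m \<in> Obj G. idt G m \<in> U}}"
    by (intro smooth_map_vimage_open[OF arrows_manifold objects_manifold tgt_smooth_map]
        smooth_map_vimage_open[OF objects_manifold arrows_manifold idt_smooth_map]
        smooth_fun_openin[OF arrows_manifold f])
  then have "openin (mtop (arrows G)) (\<tau> ` W \<inter> {g \<in> Arr G. tgt G g \<in> {m \<in> Obj G. idt G m \<in> U}})"
    using tau_open by (rule openin_Int[rotated])
  moreover have "\<tau> ` W \<inter> {g \<in> Arr G. tgt G g \<in> {m \<in> Obj G. idt G m \<in> U}} = {g \<in> \<tau> ` W. idt G (tgt G g) \<in> U}"
    using tau_Arr by auto
  ultimately show "openin (mtop (arrows G)) {g \<in> \<tau> ` W. idt G (tgt G g) \<in> U}" by simp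
  fix n S c assume p: "plot (arrows G) n S c" "c ` S \<subseteq> {g \<in> \<tau> ` W. idt G (tgt G g) \<in> U}"
  then have "algebroid_plot G n S (\<lambda>y. tgt G (c y)) (\<lambda>y. xi (c y))"
    by (intro algebroid_plot_xi) auto
  from algebroid_plot_smooth[OF this f]
  have "smooth_real n {y \<in> S. idt G (tgt G (c y)) \<in> U} (\<lambda>y. xi (c y) f)" .
  moreover have "{y \<in> S. idt G (tgt G (c y)) \<in> U} = S" using p(2) by auto
  ultimately show "smooth_real n S (\<lambda>y. xi (c y) f)" by simp
qed

text \<open>A parametrisation of the part of the \<open>t\<close>-fibre over \<open>m\<close> inside
  the tubular neighbourhood by an open subset of N-space, where N is the dimension of
  \<open>G\<close>. It is in general not injective, but \<open>fcoord\<close> followed by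
  \<open>rho\<close> is the identity (\<open>rho_fcoord\<close>), which is all that the chain rule
  needs.\<close>

definition rho :: "'g set \<Rightarrow> ('g \<Rightarrow> nat \<Rightarrow> real) \<Rightarrow> 'm \<Rightarrow> (nat \<Rightarrow> real) \<Rightarrow> 'g" where
  "rho U \<phi> m x = \<tau> (m, \<lambda>f. \<Sum>i<mdim (arrows G). x i * frame U \<phi> m i f)"

definition rho_dom :: "'g set \<Rightarrow> ('g \<Rightarrow> nat \<Rightarrow> real) \<Rightarrow> 'm \<Rightarrow> (nat \<Rightarrow> real) set" where
  "rho_dom U \<phi> m = {x \<in> eucl (mdim (arrows G)). (m, \<lambda>f. \<Sum>i<mdim (arrows G). x i * frame U \<phi> m i f) \<in> W}"

text \<open>The coordinates are redundant: their number is the dimension of \<open>G\<close>, not that of the fibres.\<close>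

definition fcoord :: "('g \<Rightarrow> nat \<Rightarrow> real) \<Rightarrow> 'g \<Rightarrow> nat \<Rightarrow> real" where
  "fcoord \<phi> g = (\<lambda>i. if i < mdim (arrows G) then xi g (\<lambda>z. \<phi> z i) else 0)"

lemma fcoord_eucl [simp]: "fcoord \<phi> g \<in> eucl (mdim (arrows G))"
  by (simp add: fcoord_def mem_eucl)

context
  fixes U :: "'g set" and \<phi> :: "'g \<Rightarrow> nat \<Rightarrow> real"
  assumes ch: "(U, \<phi>) \<in> atlas (arrows G)"
begin

lemma xi_fcoord:
  assumes "g \<in> \<tau> ` W" "idt G (tgt G g) \<in> U"
  shows "xi g = (\<lambda>f. \<Sum>i<mdim (arrows G). fcoord \<phi> g i * frame U \<phi> (tgt G g) i f)"
  using frame_expansion[OF ch _ assms(2) xi_algebroid[OF assms(1)]] tau_Arr[OF assms(1)]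
  by (simp add: fcoord_def)

lemma rho_fcoord:
  assumes "g \<in> \<tau> ` W" "idt G (tgt G g) \<in> U"
  shows "rho U \<phi> (tgt G g) (fcoord \<phi> g) = g"
  unfolding rho_def xi_fcoord[OF assms, symmetric] by (rule tau_xi[OF assms(1)])

lemma fcoord_dom:
  assumes "g \<in> \<tau> ` W" "idt G (tgt G g) \<in> U"
  shows "fcoord \<phi> g \<in> rho_dom U \<phi> (tgt G g)"
proof -
  have "(tgt G g, \<lambda>f. \<Sum>i<mdim (arrows G). fcoord \<phi> g i * frame U \<phi> (tgt G g) i f) \<in> W"
    by (rule subst[OF xi_fcoord[OF assms], where P = "\<lambda>a. (tgt G g, a) \<in> W"]) (rule xi_W[OF assms(1)])
  then show ?thesis by (simp add: rho_dom_def)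
qed

lemma rho_plot:
  assumes m: "m \<in> Obj G" "idt G m \<in> U"
  shows "plot (arrows G) (mdim (arrows G)) (rho_dom U \<phi> m) (rho U \<phi> m)"
    and "x \<in> rho_dom U \<phi> m \<Longrightarrow> tgt G (rho U \<phi> m x) = m"
proof -
  let ?N = "mdim (arrows G)"
  have E: "openin (Euclidean_space ?N) (eucl ?N)" by simp
  have ap: "algebroid_plot G ?N (eucl ?N) (\<lambda>x. m) (\<lambda>x f. \<Sum>i<?N. x i * frame U \<phi> m i f)"
    by (intro algebroid_plot_linear plot_const[OF objects_manifold m(1) E] smooth_real_coord[OF E]
        algebroid_plot_const[OF m(1) _ E] frame_algebroid[OF ch m]) simp
  have op: "openin (Euclidean_space ?N) (rho_dom U \<phi> m)"
    unfolding rho_dom_def using W_open[OF ap] by simp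
  show "plot (arrows G) ?N (rho_dom U \<phi> m) (rho U \<phi> m)"
    unfolding rho_def by (rule plot_tau[OF algebroid_plot_subset[OF ap op]]) (auto simp: rho_dom_def)
  show "tgt G (rho U \<phi> m x) = m" if "x \<in> rho_dom U \<phi> m"
    using that by (auto simp: rho_dom_def rho_def intro: tau_tgt)
qed

lemma fcoord_smooth_fun:
  assumes "i < mdim (arrows G)"
  shows "smooth_fun (arrows G) {g \<in> \<tau> ` W. idt G (tgt G g) \<in> U} (\<lambda>g. fcoord \<phi> g i)"
  using smooth_fun_xi[OF chart_coord_smooth_fun[OF arrows_manifold ch assms]] assms
  by (simp add: fcoord_def)

end

text \<open>Near \<open>g\<close> a fibre curve \<open>c\<close> equals
  \<open>rho (fcoord c)\<close>, and \<open>f\<close> composed with \<open>rho\<close> is a plot, so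
  the chain rule applies to \<open>fcoord c\<close>. The result depends on \<open>c\<close> only
  through its velocity, and linearly: this makes \<open>push\<close> independent of the chosen curve
  and also gives its linearity.\<close>

lemma fibre_velocity_expansion:
  assumes g: "g \<in> \<tau> ` W" and f: "fibre_smooth_at g f"
  shows "\<exists>(N::nat) X D. \<forall>c. fibre_curve G c \<and> c 0 = g \<longrightarrow>
    velocity (arrows G) (\<lambda>r. f (c r)) = (\<lambda>h. \<Sum>i<N. velocity (arrows G) c (X i) * D i h)"
proof -
  have gA: "g \<in> Arr G" using tau_Arr[OF g] .
  define m where "m = tgt G g"
  have m: "m \<in> Obj G" using gA by (simp add: m_def)
  obtain U \<phi> where ch: "(U, \<phi>) \<in> atlas (arrows G)" and U: "idt G m \<in> U"
    using chart_at[OF arrows_manifold idt_Arr[OF m]] by blast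
  let ?N = "mdim (arrows G)"
  define O' where "O' = {h \<in> \<tau> ` W. idt G (tgt G h) \<in> U}"
  have gO: "g \<in> O'" using g U by (simp add: O'_def m_def)
  note sm = fcoord_smooth_fun[OF ch, folded O'_def]
  obtain T where T: "fcoord \<phi> g \<in> T" "T \<subseteq> rho_dom U \<phi> m" "plot (arrows G) ?N T (\<lambda>x. f (rho U \<phi> m x))"
    using f[unfolded fibre_smooth_at_def, rule_format, of ?N "rho_dom U \<phi> m" "rho U \<phi> m" "fcoord \<phi> g"]
      rho_plot[OF ch m U] rho_fcoord[OF ch g] fcoord_dom[OF ch g] U by (auto simp: m_def)
  have "velocity (arrows G) (\<lambda>r. f (c r)) = (\<lambda>h. \<Sum>i<?N. velocity (arrows G) c (\<lambda>h. fcoord \<phi> h i) *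
      coord_velocity (arrows G) (\<lambda>x. f (rho U \<phi> m x)) (fcoord \<phi> g) i h)"
    if c: "fibre_curve G c" "c 0 = g" for c
  proof -
    have sc: "smooth_curve (arrows G) c" and ev1: "\<forall>\<^sub>F r in nhds 0. tgt G (c r) = m"
      using c by (auto simp: fibre_curve_def m_def)
    have ev2: "\<forall>\<^sub>F r in nhds 0. c r \<in> \<tau> ` W"
      using smooth_curve_eventually[OF arrows_manifold sc tau_open] c(2) g by simp
    from ev1 ev2 have "\<forall>\<^sub>F r in nhds 0. f (c r) = f (rho U \<phi> m (fcoord \<phi> (c r)))"
      by eventually_elim (use rho_fcoord[OF ch] U in auto)
    then have "velocity (arrows G) (\<lambda>r. f (c r)) = velocity (arrows G) (\<lambda>r. f (rho U \<phi> m (fcoord \<phi> (c r))))"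
      by (rule velocity_cong)
    also have "\<dots> = (\<lambda>h. \<Sum>i<?N. velocity (arrows G) c (\<lambda>h. fcoord \<phi> h i) *
      coord_velocity (arrows G) (\<lambda>x. f (rho U \<phi> m x)) (fcoord \<phi> (c 0)) i h)"
    proof (rule velocity_compose[OF arrows_manifold T(3)])
      fix i assume "i < ?N"
      then have "smooth_at (arrows G) (\<lambda>h. fcoord \<phi> h i) (c 0)"
        unfolding smooth_at_def c(2) using sm gO by (intro exI[of _ O']) simp
      from smooth_curve_DERIV[OF arrows_manifold sc this]
      show "((\<lambda>r. fcoord \<phi> (c r) i) has_real_derivative velocity (arrows G) c (\<lambda>h. fcoord \<phi> h i)) (at 0)" .
    qed (use c T in auto)
    finally show ?thesis using c by simp
  qed
  then show ?thesis
    by (intro exI[of _ ?N] exI[of _ "\<lambda>i h. fcoord \<phi> h i"]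
        exI[of _ "\<lambda>i. coord_velocity (arrows G) (\<lambda>x. f (rho U \<phi> m x)) (fcoord \<phi> g) i"]) simp
qed

text \<open>The chosen curve and \<open>c\<close> have equal velocities, and by the expansion so do
  their images.\<close>

lemma push_velocity:
  assumes g: "g \<in> \<tau> ` W" and f: "fibre_smooth_at g f" and c: "fibre_curve G c" "c 0 = g"
  shows "push G f g (velocity (arrows G) c) = velocity (arrows G) (\<lambda>r. f (c r))"
proof -
  obtain N :: nat and X D where D: "\<And>c. fibre_curve G c \<Longrightarrow> c 0 = g \<Longrightarrow>
    velocity (arrows G) (\<lambda>r. f (c r)) = (\<lambda>h. \<Sum>i<N. velocity (arrows G) c (X i) * D i h)"
    using fibre_velocity_expansion[OF g f] by blast
  define c' where "c' = (SOME c'. fibre_curve G c' \<and> c' 0 = g \<and> velocity (arrows G) c' = velocity (arrows G) c)"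
  have "fibre_curve G c' \<and> c' 0 = g \<and> velocity (arrows G) c' = velocity (arrows G) c"
    unfolding c'_def by (rule someI[of _ c]) (use c in auto)
  then show ?thesis using D[OF c] D[of c'] by (simp add: push_def c'_def[symmetric] Let_def)
qed

text \<open>The image under \<open>\<tau>\<close> of the ray through \<open>a\<close> serves
  throughout as the standard curve with velocity \<open>a\<close>.\<close>

lemma tau_curve:
  assumes m: "m \<in> Obj G" and a: "a \<in> algebroid G m"
  shows "fibre_curve G (\<lambda>r. \<tau> (m, tv_scale r a))" and "\<tau> (m, tv_scale 0 a) = idt G m"
    and "\<forall>\<^sub>F r in nhds 0. (m, tv_scale r a) \<in> W"
proof -
  have E: "openin (Euclidean_space 1) (eucl 1)" by simp
  have ap: "algebroid_plot G 1 (eucl 1) (\<lambda>y. m) (\<lambda>y. tv_scale (y 0) a)"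
    by (intro algebroid_plot_scale smooth_real_coord algebroid_plot_const m a E)
  let ?T = "{y \<in> eucl 1. (m, tv_scale (y 0) a) \<in> W}"
  have op: "openin (Euclidean_space 1) ?T" by (rule W_open[OF ap])
  have z: "(\<lambda>_. 0) \<in> ?T" using W_zero[OF m] by (simp add: scale_0)
  have pl: "plot (arrows G) 1 ?T (\<lambda>y. \<tau> (m, tv_scale (y 0) a))"
    by (rule plot_tau[OF algebroid_plot_subset[OF ap op]]) auto
  have "\<forall>\<^sub>F r in nhds 0. (\<lambda>_. 0)(0 := r) \<in> ?T" by (rule eventually_line_mem[OF op z])
  then show ev: "\<forall>\<^sub>F r in nhds 0. (m, tv_scale r a) \<in> W" by eventually_elim simp
  have "smooth_curve (arrows G) (\<lambda>r. \<tau> (m, tv_scale r a))"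
    unfolding smooth_curve_iff[OF arrows_manifold] by (intro exI[of _ ?T] conjI z pl)
  moreover have "\<forall>\<^sub>F r in nhds 0. tgt G (\<tau> (m, tv_scale r a)) = m"
    using ev by eventually_elim (rule tau_tgt)
  ultimately show "fibre_curve G (\<lambda>r. \<tau> (m, tv_scale r a))" by (rule fibre_curveI)
  show "\<tau> (m, tv_scale 0 a) = idt G m" using tau_zero[OF m] by (simp add: scale_0)
qed

lemma fibre_smooth_at_retraction:
  assumes g: "g \<in> \<tau> ` W" and t: "t \<in> {0..1}"
  shows "fibre_smooth_at g (retraction W \<tau> t)"
  unfolding fibre_smooth_at_def
proof (intro allI impI, elim conjE)
  fix n S d y0
  assume d: "plot (arrows G) n S d" "\<forall>y\<in>S. tgt G (d y) = tgt G g" "y0 \<in> S" "d y0 = g"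
  let ?T = "{y \<in> S. d y \<in> \<tau> ` W}"
  have p: "plot (arrows G) n ?T d" by (rule plot_vimage[OF arrows_manifold d(1) tau_open])
  have "plot (arrows G) n ?T (\<lambda>y. retraction W \<tau> t (d y))"
    by (rule plot_retraction[OF p]) (use t retraction_01(4) plot_openin[OF arrows_manifold p] in \<open>auto intro: smooth_real_const\<close>)
  then show "\<exists>T. y0 \<in> T \<and> T \<subseteq> S \<and> plot (arrows G) n T (\<lambda>y. retraction W \<tau> t (d y))"
    using d g by (intro exI[of _ ?T]) auto
qed

subsection \<open>Continuity of the operations near the units\<close>

text \<open>The retraction fixes the unit at all times, so in a chart the compact segment
  \<open>{idt x} \<times> {0..1}\<close> lies in the preimage of \<open>Q\<close>; the tube lemma
  thickens the unit to a neighbourhood.\<close>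

lemma retraction_near_unit:
  assumes x: "x \<in> Obj G" and Q: "openin (mtop (arrows G)) Q" "idt G x \<in> Q"
  shows "\<exists>P. openin (mtop (arrows G)) P \<and> idt G x \<in> P \<and> P \<subseteq> \<tau> ` W \<and>
    (\<forall>g\<in>P. \<forall>t\<in>{0..1}. retraction W \<tau> t g \<in> Q)"
proof -
  obtain U \<phi> where ch: "(U, \<phi>) \<in> atlas (arrows G)" and U: "idt G x \<in> U"
    using chart_at[OF arrows_manifold idt_Arr[OF x]] by blast
  let ?N = "mdim (arrows G)" let ?d = "inv_into U \<phi>"
  define S where "S = {y \<in> \<phi> ` U. ?d y \<in> \<tau> ` W}"
  have pS: "plot (arrows G) ?N S ?d"
    unfolding S_def by (rule plot_vimage[OF arrows_manifold chart_inverse_plot[OF arrows_manifold ch] tau_open])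
  have So: "openin (Euclidean_space ?N) S" using plot_openin[OF arrows_manifold pS] .
  \<comment> \<open>A point \<open>z\<close> of (N+1)-space stands for a chart point together with
    the time \<open>z N\<close>; \<open>tr\<close> forgets the time.\<close>
  define tr where "tr z = (\<lambda>i. if i < ?N then z i else 0 :: real)" for z :: "nat \<Rightarrow> real"
  have E: "openin (Euclidean_space (Suc ?N)) (eucl (Suc ?N))" by simp
  have ctr: "continuous_on A tr" for A
  proof (rule continuous_on_coordinatewise_then_product)
    fix i show "continuous_on A (\<lambda>z. tr z i)"
      by (cases "i < ?N") (simp_all add: tr_def continuous_on_coord)
  qed
  define Z where "Z = {z \<in> eucl (Suc ?N). tr z \<in> S}"
  have Zo: "openin (Euclidean_space (Suc ?N)) Z"
    unfolding Z_def by (rule openin_preimage_eucl[OF So ctr E]) (auto simp: tr_def mem_eucl)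
  have pZ: "plot (arrows G) (Suc ?N) Z (\<lambda>z. ?d (tr z))"
    by (rule plot_compose[OF arrows_manifold pS Zo])
      (auto simp: tr_def intro: smooth_real_coord[OF Zo], simp add: Z_def tr_def)
  have inT: "?d (tr z) \<in> \<tau> ` W" if "z \<in> Z" for z using that by (auto simp: Z_def S_def)
  have t: "smooth_real (Suc ?N) Z (\<lambda>z. z ?N)" by (rule smooth_real_coord[OF Zo])
  define Z' where "Z' = {z \<in> Z. (tgt G (?d (tr z)), tv_scale (z ?N) (xi (?d (tr z)))) \<in> W}"
  have Z'o: "openin (Euclidean_space (Suc ?N)) Z'"
    unfolding Z'_def by (rule retraction_domain_open[OF pZ inT t])
  have pZ': "plot (arrows G) (Suc ?N) Z' (\<lambda>z. retraction W \<tau> (z ?N) (?d (tr z)))"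
    by (rule plot_retraction[OF plot_subset[OF arrows_manifold pZ Z'o] _ smooth_real_subset[OF t Z'o]])
      (use inT in \<open>auto simp: Z'_def\<close>)
  define y0 where "y0 = \<phi> (idt G x)"
  have y0: "y0 \<in> eucl ?N" "?d y0 = idt G x" "y0 \<in> S"
    using chart_eucl[OF arrows_manifold ch U] chart_inverse[OF arrows_manifold ch U] U idt_tau[OF x]
    by (auto simp: y0_def S_def)
  have tr_upd: "tr (y(?N := t)) = y" if "y \<in> eucl ?N" for y t
    using that by (auto simp: tr_def mem_eucl fun_eq_iff)
  have ZI: "y(?N := t) \<in> Z" if "y \<in> S" for y t
    using that openin_eucl_subset[OF So] tr_upd[of y t] by (auto simp: Z_def eucl_upd)
  have "\<exists>Y. openin (Euclidean_space ?N) Y \<and> y0 \<in> Y \<and>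
     (\<forall>y\<in>Y. \<forall>t\<in>{0..1}. y(?N := t) \<in> {z \<in> Z'. retraction W \<tau> (z ?N) (?d (tr z)) \<in> Q})"
  proof (rule openin_tube[OF plot_vimage_open[OF arrows_manifold pZ' Q(1)] y0(1) compact_Icc])
    fix t :: real assume "t \<in> {0..1}"
    then show "y0(?N := t) \<in> {z \<in> Z'. retraction W \<tau> (z ?N) (?d (tr z)) \<in> Q}"
      using ZI[OF y0(3), of t] tr_upd[OF y0(1), of t] y0 Q(2) retraction_idt[OF x, of t] x
      by (auto simp: Z'_def xi_idt tv_scale_def W_zero)
  qed
  then obtain Y where Y: "openin (Euclidean_space ?N) Y" "y0 \<in> Y"
     "\<And>y t. y \<in> Y \<Longrightarrow> t \<in> {0..1} \<Longrightarrow> retraction W \<tau> ((y(?N := t)) ?N) (?d (tr (y(?N := t)))) \<in> Q"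
     "\<And>y t. y \<in> Y \<Longrightarrow> t \<in> {0..1} \<Longrightarrow> y(?N := t) \<in> Z'"
    by (metis (mono_tags, lifting) mem_Collect_eq)
  let ?P = "{g \<in> U. \<phi> g \<in> Y}"
  have "retraction W \<tau> t g \<in> Q \<and> g \<in> \<tau> ` W" if g: "g \<in> U" "\<phi> g \<in> Y" and t: "t \<in> {0..1}" for g t
  proof -
    have "?d (tr ((\<phi> g)(?N := t))) = g"
      using tr_upd[OF chart_eucl[OF arrows_manifold ch g(1)]] chart_inverse[OF arrows_manifold ch g(1)] by simp
    then show ?thesis using Y(3)[OF g(2) t] Y(4)[OF g(2) t] inT[of "(\<phi> g)(?N := t)"] by (auto simp: Z'_def)
  qed
  note P = this
  have "g \<in> \<tau> ` W" if "g \<in> ?P" for g using P[of g 0] that by simp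
  then have sub: "?P \<subseteq> \<tau> ` W" by blast
  show ?thesis
    by (intro exI[of _ ?P] conjI chart_vimage_open[OF arrows_manifold ch Y(1)] sub)
      (use P U Y(2) y0_def in auto)
qed

text \<open>Continuity of the multiplication at a unit. Composable pairs are parametrised by 2N
  coordinates: chart coordinates of the first arrow, then fibre coordinates of the second arrow over
  the source of the first. In them the product is a plot, and a box around the point of the unit
  does the job.\<close>

lemma mlt_near_unit:
  assumes x: "x \<in> Obj G" and Q: "openin (mtop (arrows G)) Q" "idt G x \<in> Q"
  shows "\<exists>P. openin (mtop (arrows G)) P \<and> idt G x \<in> P \<and>
    (\<forall>g\<in>P. \<forall>h\<in>P. src G g = tgt G h \<longrightarrow> mlt G g h \<in> Q)"
proof -
  obtain U \<phi> where ch: "(U, \<phi>) \<in> atlas (arrows G)" and U: "idt G x \<in> U"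
    using chart_at[OF arrows_manifold idt_Arr[OF x]] by blast
  let ?N = "mdim (arrows G)" let ?d = "inv_into U \<phi>"
  define tr where "tr z = (\<lambda>i. if i < ?N then z i else 0 :: real)" for z :: "nat \<Rightarrow> real"
  define m where "m z = src G (?d (tr z))" for z
  define Z where "Z = {z \<in> eucl (?N + ?N). tr z \<in> {y \<in> \<phi> ` U. idt G (src G (?d y)) \<in> U}}"
  have E: "openin (Euclidean_space (?N + ?N)) (eucl (?N + ?N))" by simp
  have ctr: "continuous_on A tr" for A
  proof (rule continuous_on_coordinatewise_then_product)
    fix i show "continuous_on A (\<lambda>z. tr z i)"
      by (cases "i < ?N") (simp_all add: tr_def continuous_on_coord)
  qed
  note pd = chart_inverse_plot[OF arrows_manifold ch]
  have So: "openin (Euclidean_space ?N) {y \<in> \<phi> ` U. idt G (src G (?d y)) \<in> U}"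
    by (rule plot_vimage_open[OF arrows_manifold plot_idt[OF plot_src[OF pd]] chart_open[OF arrows_manifold ch]])
  have Zo: "openin (Euclidean_space (?N + ?N)) Z"
    unfolding Z_def by (rule openin_preimage_eucl[OF So ctr E]) (auto simp: tr_def mem_eucl)
  have pZ: "plot (arrows G) (?N + ?N) Z (\<lambda>z. ?d (tr z))"
    by (rule plot_compose[OF arrows_manifold pd Zo])
      (auto simp: tr_def intro: smooth_real_coord[OF Zo], simp add: Z_def tr_def)
  have pm: "plot (objects G) (?N + ?N) Z m" unfolding m_def by (rule plot_src[OF pZ])
  \<comment> \<open>The last \<open>N\<close> coordinates of \<open>z\<close> are coefficients in
    the frame over the source \<open>m z\<close> of the first arrow, so
    \<open>\<tau> (m z, a z)\<close> is automatically composable with it.\<close>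
  define a where "a z = (\<lambda>f. \<Sum>i<?N. z (?N + i) * frame U \<phi> (m z) i f)" for z
  have ap: "algebroid_plot G (?N + ?N) Z m a"
    unfolding a_def
    by (intro algebroid_plot_linear pm smooth_real_coord[OF Zo] frame_plot[OF ch pm])
      (auto simp: Z_def m_def)
  define Z' where "Z' = {z \<in> Z. (m z, a z) \<in> W}"
  have Z'o: "openin (Euclidean_space (?N + ?N)) Z'" unfolding Z'_def by (rule W_open[OF ap])
  have pt: "plot (arrows G) (?N + ?N) Z' (\<lambda>z. \<tau> (m z, a z))"
    by (rule plot_tau[OF algebroid_plot_subset[OF ap Z'o]]) (auto simp: Z'_def)
  have pp: "plot (arrows G) (?N + ?N) Z' (\<lambda>z. mlt G (?d (tr z)) (\<tau> (m z, a z)))"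
    by (intro plot_mlt pt plot_subset[OF arrows_manifold pZ Z'o])
      (auto simp: Z'_def tau_tgt m_def)
  \<comment> \<open>Read as a point of 2N-space, \<open>y0\<close> has vanishing fibre coordinates
    and represents the pair of two units at \<open>x\<close>.\<close>
  define y0 where "y0 = \<phi> (idt G x)"
  have y0: "y0 \<in> eucl ?N" "?d y0 = idt G x" "y0 \<in> \<phi> ` U"
    using chart_eucl[OF arrows_manifold ch U] chart_inverse[OF arrows_manifold ch U] U by (auto simp: y0_def)
  have tr_y0: "tr y0 = y0" using y0(1) by (auto simp: tr_def mem_eucl fun_eq_iff)
  have y0n: "y0 (?N + i) = 0" for i using y0(1) by (simp add: mem_eucl)
  have y0Z: "y0 \<in> Z" using y0 tr_y0 U x by (auto simp: Z_def mem_eucl)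
  have my0: "m y0 = x" using tr_y0 y0 x by (simp add: m_def)
  have ay0: "a y0 = (\<lambda>f. 0)" by (simp add: a_def y0n)
  have "openin (Euclidean_space (?N + ?N)) {z \<in> Z'. mlt G (?d (tr z)) (\<tau> (m z, a z)) \<in> Q}"
    by (rule plot_vimage_open[OF arrows_manifold pp Q(1)])
  moreover have "y0 \<in> {z \<in> Z'. mlt G (?d (tr z)) (\<tau> (m z, a z)) \<in> Q}"
    using y0Z my0 ay0 tr_y0 y0 x Q(2) by (simp add: Z'_def W_zero tau_zero)
  ultimately obtain e where e: "e > 0" "\<And>z. z \<in> eucl (?N + ?N) \<Longrightarrow> (\<And>i. i < ?N + ?N \<Longrightarrow> \<bar>z i - y0 i\<bar> < e) \<Longrightarrow>
      mlt G (?d (tr z)) (\<tau> (m z, a z)) \<in> Q"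
    using eucl_box[of "?N + ?N" _ y0] by (metis (mono_tags, lifting) mem_Collect_eq)
  \<comment> \<open>Neighbourhood for both factors at once: its points satisfy the box condition in
    chart coordinates, as first factors, and in fibre coordinates, as second factors.\<close>
  define P where "P = {g \<in> U. \<forall>i<?N. \<phi> g i \<in> ball (y0 i) e} \<inter> 
    ({g \<in> \<tau> ` W. idt G (tgt G g) \<in> U} \<inter> {g \<in> \<tau> ` W. idt G (tgt G g) \<in> U \<and> (\<forall>i<?N. fcoord \<phi> g i \<in> ball 0 e)})"
  have fin: "openin (mtop (arrows G)) {g \<in> O'. \<forall>i<k. f g i \<in> ball (b i) e}"
    if "openin (mtop (arrows G)) O'" "\<And>i. i < k \<Longrightarrow> smooth_fun (arrows G) O' (\<lambda>g. f g i)" for O' f b and k :: nat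
    using that(2)
  proof (induction k)
    case (Suc k)
    have eq: "{g \<in> O'. \<forall>i<Suc k. f g i \<in> ball (b i) e} =
        {g \<in> O'. \<forall>i<k. f g i \<in> ball (b i) e} \<inter> {g \<in> O'. f g k \<in> ball (b k) e}"
      by (auto simp: less_Suc_eq)
    show ?case unfolding eq
      using Suc smooth_fun_vimage_open[OF arrows_manifold Suc.prems[of k] open_ball] by (intro openin_Int) auto
  qed (use that in simp)
  \<comment> \<open>Openness is read off from \<open>smooth_fun_xi\<close> for a constant function
    on \<open>U\<close>.\<close>
  have Oo: "openin (mtop (arrows G)) {g \<in> \<tau> ` W. idt G (tgt G g) \<in> U}"
    using smooth_fun_openin[OF arrows_manifold smooth_fun_xi[OF smooth_funI[OF arrows_manifold chart_open[OF arrows_manifold ch]]], of "\<lambda>_. 0"]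
    by (simp add: smooth_real_const plot_openin[OF arrows_manifold])
  have Po: "openin (mtop (arrows G)) P"
    unfolding P_def
    using fin[OF chart_open[OF arrows_manifold ch] chart_coord_smooth_fun[OF arrows_manifold ch], where k = ?N and b = y0]
      fin[OF Oo fcoord_smooth_fun[OF ch], where k = ?N and b = "\<lambda>_. 0"] Oo
    by (intro openin_Int) (auto simp: conj_assoc)
  moreover have "idt G x \<in> P"
    using U x e(1) idt_tau[OF x] by (auto simp: P_def y0_def fcoord_def xi_idt)
  moreover have "mlt G g h \<in> Q" if g: "g \<in> P" and h: "h \<in> P" and gh: "src G g = tgt G h" for g h
  proof -
    \<comment> \<open>The parameter of the pair \<open>(g, h)\<close>; it recovers \<open>g\<close>
      by \<open>dz\<close> and \<open>h\<close> by \<open>tz\<close>.\<close>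
    define z where "z i = (if i < ?N then \<phi> g i else if i < ?N + ?N then fcoord \<phi> h (i - ?N) else 0)" for i
    have gU: "g \<in> U" and hT: "h \<in> \<tau> ` W" "idt G (tgt G h) \<in> U" using g h by (auto simp: P_def)
    have "tr z = \<phi> g" using chart_eucl[OF arrows_manifold ch gU] by (auto simp: tr_def z_def mem_eucl fun_eq_iff)
    then have dz: "?d (tr z) = g" using chart_inverse[OF arrows_manifold ch gU] by simp
    have mz: "m z = tgt G h" using dz gh by (simp add: m_def)
    have "a z = xi h" unfolding xi_fcoord[OF ch hT] a_def mz by (simp add: z_def)
    then have tz: "\<tau> (m z, a z) = h" using mz tau_xi[OF hT(1)] by simp
    have "mlt G (?d (tr z)) (\<tau> (m z, a z)) \<in> Q"
    proof (rule e(2))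
      show "z \<in> eucl (?N + ?N)" by (simp add: z_def mem_eucl)
      fix i assume i: "i < ?N + ?N"
      show "\<bar>z i - y0 i\<bar> < e"
      proof (cases "i < ?N")
        case True
        then have "\<phi> g i \<in> ball (y0 i) e" using g by (simp add: P_def)
        then show ?thesis using True by (simp add: z_def dist_real_def abs_minus_commute)
      next
        case False
        then have "i - ?N < ?N" "y0 i = 0" using i y0(1) by (auto simp: mem_eucl)
        then have "fcoord \<phi> h (i - ?N) \<in> ball 0 e" using h by (simp add: P_def)
        then show ?thesis using False i \<open>y0 i = 0\<close> by (simp add: z_def dist_real_def)
      qed
    qed
    then show ?thesis by (simp add: dz tz)
  qed
  ultimately show ?thesis by blast
qed

lemma idt_map_near_unit:
  assumes x: "x \<in> Obj G" and Q: "openin (mtop (arrows G)) Q" "idt G x \<in> Q"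
  shows "\<exists>P. openin (mtop (arrows G)) P \<and> idt G x \<in> P \<and> P \<subseteq> Q \<and>
    (\<forall>g\<in>P. idt G (src G g) \<in> Q \<and> idt G (tgt G g) \<in> Q)"
proof -
  have o: "openin (mtop (objects G)) {m \<in> Obj G. idt G m \<in> Q}"
    by (rule smooth_map_vimage_open[OF objects_manifold arrows_manifold idt_smooth_map Q(1)])
  let ?P = "Q \<inter> {g \<in> Arr G. src G g \<in> {m \<in> Obj G. idt G m \<in> Q}} \<inter>
    {g \<in> Arr G. tgt G g \<in> {m \<in> Obj G. idt G m \<in> Q}}"
  have "openin (mtop (arrows G)) ?P"
    using smooth_map_vimage_open[OF arrows_manifold objects_manifold src_smooth_map o]
      smooth_map_vimage_open[OF arrows_manifold objects_manifold tgt_smooth_map o] Q(1)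
    by (intro openin_Int)
  then show ?thesis using x Q(2) by (intro exI[of _ ?P]) auto
qed

end

section \<open>Representations\<close>

locale tubular_rep = tubular G W \<tau>
  for G :: "('g, 'm) groupoid" and W :: "('m \<times> 'g tvec) set" and \<tau> :: "'m \<times> 'g tvec \<Rightarrow> 'g" +
  fixes V :: "('g, 'm, 'v::banach) rep_bundle"
  assumes rep: "lie_representation G V"
begin

section \<open>Fibres of the representation and the action on them\<close>

lemma vbundle: "vector_bundle (objects G) V"
  using rep by (simp add: lie_representation_def)

lemma vframe_at: "m \<in> Obj G \<Longrightarrow> \<exists>U e. (U, e) \<in> frames V \<and> m \<in> U"
  using vbundle by (auto simp: vector_bundle_def)

lemma vframe:
  assumes "(U, e) \<in> frames V"
  shows "openin (mtop (objects G)) U"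
    and "m \<in> U \<Longrightarrow> inj_on (e m) {..<rank V}"
    and "m \<in> U \<Longrightarrow> independent (e m ` {..<rank V})"
    and "m \<in> U \<Longrightarrow> span (e m ` {..<rank V}) = fibre V m"
proof -
  have "\<forall>(U, e)\<in>frames V. openin (mtop (objects G)) U \<and>
        (\<forall>m\<in>U. inj_on (e m) {..<rank V} \<and> independent (e m ` {..<rank V}) \<and>
           span (e m ` {..<rank V}) = fibre V m)"
    using vbundle unfolding vector_bundle_def by (elim conjE)
  from bspec[OF this assms] show "openin (mtop (objects G)) U"
    and "m \<in> U \<Longrightarrow> inj_on (e m) {..<rank V}"
    and "m \<in> U \<Longrightarrow> independent (e m ` {..<rank V})"
    and "m \<in> U \<Longrightarrow> span (e m ` {..<rank V}) = fibre V m" by auto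
qed

lemma fibre_subspace: "m \<in> Obj G \<Longrightarrow> subspace (fibre V m)"
  using vframe_at[of m] vframe(4) by (metis subspace_span)

lemma fibre_add: "m \<in> Obj G \<Longrightarrow> v \<in> fibre V m \<Longrightarrow> w \<in> fibre V m \<Longrightarrow> v + w \<in> fibre V m"
  and fibre_scale: "m \<in> Obj G \<Longrightarrow> v \<in> fibre V m \<Longrightarrow> r *\<^sub>R v \<in> fibre V m"
  and fibre_zero: "m \<in> Obj G \<Longrightarrow> 0 \<in> fibre V m"
  and fibre_sum: "m \<in> Obj G \<Longrightarrow> (\<And>i. i \<in> I \<Longrightarrow> u i \<in> fibre V m) \<Longrightarrow> (\<Sum>i\<in>I. u i) \<in> fibre V m"
  using fibre_subspace subspace_add subspace_scale subspace_0 subspace_sum by blast+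

lemma
  assumes "g \<in> Arr G" "v \<in> fibre V (src G g)"
  shows act_fibre: "act V g v \<in> fibre V (tgt G g)"
    and act_add: "w \<in> fibre V (src G g) \<Longrightarrow> act V g (v + w) = act V g v + act V g w"
    and act_scale: "act V g (r *\<^sub>R v) = r *\<^sub>R act V g v"
proof -
  have "\<forall>g\<in>Arr G. \<forall>v\<in>fibre V (src G g). act V g v \<in> fibre V (tgt G g) \<and>
        (\<forall>w\<in>fibre V (src G g). act V g (v + w) = act V g v + act V g w) \<and>
        (\<forall>r. act V g (r *\<^sub>R v) = r *\<^sub>R act V g v)"
    using rep unfolding lie_representation_def by (elim conjE)
  from bspec[OF bspec[OF this assms(1)] assms(2)] show "act V g v \<in> fibre V (tgt G g)"
    and "w \<in> fibre V (src G g) \<Longrightarrow> act V g (v + w) = act V g v + act V g w"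
    and "act V g (r *\<^sub>R v) = r *\<^sub>R act V g v" by auto
qed

lemma act_idt: "m \<in> Obj G \<Longrightarrow> v \<in> fibre V m \<Longrightarrow> act V (idt G m) v = v"
  using rep by (simp add: lie_representation_def)

lemma act_mlt: "g \<in> Arr G \<Longrightarrow> h \<in> Arr G \<Longrightarrow> src G g = tgt G h \<Longrightarrow> v \<in> fibre V (src G h) \<Longrightarrow>
    act V (mlt G g h) v = act V g (act V h v)"
  using rep by (simp add: lie_representation_def)

lemma act_ivs_right: "g \<in> Arr G \<Longrightarrow> v \<in> fibre V (tgt G g) \<Longrightarrow> act V g (act V (ivs G g) v) = v"
  using act_mlt[of g "ivs G g" v] act_idt by simp

lemma act_zero: "g \<in> Arr G \<Longrightarrow> act V g 0 = 0"
  using act_scale[of g 0 0] fibre_zero[of "src G g"] by simp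

lemma act_sum:
  assumes g: "g \<in> Arr G" and v: "\<And>i. i \<in> I \<Longrightarrow> u i \<in> fibre V (src G g)"
  shows "act V g (\<Sum>i\<in>I. u i) = (\<Sum>i\<in>I. act V g (u i))"
  using v
proof (induction I rule: infinite_finite_induct)
  case (insert i I)
  then have "(\<Sum>i\<in>I. u i) \<in> fibre V (src G g)" by (intro fibre_sum) (use g in auto)
  then show ?case using insert act_add[OF g] by simp
qed (use act_zero[OF g] in auto)

section \<open>Coefficients in a local frame\<close>

context
  fixes U :: "'m set" and e :: "'m \<Rightarrow> nat \<Rightarrow> 'v" and m :: 'm
  assumes fr: "(U, e) \<in> frames V" and m: "m \<in> U"
begin

lemma frame_coeff_add: "v \<in> fibre V m \<Longrightarrow> w \<in> fibre V m \<Longrightarrow>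
    frame_coeff (rank V) (e m) (v + w) i = frame_coeff (rank V) (e m) v i + frame_coeff (rank V) (e m) w i"
  unfolding frame_coeff_def vframe(4)[OF fr m, symmetric]
  using representation_add[OF vframe(3)[OF fr m], of w v] by simp

lemma frame_coeff_scale: "v \<in> fibre V m \<Longrightarrow>
    frame_coeff (rank V) (e m) (r *\<^sub>R v) i = r * frame_coeff (rank V) (e m) v i"
  unfolding frame_coeff_def vframe(4)[OF fr m, symmetric]
  using representation_scale[OF vframe(3)[OF fr m], of v r] by simp

lemma frame_vec_fibre: "i < rank V \<Longrightarrow> e m i \<in> fibre V m"
  unfolding vframe(4)[OF fr m, symmetric] by (intro span_base imageI) simp

lemma frame_coeff_sum_vecs:
  assumes i: "i < rank V"
  shows "frame_coeff (rank V) (e m) (\<Sum>j<rank V. c j *\<^sub>R e m j) i = c i"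
proof -
  let ?B = "e m ` {..<rank V}"
  have ind: "independent ?B" and inj: "inj_on (e m) {..<rank V}" using vframe[OF fr] m by auto
  have "representation ?B (\<Sum>j<rank V. c j *\<^sub>R e m j) = (\<lambda>b. \<Sum>j<rank V. representation ?B (c j *\<^sub>R e m j) b)"
    by (rule representation_sum[OF ind]) (auto intro: span_scale span_base)
  then have "frame_coeff (rank V) (e m) (\<Sum>j<rank V. c j *\<^sub>R e m j) i =
      (\<Sum>j<rank V. c j * representation ?B (e m j) (e m i))"
    unfolding frame_coeff_def by (simp add: representation_scale[OF ind] span_base)
  also have "\<dots> = (\<Sum>j<rank V. if j = i then c j else 0)"
    by (rule sum.cong[OF refl]) (use inj i in \<open>auto simp: representation_basis[OF ind] inj_on_eq_iff\<close>)
  finally show ?thesis using i by simp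
qed

lemma frame_coeff_expand:
  assumes "v \<in> fibre V m"
  shows "v = (\<Sum>i<rank V. frame_coeff (rank V) (e m) v i *\<^sub>R e m i)"
proof -
  let ?B = "e m ` {..<rank V}"
  have ind: "independent ?B" and inj: "inj_on (e m) {..<rank V}" using vframe[OF fr] m by auto
  have "(\<Sum>b\<in>?B. representation ?B v b *\<^sub>R b) = v"
    by (rule sum_representation_eq[OF ind]) (use assms vframe(4)[OF fr m] in auto)
  then show ?thesis by (simp add: sum.reindex[OF inj] frame_coeff_def)
qed

end

section \<open>Smooth families of vectors in the representation\<close>

lemma bundle_plot_plot: "bundle_plot (objects G) V n S \<mu> v \<Longrightarrow> plot (objects G) n S \<mu>"
  and bundle_plot_mem: "bundle_plot (objects G) V n S \<mu> v \<Longrightarrow> y \<in> S \<Longrightarrow> v y \<in> fibre V (\<mu> y)"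
  and bundle_plot_smooth: "bundle_plot (objects G) V n S \<mu> v \<Longrightarrow> (U, e) \<in> frames V \<Longrightarrow> i < rank V \<Longrightarrow>
    smooth_real n {y \<in> S. \<mu> y \<in> U} (\<lambda>y. frame_coeff (rank V) (e (\<mu> y)) (v y) i)"
  by (auto simp: bundle_plot_def)

lemma bundle_plotI:
  assumes "plot (objects G) n S \<mu>" "\<And>y. y \<in> S \<Longrightarrow> v y \<in> fibre V (\<mu> y)"
    and "\<And>U e i. (U, e) \<in> frames V \<Longrightarrow> i < rank V \<Longrightarrow> openin (Euclidean_space n) {y \<in> S. \<mu> y \<in> U} \<Longrightarrow>
      smooth_real n {y \<in> S. \<mu> y \<in> U} (\<lambda>y. frame_coeff (rank V) (e (\<mu> y)) (v y) i)"
  shows "bundle_plot (objects G) V n S \<mu> v"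
  using assms plot_vimage_open[OF objects_manifold assms(1) vframe(1)] by (auto simp: bundle_plot_def)

lemma bundle_plot_cong:
  assumes b: "bundle_plot (objects G) V n S \<mu> v"
    and eq: "\<And>y. y \<in> S \<Longrightarrow> \<mu> y = \<mu>' y" "\<And>y. y \<in> S \<Longrightarrow> v y = v' y"
  shows "bundle_plot (objects G) V n S \<mu>' v'"
proof (rule bundle_plotI)
  show "plot (objects G) n S \<mu>'" by (rule plot_cong[OF objects_manifold bundle_plot_plot[OF b] eq(1)])
  show "v' y \<in> fibre V (\<mu>' y)" if "y \<in> S" for y using bundle_plot_mem[OF b that] eq[OF that] by simp
  fix U e i assume f: "(U, e) \<in> frames V" "i < rank V"
  have sets: "{y \<in> S. \<mu>' y \<in> U} = {y \<in> S. \<mu> y \<in> U}" using eq by auto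
  show "smooth_real n {y \<in> S. \<mu>' y \<in> U} (\<lambda>y. frame_coeff (rank V) (e (\<mu>' y)) (v' y) i)"
    unfolding sets by (rule smooth_real_cong[OF bundle_plot_smooth[OF b f]]) (use eq in auto)
qed

lemma bundle_plot_add:
  assumes b: "bundle_plot (objects G) V n S \<mu> v" "bundle_plot (objects G) V n S \<mu> w"
  shows "bundle_plot (objects G) V n S \<mu> (\<lambda>y. v y + w y)"
proof (rule bundle_plotI)
  show p: "plot (objects G) n S \<mu>" using bundle_plot_plot[OF b(1)] .
  note pt = plot_pts[OF objects_manifold p]
  show "v y + w y \<in> fibre V (\<mu> y)" if "y \<in> S" for y
    using fibre_add[OF pt] bundle_plot_mem[OF b(1)] bundle_plot_mem[OF b(2)] that by auto
  fix U e i assume f: "(U, e) \<in> frames V" "i < rank V"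
  show "smooth_real n {y \<in> S. \<mu> y \<in> U} (\<lambda>y. frame_coeff (rank V) (e (\<mu> y)) (v y + w y) i)"
    by (rule smooth_real_cong[OF smooth_real_add[OF bundle_plot_smooth[OF b(1) f] bundle_plot_smooth[OF b(2) f]]])
      (use frame_coeff_add[OF f(1)] bundle_plot_mem[OF b(1)] bundle_plot_mem[OF b(2)] in auto)
qed

lemma bundle_plot_scale:
  assumes b: "bundle_plot (objects G) V n S \<mu> v"
  shows "bundle_plot (objects G) V n S \<mu> (\<lambda>y. r *\<^sub>R v y)"
proof (rule bundle_plotI)
  show p: "plot (objects G) n S \<mu>" using bundle_plot_plot[OF b(1)] .
  note pt = plot_pts[OF objects_manifold p]
  show "r *\<^sub>R v y \<in> fibre V (\<mu> y)" if "y \<in> S" for y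
    using fibre_scale[OF pt] bundle_plot_mem[OF b] that by auto
  fix U e i assume f: "(U, e) \<in> frames V" "i < rank V" and op: "openin (Euclidean_space n) {y \<in> S. \<mu> y \<in> U}"
  show "smooth_real n {y \<in> S. \<mu> y \<in> U} (\<lambda>y. frame_coeff (rank V) (e (\<mu> y)) (r *\<^sub>R v y) i)"
    by (rule smooth_real_cong[OF smooth_real_mult[OF smooth_real_const[OF op] bundle_plot_smooth[OF b f]]])
      (use frame_coeff_scale[OF f(1)] bundle_plot_mem[OF b] in auto)
qed

lemma bundle_plot_zero:
  assumes p: "plot (objects G) n S \<mu>"
  shows "bundle_plot (objects G) V n S \<mu> (\<lambda>y. 0)"
proof (rule bundle_plotI[OF p])
  note pt = plot_pts[OF objects_manifold p]
  show z: "0 \<in> fibre V (\<mu> y)" if "y \<in> S" for y using fibre_zero[OF pt[OF that]] .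
  fix U e i assume f: "(U, e) \<in> frames V" "i < rank V" and op: "openin (Euclidean_space n) {y \<in> S. \<mu> y \<in> U}"
  show "smooth_real n {y \<in> S. \<mu> y \<in> U} (\<lambda>y. frame_coeff (rank V) (e (\<mu> y)) 0 i)"
    by (rule smooth_real_cong[OF smooth_real_const[OF op, of 0]])
      (use frame_coeff_scale[OF f(1), of _ 0 0] z in auto)
qed

lemma bundle_plot_sum:
  assumes p: "plot (objects G) n S \<mu>" and b: "\<And>j. j \<in> J \<Longrightarrow> bundle_plot (objects G) V n S \<mu> (v j)"
  shows "bundle_plot (objects G) V n S \<mu> (\<lambda>y. \<Sum>j\<in>J. v j y)"
  using b by (induction J rule: infinite_finite_induct) (simp_all add: bundle_plot_zero[OF p] bundle_plot_add)

lemma bundle_plot_act: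
  assumes c: "plot (arrows G) n S c" and b: "bundle_plot (objects G) V n S \<mu> v"
    and eq: "\<And>y. y \<in> S \<Longrightarrow> \<mu> y = src G (c y)" "\<And>y. y \<in> S \<Longrightarrow> \<mu>' y = tgt G (c y)"
  shows "bundle_plot (objects G) V n S \<mu>' (\<lambda>y. act V (c y) (v y))"
proof -
  have "bundle_plot (objects G) V n S (\<lambda>y. src G (c y)) v"
    by (rule bundle_plot_cong[OF b]) (use eq in auto)
  then have "bundle_plot (objects G) V n S (\<lambda>y. tgt G (c y)) (\<lambda>y. act V (c y) (v y))"
    using rep c unfolding lie_representation_def by blast
  then show ?thesis by (rule bundle_plot_cong) (use eq in auto)
qed

text \<open>The base point of the integrand must not depend on \<open>t\<close>; then the integral
  is taken in one finite-dimensional fibre and can be computed coefficientwise in a frame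
  there.\<close>

lemma bundle_plot_integral:
  assumes b: "bundle_plot (objects G) V (Suc n) \<Omega> \<mu> v" and p: "plot (objects G) n S \<mu>'"
    and sub: "\<And>y t. y \<in> S \<Longrightarrow> t \<in> {0..1::real} \<Longrightarrow> y(n := t) \<in> \<Omega>"
    and eq: "\<And>y t. y \<in> S \<Longrightarrow> t \<in> {0..1::real} \<Longrightarrow> \<mu> (y(n := t)) = \<mu>' y"
  shows "bundle_plot (objects G) V n S \<mu>' (\<lambda>y. integral {0..1} (\<lambda>t. v (y(n := t))))"
    and "y \<in> S \<Longrightarrow> (\<lambda>t. v (y(n := t))) integrable_on {0..1}"
proof -
  let ?c = "\<lambda>e y i t. frame_coeff (rank V) (e (\<mu>' y)) (v (y(n := t))) i"
  \<comment> \<open>For fixed \<open>y\<close> the frame vectors \<open>e (\<mu>' y) i\<close> are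
    constants, so only the continuous coefficient functions are integrated.\<close>
  have key: "((\<lambda>t. v (y(n := t))) has_integral (\<Sum>i<rank V. integral {0..1} (?c e y i) *\<^sub>R e (\<mu>' y) i)) {0..1}"
    if y: "y \<in> S" and f: "(U, e) \<in> frames V" "\<mu>' y \<in> U" for y U e
  proof -
    have mem: "v (y(n := t)) \<in> fibre V (\<mu>' y)" if "t \<in> {0..1}" for t
      using bundle_plot_mem[OF b sub[OF y that]] eq[OF y that] by simp
    have "(?c e y i has_integral integral {0..1} (?c e y i)) {0..1}" if i: "i < rank V" for i
    proof (rule integrable_integral[OF integrable_continuous_real])
      have s: "continuous_on {z \<in> \<Omega>. \<mu> z \<in> U} (\<lambda>z. frame_coeff (rank V) (e (\<mu> z)) (v z) i)"
        by (rule smooth_real_continuous[OF bundle_plot_smooth[OF b f(1) i]])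
      have "continuous_on {0..1} (\<lambda>t. frame_coeff (rank V) (e (\<mu> (y(n := t)))) (v (y(n := t))) i)"
      proof (rule continuous_on_compose2[OF s])
        show "continuous_on {0..1} (\<lambda>t. y(n := t))" by (intro continuous_intros)
        show "(\<lambda>t. y(n := t)) ` {0..1} \<subseteq> {z \<in> \<Omega>. \<mu> z \<in> U}"
          by (rule image_subsetI) (use sub[OF y] eq[OF y] f in simp)
      qed
      then show "continuous_on {0..1} (?c e y i)"
        by (rule continuous_on_eq) (simp add: eq[OF y])
    qed
    then have "((\<lambda>t. \<Sum>i<rank V. ?c e y i t *\<^sub>R e (\<mu>' y) i) has_integral
        (\<Sum>i<rank V. integral {0..1} (?c e y i) *\<^sub>R e (\<mu>' y) i)) {0..1}"
      by (intro has_integral_sum has_integral_scaleR_left) auto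
    then show ?thesis
      by (rule has_integral_eq[rotated]) (rule frame_coeff_expand[OF f mem, symmetric])
  qed
  have ob: "\<mu>' y \<in> Obj G" if "y \<in> S" for y using plot_pts[OF objects_manifold p that] .
  show "y \<in> S \<Longrightarrow> (\<lambda>t. v (y(n := t))) integrable_on {0..1}"
    using key vframe_at[OF ob] by blast
  show "bundle_plot (objects G) V n S \<mu>' (\<lambda>y. integral {0..1} (\<lambda>t. v (y(n := t))))"
  proof (rule bundle_plotI[OF p])
    fix y assume y: "y \<in> S"
    obtain U e where f: "(U, e) \<in> frames V" "\<mu>' y \<in> U" using vframe_at[OF ob[OF y]] by blast
    have "integral {0..1} (\<lambda>t. v (y(n := t))) = (\<Sum>i<rank V. integral {0..1} (?c e y i) *\<^sub>R e (\<mu>' y) i)"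
      by (rule integral_unique[OF key[OF y f]])
    then show "integral {0..1} (\<lambda>t. v (y(n := t))) \<in> fibre V (\<mu>' y)"
      using ob[OF y] frame_vec_fibre[OF f] by (auto intro!: fibre_sum fibre_scale)
  next
    fix U e i assume f: "(U, e) \<in> frames V" "i < rank V" and op: "openin (Euclidean_space n) {y \<in> S. \<mu>' y \<in> U}"
    have "smooth_real n {y \<in> S. \<mu>' y \<in> U} (\<lambda>y. integral {0..1} (\<lambda>t.
        frame_coeff (rank V) (e (\<mu> (y(n := t)))) (v (y(n := t))) i))"
    proof (rule smooth_real_integral[OF bundle_plot_smooth[OF b f] op])
      fix y t assume "y \<in> {y \<in> S. \<mu>' y \<in> U}" "t \<in> {0..1::real}"
      then show "y(n := t) \<in> {y \<in> \<Omega>. \<mu> y \<in> U}" using sub eq by simp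
    qed
    then show "smooth_real n {y \<in> S. \<mu>' y \<in> U} (\<lambda>y. frame_coeff (rank V) (e (\<mu>' y))
        (integral {0..1} (\<lambda>t. v (y(n := t)))) i)"
    proof (rule smooth_real_cong)
      fix y assume "y \<in> {y \<in> S. \<mu>' y \<in> U}"
      then have y: "y \<in> S" "\<mu>' y \<in> U" by auto
      have "frame_coeff (rank V) (e (\<mu>' y)) (integral {0..1} (\<lambda>t. v (y(n := t)))) i = integral {0..1} (?c e y i)"
        unfolding integral_unique[OF key[OF y(1) f(1) y(2)]] by (rule frame_coeff_sum_vecs[OF f(1) y(2) f(2)])
      also have "\<dots> = integral {0..1} (\<lambda>t. frame_coeff (rank V) (e (\<mu> (y(n := t)))) (v (y(n := t))) i)"
        by (rule integral_cong) (simp add: eq[OF y(1)])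
      finally show "integral {0..1} (\<lambda>t. frame_coeff (rank V) (e (\<mu> (y(n := t)))) (v (y(n := t))) i) =
        frame_coeff (rank V) (e (\<mu>' y)) (integral {0..1} (\<lambda>t. v (y(n := t)))) i" by simp
    qed
  qed
qed

text \<open>Continuity in the ambient Banach space can be expected over a constant base point only:
  the fibres over different points sit in it without any relation.\<close>

lemma bundle_plot_continuous:
  assumes b: "bundle_plot (objects G) V n S (\<lambda>y. m) v" and m: "m \<in> Obj G"
  shows "continuous_on S v"
proof -
  obtain U e where f: "(U, e) \<in> frames V" "m \<in> U" using vframe_at[OF m] by blast
  have "continuous_on S (\<lambda>y. frame_coeff (rank V) (e m) (v y) i)" if "i < rank V" for i
    using smooth_real_continuous[OF bundle_plot_smooth[OF b f(1) that]] f(2) by simp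
  then have "continuous_on S (\<lambda>y. \<Sum>i<rank V. frame_coeff (rank V) (e m) (v y) i *\<^sub>R e m i)"
    by (intro continuous_on_sum continuous_on_scaleR continuous_on_const) auto
  then show ?thesis
    by (rule continuous_on_eq) (use frame_coeff_expand[OF f bundle_plot_mem[OF b]] in auto)
qed

end

section \<open>The homotopy operator in left-invariant form\<close>

text \<open>Drops the parameter coordinates: on \<open>eucl n\<close> it is a left inverse of
  \<open>\<lambda>y. y(n := t)\<close>.\<close>

definition trunc :: "nat \<Rightarrow> (nat \<Rightarrow> real) \<Rightarrow> nat \<Rightarrow> real" where
  "trunc n z = (\<lambda>i. if i < n then z i else 0)"

lemma trunc_eucl [simp]: "trunc n z \<in> eucl n"
  by (simp add: trunc_def mem_eucl)

lemma trunc_upd [simp]: "y \<in> eucl n \<Longrightarrow> trunc n (y(n := r)) = y"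
  by (auto simp: trunc_def mem_eucl fun_eq_iff)

lemma trunc_same [simp]: "y \<in> eucl n \<Longrightarrow> trunc n y = y"
  by (auto simp: trunc_def mem_eucl fun_eq_iff)

lemma openin_trunc:
  assumes "openin (Euclidean_space n) S"
  shows "openin (Euclidean_space (Suc n)) {z \<in> eucl (Suc n). trunc n z \<in> S}"
proof (rule openin_preimage_eucl[OF assms])
  show "continuous_on (eucl (Suc n)) (trunc n)"
  proof (rule continuous_on_coordinatewise_then_product)
    fix i show "continuous_on (eucl (Suc n)) (\<lambda>z. trunc n z i)"
      by (cases "i < n") (simp_all add: trunc_def continuous_on_coord)
  qed
qed auto

lemma smooth_real_trunc:
  assumes "openin (Euclidean_space N) T"
  shows "smooth_real N T (\<lambda>z. trunc n z i)"
  using smooth_real_coord[OF assms, of i] smooth_real_const[OF assms, of 0] by (cases "i < n") (simp_all add: trunc_def)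

context tubular
begin

abbreviation lam :: "real \<Rightarrow> 'g \<Rightarrow> 'g" where
  "lam \<equiv> retraction W \<tau>"

text \<open>Everything is moved back to the units by left translation, so that \<open>k\<close> becomes an integral of values
  of \<open>\<psi>\<close> itself and the form picture is no longer needed.\<close>

definition lam_push :: "real \<Rightarrow> 'g \<Rightarrow> 'g tvec \<Rightarrow> 'g tvec" where
  "lam_push t g a = velocity (arrows G)
     (\<lambda>r. mlt G (ivs G (lam t g)) (lam t (mlt G g (\<tau> (src G g, tv_scale r a)))))"

definition lam_velocity :: "real \<Rightarrow> 'g \<Rightarrow> 'g tvec" where
  "lam_velocity t g = velocity (arrows G) (\<lambda>r. mlt G (ivs G (lam t g)) (lam (t + r) g))"

text \<open>At \<open>t = 0\<close> and \<open>t = 1\<close> the time leaves the unit interval;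
  openness of \<open>W\<close> provides the necessary room.\<close>

lemma retraction_curve:
  assumes g: "g \<in> \<tau> ` W" and t: "t \<in> {0..1}"
  shows "fibre_curve G (\<lambda>r. lam (t + r) g)"
proof -
  have gA: "g \<in> Arr G" using tau_Arr[OF g] .
  have E: "openin (Euclidean_space 1) (eucl 1)" by simp
  have s: "smooth_real 1 (eucl 1) (\<lambda>y. t + y 0)"
    by (intro smooth_real_add smooth_real_const smooth_real_coord E)
  have c: "plot (arrows G) 1 (eucl 1) (\<lambda>y. g)" by (rule plot_const[OF arrows_manifold gA E])
  let ?T = "{y \<in> eucl 1. (tgt G g, tv_scale (t + y 0) (xi g)) \<in> W}"
  have op: "openin (Euclidean_space 1) ?T" by (rule retraction_domain_open[OF c g s])
  have z: "(\<lambda>_. 0) \<in> ?T" using retraction_01(4)[OF g t] by simp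
  have pl: "plot (arrows G) 1 ?T (\<lambda>y. lam (t + y 0) g)"
    by (rule plot_retraction[OF plot_subset[OF arrows_manifold c op] g smooth_real_subset[OF s op]]) auto
  have "\<forall>\<^sub>F r in nhds 0. (\<lambda>_. 0)(0 := r) \<in> ?T" by (rule eventually_line_mem[OF op z])
  then have "\<forall>\<^sub>F r in nhds 0. tgt G (lam (t + r) g) = tgt G g"
    by eventually_elim (simp add: retraction_W(2)[OF g])
  moreover have "smooth_curve (arrows G) (\<lambda>r. lam (t + r) g)"
    unfolding smooth_curve_iff[OF arrows_manifold] by (intro exI[of _ ?T] conjI z pl)
  ultimately show ?thesis by (intro fibre_curveI)
qed

section \<open>Left translation and retraction of fibre curves\<close>

lemma fibre_curve_mlt:
  assumes h: "h \<in> Arr G" "src G h = tgt G (c 0)" and c: "fibre_curve G c"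
  shows "fibre_curve G (\<lambda>r. mlt G h (c r))"
    and "\<forall>\<^sub>F r in nhds 0. tgt G (mlt G h (c r)) = tgt G h"
proof -
  have sc: "smooth_curve (arrows G) c" and ev: "\<forall>\<^sub>F r in nhds 0. tgt G (c r) = tgt G (c 0)"
    using c by (auto simp: fibre_curve_def)
  have evA: "\<forall>\<^sub>F r in nhds 0. c r \<in> Arr G"
    by (rule smooth_curve_eventually[OF arrows_manifold sc Arr_openin smooth_curve_pts[OF arrows_manifold sc]])
  from ev evA show t: "\<forall>\<^sub>F r in nhds 0. tgt G (mlt G h (c r)) = tgt G h"
    by eventually_elim (use h in simp)
  show "fibre_curve G (\<lambda>r. mlt G h (c r))"
    by (rule fibre_curveI[OF fibre_smooth_at_curve[OF fibre_smooth_at_mlt[OF h] c refl] t])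
qed

lemma fibre_curve_retraction:
  assumes g: "c 0 \<in> \<tau> ` W" and t: "t \<in> {0..1}" and c: "fibre_curve G c"
  shows "fibre_curve G (\<lambda>r. lam t (c r))"
proof -
  have sc: "smooth_curve (arrows G) c" and ev: "\<forall>\<^sub>F r in nhds 0. tgt G (c r) = tgt G (c 0)"
    using c by (auto simp: fibre_curve_def)
  have evT: "\<forall>\<^sub>F r in nhds 0. c r \<in> \<tau> ` W"
    by (rule smooth_curve_eventually[OF arrows_manifold sc tau_open g])
  from ev evT have "\<forall>\<^sub>F r in nhds 0. tgt G (lam t (c r)) = tgt G (c 0)"
    by eventually_elim (use retraction_01(2) t in simp)
  then show ?thesis
    by (intro fibre_curveI[OF fibre_smooth_at_curve[OF fibre_smooth_at_retraction[OF g t] c refl]])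
qed

lemma left_velocity_algebroid:
  assumes g: "g \<in> Arr G" and c: "fibre_curve G c" "c 0 = g"
  shows "velocity (arrows G) (\<lambda>r. mlt G (ivs G g) (c r)) \<in> algebroid G (src G g)"
  using fibre_curve_mlt[of "ivs G g" c] c g
  by (intro velocity_in_algebroid) (auto simp: fibre_curve_def)

lemma push_left_back:
  assumes g: "g \<in> \<tau> ` W" and c: "fibre_curve G c" "c 0 = g"
  shows "push G (mlt G (ivs G g)) g (velocity (arrows G) c) = velocity (arrows G) (\<lambda>r. mlt G (ivs G g) (c r))"
  using tau_Arr[OF g] by (intro push_velocity[OF g fibre_smooth_at_mlt c]) auto

lemma push_left:
  assumes g: "g \<in> Arr G" and a: "a \<in> algebroid G (src G g)"
  shows "push G (mlt G g) (idt G (src G g)) a = velocity (arrows G) (\<lambda>r. mlt G g (\<tau> (src G g, tv_scale r a)))"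
    and "fibre_curve G (\<lambda>r. mlt G g (\<tau> (src G g, tv_scale r a)))"
    and "mlt G g (\<tau> (src G g, tv_scale 0 a)) = g"
proof -
  have m: "src G g \<in> Obj G" using g by simp
  note c = tau_curve[OF m a]
  show "push G (mlt G g) (idt G (src G g)) a = velocity (arrows G) (\<lambda>r. mlt G g (\<tau> (src G g, tv_scale r a)))"
    using push_velocity[OF idt_tau[OF m] fibre_smooth_at_mlt[OF g] c(1,2)] velocity_tau[OF m a] m by simp
  show "fibre_curve G (\<lambda>r. mlt G g (\<tau> (src G g, tv_scale r a)))"
    by (rule fibre_curve_mlt(1)[OF g _ c(1)]) (simp add: c(2) m)
  show "mlt G g (\<tau> (src G g, tv_scale 0 a)) = g" using c(2) g by simp
qed

text \<open>Starting from the standard curve of \<open>a\<close>, each of the three pushes composes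
  the curve with one more map, by \<open>push_velocity\<close>. The composite curve is the one in
  the definition of \<open>lam_push\<close>.\<close>

lemma lam_push_eq:
  assumes g: "g \<in> \<tau> ` W" and t: "t \<in> {0..1}" and a: "a \<in> algebroid G (src G g)"
  shows "push G (mlt G (ivs G (lam t g))) (lam t g) (push G (lam t) g (push G (mlt G g) (idt G (src G g)) a)) =
      lam_push t g a"
    and "lam_push t g a \<in> algebroid G (src G (lam t g))"
proof -
  have gA: "g \<in> Arr G" using tau_Arr[OF g] .
  let ?c = "\<lambda>r. mlt G g (\<tau> (src G g, tv_scale r a))"
  note c = push_left[OF gA a]
  have lc: "fibre_curve G (\<lambda>r. lam t (?c r))" "lam t (?c 0) = lam t g"
    using fibre_curve_retraction[of ?c t, OF _ t c(2)] c(3) g by auto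
  have "push G (lam t) g (velocity (arrows G) ?c) = velocity (arrows G) (\<lambda>r. lam t (?c r))"
    by (rule push_velocity[OF g fibre_smooth_at_retraction[OF g t] c(2,3)])
  then show "push G (mlt G (ivs G (lam t g))) (lam t g) (push G (lam t) g (push G (mlt G g) (idt G (src G g)) a)) =
      lam_push t g a"
    using push_left_back[OF retraction_01(1)[OF g t] lc] c(1) by (simp add: lam_push_def)
  show "lam_push t g a \<in> algebroid G (src G (lam t g))"
    unfolding lam_push_def by (rule left_velocity_algebroid[OF retraction_01(3)[OF g t] lc])
qed

lemma lam_velocity_eq:
  assumes g: "g \<in> \<tau> ` W" and t: "t \<in> {0..1}"
  shows "push G (mlt G (ivs G (lam t g))) (lam t g) (velocity (arrows G) (\<lambda>r. lam (t + r) g)) = lam_velocity t g"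
    and "lam_velocity t g \<in> algebroid G (src G (lam t g))"
  using push_left_back[OF retraction_01(1)[OF g t] retraction_curve[OF g t]]
    left_velocity_algebroid[OF retraction_01(3)[OF g t] retraction_curve[OF g t]]
  by (auto simp: lam_velocity_def)

text \<open>The composite of the two translations with \<open>lam t\<close> is smooth along the
  fibre at the unit, so \<open>fibre_velocity_expansion\<close> applies to it directly.\<close>

lemma lam_push_linear:
  assumes g: "g \<in> \<tau> ` W" and t: "t \<in> {0..1}"
  shows "\<exists>(N::nat) X D. \<forall>a\<in>algebroid G (src G g). lam_push t g a = (\<lambda>h. \<Sum>i<N. a (X i) * D i h)"
proof -
  have gA: "g \<in> Arr G" and m: "src G g \<in> Obj G" using tau_Arr[OF g] by auto
  let ?B = "\<lambda>h. mlt G (ivs G (lam t g)) (lam t (mlt G g h))"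
  have "fibre_smooth_at (idt G (src G g)) ?B"
    unfolding fibre_smooth_at_def
  proof (intro allI impI, elim conjE)
    fix n S d y0
    assume d: "plot (arrows G) n S d" "\<forall>y\<in>S. tgt G (d y) = tgt G (idt G (src G g))" "y0 \<in> S" "d y0 = idt G (src G g)"
    have td: "tgt G (d y) = src G g" "d y \<in> Arr G" if "y \<in> S" for y
      using d(2) that m plot_pts[OF arrows_manifold d(1)] by auto
    have p1: "plot (arrows G) n S (\<lambda>y. mlt G g (d y))"
      by (intro plot_mlt plot_const[OF arrows_manifold gA] d(1) plot_openin[OF arrows_manifold d(1)])
        (simp add: td)
    let ?T = "{y \<in> S. mlt G g (d y) \<in> \<tau> ` W}"
    have p2: "plot (arrows G) n ?T (\<lambda>y. mlt G g (d y))" by (rule plot_vimage[OF arrows_manifold p1 tau_open])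
    note To = plot_openin[OF arrows_manifold p2]
    have p3: "plot (arrows G) n ?T (\<lambda>y. lam t (mlt G g (d y)))"
      by (rule plot_retraction[OF p2]) (use t retraction_01(4) To in \<open>auto intro: smooth_real_const\<close>)
    have "plot (arrows G) n ?T (\<lambda>y. ?B (d y))"
      using retraction_01[OF g t] retraction_01(2)[OF _ t] gA td To
      by (intro plot_mlt plot_const[OF arrows_manifold] p3) auto
    then show "\<exists>T. y0 \<in> T \<and> T \<subseteq> S \<and> plot (arrows G) n T (\<lambda>y. ?B (d y))"
      using d g gA by (intro exI[of _ ?T]) auto
  qed
  from fibre_velocity_expansion[OF idt_tau[OF m] this] obtain N :: nat and X D where
    D: "\<And>c. fibre_curve G c \<Longrightarrow> c 0 = idt G (src G g) \<Longrightarrow>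
      velocity (arrows G) (\<lambda>r. ?B (c r)) = (\<lambda>h. \<Sum>i<N. velocity (arrows G) c (X i) * D i h)"
    by blast
  have "lam_push t g a = (\<lambda>h. \<Sum>i<N. a (X i) * D i h)" if a: "a \<in> algebroid G (src G g)" for a
    unfolding lam_push_def using D[OF tau_curve(1,2)[OF m a]] velocity_tau[OF m a] by simp
  then show ?thesis by blast
qed

lemma lam_push_add:
  assumes g: "g \<in> \<tau> ` W" and t: "t \<in> {0..1}" and a: "a \<in> algebroid G (src G g)" "b \<in> algebroid G (src G g)"
  shows "lam_push t g (tv_add a b) = tv_add (lam_push t g a) (lam_push t g b)"
    and "lam_push t g (tv_scale r a) = tv_scale r (lam_push t g a)"
proof -
  have m: "src G g \<in> Obj G" using tau_Arr[OF g] by auto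
  obtain N :: nat and X D where D: "\<And>a. a \<in> algebroid G (src G g) \<Longrightarrow> lam_push t g a = (\<lambda>h. \<Sum>i<N. a (X i) * D i h)"
    using lam_push_linear[OF g t] by blast
  show "lam_push t g (tv_add a b) = tv_add (lam_push t g a) (lam_push t g b)"
    unfolding D[OF a(1)] D[OF a(2)] D[OF algebroid_add[OF m a]]
    by (simp add: tv_add_def distrib_right sum.distrib)
  show "lam_push t g (tv_scale r a) = tv_scale r (lam_push t g a)"
    unfolding D[OF a(1)] D[OF algebroid_scale[OF m a(1)]]
    by (simp add: tv_scale_def sum_distrib_left mult.assoc)
qed

text \<open>In tubular coordinates over \<open>m\<close> the retraction is multiplication by
  \<open>t\<close>, and so is its differential at the unit. This is where the factor
  \<open>t ^ q\<close> of the Poincare lemma comes from.\<close>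

lemma lam_push_idt:
  assumes m: "m \<in> Obj G" and a: "a \<in> algebroid G m" and t: "t \<in> {0..1}"
  shows "lam_push t (idt G m) a = tv_scale t a"
proof -
  have "\<forall>\<^sub>F r in nhds 0. mlt G (ivs G (lam t (idt G m))) (lam t (mlt G (idt G m) (\<tau> (m, tv_scale r a)))) =
      \<tau> (m, tv_scale r (tv_scale t a))"
    using tau_curve(3)[OF m a]
  proof eventually_elim
    case (elim r)
    then have T: "\<tau> (m, tv_scale r a) \<in> \<tau> ` W" by blast
    note l = retraction_01[OF T t]
    have "mlt G (idt G m) (\<tau> (m, tv_scale r a)) = \<tau> (m, tv_scale r a)"
      using mlt_idt_left[OF tau_Arr[OF T]] tau_tgt[OF elim] by simp
    moreover have "mlt G (idt G m) (lam t (\<tau> (m, tv_scale r a))) = lam t (\<tau> (m, tv_scale r a))"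
      using mlt_idt_left[OF l(3)] l(2) tau_tgt[OF elim] by simp
    ultimately show ?case
      using retraction_eq[OF T, of t] tau_tgt[OF elim] xi_tau[OF elim] m
      by (simp add: retraction_idt scale_scale mult.commute)
  qed
  then show ?thesis
    unfolding lam_push_def using velocity_tau[OF m algebroid_scale[OF m a]] m
    by (simp add: velocity_cong[of _ "\<lambda>r. \<tau> (m, tv_scale r (tv_scale t a))"])
qed

lemma lam_velocity_idt: "m \<in> Obj G \<Longrightarrow> lam_velocity t (idt G m) = (\<lambda>f. 0)"
  by (simp add: lam_velocity_def retraction_idt velocity_const)

section \<open>Smooth dependence of the transported vectors on parameters\<close>

lemma plot_trunc:
  assumes "plot (arrows G) N \<Omega> g"
  shows "plot (arrows G) (Suc N) {z \<in> eucl (Suc N). trunc N z \<in> \<Omega>} (\<lambda>z. g (trunc N z))"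
  by (intro plot_compose[OF arrows_manifold assms] smooth_real_trunc openin_trunc plot_openin[OF arrows_manifold assms])
    simp

lemma algebroid_plot_trunc:
  assumes "algebroid_plot G N \<Omega> \<mu> a"
  shows "algebroid_plot G (Suc N) {z \<in> eucl (Suc N). trunc N z \<in> \<Omega>} (\<lambda>z. \<mu> (trunc N z)) (\<lambda>z. a (trunc N z))"
  by (intro algebroid_plot_compose[OF assms] smooth_real_trunc openin_trunc
      plot_openin[OF objects_manifold algebroid_plot_plot[OF assms]]) simp

lemma smooth_real_compose_trunc:
  assumes "smooth_real N \<Omega> t"
  shows "smooth_real (Suc N) {z \<in> eucl (Suc N). trunc N z \<in> \<Omega>} (\<lambda>z. t (trunc N z))"
  by (intro smooth_real_compose[OF assms] smooth_real_trunc openin_trunc smooth_real_openin[OF assms]) simp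

context
  fixes N :: nat and \<Omega> :: "(nat \<Rightarrow> real) set" and g :: "(nat \<Rightarrow> real) \<Rightarrow> 'g" and t :: "(nat \<Rightarrow> real) \<Rightarrow> real"
  assumes g: "plot (arrows G) N \<Omega> g" and gT: "\<And>z. z \<in> \<Omega> \<Longrightarrow> g z \<in> \<tau> ` W"
    and t: "smooth_real N \<Omega> t" and tW: "\<And>z. z \<in> \<Omega> \<Longrightarrow> (tgt G (g z), tv_scale (t z) (xi (g z))) \<in> W"
begin

private definition "\<Omega>1 = {z \<in> eucl (Suc N). trunc N z \<in> \<Omega>}"

private lemma O1: "openin (Euclidean_space (Suc N)) \<Omega>1"
  and g1: "plot (arrows G) (Suc N) \<Omega>1 (\<lambda>z. g (trunc N z))"
  and t1: "smooth_real (Suc N) \<Omega>1 (\<lambda>z. t (trunc N z))"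
  and r1: "smooth_real (Suc N) \<Omega>1 (\<lambda>z. z N)"
  unfolding \<Omega>1_def using openin_trunc[OF plot_openin[OF arrows_manifold g]]
  by (auto intro: plot_trunc[OF g] smooth_real_compose_trunc[OF t] smooth_real_coord)

private lemma mem1: "z \<in> \<Omega>1 \<Longrightarrow> trunc N z \<in> \<Omega>"
  by (simp add: \<Omega>1_def)

private lemma \<Omega>E: "z \<in> \<Omega> \<Longrightarrow> z \<in> eucl N"
  using openin_eucl_subset[OF plot_openin[OF arrows_manifold g]] by blast

private lemma \<Omega>1I: "y \<in> \<Omega> \<Longrightarrow> y \<in> \<Omega>1"
  using \<Omega>E[of y] trunc_same[of y N] by (auto simp: \<Omega>1_def mem_eucl)

lemma plot_lam: "plot (arrows G) N \<Omega> (\<lambda>z. lam (t z) (g z))"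
  by (rule plot_retraction[OF g gT t tW])

private lemma lam1: "plot (arrows G) (Suc N) \<Omega>1 (\<lambda>z. lam (t (trunc N z)) (g (trunc N z)))"
  unfolding \<Omega>1_def using plot_trunc[OF plot_lam] .

private lemma lamA: "z \<in> \<Omega> \<Longrightarrow> lam (t z) (g z) \<in> Arr G" "z \<in> \<Omega> \<Longrightarrow> tgt G (lam (t z) (g z)) = tgt G (g z)"
  using retraction_W[OF gT tW] by auto

text \<open>An instance of \<open>algebroid_plot_velocity\<close>, with the time increment as the
  additional coordinate. \<open>\<Omega>2\<close> is the open set on which the retraction at the
  shifted time is defined.\<close>

lemma lam_velocity_plot:
  "algebroid_plot G N \<Omega> (\<lambda>z. src G (lam (t z) (g z))) (\<lambda>z. lam_velocity (t z) (g z))"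
proof -
  have s: "smooth_real (Suc N) \<Omega>1 (\<lambda>z. t (trunc N z) + z N)" by (intro smooth_real_add t1 r1)
  define \<Omega>2 where "\<Omega>2 = {z \<in> \<Omega>1. (tgt G (g (trunc N z)), tv_scale (t (trunc N z) + z N) (xi (g (trunc N z)))) \<in> W}"
  have O2: "openin (Euclidean_space (Suc N)) \<Omega>2"
    unfolding \<Omega>2_def by (rule retraction_domain_open[OF g1 _ s]) (use gT mem1 in auto)
  have sub: "\<Omega>2 \<subseteq> \<Omega>1" by (auto simp: \<Omega>2_def)
  have l2: "plot (arrows G) (Suc N) \<Omega>2 (\<lambda>z. lam (t (trunc N z) + z N) (g (trunc N z)))"
    by (rule plot_retraction[OF plot_subset[OF arrows_manifold g1 O2 sub] _ smooth_real_subset[OF s O2 sub]])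
      (use gT mem1 in \<open>auto simp: \<Omega>2_def\<close>)
  let ?H = "\<lambda>z. mlt G (ivs G (lam (t (trunc N z)) (g (trunc N z)))) (lam (t (trunc N z) + z N) (g (trunc N z)))"
  have mem2: "trunc N z \<in> \<Omega>" "(tgt G (g (trunc N z)), tv_scale (t (trunc N z) + z N) (xi (g (trunc N z)))) \<in> W"
    if "z \<in> \<Omega>2" for z using that mem1 by (auto simp: \<Omega>2_def)
  have tg: "src G (ivs G (lam (t (trunc N z)) (g (trunc N z)))) = tgt G (lam (t (trunc N z) + z N) (g (trunc N z)))"
    if "z \<in> \<Omega>2" for z
    using lamA[OF mem2(1)[OF that]] retraction_W[OF gT[OF mem2(1)[OF that]] mem2(2)[OF that]] by simp
  have H: "plot (arrows G) (Suc N) \<Omega>2 ?H"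
    by (intro plot_mlt plot_ivs plot_subset[OF arrows_manifold lam1 O2 sub] l2 tg)
  have "algebroid_plot G N \<Omega> (\<lambda>z. src G (lam (t z) (g z))) (\<lambda>y. velocity (arrows G) (\<lambda>r. ?H (y(N := r))))"
  proof (rule algebroid_plot_velocity[OF H plot_src[OF plot_lam]])
    fix y assume y: "y \<in> \<Omega>"
    have yN: "y N = 0" "trunc N y = y" using \<Omega>E[OF y] by (auto simp: mem_eucl)
    show "y \<in> \<Omega>2" using \<Omega>1I[OF y] tW[OF y] yN by (simp add: \<Omega>2_def)
    show "?H y = idt G (src G (lam (t y) (g y)))" using lamA[OF y] yN by simp
    fix r assume r: "y(N := r) \<in> \<Omega>2"
    have ty: "trunc N (y(N := r)) = y" using \<Omega>E[OF y] by simp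
    have "lam (t (trunc N (y(N := r))) + (y(N := r)) N) (g (trunc N (y(N := r)))) \<in> Arr G"
      using plot_pts[OF arrows_manifold l2 r] .
    then show "tgt G (?H (y(N := r))) = src G (lam (t y) (g y))"
      using tg[OF r] lamA[OF y] unfolding ty by simp
  qed
  then show ?thesis
    by (rule algebroid_plot_cong) (use \<Omega>E in \<open>auto simp: lam_velocity_def\<close>)
qed

text \<open>The curve defining \<open>lam_push\<close> exists only on successively smaller open
  sets: on \<open>\<Omega>2\<close> the ray stays in \<open>W\<close>, on \<open>\<Omega>3\<close>
  its left translate by \<open>g\<close> stays in the tubular neighbourhood, on
  \<open>\<Omega>4\<close> the retraction of that translate is defined. At curve parameter 0 all
  these conditions hold, so no point of \<open>\<Omega>\<close> is lost.\<close>

lemma lam_push_plot: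
  assumes a: "algebroid_plot G N \<Omega> (\<lambda>z. src G (g z)) a"
  shows "algebroid_plot G N \<Omega> (\<lambda>z. src G (lam (t z) (g z))) (\<lambda>z. lam_push (t z) (g z) (a z))"
proof -
  have gA: "g z \<in> Arr G" if "z \<in> \<Omega>" for z using tau_Arr[OF gT[OF that]] .
  have a1: "algebroid_plot G (Suc N) \<Omega>1 (\<lambda>z. src G (g (trunc N z))) (\<lambda>z. tv_scale (z N) (a (trunc N z)))"
    by (rule algebroid_plot_scale[OF r1]) (use algebroid_plot_trunc[OF a] in \<open>simp add: \<Omega>1_def\<close>)
  define \<Omega>2 where "\<Omega>2 = {z \<in> \<Omega>1. (src G (g (trunc N z)), tv_scale (z N) (a (trunc N z))) \<in> W}"
  have O2: "openin (Euclidean_space (Suc N)) \<Omega>2" unfolding \<Omega>2_def by (rule W_open[OF a1])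
  have sub2: "\<Omega>2 \<subseteq> \<Omega>1" by (auto simp: \<Omega>2_def)
  define c where "c z = \<tau> (src G (g (trunc N z)), tv_scale (z N) (a (trunc N z)))" for z
  have c2: "plot (arrows G) (Suc N) \<Omega>2 c"
    unfolding c_def by (rule plot_tau[OF algebroid_plot_subset[OF a1 O2 sub2]]) (auto simp: \<Omega>2_def)
  have tc: "tgt G (c z) = src G (g (trunc N z))" if "z \<in> \<Omega>2" for z
    using that by (auto simp: \<Omega>2_def c_def intro: tau_tgt)
  define d where "d z = mlt G (g (trunc N z)) (c z)" for z
  have d2: "plot (arrows G) (Suc N) \<Omega>2 d"
    unfolding d_def by (intro plot_mlt plot_subset[OF arrows_manifold g1 O2 sub2] c2) (simp add: tc)
  define \<Omega>3 where "\<Omega>3 = {z \<in> \<Omega>2. d z \<in> \<tau> ` W}"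
  have d3: "plot (arrows G) (Suc N) \<Omega>3 d"
    unfolding \<Omega>3_def by (rule plot_vimage[OF arrows_manifold d2 tau_open])
  have O3: "openin (Euclidean_space (Suc N)) \<Omega>3" using plot_openin[OF arrows_manifold d3] .
  have sub3: "\<Omega>3 \<subseteq> \<Omega>1" using sub2 by (auto simp: \<Omega>3_def)
  note t3 = smooth_real_subset[OF t1 O3 sub3]
  define \<Omega>4 where "\<Omega>4 = {z \<in> \<Omega>3. (tgt G (d z), tv_scale (t (trunc N z)) (xi (d z))) \<in> W}"
  have O4: "openin (Euclidean_space (Suc N)) \<Omega>4"
    unfolding \<Omega>4_def by (rule retraction_domain_open[OF d3 _ t3]) (auto simp: \<Omega>3_def)
  have sub4: "\<Omega>4 \<subseteq> \<Omega>3" "\<Omega>4 \<subseteq> \<Omega>1" "\<Omega>4 \<subseteq> \<Omega>2" using sub3 by (auto simp: \<Omega>4_def \<Omega>3_def)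
  have l4: "plot (arrows G) (Suc N) \<Omega>4 (\<lambda>z. lam (t (trunc N z)) (d z))"
    by (rule plot_retraction[OF plot_subset[OF arrows_manifold d3 O4 sub4(1)] _ smooth_real_subset[OF t3 O4 sub4(1)]])
      (auto simp: \<Omega>4_def \<Omega>3_def)
  let ?H = "\<lambda>z. mlt G (ivs G (lam (t (trunc N z)) (g (trunc N z)))) (lam (t (trunc N z)) (d z))"
  have tl: "tgt G (lam (t (trunc N z)) (d z)) = tgt G (g (trunc N z))" if z: "z \<in> \<Omega>4" for z
  proof -
    have z2: "z \<in> \<Omega>2" "d z \<in> \<tau> ` W" "(tgt G (d z), tv_scale (t (trunc N z)) (xi (d z))) \<in> W"
      using z by (auto simp: \<Omega>4_def \<Omega>3_def)
    have "tgt G (d z) = tgt G (g (trunc N z))"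
      unfolding d_def using tc[OF z2(1)] plot_pts[OF arrows_manifold c2 z2(1)] gA[OF mem1[OF subsetD[OF sub2 z2(1)]]] by simp
    then show ?thesis using retraction_W(2)[OF z2(2,3)] by simp
  qed
  have tg: "src G (ivs G (lam (t (trunc N z)) (g (trunc N z)))) = tgt G (lam (t (trunc N z)) (d z))"
    if "z \<in> \<Omega>4" for z
    using lamA[OF mem1] that sub4 tl by auto
  have H: "plot (arrows G) (Suc N) \<Omega>4 ?H"
    by (intro plot_mlt plot_ivs plot_subset[OF arrows_manifold lam1 O4 sub4(2)] l4 tg)
  have "algebroid_plot G N \<Omega> (\<lambda>z. src G (lam (t z) (g z))) (\<lambda>y. velocity (arrows G) (\<lambda>r. ?H (y(N := r))))"
  proof (rule algebroid_plot_velocity[OF H plot_src[OF plot_lam]])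
    fix y assume y: "y \<in> \<Omega>"
    have yN: "y N = 0" "trunc N y = y" using \<Omega>E[OF y] by (auto simp: mem_eucl)
    have sy: "src G (g y) \<in> Obj G" using gA[OF y] by simp
    have cy: "c y = idt G (src G (g y))" using yN sy by (simp add: c_def scale_0 tau_zero)
    have dy: "d y = g y" using cy yN gA[OF y] by (simp add: d_def)
    show "y \<in> \<Omega>4" using \<Omega>1I[OF y] tW[OF y] gT[OF y] yN dy W_zero[OF sy]
      by (simp add: \<Omega>4_def \<Omega>3_def \<Omega>2_def scale_0)
    show "?H y = idt G (src G (lam (t y) (g y)))" using lamA[OF y] yN dy by simp
    fix r assume r: "y(N := r) \<in> \<Omega>4"
    have ty: "trunc N (y(N := r)) = y" using \<Omega>E[OF y] by simp
    have "lam (t (trunc N (y(N := r)))) (d (y(N := r))) \<in> Arr G"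
      using plot_pts[OF arrows_manifold l4 r] .
    then show "tgt G (?H (y(N := r))) = src G (lam (t y) (g y))"
      using tg[OF r] lamA[OF y] unfolding ty by simp
  qed
  then show ?thesis
    by (rule algebroid_plot_cong) (use \<Omega>E in \<open>auto simp: lam_push_def d_def c_def\<close>)
qed

end

end

section \<open>Smooth elements of the double complex near the units\<close>

context tubular_rep
begin

definition alt_form :: "'m \<Rightarrow> nat \<Rightarrow> ('g tvec list \<Rightarrow> 'v) \<Rightarrow> bool" where
  "alt_form m q f \<longleftrightarrow> (\<forall>as. length as = q \<and> set as \<subseteq> algebroid G m \<longrightarrow>
     f as \<in> fibre V m \<and>
     (\<forall>i<q. \<forall>a\<in>algebroid G m. \<forall>b\<in>algebroid G m. \<forall>r.
        f (as[i := tv_add a b]) = f (as[i := a]) + f (as[i := b]) \<and>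
        f (as[i := tv_scale r a]) = r *\<^sub>R f (as[i := a])) \<and>
     (\<forall>i<q. \<forall>j<q. i \<noteq> j \<and> as ! i = as ! j \<longrightarrow> f as = 0))"

lemma
  assumes "alt_form m q f" "length as = q" "set as \<subseteq> algebroid G m"
  shows alt_form_mem: "f as \<in> fibre V m"
    and alt_form_add: "i < q \<Longrightarrow> a \<in> algebroid G m \<Longrightarrow> b \<in> algebroid G m \<Longrightarrow>
      f (as[i := tv_add a b]) = f (as[i := a]) + f (as[i := b])"
    and alt_form_scale: "i < q \<Longrightarrow> a \<in> algebroid G m \<Longrightarrow> f (as[i := tv_scale r a]) = r *\<^sub>R f (as[i := a])"
    and alt_form_alt: "i < q \<Longrightarrow> j < q \<Longrightarrow> i \<noteq> j \<Longrightarrow> as ! i = as ! j \<Longrightarrow> f as = 0"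
  using assms unfolding alt_form_def by blast+

lemma alt_formI:
  assumes "\<And>as. length as = q \<Longrightarrow> set as \<subseteq> algebroid G m \<Longrightarrow> f as \<in> fibre V m"
    and "\<And>as i a b. length as = q \<Longrightarrow> set as \<subseteq> algebroid G m \<Longrightarrow> i < q \<Longrightarrow> a \<in> algebroid G m \<Longrightarrow>
      b \<in> algebroid G m \<Longrightarrow> f (as[i := tv_add a b]) = f (as[i := a]) + f (as[i := b])"
    and "\<And>as i a r. length as = q \<Longrightarrow> set as \<subseteq> algebroid G m \<Longrightarrow> i < q \<Longrightarrow> a \<in> algebroid G m \<Longrightarrow>
      f (as[i := tv_scale r a]) = r *\<^sub>R f (as[i := a])"
    and "\<And>as i j. length as = q \<Longrightarrow> set as \<subseteq> algebroid G m \<Longrightarrow> i < q \<Longrightarrow> j < q \<Longrightarrow> i \<noteq> j \<Longrightarrow>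
      as ! i = as ! j \<Longrightarrow> f as = 0"
  shows "alt_form m q f"
  using assms unfolding alt_form_def by simp

lemma alt_form_plus:
  assumes m: "m \<in> Obj G" and f: "alt_form m q f" and g: "alt_form m q g"
  shows "alt_form m q (\<lambda>as. f as + g as)"
proof (rule alt_formI)
  fix as :: "'g tvec list" assume as: "length as = q" "set as \<subseteq> algebroid G m"
  show "f as + g as \<in> fibre V m" using alt_form_mem[OF f as] alt_form_mem[OF g as] fibre_add[OF m] by simp
  show "f (as[i := tv_add a b]) + g (as[i := tv_add a b]) =
      f (as[i := a]) + g (as[i := a]) + (f (as[i := b]) + g (as[i := b]))"
    if "i < q" "a \<in> algebroid G m" "b \<in> algebroid G m" for i a b
    using alt_form_add[OF f as that] alt_form_add[OF g as that] by simp
  show "f (as[i := tv_scale r a]) + g (as[i := tv_scale r a]) = r *\<^sub>R (f (as[i := a]) + g (as[i := a]))"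
    if "i < q" "a \<in> algebroid G m" for i a r
    using alt_form_scale[OF f as that] alt_form_scale[OF g as that] by (simp add: scaleR_add_right)
  show "f as + g as = 0" if "i < q" "j < q" "i \<noteq> j" "as ! i = as ! j" for i j
    using alt_form_alt[OF f as that] alt_form_alt[OF g as that] by simp
qed

lemma alt_form_scaleR:
  assumes m: "m \<in> Obj G" and f: "alt_form m q f"
  shows "alt_form m q (\<lambda>as. c *\<^sub>R f as)"
proof (rule alt_formI)
  fix as :: "'g tvec list" assume as: "length as = q" "set as \<subseteq> algebroid G m"
  show "c *\<^sub>R f as \<in> fibre V m" using alt_form_mem[OF f as] fibre_scale[OF m] by simp
  show "c *\<^sub>R f (as[i := tv_add a b]) = c *\<^sub>R f (as[i := a]) + c *\<^sub>R f (as[i := b])"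
    if "i < q" "a \<in> algebroid G m" "b \<in> algebroid G m" for i a b
    using alt_form_add[OF f as that] by (simp add: scaleR_add_right)
  show "c *\<^sub>R f (as[i := tv_scale r a]) = r *\<^sub>R c *\<^sub>R f (as[i := a])"
    if "i < q" "a \<in> algebroid G m" for i a r
    using alt_form_scale[OF f as that] by simp
  show "c *\<^sub>R f as = 0" if "i < q" "j < q" "i \<noteq> j" "as ! i = as ! j" for i j
    using alt_form_alt[OF f as that] by simp
qed

lemma alt_form_zero: "m \<in> Obj G \<Longrightarrow> alt_form m q (\<lambda>as. 0)"
  by (rule alt_formI) (simp_all add: fibre_zero)

lemma alt_form_finite_sum:
  assumes m: "m \<in> Obj G" and f: "\<And>j. j \<in> J \<Longrightarrow> alt_form m q (f j)"
  shows "alt_form m q (\<lambda>as. \<Sum>j\<in>J. f j as)"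
  using f by (induction J rule: infinite_finite_induct) (simp_all add: alt_form_zero[OF m] alt_form_plus[OF m])

text \<open>Finite linear combinations in the first slot, which is the one used for contraction. The
  case of the empty sum gives the value 0 on the zero vector.\<close>

lemma alt_form_linear:
  assumes m: "m \<in> Obj G" and f: "alt_form m (Suc q) f" and l: "length l = q" "set l \<subseteq> algebroid G m"
    and J: "finite J" and v: "\<And>j. j \<in> J \<Longrightarrow> v j \<in> algebroid G m"
  shows "f ((\<lambda>h. \<Sum>j\<in>J. x j * v j h) # l) = (\<Sum>j\<in>J. x j *\<^sub>R f (v j # l))"
  using J v
proof (induction J rule: finite_induct)
  case empty
  have "length ((\<lambda>h. 0) # l) = Suc q" "set ((\<lambda>h. 0) # l) \<subseteq> algebroid G m"
    using l algebroid_zero[OF m] by auto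
  from alt_form_scale[OF f this, of 0 "\<lambda>h. 0" 0] show ?case
    using algebroid_zero[OF m] by (simp add: scale_0)
next
  case (insert j J)
  let ?w = "\<lambda>h. \<Sum>j\<in>J. x j * v j h"
  have w: "?w \<in> algebroid G m" by (rule algebroid_linear[OF m]) (use insert in auto)
  have vj: "v j \<in> algebroid G m" using insert by simp
  have as: "length (v j # l) = Suc q" "set (v j # l) \<subseteq> algebroid G m" using l vj by auto
  have "(\<lambda>h. \<Sum>j\<in>insert j J. x j * v j h) = tv_add (tv_scale (x j) (v j)) ?w"
    using insert by (simp add: tv_add_def tv_scale_def)
  then show ?case
    using alt_form_add[OF f as, of 0, OF _ algebroid_scale[OF m vj] w, of "x j"] alt_form_scale[OF f as, of 0, OF _ vj, of "x j"]
      insert by simp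
qed

abbreviation chain :: "'g list \<Rightarrow> bool" where
  "chain \<equiv> successively (\<lambda>a b. src G a = tgt G b)"

text \<open>The points \<open>(gs; g)\<close> of \<open>E\<^sub>pG\<close> in a product
  neighbourhood: the condition \<open>m\<^sub>p = t(g)\<close> amounts to composability of the
  prolonged list.\<close>

definition epts :: "nat \<Rightarrow> 'g set \<Rightarrow> ('g list \<times> 'g) set" where
  "epts p Q = {(gs, g). length gs = p \<and> set gs \<subseteq> Q \<and> g \<in> Q \<and> chain (gs @ [g])}"

lemma epts_mono: "P \<subseteq> Q \<Longrightarrow> epts p P \<subseteq> epts p Q"
  by (auto simp: epts_def)

text \<open>The last arrow may be moved inside its \<open>t\<close>-fibre, which is what the
  retraction does.\<close>

lemma epts_change:
  assumes "(gs, g) \<in> epts p P" "P \<subseteq> Q" "h \<in> Q" "tgt G h = tgt G g"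
  shows "(gs, h) \<in> epts p Q"
  using assms by (auto simp: epts_def successively_append_iff)

text \<open>Alternation is carried along with smoothness because the Poincare lemma at the units
  rearranges and rescales the form arguments.\<close>

definition smooth_on :: "nat \<Rightarrow> nat \<Rightarrow> ('g, 'v) dcochain \<Rightarrow> 'g set \<Rightarrow> bool" where
  "smooth_on p q \<psi> Q \<longleftrightarrow>
     (\<forall>gs g. (gs, g) \<in> epts p Q \<longrightarrow> alt_form (src G g) q (\<psi> gs g)) \<and>
     (\<forall>n S gs g as. (\<forall>i<p. plot (arrows G) n S (\<lambda>y. gs y ! i)) \<and> plot (arrows G) n S g \<and>
        (\<forall>y\<in>S. (gs y, g y) \<in> epts p Q \<and> length (as y) = q) \<and>
        (\<forall>i<q. algebroid_plot G n S (\<lambda>y. src G (g y)) (\<lambda>y. as y ! i)) \<longrightarrow>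
        bundle_plot (objects G) V n S (\<lambda>y. src G (g y)) (\<lambda>y. \<psi> (gs y) (g y) (as y)))"

lemma smooth_on_alt: "smooth_on p q \<psi> Q \<Longrightarrow> (gs, g) \<in> epts p Q \<Longrightarrow> alt_form (src G g) q (\<psi> gs g)"
  by (simp add: smooth_on_def)

lemma smooth_on_plot:
  assumes "smooth_on p q \<psi> Q"
    and "\<And>i. i < p \<Longrightarrow> plot (arrows G) n S (\<lambda>y. gs y ! i)" "plot (arrows G) n S g"
    and "\<And>y. y \<in> S \<Longrightarrow> (gs y, g y) \<in> epts p Q" "\<And>y. y \<in> S \<Longrightarrow> length (as y) = q"
    and "\<And>i. i < q \<Longrightarrow> algebroid_plot G n S (\<lambda>y. src G (g y)) (\<lambda>y. as y ! i)"
  shows "bundle_plot (objects G) V n S (\<lambda>y. src G (g y)) (\<lambda>y. \<psi> (gs y) (g y) (as y))"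
proof -
  have "\<forall>n S gs g as. (\<forall>i<p. plot (arrows G) n S (\<lambda>y. gs y ! i)) \<and> plot (arrows G) n S g \<and>
        (\<forall>y\<in>S. (gs y, g y) \<in> epts p Q \<and> length (as y) = q) \<and>
        (\<forall>i<q. algebroid_plot G n S (\<lambda>y. src G (g y)) (\<lambda>y. as y ! i)) \<longrightarrow>
        bundle_plot (objects G) V n S (\<lambda>y. src G (g y)) (\<lambda>y. \<psi> (gs y) (g y) (as y))"
    using assms(1) unfolding smooth_on_def by (elim conjE)
  from this[rule_format, of n S gs g as] assms(2-) show ?thesis by simp
qed

definition smooth_dc :: "nat \<Rightarrow> nat \<Rightarrow> ('g, 'v) dcochain \<Rightarrow> bool" where
  "smooth_dc p q \<psi> \<longleftrightarrow> (\<forall>x\<in>Obj G. \<exists>Q. openin (mtop (arrows G)) Q \<and> idt G x \<in> Q \<and> smooth_on p q \<psi> Q)"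

subsection \<open>The operator \<open>k\<close>\<close>

text \<open>The integrand of \<open>k\<close> after left translation to the units. The contracted
  vector \<open>v\<close> is left free: \<open>k\<close> itself uses \<open>lam_velocity\<close>,
  the Poincare lemma decomposes that into the vectors \<open>coord_push\<close>.\<close>

definition kern :: "('g, 'v) dcochain \<Rightarrow> 'g list \<Rightarrow> 'g \<Rightarrow> 'g tvec list \<Rightarrow> real \<Rightarrow> 'g tvec \<Rightarrow> 'v" where
  "kern \<psi> gs g as t v = act V (lam t g) (\<psi> gs (lam t g) (v # map (lam_push t g) as))"

lemma op_k_eq:
  assumes g: "g \<in> \<tau> ` W" and as: "set as \<subseteq> algebroid G (src G g)"
  shows "op_k G V W \<tau> \<psi> gs g as = act V (ivs G g)
    ((-1) ^ length gs *\<^sub>R integral {0..1} (\<lambda>t. kern \<psi> gs g as t (lam_velocity t g)))"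
proof -
  have "T_Rh G W \<tau> (to_form G V \<psi> gs) g (map (push G (mlt G g) (idt G (src G g))) as) =
     integral {0..1} (\<lambda>t. kern \<psi> gs g as t (lam_velocity t g))"
    unfolding T_Rh_def
  proof (rule integral_cong)
    fix t :: real assume t: "t \<in> {0..1}"
    have "map (push G (mlt G (ivs G (lam t g))) (lam t g)) (map (push G (lam t) g)
        (map (push G (mlt G g) (idt G (src G g))) as)) = map (lam_push t g) as"
      using lam_push_eq(1)[OF g t] as by auto
    then show "to_form G V \<psi> gs (lam t g) (velocity (arrows G) (\<lambda>r. lam (t + r) g) #
        map (push G (lam t) g) (map (push G (mlt G g) (idt G (src G g))) as)) =
        kern \<psi> gs g as t (lam_velocity t g)"
      unfolding to_form_def kern_def by (simp only: list.map lam_velocity_eq(1)[OF g t])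
  qed
  then show ?thesis by (simp add: op_k_def from_form_def)
qed

context
  fixes p q :: nat and \<psi> :: "('g, 'v) dcochain" and Q P :: "'g set"
  assumes \<psi>: "smooth_on p (Suc q) \<psi> Q" and Q: "openin (mtop (arrows G)) Q"
    and P: "P \<subseteq> \<tau> ` W" and PQ: "\<And>h t. h \<in> P \<Longrightarrow> t \<in> {0..1} \<Longrightarrow> lam t h \<in> Q"
begin

lemma P_Q: "P \<subseteq> Q"
proof
  fix h assume h: "h \<in> P"
  then have "h \<in> \<tau> ` W" using P by auto
  then have "lam 1 h = h" by (simp add: retraction_eq tau_xi)
  then show "h \<in> Q" using PQ[OF h, of 1] by simp
qed

lemma kern_alt:
  assumes e: "(gs, g) \<in> epts p P" and t: "t \<in> {0..1}" and v: "v \<in> algebroid G (src G (lam t g))"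
  shows "as \<in> {as. length as = q \<and> set as \<subseteq> algebroid G (src G g)} \<Longrightarrow> kern \<psi> gs g as t v \<in> fibre V (tgt G g)"
    and "length as = q \<Longrightarrow> set as \<subseteq> algebroid G (src G g) \<Longrightarrow> i < q \<Longrightarrow> a \<in> algebroid G (src G g) \<Longrightarrow>
      b \<in> algebroid G (src G g) \<Longrightarrow>
      kern \<psi> gs g (as[i := tv_add a b]) t v = kern \<psi> gs g (as[i := a]) t v + kern \<psi> gs g (as[i := b]) t v"
    and "length as = q \<Longrightarrow> set as \<subseteq> algebroid G (src G g) \<Longrightarrow> i < q \<Longrightarrow> a \<in> algebroid G (src G g) \<Longrightarrow>
      kern \<psi> gs g (as[i := tv_scale r a]) t v = r *\<^sub>R kern \<psi> gs g (as[i := a]) t v"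
    and "length as = q \<Longrightarrow> set as \<subseteq> algebroid G (src G g) \<Longrightarrow> i < q \<Longrightarrow> j < q \<Longrightarrow> i \<noteq> j \<Longrightarrow> as ! i = as ! j \<Longrightarrow>
      kern \<psi> gs g as t v = 0"
proof -
  have gP: "g \<in> P" using e by (auto simp: epts_def)
  then have g: "g \<in> \<tau> ` W" using P by auto
  have gA: "g \<in> Arr G" using tau_Arr[OF g] .
  note l = retraction_01[OF g t]
  have el: "(gs, lam t g) \<in> epts p Q" by (rule epts_change[OF e P_Q PQ[OF gP t] l(2)])
  note f = smooth_on_alt[OF \<psi> el]
  let ?A = "algebroid G (src G g)" and ?B = "algebroid G (src G (lam t g))"
  have L: "length (v # map (lam_push t g) as) = Suc q \<and> set (v # map (lam_push t g) as) \<subseteq> ?B"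
    if "length as = q" "set as \<subseteq> ?A" for as
    using that v lam_push_eq(2)[OF g t] by auto
  have mem: "\<psi> gs (lam t g) (v # map (lam_push t g) as) \<in> fibre V (src G (lam t g))"
    if "length as = q" "set as \<subseteq> ?A" for as
    using L[OF that] alt_form_mem[OF f] by blast
  have upd: "set (as[i := a]) \<subseteq> ?A" if "set as \<subseteq> ?A" "a \<in> ?A" for as i a
    using that set_update_subset_insert[of as i a] by auto
  show "kern \<psi> gs g as t v \<in> fibre V (tgt G g)" if "as \<in> {as. length as = q \<and> set as \<subseteq> ?A}"
    unfolding kern_def using act_fibre[OF l(3) mem] that l(2) by simp
  have cons: "v # map (lam_push t g) (as[i := a]) = (v # map (lam_push t g) as)[Suc i := lam_push t g a]" for as i a
    by (simp add: map_update)
  show "kern \<psi> gs g (as[i := tv_add a b]) t v = kern \<psi> gs g (as[i := a]) t v + kern \<psi> gs g (as[i := b]) t v"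
    if as: "length as = q" "set as \<subseteq> ?A" and i: "i < q" and ab: "a \<in> ?A" "b \<in> ?A"
  proof -
    have "\<psi> gs (lam t g) (v # map (lam_push t g) (as[i := tv_add a b])) =
      \<psi> gs (lam t g) (v # map (lam_push t g) (as[i := a])) + \<psi> gs (lam t g) (v # map (lam_push t g) (as[i := b]))"
      unfolding cons lam_push_add(1)[OF g t ab]
      using L[OF as] i ab lam_push_eq(2)[OF g t] by (intro alt_form_add[OF f]) auto
    then show ?thesis unfolding kern_def
      using act_add[OF l(3) mem mem] as upd[OF as(2) ab(1)] upd[OF as(2) ab(2)] by simp
  qed
  show "kern \<psi> gs g (as[i := tv_scale r a]) t v = r *\<^sub>R kern \<psi> gs g (as[i := a]) t v"
    if as: "length as = q" "set as \<subseteq> ?A" and i: "i < q" and a: "a \<in> ?A"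
  proof -
    have "\<psi> gs (lam t g) (v # map (lam_push t g) (as[i := tv_scale r a])) =
      r *\<^sub>R \<psi> gs (lam t g) (v # map (lam_push t g) (as[i := a]))"
      unfolding cons lam_push_add(2)[OF g t a a]
      using L[OF as] i a lam_push_eq(2)[OF g t] by (intro alt_form_scale[OF f]) auto
    then show ?thesis unfolding kern_def
      using act_scale[OF l(3) mem] as upd[OF as(2) a] by simp
  qed
  show "kern \<psi> gs g as t v = 0"
    if as: "length as = q" "set as \<subseteq> ?A" and ij: "i < q" "j < q" "i \<noteq> j" "as ! i = as ! j"
    unfolding kern_def using alt_form_alt[OF f, of "v # map (lam_push t g) as" "Suc i" "Suc j"] L[OF as] ij as
      act_zero[OF l(3)] by simp
qed

text \<open>Stated for any family \<open>v y t\<close> of vectors at the retracted point, so as to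
  serve both choices of the contracted vector. The assumption on \<open>v\<close> ranges over all
  open \<Omega>, since the domain actually needed is constructed only inside the proof.\<close>

lemma kern_integral_plot:
  assumes gs: "\<And>i. i < p \<Longrightarrow> plot (arrows G) n S (\<lambda>y. gs y ! i)" and g: "plot (arrows G) n S g"
    and e: "\<And>y. y \<in> S \<Longrightarrow> (gs y, g y) \<in> epts p P" and las: "\<And>y. y \<in> S \<Longrightarrow> length (as y) = q"
    and as: "\<And>i. i < q \<Longrightarrow> algebroid_plot G n S (\<lambda>y. src G (g y)) (\<lambda>y. as y ! i)"
    and v: "\<And>\<Omega>. openin (Euclidean_space (Suc n)) \<Omega> \<Longrightarrow>
      (\<And>z. z \<in> \<Omega> \<Longrightarrow> trunc n z \<in> S \<and> (tgt G (g (trunc n z)), tv_scale (z n) (xi (g (trunc n z)))) \<in> W) \<Longrightarrow>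
      algebroid_plot G (Suc n) \<Omega> (\<lambda>z. src G (lam (z n) (g (trunc n z)))) (\<lambda>z. v (trunc n z) (z n))"
  shows "bundle_plot (objects G) V n S (\<lambda>y. tgt G (g y))
      (\<lambda>y. integral {0..1} (\<lambda>t. kern \<psi> (gs y) (g y) (as y) t (v y t)))"
    and "y \<in> S \<Longrightarrow> (\<lambda>t. kern \<psi> (gs y) (g y) (as y) t (v y t)) integrable_on {0..1}"
proof -
  have So: "openin (Euclidean_space n) S" using plot_openin[OF arrows_manifold g] .
  have SE: "y \<in> eucl n" if "y \<in> S" for y using openin_eucl_subset[OF So] that by blast
  have gP: "g y \<in> P" if "y \<in> S" for y using e[OF that] by (auto simp: epts_def)
  have gT: "g y \<in> \<tau> ` W" if "y \<in> S" for y using gP[OF that] P by auto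
  \<comment> \<open>Three nested open domains in (n+1)-space: the base point lies in
    \<open>S\<close>, the retraction is defined, its value lies in \<open>Q\<close>. Even the
    smallest contains all \<open>y(n := t)\<close> with \<open>y \<in> S\<close> and
    \<open>t \<in> {0..1}\<close>, see \<open>sub01\<close>.\<close>
  define \<Omega>1 where "\<Omega>1 = {z \<in> eucl (Suc n). trunc n z \<in> S}"
  have O1: "openin (Euclidean_space (Suc n)) \<Omega>1" unfolding \<Omega>1_def by (rule openin_trunc[OF So])
  have g1: "plot (arrows G) (Suc n) \<Omega>1 (\<lambda>z. g (trunc n z))" unfolding \<Omega>1_def by (rule plot_trunc[OF g])
  have t1: "smooth_real (Suc n) \<Omega>1 (\<lambda>z. z n)" by (rule smooth_real_coord[OF O1])
  have gT1: "g (trunc n z) \<in> \<tau> ` W" if "z \<in> \<Omega>1" for z using gT that by (simp add: \<Omega>1_def)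
  define \<Omega>2 where "\<Omega>2 = {z \<in> \<Omega>1. (tgt G (g (trunc n z)), tv_scale (z n) (xi (g (trunc n z)))) \<in> W}"
  have O2: "openin (Euclidean_space (Suc n)) \<Omega>2"
    unfolding \<Omega>2_def by (rule retraction_domain_open[OF g1 gT1 t1])
  have sub2: "\<Omega>2 \<subseteq> \<Omega>1" by (auto simp: \<Omega>2_def)
  note g2 = plot_subset[OF arrows_manifold g1 O2 sub2] and t2 = smooth_real_subset[OF t1 O2 sub2]
  have gT2: "g (trunc n z) \<in> \<tau> ` W" if "z \<in> \<Omega>2" for z using gT1 that sub2 by auto
  have W2: "(tgt G (g (trunc n z)), tv_scale (z n) (xi (g (trunc n z)))) \<in> W" if "z \<in> \<Omega>2" for z
    using that by (simp add: \<Omega>2_def)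
  have l2: "plot (arrows G) (Suc n) \<Omega>2 (\<lambda>z. lam (z n) (g (trunc n z)))"
    by (rule plot_lam[OF g2 gT2 t2 W2])
  define \<Omega> where "\<Omega> = {z \<in> \<Omega>2. lam (z n) (g (trunc n z)) \<in> Q}"
  have O: "openin (Euclidean_space (Suc n)) \<Omega>"
    unfolding \<Omega>_def by (rule plot_vimage_open[OF arrows_manifold l2 Q])
  have sub: "\<Omega> \<subseteq> \<Omega>2" "\<Omega> \<subseteq> \<Omega>1" using sub2 by (auto simp: \<Omega>_def)
  note g3 = plot_subset[OF arrows_manifold g2 O sub(1)] and t3 = smooth_real_subset[OF t2 O sub(1)]
  have gT3: "g (trunc n z) \<in> \<tau> ` W" and W3: "(tgt G (g (trunc n z)), tv_scale (z n) (xi (g (trunc n z)))) \<in> W"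
    and S3: "trunc n z \<in> S" and Q3: "lam (z n) (g (trunc n z)) \<in> Q" if "z \<in> \<Omega>" for z
    using gT2 W2 that sub by (auto simp: \<Omega>_def \<Omega>1_def)
  have l3: "plot (arrows G) (Suc n) \<Omega> (\<lambda>z. lam (z n) (g (trunc n z)))"
    by (rule plot_lam[OF g3 gT3 t3 W3])
  have tl: "tgt G (lam (z n) (g (trunc n z))) = tgt G (g (trunc n z))" if "z \<in> \<Omega>" for z
    using retraction_W(2)[OF gT3[OF that] W3[OF that]] .
  have "bundle_plot (objects G) V (Suc n) \<Omega> (\<lambda>z. src G (lam (z n) (g (trunc n z))))
      (\<lambda>z. \<psi> (gs (trunc n z)) (lam (z n) (g (trunc n z)))
        (v (trunc n z) (z n) # map (lam_push (z n) (g (trunc n z))) (as (trunc n z))))"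
  proof (rule smooth_on_plot[OF \<psi> _ l3])
    show "plot (arrows G) (Suc n) \<Omega> (\<lambda>z. gs (trunc n z) ! i)" if "i < p" for i
      using plot_subset[OF arrows_manifold plot_trunc[OF gs[OF that]] O] sub(2) by (simp add: \<Omega>1_def)
    show "(gs (trunc n z), lam (z n) (g (trunc n z))) \<in> epts p Q" if "z \<in> \<Omega>" for z
      by (rule epts_change[OF e[OF S3[OF that]] P_Q Q3[OF that] tl[OF that]])
    show "length (v (trunc n z) (z n) # map (lam_push (z n) (g (trunc n z))) (as (trunc n z))) = Suc q"
      if "z \<in> \<Omega>" for z using las[OF S3[OF that]] by simp
    fix i assume i: "i < Suc q"
    show "algebroid_plot G (Suc n) \<Omega> (\<lambda>z. src G (lam (z n) (g (trunc n z))))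
      (\<lambda>z. (v (trunc n z) (z n) # map (lam_push (z n) (g (trunc n z))) (as (trunc n z))) ! i)"
    proof (cases i)
      case 0
      have "algebroid_plot G (Suc n) \<Omega> (\<lambda>z. src G (lam (z n) (g (trunc n z)))) (\<lambda>z. v (trunc n z) (z n))"
        by (rule v[OF O]) (use S3 W3 in auto)
      then show ?thesis using 0 by simp
    next
      case (Suc j)
      then have j: "j < q" using i by simp
      have "algebroid_plot G (Suc n) \<Omega> (\<lambda>z. src G (g (trunc n z))) (\<lambda>z. as (trunc n z) ! j)"
        using algebroid_plot_subset[OF algebroid_plot_trunc[OF as[OF j]] O] sub(2) by (simp add: \<Omega>1_def)
      from lam_push_plot[OF g3 gT3 t3 W3 this] show ?thesis
        by (rule algebroid_plot_cong) (use Suc j las S3 in auto)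
    qed
  qed
  then have b: "bundle_plot (objects G) V (Suc n) \<Omega> (\<lambda>z. tgt G (g (trunc n z)))
      (\<lambda>z. kern \<psi> (gs (trunc n z)) (g (trunc n z)) (as (trunc n z)) (z n) (v (trunc n z) (z n)))"
    unfolding kern_def by (rule bundle_plot_act[OF l3]) (use tl in auto)
  have sub01: "y(n := t) \<in> \<Omega>" if "y \<in> S" "t \<in> {0..1}" for y t
    using SE[OF that(1)] that PQ[OF gP[OF that(1)] that(2)] retraction_01(4)[OF gT[OF that(1)] that(2)]
    by (simp add: \<Omega>_def \<Omega>2_def \<Omega>1_def eucl_upd)
  have eq: "tgt G (g (trunc n (y(n := t)))) = tgt G (g y)" if "y \<in> S" for y t using SE[OF that] by simp
  note I = bundle_plot_integral[OF b plot_tgt[OF g] sub01 eq]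
  have tr: "trunc n (y(n := t)) = y" if "y \<in> S" for y t using SE[OF that] by simp
  show "bundle_plot (objects G) V n S (\<lambda>y. tgt G (g y))
      (\<lambda>y. integral {0..1} (\<lambda>t. kern \<psi> (gs y) (g y) (as y) t (v y t)))"
    by (rule bundle_plot_cong[OF I(1)]) (auto simp: tr)
  show "y \<in> S \<Longrightarrow> (\<lambda>t. kern \<psi> (gs y) (g y) (as y) t (v y t)) integrable_on {0..1}"
    using I(2)[of y] by (simp add: tr)
qed

lemma lam_velocity_kern_plot:
  assumes g: "plot (arrows G) n S g" and gP: "\<And>y. y \<in> S \<Longrightarrow> g y \<in> P"
    and O: "openin (Euclidean_space (Suc n)) \<Omega>"
    and W: "\<And>z. z \<in> \<Omega> \<Longrightarrow> trunc n z \<in> S \<and> (tgt G (g (trunc n z)), tv_scale (z n) (xi (g (trunc n z)))) \<in> W"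
  shows "algebroid_plot G (Suc n) \<Omega> (\<lambda>z. src G (lam (z n) (g (trunc n z)))) (\<lambda>z. lam_velocity (z n) (g (trunc n z)))"
proof (rule lam_velocity_plot)
  show "plot (arrows G) (Suc n) \<Omega> (\<lambda>z. g (trunc n z))"
    by (intro plot_compose[OF arrows_manifold g O] smooth_real_trunc O) (use W in auto)
qed (use W gP P O in \<open>auto intro: smooth_real_coord\<close>)

lemma smooth_on_k: "smooth_on p q (op_k G V W \<tau> \<psi>) P"
  unfolding smooth_on_def
proof (intro conjI allI impI)
  fix gs g assume e: "(gs, g) \<in> epts p P"
  then have gP: "g \<in> P" by (auto simp: epts_def)
  then have g: "g \<in> \<tau> ` W" using P by auto
  have gA: "g \<in> Arr G" using tau_Arr[OF g] .
  have sm: "src G g \<in> Obj G" "tgt G g \<in> Obj G" using gA by auto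
  let ?A = "algebroid G (src G g)"
  let ?I = "\<lambda>as. integral {0..1} (\<lambda>t. kern \<psi> gs g as t (lam_velocity t g))"
  \<comment> \<open>A single point of \<open>E\<^sub>pG\<close> is a plot on 0-space. In this way
    \<open>kern_integral_plot\<close> also yields integrability for fixed arguments and the fibre in
    which the integral lies.\<close>
  have E: "openin (Euclidean_space 0) (eucl 0)" by simp
  have gpl: "plot (arrows G) 0 (eucl 0) (\<lambda>y. g)" by (rule plot_const[OF arrows_manifold gA E])
  have set1: "set gs \<subseteq> Arr G" using e P tau_Arr by (auto simp: epts_def)
  have gsl: "length gs = p" using e by (auto simp: epts_def)
  have gspl: "plot (arrows G) 0 (eucl 0) (\<lambda>y. gs ! i)" if "i < p" for i
    by (rule plot_const[OF arrows_manifold _ E]) (use set1 gsl that nth_mem in blast)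
  have int: "(\<lambda>t. kern \<psi> gs g as t (lam_velocity t g)) integrable_on {0..1}"
    and Imem: "?I as \<in> fibre V (tgt G g)"
    if as: "length as = q" "set as \<subseteq> ?A" for as
  proof -
    have ap: "algebroid_plot G 0 (eucl 0) (\<lambda>y. src G g) (\<lambda>y. as ! i)" if "i < q" for i
      by (rule algebroid_plot_const[OF sm(1) _ E]) (use as that nth_mem in blast)
    show "(\<lambda>t. kern \<psi> gs g as t (lam_velocity t g)) integrable_on {0..1}"
      by (rule kern_integral_plot(2)[OF gspl gpl e as(1) ap lam_velocity_kern_plot[OF gpl gP], of "\<lambda>_. 0"]) auto
    have "bundle_plot (objects G) V 0 (eucl 0) (\<lambda>y. tgt G g) (\<lambda>y. ?I as)"
      by (rule kern_integral_plot(1)[OF gspl gpl e as(1) ap lam_velocity_kern_plot[OF gpl gP]]) auto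
    from bundle_plot_mem[OF this, of "\<lambda>_. 0"] show "?I as \<in> fibre V (tgt G g)" by simp
  qed
  have upd: "set (as[i := a]) \<subseteq> ?A" if "set as \<subseteq> ?A" "a \<in> ?A" for as i a
    using that set_update_subset_insert[of as i a] by auto
  have iA: "ivs G g \<in> Arr G" and si: "src G (ivs G g) = tgt G g" "tgt G (ivs G g) = src G g" using gA by auto
  let ?s = "(-1) ^ length gs :: real"
  have smem: "?s *\<^sub>R ?I as \<in> fibre V (src G (ivs G g))" if "length as = q" "set as \<subseteq> ?A" for as
    using fibre_scale[OF sm(2) Imem[OF that]] si by simp
  have keq: "op_k G V W \<tau> \<psi> gs g as = act V (ivs G g) (?s *\<^sub>R ?I as)" if "set as \<subseteq> ?A" for as
    by (rule op_k_eq[OF g that])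
  note lv = lam_velocity_eq(2)[OF g]
  show "alt_form (src G g) q (op_k G V W \<tau> \<psi> gs g)"
  proof (rule alt_formI)
    fix as assume as: "length as = q" "set as \<subseteq> ?A"
    show "op_k G V W \<tau> \<psi> gs g as \<in> fibre V (src G g)"
      unfolding keq[OF as(2)] using act_fibre[OF iA smem[OF as]] si by simp
    show "op_k G V W \<tau> \<psi> gs g (as[i := tv_add a b]) =
        op_k G V W \<tau> \<psi> gs g (as[i := a]) + op_k G V W \<tau> \<psi> gs g (as[i := b])"
      if i: "i < q" and ab: "a \<in> ?A" "b \<in> ?A" for i a b
    proof -
      have "?I (as[i := tv_add a b]) = integral {0..1} (\<lambda>t. kern \<psi> gs g (as[i := a]) t (lam_velocity t g) +
          kern \<psi> gs g (as[i := b]) t (lam_velocity t g))"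
        by (rule integral_cong) (rule kern_alt(2)[OF e _ lv as i ab])
      also have "\<dots> = ?I (as[i := a]) + ?I (as[i := b])"
        using as upd[OF as(2)] ab by (intro integral_add int) auto
      finally show ?thesis
        unfolding keq[OF upd[OF as(2) ab(1)]] keq[OF upd[OF as(2) ab(2)]] keq[OF upd[OF as(2) algebroid_add[OF sm(1) ab]]]
        using act_add[OF iA smem smem, of "as[i := a]" "as[i := b]"] as upd[OF as(2)] ab
        by (simp add: scaleR_add_right)
    qed
    show "op_k G V W \<tau> \<psi> gs g (as[i := tv_scale r a]) = r *\<^sub>R op_k G V W \<tau> \<psi> gs g (as[i := a])"
      if i: "i < q" and a: "a \<in> ?A" for i a r
    proof -
      have "?I (as[i := tv_scale r a]) = integral {0..1} (\<lambda>t. r *\<^sub>R kern \<psi> gs g (as[i := a]) t (lam_velocity t g))"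
        by (rule integral_cong) (rule kern_alt(3)[OF e _ lv as i a])
      then have "?I (as[i := tv_scale r a]) = r *\<^sub>R ?I (as[i := a])" by simp
      then show ?thesis
        unfolding keq[OF upd[OF as(2) a]] keq[OF upd[OF as(2) algebroid_scale[OF sm(1) a]]]
        using act_scale[OF iA smem, of "as[i := a]" r] as upd[OF as(2) a]
        by (simp add: mult.commute)
    qed
    show "op_k G V W \<tau> \<psi> gs g as = 0" if ij: "i < q" "j < q" "i \<noteq> j" "as ! i = as ! j" for i j
    proof -
      have "kern \<psi> gs g as t (lam_velocity t g) = 0" if "t \<in> {0..1}" for t
        by (rule kern_alt(4)[OF e that lv[OF that] as ij])
      then have "?I as = integral {0..1} (\<lambda>t::real. 0 :: 'v)" by (rule integral_cong)
      then show ?thesis unfolding keq[OF as(2)] using act_zero[OF iA] by simp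
    qed
  qed
next
  fix n S gs g as
  assume "(\<forall>i<p. plot (arrows G) n S (\<lambda>y. gs y ! i)) \<and> plot (arrows G) n S g \<and>
        (\<forall>y\<in>S. (gs y, g y) \<in> epts p P \<and> length (as y) = q) \<and>
        (\<forall>i<q. algebroid_plot G n S (\<lambda>y. src G (g y)) (\<lambda>y. as y ! i))"
  then have gs: "\<And>i. i < p \<Longrightarrow> plot (arrows G) n S (\<lambda>y. gs y ! i)" and g: "plot (arrows G) n S g"
    and e: "\<And>y. y \<in> S \<Longrightarrow> (gs y, g y) \<in> epts p P" and las: "\<And>y. y \<in> S \<Longrightarrow> length (as y) = q"
    and as: "\<And>i. i < q \<Longrightarrow> algebroid_plot G n S (\<lambda>y. src G (g y)) (\<lambda>y. as y ! i)" by auto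
  have gP: "g y \<in> P" if "y \<in> S" for y using e[OF that] by (auto simp: epts_def)
  have gT: "g y \<in> \<tau> ` W" if "y \<in> S" for y using gP[OF that] P by auto
  have asA: "set (as y) \<subseteq> algebroid G (src G (g y))" if y: "y \<in> S" for y
    using algebroid_plot_mem[OF as y] las[OF y] by (auto simp: set_conv_nth)
  have "bundle_plot (objects G) V n S (\<lambda>y. tgt G (g y))
      (\<lambda>y. integral {0..1} (\<lambda>t. kern \<psi> (gs y) (g y) (as y) t (lam_velocity t (g y))))"
    by (rule kern_integral_plot(1)[OF gs g e las as lam_velocity_kern_plot[OF g gP]])
  from bundle_plot_act[OF plot_ivs[OF g] bundle_plot_scale[OF this, of "(-1) ^ p"]]
  have "bundle_plot (objects G) V n S (\<lambda>y. src G (g y)) (\<lambda>y. act V (ivs G (g y)) ((-1) ^ p *\<^sub>R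
      integral {0..1} (\<lambda>t. kern \<psi> (gs y) (g y) (as y) t (lam_velocity t (g y)))))"
    using tau_Arr[OF gT] by simp
  then show "bundle_plot (objects G) V n S (\<lambda>y. src G (g y)) (\<lambda>y. op_k G V W \<tau> \<psi> (gs y) (g y) (as y))"
    by (rule bundle_plot_cong) (use op_k_eq[OF gT asA] e in \<open>auto simp: epts_def\<close>)
qed

end

lemma smooth_dc_k:
  assumes "smooth_dc p (Suc q) \<psi>"
  shows "smooth_dc p q (op_k G V W \<tau> \<psi>)"
  unfolding smooth_dc_def
proof
  fix x assume x: "x \<in> Obj G"
  obtain Q where Q: "openin (mtop (arrows G)) Q" "idt G x \<in> Q" "smooth_on p (Suc q) \<psi> Q"
    using assms x by (auto simp: smooth_dc_def)
  obtain P where P: "openin (mtop (arrows G)) P" "idt G x \<in> P" "P \<subseteq> \<tau> ` W"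
     "\<And>g t. g \<in> P \<Longrightarrow> t \<in> {0..1} \<Longrightarrow> lam t g \<in> Q"
    using retraction_near_unit[OF x Q(1,2)] by blast
  then show "\<exists>Q. openin (mtop (arrows G)) Q \<and> idt G x \<in> Q \<and> smooth_on p q (op_k G V W \<tau> \<psi>) Q"
    using smooth_on_k[OF Q(3,1) P(3,4)] by blast
qed

subsection \<open>The operator \<open>\<delta>\<close>\<close>

lemma merge_nth:
  assumes "1 \<le> i" "i < length gs" "j < length gs - 1"
  shows "merge G i gs ! j =
    (if j < i - 1 then gs ! j else if j = i - 1 then mlt G (gs ! (i - 1)) (gs ! i) else gs ! Suc j)"
proof -
  have [simp]: "length (take (i - 1) gs) = i - 1" using assms by simp
  have lle: "\<not> length gs \<le> i - 1" using assms by simp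
  consider "j < i - 1" | "j = i - 1" | "i - 1 < j" by linarith
  then show ?thesis
  proof cases
    case 3
    then have "Suc i + (j - i) = Suc j" using assms by simp
    moreover have "\<not> j < i" using 3 assms by auto
    ultimately show ?thesis using 3 assms lle by (simp add: merge_def nth_append min_def nth_Cons')
  qed (use assms lle in \<open>simp_all add: merge_def nth_append min_def\<close>)
qed

lemma merge_split:
  assumes "1 \<le> i" "i < length gs"
  shows "gs = take (i - 1) gs @ gs ! (i - 1) # gs ! i # drop (Suc i) gs"
proof -
  have "gs = take (i - 1) gs @ gs ! (i - 1) # drop (Suc (i - 1)) gs"
    using assms by (intro id_take_nth_drop) simp
  moreover have "drop (Suc (i - 1)) gs = gs ! i # drop (Suc i) gs"
    using assms Cons_nth_drop_Suc[of i gs] by simp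
  ultimately show ?thesis by metis
qed

context
  fixes P Q :: "'g set"
  assumes PA: "P \<subseteq> Arr G" and PQ: "P \<subseteq> Q"
    and mul: "\<And>g h. g \<in> P \<Longrightarrow> h \<in> P \<Longrightarrow> src G g = tgt G h \<Longrightarrow> mlt G g h \<in> Q"
begin

lemma epts_tl:
  assumes "(gs, g) \<in> epts (Suc p) P"
  shows "(tl gs, g) \<in> epts p Q"
proof (cases gs)
  case (Cons a l)
  then show ?thesis using assms PQ by (auto simp: epts_def successively_Cons)
qed (use assms in \<open>simp add: epts_def\<close>)

lemma epts_merge:
  assumes e: "(gs, g) \<in> epts (Suc p) P" and i: "1 \<le> i" "i < length gs"
  shows "(merge G i gs, g) \<in> epts p Q"
proof -
  obtain xs a b ys where gs: "gs = xs @ a # b # ys" and mg: "merge G i gs = xs @ mlt G a b # ys"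
    by (rule that[OF merge_split[OF i]]) (simp add: merge_def)
  have len: "length gs = Suc p" and sub: "set gs \<subseteq> P" "g \<in> P" and ch: "chain (gs @ [g])"
    using e by (auto simp: epts_def)
  have ab: "a \<in> P" "b \<in> P" using sub gs by auto
  have abs: "src G a = tgt G b" using ch unfolding gs by (auto simp: successively_append_iff successively_Cons)
  then have m: "mlt G a b \<in> Q" "src G (mlt G a b) = src G b" "tgt G (mlt G a b) = tgt G a"
    using ab PA mul[OF ab] subsetD[OF PA ab(1)] subsetD[OF PA ab(2)] by auto
  have "chain (merge G i gs @ [g])"
    using ch unfolding mg unfolding gs using m(2,3) by (auto simp: successively_append_iff successively_Cons)
  moreover have "set (merge G i gs) \<subseteq> Q" using sub PQ m unfolding mg unfolding gs by auto
  moreover have "length (merge G i gs) = p" using len unfolding mg unfolding gs by simp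
  ultimately show ?thesis using sub PQ by (auto simp: epts_def)
qed

lemma epts_butlast:
  assumes e: "(gs, g) \<in> epts (Suc p) P"
  shows "(butlast gs, mlt G (last gs) g) \<in> epts p Q" and "src G (mlt G (last gs) g) = src G g"
    and "src G (last gs) = tgt G g" and "last gs \<in> P"
proof -
  obtain xs a where gs: "gs = xs @ [a]" using e by (cases gs rule: rev_cases) (auto simp: epts_def)
  have ag: "a \<in> P" "g \<in> P" "src G a = tgt G g" using e by (auto simp: epts_def gs successively_append_iff)
  then have m: "mlt G a g \<in> Q" "src G (mlt G a g) = src G g" "tgt G (mlt G a g) = tgt G a"
    using PA mul[of a g] subsetD[OF PA, of a] subsetD[OF PA, of g] by auto
  show "(butlast gs, mlt G (last gs) g) \<in> epts p Q"
    using e PQ m by (auto simp: epts_def gs successively_append_iff)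
  show "src G (mlt G (last gs) g) = src G g" "src G (last gs) = tgt G g" "last gs \<in> P"
    using m ag by (auto simp: gs)
qed

text \<open>Every face of a point over \<open>P\<close> lies over \<open>Q\<close>, and its entries
  are again plots, so each summand is covered by the smoothness of \<psi>. Shrinking from
  \<open>Q\<close> to \<open>P\<close> is forced by the products.\<close>

lemma smooth_on_delta:
  assumes \<psi>: "smooth_on p q \<psi> Q"
  shows "smooth_on (Suc p) q (op_delta G \<psi>) P"
  unfolding smooth_on_def
proof (intro conjI allI impI)
  fix gs g assume e: "(gs, g) \<in> epts (Suc p) P"
  then have gP: "g \<in> P" and ne: "gs \<noteq> []" by (auto simp: epts_def)
  have m: "src G g \<in> Obj G" using gP PA by auto
  have d: "op_delta G \<psi> gs g = (\<lambda>as. \<psi> (tl gs) g as + (\<Sum>i = 1..<length gs. (-1) ^ i *\<^sub>R \<psi> (merge G i gs) g as) +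
     (-1) ^ length gs *\<^sub>R \<psi> (butlast gs) (mlt G (last gs) g) as)"
    using ne by (simp add: op_delta_def fun_eq_iff)
  show "alt_form (src G g) q (op_delta G \<psi> gs g)"
    unfolding d
  proof (intro alt_form_plus[OF m] alt_form_finite_sum[OF m] alt_form_scaleR[OF m])
    show "alt_form (src G g) q (\<psi> (tl gs) g)" by (rule smooth_on_alt[OF \<psi> epts_tl[OF e]])
    show "alt_form (src G g) q (\<psi> (merge G i gs) g)" if "i \<in> {1..<length gs}" for i
      by (rule smooth_on_alt[OF \<psi> epts_merge[OF e]]) (use that in auto)
    show "alt_form (src G g) q (\<psi> (butlast gs) (mlt G (last gs) g))"
      using smooth_on_alt[OF \<psi> epts_butlast(1)[OF e]] epts_butlast(2)[OF e] by simp
  qed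
next
  fix n S gs g as
  assume "(\<forall>i<Suc p. plot (arrows G) n S (\<lambda>y. gs y ! i)) \<and> plot (arrows G) n S g \<and>
        (\<forall>y\<in>S. (gs y, g y) \<in> epts (Suc p) P \<and> length (as y) = q) \<and>
        (\<forall>i<q. algebroid_plot G n S (\<lambda>y. src G (g y)) (\<lambda>y. as y ! i))"
  then have gs: "\<And>i. i < Suc p \<Longrightarrow> plot (arrows G) n S (\<lambda>y. gs y ! i)" and g: "plot (arrows G) n S g"
    and e: "\<And>y. y \<in> S \<Longrightarrow> (gs y, g y) \<in> epts (Suc p) P" and las: "\<And>y. y \<in> S \<Longrightarrow> length (as y) = q"
    and as: "\<And>i. i < q \<Longrightarrow> algebroid_plot G n S (\<lambda>y. src G (g y)) (\<lambda>y. as y ! i)" by auto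
  have lgs: "length (gs y) = Suc p" if "y \<in> S" for y using e[OF that] by (simp add: epts_def)
  have chn: "src G (gs y ! (i - 1)) = tgt G (gs y ! i)" if y: "y \<in> S" and i: "1 \<le> i" "i < Suc p" for y i
  proof -
    have "chain (gs y)" using e[OF y] by (simp add: epts_def successively_append_iff)
    then show ?thesis using i lgs[OF y] by (auto simp: successively_conv_nth)
  qed
  have b1: "bundle_plot (objects G) V n S (\<lambda>y. src G (g y)) (\<lambda>y. \<psi> (tl (gs y)) (g y) (as y))"
  proof (rule smooth_on_plot[OF \<psi> _ g epts_tl[OF e] las as])
    show "plot (arrows G) n S (\<lambda>y. tl (gs y) ! i)" if "i < p" for i
      by (rule plot_cong[OF arrows_manifold gs[of "Suc i"]]) (use that lgs in \<open>auto simp: nth_tl\<close>)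
  qed
  have b2: "bundle_plot (objects G) V n S (\<lambda>y. src G (g y)) (\<lambda>y. \<psi> (merge G i (gs y)) (g y) (as y))"
    if i: "i \<in> {1..<Suc p}" for i
  proof (rule smooth_on_plot[OF \<psi> _ g epts_merge[OF e] las as])
    fix j assume j: "j < p"
    have "plot (arrows G) n S (\<lambda>y. if j < i - 1 then gs y ! j else if j = i - 1
        then mlt G (gs y ! (i - 1)) (gs y ! i) else gs y ! Suc j)"
    proof -
      consider "j < i - 1" | "j = i - 1" | "i - 1 < j" by linarith
      then show ?thesis
      proof cases
        case 2
        have "plot (arrows G) n S (\<lambda>y. mlt G (gs y ! (i - 1)) (gs y ! i))"
          using i chn by (intro plot_mlt gs) auto
        then show ?thesis using 2 by simp
      qed (use gs[of j] gs[of "Suc j"] j in simp_all)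
    qed
    then show "plot (arrows G) n S (\<lambda>y. merge G i (gs y) ! j)"
      by (rule plot_cong[OF arrows_manifold]) (use merge_nth i j lgs in auto)
  qed (use i lgs in auto)
  have b3: "bundle_plot (objects G) V n S (\<lambda>y. src G (g y)) (\<lambda>y. \<psi> (butlast (gs y)) (mlt G (last (gs y)) (g y)) (as y))"
  proof -
    have l: "plot (arrows G) n S (\<lambda>y. last (gs y))"
      by (rule plot_cong[OF arrows_manifold gs[of p]]) (use lgs in \<open>auto simp: last_conv_nth length_0_conv[symmetric] simp del: length_0_conv\<close>)
    have "bundle_plot (objects G) V n S (\<lambda>y. src G (mlt G (last (gs y)) (g y)))
       (\<lambda>y. \<psi> (butlast (gs y)) (mlt G (last (gs y)) (g y)) (as y))"
    proof (rule smooth_on_plot[OF \<psi> _ plot_mlt[OF l g epts_butlast(3)[OF e]] epts_butlast(1)[OF e] las])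
      show "plot (arrows G) n S (\<lambda>y. butlast (gs y) ! i)" if "i < p" for i
        by (rule plot_cong[OF arrows_manifold gs[of i]]) (use that lgs in \<open>auto simp: nth_butlast\<close>)
      show "algebroid_plot G n S (\<lambda>y. src G (mlt G (last (gs y)) (g y))) (\<lambda>y. as y ! i)" if "i < q" for i
        by (rule algebroid_plot_cong[OF as[OF that]]) (use epts_butlast(2)[OF e] in auto)
    qed
    then show ?thesis by (rule bundle_plot_cong) (use epts_butlast(2)[OF e] in auto)
  qed
  have "bundle_plot (objects G) V n S (\<lambda>y. src G (g y)) (\<lambda>y. \<psi> (tl (gs y)) (g y) (as y) +
     (\<Sum>i\<in>{1..<Suc p}. (-1) ^ i *\<^sub>R \<psi> (merge G i (gs y)) (g y) (as y)) +
     (-1) ^ Suc p *\<^sub>R \<psi> (butlast (gs y)) (mlt G (last (gs y)) (g y)) (as y))"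
    by (intro bundle_plot_add bundle_plot_sum bundle_plot_scale b1 b2 b3 plot_src[OF g])
  then show "bundle_plot (objects G) V n S (\<lambda>y. src G (g y)) (\<lambda>y. op_delta G \<psi> (gs y) (g y) (as y))"
  proof (rule bundle_plot_cong)
    fix y assume "y \<in> S"
    then have "length (gs y) = Suc p" "gs y \<noteq> []" using lgs[of y] by auto
    then show "\<psi> (tl (gs y)) (g y) (as y) +
     (\<Sum>i\<in>{1..<Suc p}. (-1) ^ i *\<^sub>R \<psi> (merge G i (gs y)) (g y) (as y)) +
     (-1) ^ Suc p *\<^sub>R \<psi> (butlast (gs y)) (mlt G (last (gs y)) (g y)) (as y) =
     op_delta G \<psi> (gs y) (g y) (as y)" unfolding op_delta_def by (simp only: if_False)
  qed simp
qed

end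

lemma mlt_near_unit':
  assumes x: "x \<in> Obj G" and Q: "openin (mtop (arrows G)) Q" "idt G x \<in> Q"
  obtains P where "openin (mtop (arrows G)) P" "idt G x \<in> P" "P \<subseteq> Arr G" "P \<subseteq> Q"
    "\<And>g h. g \<in> P \<Longrightarrow> h \<in> P \<Longrightarrow> src G g = tgt G h \<Longrightarrow> mlt G g h \<in> Q"
proof -
  obtain P where "openin (mtop (arrows G)) P" "idt G x \<in> P"
    "\<And>g h. g \<in> P \<Longrightarrow> h \<in> P \<Longrightarrow> src G g = tgt G h \<Longrightarrow> mlt G g h \<in> Q"
    using mlt_near_unit[OF x Q] by blast
  then show ?thesis using Q openin_subset[of "mtop (arrows G)" P] by (intro that[of "P \<inter> Q"]) auto
qed

lemma smooth_dc_delta: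
  assumes "smooth_dc p q \<psi>"
  shows "smooth_dc (Suc p) q (op_delta G \<psi>)"
  unfolding smooth_dc_def
proof
  fix x assume x: "x \<in> Obj G"
  obtain Q where Q: "openin (mtop (arrows G)) Q" "idt G x \<in> Q" "smooth_on p q \<psi> Q"
    using assms x by (auto simp: smooth_dc_def)
  obtain P where P: "openin (mtop (arrows G)) P" "idt G x \<in> P" "P \<subseteq> Arr G" "P \<subseteq> Q"
     "\<And>g h. g \<in> P \<Longrightarrow> h \<in> P \<Longrightarrow> src G g = tgt G h \<Longrightarrow> mlt G g h \<in> Q"
    using mlt_near_unit'[OF x Q(1,2)] by blast
  show "\<exists>Q. openin (mtop (arrows G)) Q \<and> idt G x \<in> Q \<and> smooth_on (Suc p) q (op_delta G \<psi>) Q"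
    by (intro exI[of _ P] conjI P(1,2) smooth_on_delta[OF P(3-5) Q(3)])
qed

subsection \<open>The cochains representing \<open>R\<^sub>G\<close>\<close>

lemma algebroid_cochain_alt_form:
  "\<alpha> \<in> algebroid_cochains G V q \<Longrightarrow> m \<in> Obj G \<Longrightarrow> alt_form m q (\<alpha> m)"
  unfolding algebroid_cochains_def alt_form_def by blast

lemma smooth_dc_i:
  assumes \<alpha>: "\<alpha> \<in> algebroid_cochains G V q"
  shows "smooth_dc 0 q (op_i G \<alpha>)"
  unfolding smooth_dc_def
proof
  fix x assume x: "x \<in> Obj G"
  have "smooth_on 0 q (op_i G \<alpha>) (Arr G)"
    unfolding smooth_on_def
  proof (intro conjI allI impI)
    fix gs g assume "(gs, g) \<in> epts 0 (Arr G)"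
    then have "gs = []" "g \<in> Arr G" by (auto simp: epts_def)
    moreover have "op_i G \<alpha> [] g = \<alpha> (src G g)" by (simp add: op_i_def fun_eq_iff)
    ultimately show "alt_form (src G g) q (op_i G \<alpha> gs g)"
      using algebroid_cochain_alt_form[OF \<alpha>] by simp
  next
    fix n S gs g as
    assume "(\<forall>i<0. plot (arrows G) n S (\<lambda>y. gs y ! i)) \<and> plot (arrows G) n S g \<and>
        (\<forall>y\<in>S. (gs y, g y) \<in> epts 0 (Arr G) \<and> length (as y) = q) \<and>
        (\<forall>i<q. algebroid_plot G n S (\<lambda>y. src G (g y)) (\<lambda>y. as y ! i))"
    then have g: "plot (arrows G) n S g" and gs: "\<And>y. y \<in> S \<Longrightarrow> gs y = []"
      and as: "\<forall>y\<in>S. length (as y) = q" "\<forall>i<q. algebroid_plot G n S (\<lambda>y. src G (g y)) (\<lambda>y. as y ! i)"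
      by (auto simp: epts_def)
    have "\<forall>n S \<mu> as. plot (objects G) n S \<mu> \<and> (\<forall>y\<in>S. length (as y) = q) \<and>
          (\<forall>i<q. algebroid_plot G n S \<mu> (\<lambda>y. as y ! i)) \<longrightarrow>
        bundle_plot (objects G) V n S \<mu> (\<lambda>y. \<alpha> (\<mu> y) (as y))"
      using \<alpha> by (simp add: algebroid_cochains_def)
    from this[rule_format, of n S "\<lambda>y. src G (g y)" as]
    have "bundle_plot (objects G) V n S (\<lambda>y. src G (g y)) (\<lambda>y. \<alpha> (src G (g y)) (as y))"
      using plot_src[OF g] as by simp
    then show "bundle_plot (objects G) V n S (\<lambda>y. src G (g y)) (\<lambda>y. op_i G \<alpha> (gs y) (g y) (as y))"
      by (rule bundle_plot_cong) (use gs in \<open>auto simp: op_i_def\<close>)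
  qed
  then show "\<exists>Q. openin (mtop (arrows G)) Q \<and> idt G x \<in> Q \<and> smooth_on 0 q (op_i G \<alpha>) Q"
    using x by (intro exI[of _ "Arr G"]) simp
qed

text \<open>The \<open>z\<^sub>n\<close> of the overview, of bidegree \<open>(n, q - n)\<close> for
  \<alpha> of degree \<open>q\<close>.\<close>

definition zig :: "('m \<Rightarrow> 'g tvec list \<Rightarrow> 'v) \<Rightarrow> nat \<Rightarrow> ('g, 'v) dcochain" where
  "zig \<alpha> n = ((op_delta G \<circ> op_k G V W \<tau>) ^^ n) (op_i G \<alpha>)"

lemma zig_0: "zig \<alpha> 0 = op_i G \<alpha>" and zig_Suc: "zig \<alpha> (Suc n) = op_delta G (op_k G V W \<tau> (zig \<alpha> n))"
  by (simp_all add: zig_def)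

lemma smooth_dc_zig:
  assumes "\<alpha> \<in> algebroid_cochains G V q"
  shows "n \<le> q \<Longrightarrow> smooth_dc n (q - n) (zig \<alpha> n)"
proof (induction n)
  case 0 then show ?case using smooth_dc_i[OF assms] by (simp add: zig_0)
next
  case (Suc n)
  then have "smooth_dc n (Suc (q - Suc n)) (zig \<alpha> n)" by (simp add: Suc_diff_Suc)
  then show ?case unfolding zig_Suc by (intro smooth_dc_delta smooth_dc_k)
qed

text \<open>Embeds \<open>B\<^sub>pG\<close> into \<open>E\<^sub>pG\<close> by taking the unit at
  \<open>m\<^sub>p\<close> as last arrow; \<open>epts_near_units\<close> goes back.\<close>

lemma near_units_epts:
  assumes "(gs, m) \<in> near_units G p P" "P \<subseteq> Q"
  shows "(gs, idt G m) \<in> epts p Q" and "m \<in> Obj G"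
proof -
  have c: "length gs = p" "m \<in> Obj G" "\<And>i. Suc i < p \<Longrightarrow> src G (gs ! i) = tgt G (gs ! Suc i)"
    "gs \<noteq> [] \<Longrightarrow> src G (last gs) = m" "set gs \<subseteq> P" "idt G m \<in> P"
    using assms(1) by (auto simp: near_units_def composable_def)
  have "chain gs" using c(1,3) by (simp add: successively_conv_nth)
  then have "chain (gs @ [idt G m])" using c(2,4) by (cases "gs = []") (simp_all add: successively_append_iff)
  then show "(gs, idt G m) \<in> epts p Q" "m \<in> Obj G" using c assms(2) by (auto simp: epts_def)
qed

lemma epts_near_units:
  assumes "(gs, idt G m) \<in> epts p P" "m \<in> Obj G" "P \<subseteq> Arr G"
  shows "(gs, m) \<in> near_units G p P"
proof -
  have c: "length gs = p" "set gs \<subseteq> P" "idt G m \<in> P" "chain (gs @ [idt G m])"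
    using assms(1) by (auto simp: epts_def)
  then have "chain gs" "gs \<noteq> [] \<longrightarrow> src G (last gs) = m"
    using assms(2) by (auto simp: successively_append_iff)
  then show ?thesis using c assms(2,3) by (auto simp: near_units_def composable_def successively_conv_nth)
qed

lemma smooth_near_units_q:
  assumes "smooth_dc p 0 \<psi>"
  shows "smooth_near_units G V p (\<lambda>gs m. c *\<^sub>R op_q G V \<psi> gs m)"
  unfolding smooth_near_units_def
proof
  fix x assume x: "x \<in> Obj G"
  obtain Q where Q: "openin (mtop (arrows G)) Q" "idt G x \<in> Q" "smooth_on p 0 \<psi> Q"
    using assms x by (auto simp: smooth_dc_def)
  have "bundle_plot (objects G) V n S m (\<lambda>y. c *\<^sub>R op_q G V \<psi> (gs y) (m y))"
    if m: "plot (objects G) n S m" and gs: "\<forall>i<p. plot (arrows G) n S (\<lambda>y. gs y ! i)"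
      and e: "\<forall>y\<in>S. (gs y, m y) \<in> near_units G p Q" for n S gs m
  proof -
    note e' = near_units_epts[OF bspec[OF e]]
    have "bundle_plot (objects G) V n S (\<lambda>y. src G (idt G (m y))) (\<lambda>y. \<psi> (gs y) (idt G (m y)) [])"
      by (rule smooth_on_plot[OF Q(3) _ plot_idt[OF m] e'(1)[OF _ subset_refl]]) (use gs in auto)
    then have b: "bundle_plot (objects G) V n S m (\<lambda>y. \<psi> (gs y) (idt G (m y)) [])"
      by (rule bundle_plot_cong) (use plot_pts[OF objects_manifold m] in auto)
    have "act V (idt G (m y)) (\<psi> (gs y) (idt G (m y)) []) = \<psi> (gs y) (idt G (m y)) []" if "y \<in> S" for y
      by (rule act_idt[OF plot_pts[OF objects_manifold m that] bundle_plot_mem[OF b that]])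
    then show ?thesis
      by (intro bundle_plot_cong[OF bundle_plot_scale[OF b, of c]]) (simp_all add: op_q_def to_form_def)
  qed
  then show "\<exists>Q. openin (mtop (arrows G)) Q \<and> idt G x \<in> Q \<and>
        (\<forall>n S gs m. plot (objects G) n S m \<and> (\<forall>i<p. plot (arrows G) n S (\<lambda>y. gs y ! i)) \<and>
             (\<forall>y\<in>S. (gs y, m y) \<in> near_units G p Q) \<longrightarrow>
           bundle_plot (objects G) V n S m (\<lambda>y. c *\<^sub>R op_q G V \<psi> (gs y) (m y)))"
    by (intro exI[of _ Q] conjI Q(1,2) allI impI) (elim conjE, simp)
qed

lemma RG_groupoid_cochain:
  assumes "\<alpha> \<in> algebroid_cochains G V q"
  shows "RG G V W \<tau> q \<alpha> \<in> groupoid_cochains G V q"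
proof -
  have "smooth_dc q 0 (zig \<alpha> q)" using smooth_dc_zig[OF assms, of q] by simp
  from smooth_near_units_q[OF this, of "(-1) ^ q"] show ?thesis
    unfolding RG_def groupoid_cochains_def zig_def by blast
qed

subsection \<open>Agreement near the units\<close>

text \<open>Equality of germs in bidegree \<open>(p, q)\<close>. An entire neighbourhood is kept
  since \<open>d\<close> differentiates in the last argument.\<close>

definition agree :: "nat \<Rightarrow> nat \<Rightarrow> ('g, 'v) dcochain \<Rightarrow> ('g, 'v) dcochain \<Rightarrow> bool" where
  "agree p q \<psi> \<phi> \<longleftrightarrow> (\<forall>x\<in>Obj G. \<exists>Q. openin (mtop (arrows G)) Q \<and> idt G x \<in> Q \<and>
     (\<forall>gs g as. (gs, g) \<in> epts p Q \<and> length as = q \<and> set as \<subseteq> algebroid G (src G g) \<longrightarrow>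
        \<psi> gs g as = \<phi> gs g as))"

lemma op_k_idt:
  assumes \<psi>: "smooth_on p (Suc q) \<psi> Q" and e: "(gs, idt G m) \<in> epts p Q" and m: "m \<in> Obj G"
    and as: "length as = q" "set as \<subseteq> algebroid G m"
  shows "op_k G V W \<tau> \<psi> gs (idt G m) as = 0"
proof -
  have f: "alt_form m (Suc q) (\<psi> gs (idt G m))" using smooth_on_alt[OF \<psi> e] m by simp
  have "kern \<psi> gs (idt G m) as t (lam_velocity t (idt G m)) = 0" if t: "t \<in> {0..1}" for t
  proof -
    let ?l = "map (lam_push t (idt G m)) as"
    have l: "length ?l = q" "set ?l \<subseteq> algebroid G m"
      using as lam_push_idt[OF m _ t] algebroid_scale[OF m] by auto
    have "\<psi> gs (idt G m) ((\<lambda>f. 0) # ?l) = 0"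
      using alt_form_linear[OF m f l, of "{}"] by simp
    then show ?thesis
      using act_zero[of "idt G m"] m by (simp add: kern_def retraction_idt lam_velocity_idt)
  qed
  then have "integral {0..1} (\<lambda>t. kern \<psi> gs (idt G m) as t (lam_velocity t (idt G m))) = integral {0..1} (\<lambda>t::real. 0 :: 'v)"
    by (intro integral_cong)
  then show ?thesis
    using op_k_eq[OF idt_tau[OF m], of as \<psi> gs] as m act_zero[of "idt G m"] by simp
qed

text \<open>The shift performed by \<open>h\<close>: the old last arrow joins the list and the unit
  at its source takes its place.\<close>

lemma epts_snoc:
  assumes "(gs, g) \<in> epts p P" "P \<subseteq> Q" "idt G (src G g) \<in> Q" "P \<subseteq> Arr G"
  shows "(gs @ [g], idt G (src G g)) \<in> epts (Suc p) Q"
  using assms by (auto simp: epts_def successively_append_iff)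

lemma h_delta_k:
  assumes "smooth_dc p (Suc q) \<psi>"
  shows "agree p q (op_h G (op_delta G (op_k G V W \<tau> \<psi>))) (op_k G V W \<tau> \<psi>)"
  unfolding agree_def
proof
  fix x assume x: "x \<in> Obj G"
  obtain Q where Q: "openin (mtop (arrows G)) Q" "idt G x \<in> Q" "smooth_on p (Suc q) \<psi> Q"
    using assms x by (auto simp: smooth_dc_def)
  obtain P where P: "openin (mtop (arrows G)) P" "idt G x \<in> P" "P \<subseteq> Arr G" "P \<subseteq> Q"
     "\<And>g h. g \<in> P \<Longrightarrow> h \<in> P \<Longrightarrow> src G g = tgt G h \<Longrightarrow> mlt G g h \<in> Q"
    using mlt_near_unit'[OF x Q(1,2)] by blast
  obtain P' where P': "openin (mtop (arrows G)) P'" "idt G x \<in> P'" "P' \<subseteq> P"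
     "\<And>g. g \<in> P' \<Longrightarrow> idt G (src G g) \<in> P"
    using idt_map_near_unit[OF x P(1,2)] by blast
  let ?\<kappa> = "op_k G V W \<tau> \<psi>"
  have "op_h G (op_delta G ?\<kappa>) gs g as = ?\<kappa> gs g as"
    if e: "(gs, g) \<in> epts p P'" and as: "length as = q" "set as \<subseteq> algebroid G (src G g)" for gs g as
  proof -
    have gP': "g \<in> P'" and len: "length gs = p" using e by (auto simp: epts_def)
    then have gA: "g \<in> Arr G" using P' P by auto
    let ?m = "src G g" let ?l = "gs @ [g]"
    have m: "?m \<in> Obj G" using gA by simp
    have e': "(?l, idt G ?m) \<in> epts (Suc p) P"
      by (rule epts_snoc[OF e P'(3) P'(4)[OF gP']]) (use P P' in auto)
    \<comment> \<open>All faces but the last leave the unit in the last argument, where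
      \<open>k\<close> vanishes by \<open>op_k_idt\<close>.\<close>
    have z1: "?\<kappa> (tl ?l) (idt G ?m) as = 0"
      by (rule op_k_idt[OF Q(3) epts_tl[OF P(3-5) e'] m as])
    have z2: "?\<kappa> (merge G i ?l) (idt G ?m) as = 0" if "i \<in> {1..<length ?l}" for i
      by (rule op_k_idt[OF Q(3) epts_merge[OF P(3-5) e'] m as]) (use that in auto)
    \<comment> \<open>The last face multiplies \<open>g\<close> by a unit and so restores
      \<open>(gs; g)\<close>. Its sign \<open>(-1) ^ Suc p\<close> is cancelled by the one in
      \<open>op_h\<close>.\<close>
    have "op_delta G ?\<kappa> ?l (idt G ?m) as = (-1) ^ Suc p *\<^sub>R ?\<kappa> gs g as"
      unfolding op_delta_def using z1 z2 gA len by simp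
    then show ?thesis by (simp add: op_h_def len)
  qed
  then show "\<exists>Q. openin (mtop (arrows G)) Q \<and> idt G x \<in> Q \<and>
     (\<forall>gs g as. (gs, g) \<in> epts p Q \<and> length as = q \<and> set as \<subseteq> algebroid G (src G g) \<longrightarrow>
        op_h G (op_delta G ?\<kappa>) gs g as = ?\<kappa> gs g as)"
    using P' by blast
qed

end

section \<open>The Poincare lemma at the units\<close>

lemma openin_preimage_smooth:
  assumes T: "openin (Euclidean_space N) T" and S: "openin (Euclidean_space n) S"
    and x: "\<And>i. i < N \<Longrightarrow> smooth_real n S (\<lambda>y. x y i)" "\<And>y. y \<in> S \<Longrightarrow> x y \<in> eucl N"
  shows "openin (Euclidean_space n) {y \<in> S. x y \<in> T}"
proof (rule openin_preimage_eucl[OF T _ S x(2)])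
  show "continuous_on S x"
  proof (rule continuous_on_coordinatewise_then_product)
    fix i show "continuous_on S (\<lambda>y. x y i)"
    proof (cases "i < N")
      case False
      then have "x y i = 0" if "y \<in> S" for y using x(2)[OF that] by (simp add: mem_eucl)
      then show ?thesis by (intro continuous_on_eq[OF continuous_on_const[of _ 0]]) simp
    qed (rule smooth_real_continuous[OF x(1)])
  qed
qed

text \<open>Product rule at a zero of \<open>f\<close>, where mere continuity of \<open>g\<close>
  suffices. It is applied with \<open>f\<close> a fibre coordinate, which vanishes at the unit, and
  \<open>g\<close> the integral multiplying it.\<close>

lemma has_vector_derivative_scaleR_zero:
  fixes g :: "real \<Rightarrow> 'a::real_normed_vector"
  assumes f: "(f has_real_derivative f') (at 0)" "f 0 = 0" and g: "isCont g 0"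
  shows "((\<lambda>r. f r *\<^sub>R g r) has_vector_derivative f' *\<^sub>R g 0) (at 0)"
proof -
  have "((\<lambda>r. f r / r) \<longlongrightarrow> f') (at 0)" using f by (simp add: has_field_derivative_iff)
  then have "((\<lambda>r. (f r / r) *\<^sub>R g r) \<longlongrightarrow> f' *\<^sub>R g 0) (at 0)"
    using g by (intro tendsto_scaleR) (simp_all add: isCont_def)
  then have "((\<lambda>r. (1 / r) *\<^sub>R (f r *\<^sub>R g r)) \<longlongrightarrow> f' *\<^sub>R g 0) (at 0)" by simp
  then have "((\<lambda>r. (1 / r) *\<^sub>R (f r *\<^sub>R g r - r *\<^sub>R f' *\<^sub>R g 0)) \<longlongrightarrow> 0) (at 0)"
    by (rule Lim_transform_eventually[OF tendsto_diff[OF _ tendsto_const, of _ "f' *\<^sub>R g 0" _ "f' *\<^sub>R g 0", simplified]])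
      (auto simp: eventually_at_filter scaleR_diff_right)
  moreover have "(\<lambda>r. (1 / norm r) *\<^sub>R (f r *\<^sub>R g r - r *\<^sub>R f' *\<^sub>R g 0)) =
      (\<lambda>r. sgn r *\<^sub>R (1 / r) *\<^sub>R (f r *\<^sub>R g r - r *\<^sub>R f' *\<^sub>R g 0))"
    by (auto simp: fun_eq_iff sgn_if)
  moreover have "bounded_linear (\<lambda>r. r *\<^sub>R f' *\<^sub>R g 0)" by (rule bounded_linear_scaleR_left)
  ultimately show ?thesis
    unfolding has_vector_derivative_def has_derivative_at
    using tendsto_norm_zero_iff[of "\<lambda>r. (1 / r) *\<^sub>R (f r *\<^sub>R g r - r *\<^sub>R f' *\<^sub>R g 0)"]
    by (simp add: f(2) divide_inverse_commute)
qed

context tubular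
begin

section \<open>Fibre coordinates over a single base point\<close>

context
  fixes U :: "'g set" and \<phi> :: "'g \<Rightarrow> nat \<Rightarrow> real" and m :: 'm
  assumes ch: "(U, \<phi>) \<in> atlas (arrows G)" and m: "m \<in> Obj G" and U: "idt G m \<in> U"
begin

private abbreviation "N \<equiv> mdim (arrows G)"

text \<open>In fibre coordinates the retraction is the straight-line contraction, because
  \<open>rho\<close> is \<open>\<tau>\<close> after a linear map.\<close>

lemma rho_scale:
  assumes h: "h \<in> \<tau> ` W" "tgt G h = m"
  shows "rho U \<phi> m (\<lambda>i. t * fcoord \<phi> h i) = lam t h"
    and "(m, tv_scale t (xi h)) \<in> W \<Longrightarrow> (\<lambda>i. t * fcoord \<phi> h i) \<in> rho_dom U \<phi> m"
proof -
  have "xi h = (\<lambda>f. \<Sum>i<N. fcoord \<phi> h i * frame U \<phi> m i f)"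
    using xi_fcoord[OF ch h(1)] h(2) U by simp
  then have eq: "tv_scale t (xi h) = (\<lambda>f. \<Sum>i<N. t * fcoord \<phi> h i * frame U \<phi> m i f)"
    by (simp add: tv_scale_def sum_distrib_left mult.assoc)
  show "rho U \<phi> m (\<lambda>i. t * fcoord \<phi> h i) = lam t h"
    unfolding rho_def retraction_eq[OF h(1)] eq h(2) ..
  have "(\<lambda>i. t * fcoord \<phi> h i) \<in> eucl N" by (simp add: fcoord_def mem_eucl)
  then show "(m, tv_scale t (xi h)) \<in> W \<Longrightarrow> (\<lambda>i. t * fcoord \<phi> h i) \<in> rho_dom U \<phi> m"
    unfolding rho_dom_def eq by simp
qed

text \<open>The j-th coordinate vector of \<open>rho\<close> at the retracted point, brought back to
  the unit by left translation.\<close>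

definition coord_push :: "real \<Rightarrow> 'g \<Rightarrow> nat \<Rightarrow> 'g tvec" where
  "coord_push t h = coord_velocity (arrows G) (\<lambda>x. mlt G (ivs G (lam t h)) (rho U \<phi> m x)) (\<lambda>i. t * fcoord \<phi> h i)"

lemma left_rho_plot:
  assumes "l \<in> Arr G" "tgt G l = m"
  shows "plot (arrows G) N (rho_dom U \<phi> m) (\<lambda>x. mlt G (ivs G l) (rho U \<phi> m x))"
  using rho_plot[OF ch m U] assms plot_openin[OF arrows_manifold rho_plot(1)[OF ch m U]]
  by (intro plot_mlt plot_const[OF arrows_manifold]) auto

text \<open>The derivative of the straight line \<open>t x\<close> in \<open>t\<close> is
  \<open>x\<close>, so the coordinates of the point itself are the coefficients. They vanish at the
  unit, which is why only the first-order part of this vector field matters there.\<close>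

lemma lam_velocity_expansion:
  assumes h: "h \<in> \<tau> ` W" "tgt G h = m" and t: "t \<in> {0..1}"
  shows "lam_velocity t h = (\<lambda>f. \<Sum>j<N. fcoord \<phi> h j * coord_push t h j f)"
proof -
  note l = retraction_01[OF h(1) t]
  have "lam_velocity t h = velocity (arrows G) (\<lambda>r. mlt G (ivs G (lam t h)) (rho U \<phi> m (\<lambda>i. (t + r) * fcoord \<phi> h i)))"
    unfolding lam_velocity_def rho_scale(1)[OF h] ..
  also have "\<dots> = (\<lambda>f. \<Sum>j<N. fcoord \<phi> h j * coord_velocity (arrows G)
      (\<lambda>x. mlt G (ivs G (lam t h)) (rho U \<phi> m x)) (\<lambda>i. (t + 0) * fcoord \<phi> h i) j f)"
  proof (rule velocity_compose[OF arrows_manifold left_rho_plot])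
    show "(\<lambda>i. (t + 0) * fcoord \<phi> h i) \<in> rho_dom U \<phi> m" using rho_scale(2)[OF h, of t] l(4) h(2) by simp
    show "\<forall>\<^sub>F r in nhds 0. (\<lambda>i. (t + r) * fcoord \<phi> h i) \<in> eucl N"
      by (intro always_eventually) (simp add: fcoord_def mem_eucl)
    show "((\<lambda>r. (t + r) * fcoord \<phi> h j) has_real_derivative fcoord \<phi> h j) (at 0)" for j
      by (auto intro!: derivative_eq_intros)
  qed (use l h in auto)
  finally show ?thesis by (simp add: coord_push_def)
qed

lemma coord_push_algebroid:
  assumes h: "h \<in> \<tau> ` W" "tgt G h = m" and t: "t \<in> {0..1}" and j: "j < N"
  shows "coord_push t h j \<in> algebroid G (src G (lam t h))"
proof -
  note l = retraction_01[OF h(1) t]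
  let ?x = "\<lambda>i. t * fcoord \<phi> h i"
  let ?c = "\<lambda>r. rho U \<phi> m (?x(j := ?x j + r))"
  have x: "?x \<in> rho_dom U \<phi> m" using rho_scale(2)[OF h] l(4) h(2) by simp
  note rp = rho_plot[OF ch m U]
  have "smooth_curve (arrows G) ?c" by (rule smooth_curve_coord[OF arrows_manifold rp(1) x j])
  moreover have "\<forall>\<^sub>F r in nhds 0. tgt G (?c r) = m"
  proof -
    have "\<forall>\<^sub>F s in nhds (?x j). ?x(j := s) \<in> rho_dom U \<phi> m"
      by (rule eventually_fun_upd_mem[OF plot_openin[OF arrows_manifold rp(1)] x j])
    moreover have "filterlim (\<lambda>r. ?x j + r) (nhds (?x j)) (nhds 0)"
      using tendsto_add[OF tendsto_const[of "?x j"] filterlim_ident[of "nhds (0::real)"]] by simp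
    ultimately have "\<forall>\<^sub>F r in nhds 0. ?x(j := ?x j + r) \<in> rho_dom U \<phi> m"
      unfolding filterlim_iff by blast
    then show ?thesis by eventually_elim (rule rp(2))
  qed
  ultimately have "fibre_curve G ?c" by (rule fibre_curveI)
  moreover have "?x(j := ?x j + 0) = ?x" by (rule ext) simp
  then have "?c 0 = lam t h" using rho_scale(1)[OF h, of t] by (simp only:)
  ultimately show ?thesis
    unfolding coord_push_def coord_velocity_def by (rule left_velocity_algebroid[OF l(3)])
qed

lemma coord_push_plot:
  fixes g :: "(nat \<Rightarrow> real) \<Rightarrow> 'g"
  assumes g: "plot (arrows G) n \<Omega> g" and gT: "\<And>z. z \<in> \<Omega> \<Longrightarrow> g z \<in> \<tau> ` W" "\<And>z. z \<in> \<Omega> \<Longrightarrow> tgt G (g z) = m"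
    and t: "smooth_real n \<Omega> t" and tW: "\<And>z. z \<in> \<Omega> \<Longrightarrow> (tgt G (g z), tv_scale (t z) (xi (g z))) \<in> W"
    and j: "j < N"
  shows "algebroid_plot G n \<Omega> (\<lambda>z. src G (lam (t z) (g z))) (\<lambda>z. coord_push (t z) (g z) j)"
proof -
  have O: "openin (Euclidean_space n) \<Omega>" using plot_openin[OF arrows_manifold g] .
  have OE: "z \<in> eucl n" if "z \<in> \<Omega>" for z using openin_eucl_subset[OF O] that by auto
  note l = plot_lam[OF g gT(1) t tW]
  have lA: "lam (t z) (g z) \<in> Arr G" "tgt G (lam (t z) (g z)) = m" if "z \<in> \<Omega>" for z
    using retraction_W[OF gT(1)[OF that] tW[OF that]] gT(2)[OF that] by auto
  define \<Omega>1 where "\<Omega>1 = {z \<in> eucl (Suc n). trunc n z \<in> \<Omega>}"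
  have O1: "openin (Euclidean_space (Suc n)) \<Omega>1" unfolding \<Omega>1_def by (rule openin_trunc[OF O])
  define x where "x z = (\<lambda>i. t z * fcoord \<phi> (g z) i)" for z
  \<comment> \<open>The new coordinate \<open>z n\<close> is the increment of the j-th fibre
    coordinate, i.e. the parameter of the curve whose velocity defines
    \<open>coord_push\<close>.\<close>
  define y where "y z = (x (trunc n z))(j := x (trunc n z) j + z n)" for z
  have "smooth_real n \<Omega> (\<lambda>z. fcoord \<phi> (g z) i)" if "i < N" for i
  proof -
    have "{z \<in> \<Omega>. g z \<in> {h \<in> \<tau> ` W. idt G (tgt G h) \<in> U}} = \<Omega>" using gT U by auto
    then show ?thesis using smooth_fun_plot[OF arrows_manifold fcoord_smooth_fun[OF ch that] g] by simp
  qed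
  then have xs: "smooth_real n \<Omega> (\<lambda>z. x z i)" if "i < N" for i
    unfolding x_def using that by (intro smooth_real_mult[OF t]) auto
  have ys: "smooth_real (Suc n) \<Omega>1 (\<lambda>z. y z i)" if "i < N" for i
  proof -
    have "smooth_real (Suc n) \<Omega>1 (\<lambda>z. x (trunc n z) i)"
      unfolding \<Omega>1_def using smooth_real_compose_trunc[OF xs[OF that]] .
    then show ?thesis
      using smooth_real_add[OF _ smooth_real_coord[OF O1, of n]] by (cases "i = j") (simp_all add: y_def)
  qed
  have yE: "y z \<in> eucl N" for z using j by (auto simp: y_def x_def fcoord_def mem_eucl)
  note rp = rho_plot[OF ch m U]
  define \<Omega>2 where "\<Omega>2 = {z \<in> \<Omega>1. y z \<in> rho_dom U \<phi> m}"
  have O2: "openin (Euclidean_space (Suc n)) \<Omega>2"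
    unfolding \<Omega>2_def by (rule openin_preimage_smooth[OF plot_openin[OF arrows_manifold rp(1)] O1 ys yE])
  have sub: "\<Omega>2 \<subseteq> \<Omega>1" by (auto simp: \<Omega>2_def)
  have mem2: "trunc n z \<in> \<Omega>" "y z \<in> rho_dom U \<phi> m" if "z \<in> \<Omega>2" for z using that by (auto simp: \<Omega>2_def \<Omega>1_def)
  have r2: "plot (arrows G) (Suc n) \<Omega>2 (\<lambda>z. rho U \<phi> m (y z))"
    by (rule plot_compose[OF arrows_manifold rp(1) O2 smooth_real_subset[OF ys O2 sub] mem2(2)])
  have l2: "plot (arrows G) (Suc n) \<Omega>2 (\<lambda>z. lam (t (trunc n z)) (g (trunc n z)))"
    using plot_subset[OF arrows_manifold plot_trunc[OF l] O2] sub by (simp add: \<Omega>1_def)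
  let ?H = "\<lambda>z. mlt G (ivs G (lam (t (trunc n z)) (g (trunc n z)))) (rho U \<phi> m (y z))"
  have tg: "src G (ivs G (lam (t (trunc n z)) (g (trunc n z)))) = tgt G (rho U \<phi> m (y z))" if "z \<in> \<Omega>2" for z
    using lA[OF mem2(1)[OF that]] rp(2)[OF mem2(2)[OF that]] by simp
  have H: "plot (arrows G) (Suc n) \<Omega>2 ?H" by (intro plot_mlt plot_ivs l2 r2 tg)
  have xr: "rho U \<phi> m (x z) = lam (t z) (g z)" "x z \<in> rho_dom U \<phi> m" if "z \<in> \<Omega>" for z
    unfolding x_def using rho_scale[OF gT(1)[OF that] gT(2)[OF that], of "t z"] tW[OF that] gT(2)[OF that] by auto
  have "algebroid_plot G n \<Omega> (\<lambda>z. src G (lam (t z) (g z))) (\<lambda>z. velocity (arrows G) (\<lambda>r. ?H (z(n := r))))"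
  proof (rule algebroid_plot_velocity[OF H plot_src[OF l]])
    fix z assume z: "z \<in> \<Omega>"
    have zn: "z n = 0" "trunc n z = z" using OE[OF z] by (auto simp: mem_eucl)
    have yz: "y z = x z" using zn by (simp add: y_def)
    show "z \<in> \<Omega>2" using z zn xr(2)[OF z] OE[OF z] by (auto simp: \<Omega>2_def \<Omega>1_def yz mem_eucl)
    show "?H z = idt G (src G (lam (t z) (g z)))" using zn yz xr(1)[OF z] lA[OF z] by simp
    fix r assume r: "z(n := r) \<in> \<Omega>2"
    have tz: "trunc n (z(n := r)) = z" using OE[OF z] by simp
    show "tgt G (?H (z(n := r))) = src G (lam (t z) (g z))"
      using tg[OF r] lA[OF z] plot_pts[OF arrows_manifold r2 r] unfolding tz by simp
  qed
  then show ?thesis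
    by (rule algebroid_plot_cong) (use OE in \<open>auto simp: coord_push_def coord_velocity_def y_def x_def\<close>)
qed

text \<open>No \<open>t\<close> on the right: the unit is fixed by the retraction and has fibre
  coordinates 0.\<close>

lemma coord_push_idt: "coord_push t (idt G m) = coord_velocity (arrows G) (\<lambda>x. mlt G (idt G m) (rho U \<phi> m x)) (\<lambda>_. 0)"
proof -
  have "fcoord \<phi> (idt G m) = (\<lambda>_. 0)" by (simp add: fcoord_def xi_idt m fun_eq_iff)
  then show ?thesis by (simp add: coord_push_def retraction_idt m)
qed

text \<open>Because \<open>fcoord\<close> followed by \<open>rho\<close> is the identity, the
  derivatives of the fibre coordinates along \<open>c\<close> recombine with the vectors
  \<open>coord_push\<close> to the velocity of \<open>c\<close>, although these vectors need not be
  independent.\<close>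

lemma fibre_curve_fcoord:
  assumes c: "fibre_curve G c" "c 0 = idt G m"
  shows "\<exists>x'. (\<forall>j<N. ((\<lambda>r. fcoord \<phi> (c r) j) has_real_derivative x' j) (at 0)) \<and>
    velocity (arrows G) c = (\<lambda>f. \<Sum>j<N. x' j * coord_push t (idt G m) j f)"
proof -
  let ?O = "{g \<in> \<tau> ` W. idt G (tgt G g) \<in> U}"
  have sc: "smooth_curve (arrows G) c" and ev1: "\<forall>\<^sub>F r in nhds 0. tgt G (c r) = m"
    using c m by (auto simp: fibre_curve_def)
  have ev2: "\<forall>\<^sub>F r in nhds 0. c r \<in> \<tau> ` W"
    using smooth_curve_eventually[OF arrows_manifold sc tau_open] c(2) idt_tau[OF m] by simp
  define x' where "x' j = velocity (arrows G) c (\<lambda>h. fcoord \<phi> h j)" for j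
  have dx: "((\<lambda>r. fcoord \<phi> (c r) j) has_real_derivative x' j) (at 0)" if "j < N" for j
  proof -
    have "smooth_at (arrows G) (\<lambda>h. fcoord \<phi> h j) (c 0)"
      unfolding smooth_at_def c(2) using fcoord_smooth_fun[OF ch that] idt_tau[OF m] m U
      by (intro exI[of _ ?O]) simp
    from smooth_curve_DERIV[OF arrows_manifold sc this] show ?thesis by (simp add: x'_def)
  qed
  have f0: "fcoord \<phi> (c 0) = (\<lambda>_. 0)" by (simp add: fcoord_def xi_idt m fun_eq_iff c)
  from ev1 ev2 have "\<forall>\<^sub>F r in nhds 0. c r = mlt G (idt G m) (rho U \<phi> m (fcoord \<phi> (c r)))"
  proof eventually_elim
    case (elim r)
    then show ?case
      using rho_fcoord[OF ch elim(2)] U mlt_idt_left[OF tau_Arr[OF elim(2)]] by simp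
  qed
  then have "velocity (arrows G) c = velocity (arrows G) (\<lambda>r. mlt G (idt G m) (rho U \<phi> m (fcoord \<phi> (c r))))"
    by (rule velocity_cong)
  also have "\<dots> = (\<lambda>f. \<Sum>j<N. x' j *
      coord_velocity (arrows G) (\<lambda>x. mlt G (idt G m) (rho U \<phi> m x)) (fcoord \<phi> (c 0)) j f)"
  proof (rule velocity_compose[OF arrows_manifold _ _ _ dx])
    show "plot (arrows G) N (rho_dom U \<phi> m) (\<lambda>x. mlt G (idt G m) (rho U \<phi> m x))"
      using left_rho_plot[of "idt G m"] m by simp
    show "fcoord \<phi> (c 0) \<in> rho_dom U \<phi> m" using fcoord_dom[OF ch, of "c 0"] c(2) idt_tau[OF m] m U by simp
  qed simp_all
  finally show ?thesis unfolding coord_push_idt f0 using dx by blast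
qed

end

end

context tubular_rep
begin

section \<open>Scaling and sign rules for alternating forms\<close>

lemma alt_form_scale_all:
  assumes f: "alt_form m (Suc q) f" and m: "m \<in> Obj G" and v: "v \<in> algebroid G m"
    and l: "length l = q" "set l \<subseteq> algebroid G m"
  shows "f (v # map (tv_scale t) l) = t ^ q *\<^sub>R f (v # l)"
proof -
  \<comment> \<open>Induction on the number \<open>n\<close> of entries already rescaled.\<close>
  have "f (v # map (tv_scale t) (take n l) @ drop n l) = t ^ n *\<^sub>R f (v # l)" if "n \<le> q" for n
    using that
  proof (induction n)
    case (Suc n)
    let ?L = "v # map (tv_scale t) (take n l) @ drop n l"
    have n: "n < length l" using Suc l by simp
    have ln: "l ! n \<in> algebroid G m" using n l by auto
    have L: "length ?L = Suc q" using n l by simp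
    have "set (take n l) \<subseteq> algebroid G m" "set (drop n l) \<subseteq> algebroid G m"
      using l set_take_subset[of n l] set_drop_subset[of n l] by auto
    then have LA: "set ?L \<subseteq> algebroid G m" using v algebroid_scale[OF m] by auto
    have dr: "drop n l = l ! n # drop (Suc n) l" using Cons_nth_drop_Suc[OF n] by simp
    have lt: "length (map (tv_scale t) (take n l)) = n" using n by simp
    have up: "?L[Suc n := a] = v # map (tv_scale t) (take n l) @ a # drop (Suc n) l" for a
      unfolding dr using lt by (simp add: list_update_append)
    have "v # map (tv_scale t) (take (Suc n) l) @ drop (Suc n) l = ?L[Suc n := tv_scale t (l ! n)]"
      unfolding up using n by (simp add: take_Suc_conv_app_nth)
    moreover have "?L[Suc n := l ! n] = ?L" unfolding up dr[symmetric] ..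
    ultimately show ?case
      using alt_form_scale[OF f L LA, of "Suc n" "l ! n" t] n l ln Suc by simp
  qed simp
  from this[of q] l show ?thesis by simp
qed

text \<open>\<open>alt_form\<close> demands vanishing on equal arguments; antisymmetry follows by
  expanding the value with \<open>a + b\<close> in both slots.\<close>

lemma alt_form_swap:
  assumes f: "alt_form m n f" and m: "m \<in> Obj G" and l: "length (xs @ a # b # ys) = n" "set (xs @ a # b # ys) \<subseteq> algebroid G m"
  shows "f (xs @ a # b # ys) = - f (xs @ b # a # ys)"
proof -
  have A: "a \<in> algebroid G m" "b \<in> algebroid G m" "set xs \<subseteq> algebroid G m" "set ys \<subseteq> algebroid G m"
    using l by auto
  note s = algebroid_add[OF m A(1,2)]
  define F where "F x y = f (xs @ x # y # ys)" for x y
  have add1: "F (tv_add a b) y = F a y + F b y" if "y \<in> algebroid G m" for y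
    using alt_form_add[OF f, of "xs @ a # y # ys" "length xs" a b] l A that by (simp add: F_def)
  have add2: "F x (tv_add a b) = F x a + F x b" if "x \<in> algebroid G m" for x
    using alt_form_add[OF f, of "xs @ x # a # ys" "Suc (length xs)" a b] l A that
    by (simp add: F_def list_update_append)
  have alt: "F x x = 0" if "x \<in> algebroid G m" for x
    using alt_form_alt[OF f, of "xs @ x # x # ys" "length xs" "Suc (length xs)"] l A that
    by (simp add: F_def nth_append)
  have "F a b + F b a = 0"
    using alt[OF s] add1[OF s] add2[OF A(1)] add2[OF A(2)] alt[OF A(1)] alt[OF A(2)] by simp
  then show ?thesis by (simp add: F_def eq_neg_iff_add_eq_0)
qed

lemma alt_form_move:
  assumes f: "alt_form m n f" and m: "m \<in> Obj G"
  shows "length (zs @ a # xs @ ys) = n \<Longrightarrow> set (zs @ a # xs @ ys) \<subseteq> algebroid G m \<Longrightarrow>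
    f (zs @ a # xs @ ys) = (-1) ^ length xs *\<^sub>R f (zs @ xs @ a # ys)"
proof (induction xs arbitrary: zs)
  case (Cons x xs)
  have "f (zs @ a # x # xs @ ys) = - f (zs @ x # a # xs @ ys)"
    by (rule alt_form_swap[OF f m]) (use Cons.prems in auto)
  then show ?case using Cons.IH[of "zs @ [x]"] Cons.prems by simp
qed simp

text \<open>Contraction places \<open>ws ! k\<close> first; the resulting sign cancels the
  \<open>(-1) ^ k\<close> of the de Rham differential, so that all its summands become
  equal.\<close>

lemma alt_form_front:
  assumes f: "alt_form m n f" and m: "m \<in> Obj G" and l: "length l = n" "set l \<subseteq> algebroid G m" and k: "k < n"
  shows "f (l ! k # take k l @ drop (Suc k) l) = (-1) ^ k *\<^sub>R f l"
proof -
  have id: "l = take k l @ l ! k # drop (Suc k) l" using k l by (simp add: id_take_nth_drop)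
  have "set (take k l) \<subseteq> algebroid G m" "set (drop (Suc k) l) \<subseteq> algebroid G m" "l ! k \<in> algebroid G m"
    using l k set_take_subset[of k l] set_drop_subset[of "Suc k" l] nth_mem[of k l] by auto
  then have "f ([] @ l ! k # take k l @ drop (Suc k) l) = (-1) ^ length (take k l) *\<^sub>R f ([] @ take k l @ l ! k # drop (Suc k) l)"
    using l k by (intro alt_form_move[OF f m]) auto
  then show ?thesis using id k l by simp
qed

section \<open>The de Rham differential at a unit\<close>

lemma left_idt_velocity:
  assumes m: "m \<in> Obj G" and ev: "\<forall>\<^sub>F r in nhds 0. c r \<in> Arr G \<and> tgt G (c r) = m"
  shows "velocity (arrows G) (\<lambda>r. mlt G (idt G m) (c r)) = velocity (arrows G) c"
  by (rule velocity_cong) (use ev in \<open>auto elim!: eventually_mono\<close>)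

lemma push_left_idt:
  assumes m: "m \<in> Obj G" and a: "a \<in> algebroid G m"
  shows "push G (mlt G (idt G m)) (idt G m) a = a"
proof -
  have "\<forall>\<^sub>F r in nhds 0. \<tau> (m, tv_scale r a) \<in> Arr G \<and> tgt G (\<tau> (m, tv_scale r a)) = m"
    using tau_curve(3)[OF m a] by eventually_elim (auto intro: tau_tgt tau_Arr)
  then show ?thesis
    using push_left(1)[of "idt G m" a] left_idt_velocity[OF m] velocity_tau[OF m a] m a by simp
qed

text \<open>Guarantees that the choice in \<open>d_Rh\<close> is from a nonempty set. The witness is
  \<tau> composed with the linear map sending the k-th basis vector to
  \<open>ws ! k\<close>.\<close>

lemma fibre_map_exists:
  assumes m: "m \<in> Obj G" and ws: "set ws \<subseteq> algebroid G m"
  shows "\<exists>F. fibre_map_through G (idt G m) ws F"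
proof -
  let ?n = "length ws"
  have E: "openin (Euclidean_space ?n) (eucl ?n)" by simp
  have w: "ws ! k \<in> algebroid G m" if "k < ?n" for k using ws that by auto
  let ?a = "\<lambda>y f. \<Sum>k<?n. y k * (ws ! k) f"
  have ap: "algebroid_plot G ?n (eucl ?n) (\<lambda>y. m) ?a"
    by (intro algebroid_plot_linear plot_const[OF objects_manifold m E] smooth_real_coord[OF E]
        algebroid_plot_const[OF m w E]) simp
  let ?S = "{y \<in> eucl ?n. (m, ?a y) \<in> W}"
  have op: "openin (Euclidean_space ?n) ?S" by (rule W_open[OF ap])
  let ?F = "\<lambda>y. \<tau> (m, ?a y)"
  have p: "plot (arrows G) ?n ?S ?F" by (rule plot_tau[OF algebroid_plot_subset[OF ap op]]) auto
  have z: "(\<lambda>_. 0) \<in> ?S" using W_zero[OF m] by simp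
  have "coord_velocity (arrows G) ?F (\<lambda>_. 0) k = ws ! k" if k: "k < ?n" for k
  proof -
    have "?a ((\<lambda>_. 0)(k := 0 + r)) = tv_scale r (ws ! k)" for r
    proof
      fix f
      have "?a ((\<lambda>_. 0)(k := 0 + r)) f = (\<Sum>j<?n. if j = k then r * (ws ! j) f else 0)"
        by (intro sum.cong) auto
      then show "?a ((\<lambda>_. 0)(k := 0 + r)) f = tv_scale r (ws ! k) f" using k by (simp add: tv_scale_def)
    qed
    then show ?thesis unfolding coord_velocity_def using velocity_tau[OF m w[OF k]] by (simp only:)
  qed
  then have "fibre_map_through G (idt G m) ws ?F"
    unfolding fibre_map_through_def using p z tau_tgt tau_zero[OF m] m
    by (intro conjI exI[of _ ?S]) auto
  then show ?thesis by blast
qed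

text \<open>The k-th summand of \<open>d_Rh\<close> at a unit, without its sign, for an arbitrary
  admissible \<open>F\<close>. Along the k-th axis the form is a sum of fibre coordinates times
  integrals \<open>I j\<close>. The coordinates vanish at the unit, so their derivatives are
  multiplied by the values \<open>I j 0\<close>, and no derivative of the integrals or of the other
  arguments enters. The constant \<open>c\<close> accommodates the sign carried by the cochains to
  which this is applied.\<close>

lemma fibre_map_derivative:
  assumes \<psi>: "smooth_on p (Suc q) \<psi> Q" and Q: "openin (mtop (arrows G)) Q"
    and P: "P \<subseteq> \<tau> ` W" "openin (mtop (arrows G)) P" "\<And>h t. h \<in> P \<Longrightarrow> t \<in> {0..1} \<Longrightarrow> lam t h \<in> Q"
    and m: "m \<in> Obj G" and e: "(gs, idt G m) \<in> epts p P"
    and \<phi>: "\<And>h as. (gs, h) \<in> epts p P \<Longrightarrow> length as = q \<Longrightarrow> set as \<subseteq> algebroid G (src G h) \<Longrightarrow>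
      \<phi> gs h as = c *\<^sub>R op_k G V W \<tau> \<psi> gs h as"
    and ws: "length ws = Suc q" "set ws \<subseteq> algebroid G m" and F: "fibre_map_through G (idt G m) ws F"
    and k: "k < Suc q"
  shows "((\<lambda>r. to_form G V \<phi> gs (F (axis_pt k r)) (map (coord_velocity (arrows G) F (axis_pt k r)) ([0..<k] @ [Suc k..<Suc q])))
    has_vector_derivative ((-1) ^ p * c / real (Suc q)) *\<^sub>R \<psi> gs (idt G m) (ws ! k # take k ws @ drop (Suc k) ws)) (at 0)"
proof -
  \<comment> \<open>The directions other than \<open>k\<close>, whose coordinate velocities remain
    as arguments.\<close>
  define js where "js = [0..<k] @ [Suc k..<Suc q]"
  have js: "length js = q" using k by (simp add: js_def)
  have jsk: "js ! i < Suc q" "js ! i \<noteq> k" if "i < q" for i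
  proof -
    have "js ! i \<in> set js" using that js by simp
    moreover have "set js \<subseteq> {..<Suc q} - {k}" using k by (auto simp: js_def)
    ultimately show "js ! i < Suc q" "js ! i \<noteq> k" by auto
  qed
  have ljs: "j < Suc q" if "j \<in> set js" for j using that k by (auto simp: js_def)
  obtain SF where SF: "(\<lambda>_. 0) \<in> SF" "plot (arrows G) (Suc q) SF F" "\<And>y. y \<in> SF \<Longrightarrow> tgt G (F y) = m"
    and F0: "F (\<lambda>_. 0) = idt G m" and Fk: "\<And>k. k < Suc q \<Longrightarrow> coord_velocity (arrows G) F (\<lambda>_. 0) k = ws ! k"
    using F m ws(1) unfolding fibre_map_through_def by auto
  have SFo: "openin (Euclidean_space (Suc q)) SF" using plot_openin[OF arrows_manifold SF(2)] .
  have ax: "axis_pt k r \<in> eucl (Suc q)" for r using k by (auto simp: axis_pt_def mem_eucl)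
  have ax0: "axis_pt k 0 = (\<lambda>_. 0)" by (auto simp: axis_pt_def)
  have E1: "openin (Euclidean_space 1) (eucl 1)" by simp
  define hr where "hr r = F (axis_pt k r)" for r
  have axs: "smooth_real n T (\<lambda>y. axis_pt k (y 0) i)" if "openin (Euclidean_space n) T" for n T i
    using smooth_real_coord[OF that, of 0] smooth_real_const[OF that, of 0]
    by (cases "i = k") (simp_all add: axis_pt_def)
  define S0 where "S0 = {y \<in> eucl 1. axis_pt k (y 0) \<in> SF}"
  have S0o: "openin (Euclidean_space 1) S0"
    unfolding S0_def by (rule openin_preimage_smooth[OF SFo E1 axs[OF E1] ax])
  have h0: "plot (arrows G) 1 S0 (\<lambda>y. hr (y 0))"
    unfolding hr_def by (rule plot_compose[OF arrows_manifold SF(2) S0o axs[OF S0o]]) (simp add: S0_def)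
  \<comment> \<open>Restricts the axis to parameters for which the curve stays in \<open>P\<close>,
    where \<phi> is known to be a multiple of \<open>k\<close> applied to \<psi>.\<close>
  define S where "S = {y \<in> S0. hr (y 0) \<in> P}"
  have hS: "plot (arrows G) 1 S (\<lambda>y. hr (y 0))" unfolding S_def by (rule plot_vimage[OF arrows_manifold h0 P(2)])
  have So: "openin (Euclidean_space 1) S" using plot_openin[OF arrows_manifold hS] .
  have m1: "hr 0 = idt G m" using F0 by (simp add: hr_def ax0)
  have P1: "idt G m \<in> P" using e by (simp add: epts_def)
  have zS: "(\<lambda>_. 0) \<in> S" using SF(1) m1 P1 by (simp add: S_def S0_def ax0)
  have SE: "y \<in> eucl 1" "axis_pt k (y 0) \<in> SF" "hr (y 0) \<in> P" if "y \<in> S" for y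
    using that by (auto simp: S_def S0_def)
  have hT: "hr (y 0) \<in> \<tau> ` W" if "y \<in> S" for y using SE(3)[OF that] P(1) by auto
  have htgt: "tgt G (hr (y 0)) = m" if "y \<in> S" for y using SF(3)[OF SE(2)[OF that]] by (simp add: hr_def)
  have hA: "hr (y 0) \<in> Arr G" if "y \<in> S" for y using tau_Arr[OF hT[OF that]] .
  have PQ: "P \<subseteq> Q" by (rule P_Q[OF \<psi> Q P(1,3)])
  have eh: "(gs, hr (y 0)) \<in> epts p P" if "y \<in> S" for y
    by (rule epts_change[OF e subset_refl SE(3)[OF that]]) (use htgt[OF that] m in simp)
  have fc: "fibre_curve G (\<lambda>s. F (z(j := z j + s)))" if z: "z \<in> SF" and j: "j < Suc q" for z j
  proof (rule fibre_curveI)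
    show "smooth_curve (arrows G) (\<lambda>s. F (z(j := z j + s)))" by (rule smooth_curve_coord[OF arrows_manifold SF(2) z j])
    have "\<forall>\<^sub>F s in nhds (z j). z(j := s) \<in> SF" by (rule eventually_fun_upd_mem[OF SFo z j])
    moreover have "filterlim (\<lambda>r. z j + r) (nhds (z j)) (nhds 0)"
      using tendsto_add[OF tendsto_const[of "z j"] filterlim_ident[of "nhds (0::real)"]] by simp
    ultimately have "\<forall>\<^sub>F r in nhds 0. z(j := z j + r) \<in> SF" unfolding filterlim_iff by blast
    then show "\<forall>\<^sub>F s in nhds 0. tgt G (F (z(j := z j + s))) = m" by eventually_elim (rule SF(3))
  qed
  have upd0: "z(j := z j + 0) = z" for z :: "nat \<Rightarrow> real" and j by (rule ext) simp
  \<comment> \<open>The remaining coordinate velocities at \<open>hr r\<close>, translated to the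
    unit at the source of \<open>hr r\<close>, where \<psi> takes its arguments.\<close>
  define av where "av r = map (\<lambda>j. velocity (arrows G) (\<lambda>s. mlt G (ivs G (hr r))
      (F ((axis_pt k r)(j := axis_pt k r j + s))))) js" for r
  have lav: "length (av r) = q" for r by (simp add: av_def js)
  have avp: "map (push G (mlt G (ivs G (hr (y 0)))) (hr (y 0))) (map (coord_velocity (arrows G) F (axis_pt k (y 0))) js) = av (y 0)"
    and avA: "set (av (y 0)) \<subseteq> algebroid G (src G (hr (y 0)))" if y: "y \<in> S" for y
  proof -
    have c0: "F ((axis_pt k (y 0))(j := axis_pt k (y 0) j + 0)) = hr (y 0)" for j by (simp only: upd0 hr_def)
    have "push G (mlt G (ivs G (hr (y 0)))) (hr (y 0)) (coord_velocity (arrows G) F (axis_pt k (y 0)) j) =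
      velocity (arrows G) (\<lambda>s. mlt G (ivs G (hr (y 0))) (F ((axis_pt k (y 0))(j := axis_pt k (y 0) j + s))))"
      if "j \<in> set js" for j
      unfolding coord_velocity_def by (rule push_left_back[OF hT[OF y] fc[OF SE(2)[OF y] ljs[OF that]] c0])
    then show "map (push G (mlt G (ivs G (hr (y 0)))) (hr (y 0))) (map (coord_velocity (arrows G) F (axis_pt k (y 0))) js) = av (y 0)"
      by (simp add: av_def)
    show "set (av (y 0)) \<subseteq> algebroid G (src G (hr (y 0)))"
      unfolding av_def set_map
      by (intro image_subsetI left_velocity_algebroid[OF hA[OF y] fc[OF SE(2)[OF y] ljs] c0])
  qed
  have avpl: "algebroid_plot G 1 S (\<lambda>y. src G (hr (y 0))) (\<lambda>y. av (y 0) ! i)" if i: "i < q" for i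
  proof -
    define j where "j = js ! i"
    have j: "j < Suc q" "j \<noteq> k" using jsk[OF i] by (auto simp: j_def)
    have E2: "openin (Euclidean_space (Suc 1)) (eucl (Suc 1))" by simp
    \<comment> \<open>2-space with coordinates \<open>(r, s)\<close>: \<open>r\<close> moves along
      axis \<open>k\<close>, and \<open>s\<close> is the parameter of the curve in direction
      \<open>j\<close>.\<close>
    define w where "w z = (axis_pt k (z 0))(j := axis_pt k (z 0) j + z (Suc 0))" for z :: "nat \<Rightarrow> real"
    have ws': "smooth_real n T (\<lambda>z. w z i)" if "openin (Euclidean_space n) T" for n T i
      using smooth_real_add[OF axs[OF that, of i] smooth_real_coord[OF that, of "Suc 0"]] axs[OF that, of i]
      by (cases "i = j") (simp_all add: w_def)
    have wE: "w z \<in> eucl (Suc q)" for z using j k by (auto simp: w_def axis_pt_def mem_eucl)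
    define \<Omega>1 where "\<Omega>1 = {z \<in> eucl (Suc 1). axis_pt k (z 0) \<in> SF}"
    have O1: "openin (Euclidean_space (Suc 1)) \<Omega>1"
      unfolding \<Omega>1_def by (rule openin_preimage_smooth[OF SFo E2 axs[OF E2] ax])
    define \<Omega> where "\<Omega> = {z \<in> \<Omega>1. w z \<in> SF}"
    have O: "openin (Euclidean_space (Suc 1)) \<Omega>"
      unfolding \<Omega>_def by (rule openin_preimage_smooth[OF SFo O1 ws'[OF O1] wE])
    have p1: "plot (arrows G) (Suc 1) \<Omega> (\<lambda>z. F (axis_pt k (z 0)))"
      by (rule plot_compose[OF arrows_manifold SF(2) O axs[OF O]]) (simp add: \<Omega>_def \<Omega>1_def)
    have p2: "plot (arrows G) (Suc 1) \<Omega> (\<lambda>z. F (w z))"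
      by (rule plot_compose[OF arrows_manifold SF(2) O ws'[OF O]]) (simp add: \<Omega>_def)
    have tt: "tgt G (F (axis_pt k (z 0))) = m" "tgt G (F (w z)) = m" "F (axis_pt k (z 0)) \<in> Arr G" "F (w z) \<in> Arr G"
      if "z \<in> \<Omega>" for z
      using that SF(3) plot_pts[OF arrows_manifold p1 that] plot_pts[OF arrows_manifold p2 that]
      by (auto simp: \<Omega>_def \<Omega>1_def)
    have H: "plot (arrows G) (Suc 1) \<Omega> (\<lambda>z. mlt G (ivs G (F (axis_pt k (z 0)))) (F (w z)))"
      by (intro plot_mlt plot_ivs p1 p2) (simp add: tt)
    have "algebroid_plot G 1 S (\<lambda>y. src G (hr (y 0))) (\<lambda>y. velocity (arrows G)
      (\<lambda>r. mlt G (ivs G (F (axis_pt k ((y(1 := r)) 0)))) (F (w (y(1 := r))))))"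
    proof (rule algebroid_plot_velocity[OF H plot_src[OF hS]])
      fix y assume y: "y \<in> S"
      have y1: "y (Suc 0) = 0" using SE(1)[OF y] by (simp add: mem_eucl)
      have wy: "w y = axis_pt k (y 0)" by (rule ext) (simp add: w_def y1)
      show "y \<in> \<Omega>" using SE[OF y] by (simp add: \<Omega>_def \<Omega>1_def wy mem_eucl)
      show "mlt G (ivs G (F (axis_pt k (y 0)))) (F (w y)) = idt G (src G (hr (y 0)))"
        unfolding wy using hA[OF y] by (simp add: hr_def)
      fix r assume "y(1 := r) \<in> \<Omega>"
      from tt[OF this] show "tgt G (mlt G (ivs G (F (axis_pt k ((y(1 := r)) 0)))) (F (w (y(1 := r))))) = src G (hr (y 0))"
        by (simp add: hr_def)
    qed
    then show ?thesis
      by (rule algebroid_plot_cong) (simp_all add: av_def js i hr_def j_def[symmetric] w_def)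
  qed
  obtain U \<theta> where ch: "(U, \<theta>) \<in> atlas (arrows G)" and U: "idt G m \<in> U"
    using chart_at[OF arrows_manifold idt_Arr[OF m]] by blast
  let ?N = "mdim (arrows G)"
  note cp = ch m U
  let ?e = "\<lambda>t h j. coord_push U \<theta> m t h j"
  have gsA: "gs ! i \<in> Arr G" if "i < p" for i
  proof -
    have "gs ! i \<in> P" using e that by (auto simp: epts_def)
    then show ?thesis using P(1) tau_Arr by auto
  qed
  have gspl: "plot (arrows G) 1 S (\<lambda>y. gs ! i)" if "i < p" for i
    by (rule plot_const[OF arrows_manifold gsA[OF that] So])
  have epl: "algebroid_plot G (Suc 1) \<Omega> (\<lambda>z. src G (lam (z 1) (hr (trunc 1 z 0)))) (\<lambda>z. ?e (z 1) (hr (trunc 1 z 0)) j)"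
    if O: "openin (Euclidean_space (Suc 1)) \<Omega>" and z: "\<And>z. z \<in> \<Omega> \<Longrightarrow> trunc 1 z \<in> S \<and>
      (tgt G (hr (trunc 1 z 0)), tv_scale (z 1) (xi (hr (trunc 1 z 0)))) \<in> W" and j: "j < ?N" for \<Omega> j
  proof (rule coord_push_plot[OF cp _ _ _ _ _ j])
    show "plot (arrows G) (Suc 1) \<Omega> (\<lambda>z. hr (trunc 1 z 0))"
      by (rule plot_compose[OF arrows_manifold hS O smooth_real_trunc[OF O]]) (use z in auto)
    show "smooth_real (Suc 1) \<Omega> (\<lambda>z. z 1)" by (rule smooth_real_coord[OF O])
  qed (use z hT htgt in auto)
  \<comment> \<open>The integral of \<open>k\<close> with the contracted vector replaced by the j-th
    coordinate vector; it is what multiplies the j-th fibre coordinate of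
    \<open>hr r\<close>.\<close>
  define I where "I j r = integral {0..1} (\<lambda>t. kern \<psi> gs (hr r) (av r) t (?e t (hr r) j))" for j r
  have ki: "bundle_plot (objects G) V 1 S (\<lambda>y. tgt G (hr (y 0)))
      (\<lambda>y. integral {0..1} (\<lambda>t. kern \<psi> gs (hr (y 0)) (av (y 0)) t (v y t))) \<and>
      (\<forall>y\<in>S. (\<lambda>t. kern \<psi> gs (hr (y 0)) (av (y 0)) t (v y t)) integrable_on {0..1})"
    if v: "\<And>\<Omega>. openin (Euclidean_space (Suc 1)) \<Omega> \<Longrightarrow> (\<And>z. z \<in> \<Omega> \<Longrightarrow> trunc 1 z \<in> S \<and>
        (tgt G (hr (trunc 1 z 0)), tv_scale (z 1) (xi (hr (trunc 1 z 0)))) \<in> W) \<Longrightarrow>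
      algebroid_plot G (Suc 1) \<Omega> (\<lambda>z. src G (lam (z 1) (hr (trunc 1 z 0)))) (\<lambda>z. v (trunc 1 z) (z 1))" for v
    using kern_integral_plot[where gs = "\<lambda>y. gs" and g = "\<lambda>y. hr (y 0)" and as = "\<lambda>y. av (y 0)" and v = v,
        OF \<psi> Q P(1,3) _ hS] gspl eh lav avpl v by blast+
  have Ipl: "bundle_plot (objects G) V 1 S (\<lambda>y. tgt G (hr (y 0))) (\<lambda>y. I j (y 0))"
    and Iint: "\<And>y. y \<in> S \<Longrightarrow> (\<lambda>t. kern \<psi> gs (hr (y 0)) (av (y 0)) t (?e t (hr (y 0)) j)) integrable_on {0..1}"
    if j: "j < ?N" for j
  proof -
    note k = ki[where v = "\<lambda>y t. ?e t (hr (y 0)) j", OF epl[OF _ _ j]]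
    show "bundle_plot (objects G) V 1 S (\<lambda>y. tgt G (hr (y 0))) (\<lambda>y. I j (y 0))"
      unfolding I_def by (rule conjunct1[OF k])
    show "\<And>y. y \<in> S \<Longrightarrow> (\<lambda>t. kern \<psi> gs (hr (y 0)) (av (y 0)) t (?e t (hr (y 0)) j)) integrable_on {0..1}"
      by (rule bspec[OF conjunct2[OF k]])
  qed
  \<comment> \<open>The curve stays in one \<open>t\<close>-fibre, so all values lie in
    \<open>V\<close> over \<open>m\<close> and continuity in the Banach space makes sense.\<close>
  have Icont: "isCont (I j) 0" if j: "j < ?N" for j
  proof -
    have "bundle_plot (objects G) V 1 S (\<lambda>y. m) (\<lambda>y. I j (y 0))"
      by (rule bundle_plot_cong[OF Ipl[OF j]]) (use htgt in auto)
    then have c: "continuous_on S (\<lambda>y. I j (y 0))" by (rule bundle_plot_continuous[OF _ m])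
    obtain d where d: "d > 0" "\<And>r. \<bar>r\<bar> < d \<Longrightarrow> (\<lambda>_. 0)(0 := r) \<in> S"
      using openin_eucl_fun_upd_line[OF So zS, of 0] by auto
    have "continuous_on (ball 0 d) (\<lambda>r. I j (((\<lambda>_. 0)(0::nat := r)) 0))"
    proof (rule continuous_on_compose2[where f = "\<lambda>r. (\<lambda>_. 0)(0 := r)", OF c])
      show "continuous_on (ball 0 d) (\<lambda>r::real. (\<lambda>_. 0)(0::nat := r))"
        by (rule continuous_on_fun_upd[where f = "\<lambda>_ _. 0" and g = "\<lambda>r. r", OF continuous_on_const continuous_on_id])
      show "(\<lambda>r. (\<lambda>_. 0)(0::nat := r)) ` ball 0 d \<subseteq> S"
        by (rule image_subsetI, rule d(2)) (simp add: dist_real_def)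
    qed
    then have "continuous_on (ball 0 d) (I j)" by simp
    then show ?thesis using d(1) by (simp add: continuous_on_eq_continuous_at)
  qed
  \<comment> \<open>The action of \<open>hr r\<close> in \<open>to_form\<close> cancels that of its
    inverse in \<open>op_k\<close>, and the expansion of \<open>lam_velocity\<close> is pulled out
    of the form and out of the integral.\<close>
  have form_value: "to_form G V \<phi> gs (hr r) (map (coord_velocity (arrows G) F (axis_pt k r)) js) =
      ((-1) ^ p * c) *\<^sub>R (\<Sum>j<?N. fcoord \<theta> (hr r) j *\<^sub>R I j r)"
    if r: "(\<lambda>_. 0)(0 := r) \<in> S" for r
  proof -
    let ?h = "hr r"
    have y: "((\<lambda>_. 0)(0 := r)) 0 = r" by simp
    note hT = hT[OF r, unfolded y] and ht = htgt[OF r, unfolded y] and hA = hA[OF r, unfolded y]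
      and eh = eh[OF r, unfolded y] and avA = avA[OF r, unfolded y]
    have gl: "length gs = p" using e by (simp add: epts_def)
    let ?I = "integral {0..1} (\<lambda>t. kern \<psi> gs ?h (av r) t (lam_velocity t ?h))"
    have kexp: "kern \<psi> gs ?h (av r) t (lam_velocity t ?h) = (\<Sum>j<?N. fcoord \<theta> ?h j *\<^sub>R kern \<psi> gs ?h (av r) t (?e t ?h j))"
      if t: "t \<in> {0..1}" for t
    proof -
      note l = retraction_01[OF hT t]
      have f: "alt_form (src G (lam t ?h)) (Suc q) (\<psi> gs (lam t ?h))"
        by (rule smooth_on_alt[OF \<psi> epts_change[OF eh PQ P(3)[OF _ t] l(2)]]) (use eh in \<open>simp add: epts_def\<close>)
      let ?l = "map (lam_push t ?h) (av r)"
      have l1: "length ?l = q" "set ?l \<subseteq> algebroid G (src G (lam t ?h))"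
        using avA lam_push_eq(2)[OF hT t] lav by auto
      have eA: "?e t ?h j \<in> algebroid G (src G (lam t ?h))" if "j \<in> {..<?N}" for j
        using coord_push_algebroid[OF cp hT ht t] that by simp
      have mem: "\<psi> gs (lam t ?h) (?e t ?h j # ?l) \<in> fibre V (src G (lam t ?h))" if "j \<in> {..<?N}" for j
        by (rule alt_form_mem[OF f]) (use l1 eA[OF that] in auto)
      have sO: "src G (lam t ?h) \<in> Obj G" using l(3) by simp
      have "\<psi> gs (lam t ?h) (lam_velocity t ?h # ?l) = (\<Sum>j<?N. fcoord \<theta> ?h j *\<^sub>R \<psi> gs (lam t ?h) (?e t ?h j # ?l))"
        unfolding lam_velocity_expansion[OF cp hT ht t]
        by (rule alt_form_linear[OF sO f l1]) (use eA in auto)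
      then show ?thesis unfolding kern_def
        using act_sum[OF l(3), of "{..<?N}" "\<lambda>j. fcoord \<theta> ?h j *\<^sub>R \<psi> gs (lam t ?h) (?e t ?h j # ?l)"]
          mem act_scale[OF l(3) mem] fibre_scale[OF sO mem] by simp
    qed
    have "?I = integral {0..1} (\<lambda>t. \<Sum>j<?N. fcoord \<theta> ?h j *\<^sub>R kern \<psi> gs ?h (av r) t (?e t ?h j))"
      by (rule integral_cong) (rule kexp)
    also have "\<dots> = (\<Sum>j<?N. integral {0..1} (\<lambda>t. fcoord \<theta> ?h j *\<^sub>R kern \<psi> gs ?h (av r) t (?e t ?h j)))"
      using Iint[OF _ r, unfolded y] by (intro integral_sum integrable_cmul) auto
    also have "\<dots> = (\<Sum>j<?N. fcoord \<theta> ?h j *\<^sub>R I j r)" by (simp add: I_def)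
    finally have Ieq: "?I = (\<Sum>j<?N. fcoord \<theta> ?h j *\<^sub>R I j r)" .
    have Imem: "?I \<in> fibre V (tgt G ?h)"
    proof -
      have "I j r \<in> fibre V (tgt G ?h)" if "j < ?N" for j
        using bundle_plot_mem[OF Ipl[OF that] r] by simp
      then show ?thesis unfolding Ieq using hA by (intro fibre_sum fibre_scale) auto
    qed
    have sm: "(-1) ^ p *\<^sub>R ?I \<in> fibre V (tgt G ?h)" using fibre_scale[OF _ Imem] hA by simp
    have iA: "act V (ivs G ?h) ((-1) ^ p *\<^sub>R ?I) \<in> fibre V (src G ?h)"
      using act_fibre[of "ivs G ?h" "(-1) ^ p *\<^sub>R ?I"] sm hA by simp
    have "to_form G V \<phi> gs ?h (map (coord_velocity (arrows G) F (axis_pt k r)) js) = act V ?h (\<phi> gs ?h (av r))"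
      unfolding to_form_def using avp[OF r, unfolded y] by simp
    also have "\<dots> = act V ?h (c *\<^sub>R act V (ivs G ?h) ((-1) ^ p *\<^sub>R ?I))"
      using \<phi>[OF eh lav avA] op_k_eq[OF hT avA, of \<psi> gs] gl by simp
    also have "\<dots> = c *\<^sub>R (-1) ^ p *\<^sub>R ?I"
      using act_scale[OF hA iA] act_ivs_right[OF hA sm] by simp
    finally show ?thesis using Ieq by (simp add: mult.commute)
  qed
  have hc: "fibre_curve G hr"
  proof (rule fibre_curveI)
    show "smooth_curve (arrows G) hr"
      unfolding smooth_curve_iff[OF arrows_manifold] by (intro exI[of _ S] conjI zS hS)
    have "\<forall>\<^sub>F r in nhds 0. (\<lambda>_. 0)(0 := r) \<in> S" by (rule eventually_line_mem[OF So zS])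
    then show "\<forall>\<^sub>F r in nhds 0. tgt G (hr r) = m" by eventually_elim (use htgt in fastforce)
  qed
  obtain x' where x': "\<And>j. j < ?N \<Longrightarrow> ((\<lambda>r. fcoord \<theta> (hr r) j) has_real_derivative x' j) (at 0)"
    and vh: "velocity (arrows G) hr = (\<lambda>f. \<Sum>j<?N. x' j * ?e 0 (idt G m) j f)"
    using fibre_curve_fcoord[OF cp hc m1, of 0] by blast
  \<comment> \<open>At the unit the coordinate vectors do not depend on \<open>t\<close>, so time
    enters the integrand below only through scaling.\<close>
  have ei: "?e t (idt G m) = ?e 0 (idt G m)" for t unfolding coord_push_idt[OF cp] ..
  have f0: "fcoord \<theta> (hr 0) j = 0" for j by (simp add: m1 fcoord_def xi_idt m)
  have mT: "idt G m \<in> \<tau> ` W" using idt_tau[OF m] .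
  have eA: "?e 0 (idt G m) j \<in> algebroid G m" if "j < ?N" for j
    using coord_push_algebroid[OF cp mT _ _ that, of 0] m by (simp add: retraction_idt)
  have axu: "axis_pt k r = (\<lambda>_. 0)(k := 0 + r)" for r by (auto simp: axis_pt_def)
  have vk: "velocity (arrows G) hr = ws ! k"
    using Fk[OF k] unfolding coord_velocity_def hr_def axu .
  have av0: "av 0 = take k ws @ drop (Suc k) ws"
  proof -
    have "velocity (arrows G) (\<lambda>s. mlt G (ivs G (hr 0)) (F ((axis_pt k 0)(j := axis_pt k 0 j + s)))) = ws ! j"
      if j: "j < Suc q" for j
    proof -
      have c: "fibre_curve G (\<lambda>s. F ((\<lambda>_. 0)(j := 0 + s)))" using fc[OF SF(1) j] by simp
      have c0: "F ((\<lambda>_. 0)(j := 0 + 0)) = idt G m" using upd0[of "\<lambda>_. 0" j] F0 by simp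
      have sc: "smooth_curve (arrows G) (\<lambda>s. F ((\<lambda>_. 0)(j := 0 + s)))"
        and ev: "\<forall>\<^sub>F s in nhds 0. tgt G (F ((\<lambda>_. 0)(j := 0 + s))) = m"
        using c c0 m by (auto simp: fibre_curve_def)
      have evA: "\<forall>\<^sub>F s in nhds 0. F ((\<lambda>_. 0)(j := 0 + s)) \<in> Arr G"
        by (rule smooth_curve_eventually[OF arrows_manifold sc Arr_openin]) (use c0 m in simp)
      have "velocity (arrows G) (\<lambda>s. mlt G (idt G m) (F ((\<lambda>_. 0)(j := 0 + s)))) = ws ! j"
        using left_idt_velocity[OF m eventually_conj[OF evA ev]] Fk[OF j] by (simp only: coord_velocity_def)
      then show ?thesis unfolding ax0 m1 ivs_idt[OF m] .
    qed
    then have "av 0 = map ((!) ws) js" unfolding av_def by (intro map_cong refl) (use ljs in blast)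
    also have "\<dots> = take k ws @ drop (Suc k) ws"
    proof -
      have "map ((!) ws) [0..<k] = take k ws" by (rule nth_equalityI) (use k ws(1) in auto)
      moreover have "map ((!) ws) [Suc k..<Suc q] = drop (Suc k) ws"
        by (rule nth_equalityI) (use k ws(1) in \<open>auto simp del: upt_Suc\<close>)
      ultimately show ?thesis by (simp add: js_def del: upt_Suc)
    qed
    finally show ?thesis .
  qed
  have f1: "alt_form m (Suc q) (\<psi> gs (idt G m))"
    using smooth_on_alt[OF \<psi>, of gs "idt G m"] e epts_mono[OF PQ] m by auto
  have l0: "length (av 0) = q" "set (av 0) \<subseteq> algebroid G m"
    using lav avA[OF zS] m1 m by auto
  \<comment> \<open>Each of the \<open>q\<close> remaining arguments is scaled by \<open>t\<close>
    at the unit, so the integrand is \<open>t ^ q\<close> times a constant vector.\<close>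
  have I0: "I j 0 = (1 / real (Suc q)) *\<^sub>R \<psi> gs (idt G m) (?e 0 (idt G m) j # av 0)" if j: "j < ?N" for j
  proof -
    have "kern \<psi> gs (hr 0) (av 0) t (?e t (hr 0) j) = t ^ q *\<^sub>R \<psi> gs (idt G m) (?e 0 (idt G m) j # av 0)"
      if t: "t \<in> {0..1}" for t
    proof -
      have mp: "map (lam_push t (idt G m)) (av 0) = map (tv_scale t) (av 0)"
        using lam_push_idt[OF m _ t] l0(2) by (intro map_cong) auto
      have "set (map (tv_scale t) (av 0)) \<subseteq> algebroid G m" using l0(2) algebroid_scale[OF m] by auto
      then have "\<psi> gs (idt G m) (?e 0 (idt G m) j # map (tv_scale t) (av 0)) \<in> fibre V m"
        using eA[OF j] l0(1) by (intro alt_form_mem[OF f1]) auto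
      then show ?thesis
        unfolding kern_def m1 ei[of t] mp retraction_idt[OF m]
        using act_idt[OF m] alt_form_scale_all[OF f1 m eA[OF j] l0] by simp
    qed
    then have "I j 0 = integral {0..1} (\<lambda>t. t ^ q *\<^sub>R \<psi> gs (idt G m) (?e 0 (idt G m) j # av 0))"
      unfolding I_def by (rule integral_cong)
    also have "\<dots> = (1 / real (Suc q)) *\<^sub>R \<psi> gs (idt G m) (?e 0 (idt G m) j # av 0)"
    proof (rule integral_unique, rule has_integral_scaleR_left)
      have "((\<lambda>t. t ^ q) has_integral (1 ^ Suc q / real (Suc q) - 0 ^ Suc q / real (Suc q))) {0..1::real}"
      proof (rule fundamental_theorem_of_calculus)
        fix x :: real assume "x \<in> {0..1}"
        have "((\<lambda>x. x ^ Suc q / real (Suc q)) has_real_derivative x ^ q) (at x within {0..1})"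
          by (rule derivative_eq_intros refl | simp)+
        then show "((\<lambda>x. x ^ Suc q / real (Suc q)) has_vector_derivative x ^ q) (at x within {0..1})"
          by (simp add: has_real_derivative_iff_has_vector_derivative)
      qed simp
      then show "((\<lambda>t. t ^ q) has_integral 1 / real (Suc q)) {0..1::real}" by simp
    qed
    finally show ?thesis .
  qed
  have "((\<lambda>r. ((-1) ^ p * c) *\<^sub>R (\<Sum>j<?N. fcoord \<theta> (hr r) j *\<^sub>R I j r)) has_vector_derivative
      ((-1) ^ p * c) *\<^sub>R (\<Sum>j<?N. x' j *\<^sub>R I j 0)) (at 0)"
    using has_vector_derivative_scaleR_zero[OF x' f0 Icont]
    by (intro bounded_linear.has_vector_derivative[OF bounded_linear_scaleR_right] has_vector_derivative_sum) auto
  \<comment> \<open>Linearity in the first slot reassembles the coordinate vectors to the velocity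
    of \<open>hr\<close>, which is \<open>ws ! k\<close>.\<close>
  moreover have "(\<Sum>j<?N. x' j *\<^sub>R I j 0) = (1 / real (Suc q)) *\<^sub>R \<psi> gs (idt G m) (ws ! k # av 0)"
  proof -
    have "(\<Sum>j<?N. x' j *\<^sub>R I j 0) = (1 / real (Suc q)) *\<^sub>R (\<Sum>j<?N. x' j *\<^sub>R \<psi> gs (idt G m) (?e 0 (idt G m) j # av 0))"
      using I0 by (simp add: scaleR_sum_right mult.commute)
    also have "(\<Sum>j<?N. x' j *\<^sub>R \<psi> gs (idt G m) (?e 0 (idt G m) j # av 0)) = \<psi> gs (idt G m) (ws ! k # av 0)"
      unfolding vk[symmetric] vh by (rule alt_form_linear[OF m f1 l0, symmetric]) (use eA in auto)
    finally show ?thesis .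
  qed
  ultimately have D: "((\<lambda>r. ((-1) ^ p * c) *\<^sub>R (\<Sum>j<?N. fcoord \<theta> (hr r) j *\<^sub>R I j r)) has_vector_derivative
      ((-1) ^ p * c / real (Suc q)) *\<^sub>R \<psi> gs (idt G m) (ws ! k # take k ws @ drop (Suc k) ws)) (at 0)"
    by (simp add: av0)
  have ev: "\<forall>\<^sub>F r in nhds 0. (\<lambda>_. 0)(0 := r) \<in> S" by (rule eventually_line_mem[OF So zS])
  \<comment> \<open>The guard \<open>r \<in> UNIV\<close> fits the congruence rule for derivatives
    within a set.\<close>
  have "\<forall>\<^sub>F r in nhds 0. r \<in> UNIV \<longrightarrow> to_form G V \<phi> gs (F (axis_pt k r)) (map (coord_velocity (arrows G) F (axis_pt k r)) js)
    = ((-1) ^ p * c) *\<^sub>R (\<Sum>j<?N. fcoord \<theta> (hr r) j *\<^sub>R I j r)"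
    using ev by eventually_elim (use form_value in \<open>simp add: hr_def\<close>)
  from has_vector_derivative_cong_ev[OF this] D show ?thesis
    using form_value[of 0] zS unfolding js_def[symmetric] by (simp add: hr_def fun_upd_idem)
qed

section \<open>Germs and the differential of the homotopy at the units\<close>

lemma agreeE:
  assumes "agree p q \<psi> \<phi>" "x \<in> Obj G"
  obtains Q where "openin (mtop (arrows G)) Q" "idt G x \<in> Q"
    "\<And>gs g as. (gs, g) \<in> epts p Q \<Longrightarrow> length as = q \<Longrightarrow> set as \<subseteq> algebroid G (src G g) \<Longrightarrow> \<psi> gs g as = \<phi> gs g as"
proof -
  from bspec[OF assms(1)[unfolded agree_def] assms(2)] obtain Q where
    "openin (mtop (arrows G)) Q" "idt G x \<in> Q"
    "\<forall>gs g as. (gs, g) \<in> epts p Q \<and> length as = q \<and> set as \<subseteq> algebroid G (src G g) \<longrightarrow> \<psi> gs g as = \<phi> gs g as"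
    by (elim exE conjE)
  then show ?thesis by (intro that[of Q]) simp_all
qed

lemma germE:
  assumes "\<sigma> \<in> germ G p \<rho>" "x \<in> Obj G"
  obtains Q where "openin (mtop (arrows G)) Q" "idt G x \<in> Q"
    "\<And>gs m. (gs, m) \<in> near_units G p Q \<Longrightarrow> \<sigma> gs m = \<rho> gs m"
proof -
  from bspec[OF assms(1)[unfolded germ_def mem_Collect_eq] assms(2)] obtain Q where
    Q: "openin (mtop (arrows G)) Q" "idt G x \<in> Q" "\<forall>(gs, m)\<in>near_units G p Q. \<sigma> gs m = \<rho> gs m"
    by (elim exE conjE)
  show ?thesis
  proof (rule that[OF Q(1,2)])
    fix gs m assume "(gs, m) \<in> near_units G p Q"
    from bspec[OF Q(3) this] show "\<sigma> gs m = \<rho> gs m" by simp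
  qed
qed

text \<open>The Poincare lemma over the units, for any \<phi> with the germ of \<open>c\<close>
  times \<open>k\<close> applied to \<psi>. The hypothesis concerns a neighbourhood, as
  \<open>d\<close> differentiates; the conclusion concerns units in the last argument, as more would
  be false for \<psi> that are not closed.\<close>

lemma op_d_at_units:
  assumes \<psi>: "smooth_dc p (Suc q) \<psi>" and \<phi>: "agree p q \<phi> (\<lambda>gs g as. c *\<^sub>R op_k G V W \<tau> \<psi> gs g as)"
    and x: "x \<in> Obj G"
  shows "\<exists>P. openin (mtop (arrows G)) P \<and> idt G x \<in> P \<and> (\<forall>gs m ws. m \<in> Obj G \<and> (gs, idt G m) \<in> epts p P \<and>
     length ws = Suc q \<and> set ws \<subseteq> algebroid G m \<longrightarrow> op_d G V \<phi> gs (idt G m) ws = c *\<^sub>R \<psi> gs (idt G m) ws)"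
proof -
  obtain Q where Q: "openin (mtop (arrows G)) Q" "idt G x \<in> Q" "smooth_on p (Suc q) \<psi> Q"
    using \<psi> x by (auto simp: smooth_dc_def)
  obtain R where R: "openin (mtop (arrows G)) R" "idt G x \<in> R"
    "\<And>gs g as. (gs, g) \<in> epts p R \<Longrightarrow> length as = q \<Longrightarrow> set as \<subseteq> algebroid G (src G g) \<Longrightarrow>
      \<phi> gs g as = c *\<^sub>R op_k G V W \<tau> \<psi> gs g as"
    by (rule agreeE[OF \<phi> x]) (rule that)
  obtain P0 where P0: "openin (mtop (arrows G)) P0" "idt G x \<in> P0" "P0 \<subseteq> \<tau> ` W"
     "\<And>g t. g \<in> P0 \<Longrightarrow> t \<in> {0..1} \<Longrightarrow> lam t g \<in> Q"
    using retraction_near_unit[OF x Q(1,2)] by blast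
  define P where "P = P0 \<inter> R"
  have Po: "openin (mtop (arrows G)) P" "idt G x \<in> P" and PT: "P \<subseteq> \<tau> ` W"
    and PQ: "\<And>g t. g \<in> P \<Longrightarrow> t \<in> {0..1} \<Longrightarrow> lam t g \<in> Q" and PR: "P \<subseteq> R"
    using P0 R by (auto simp: P_def)
  have "op_d G V \<phi> gs (idt G m) ws = c *\<^sub>R \<psi> gs (idt G m) ws"
    if m: "m \<in> Obj G" and e: "(gs, idt G m) \<in> epts p P" and ws: "length ws = Suc q" "set ws \<subseteq> algebroid G m" for gs m ws
  proof -
    define F where "F = (SOME F. fibre_map_through G (idt G m) ws F)"
    have F: "fibre_map_through G (idt G m) ws F"
      unfolding F_def using fibre_map_exists[OF m ws(2)] by (rule someI_ex)
    have \<phi>': "\<phi> gs h as = c *\<^sub>R op_k G V W \<tau> \<psi> gs h as"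
      if "(gs, h) \<in> epts p P" "length as = q" "set as \<subseteq> algebroid G (src G h)" for h as
      using R(3) that epts_mono[OF PR] by blast
    have len: "length gs = p" using e by (simp add: epts_def)
    have f: "alt_form m (Suc q) (\<psi> gs (idt G m))"
      using smooth_on_alt[OF Q(3), of gs "idt G m"] e epts_mono[OF P_Q[OF Q(3,1) PT PQ]] m by auto
    have "d_Rh G (to_form G V \<phi> gs) (idt G m) ws = (\<Sum>k<Suc q. (-1) ^ k *\<^sub>R
        ((-1) ^ p * c / real (Suc q)) *\<^sub>R \<psi> gs (idt G m) (ws ! k # take k ws @ drop (Suc k) ws))"
      unfolding d_Rh_def F_def[symmetric] Let_def ws(1)
    proof (rule sum.cong[OF refl])
      fix k assume "k \<in> {..<Suc q}"
      then have "k < Suc q" by simp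
      from vector_derivative_at[OF fibre_map_derivative[where \<phi> = \<phi> and c = c, OF Q(3,1) PT Po(1) PQ m e \<phi>' ws F this]]
      show "(-1) ^ k *\<^sub>R vector_derivative (\<lambda>r. to_form G V \<phi> gs (F (axis_pt k r))
          (map (coord_velocity (arrows G) F (axis_pt k r)) ([0..<k] @ [Suc k..<Suc q]))) (at 0) =
        (-1) ^ k *\<^sub>R ((-1) ^ p * c / real (Suc q)) *\<^sub>R \<psi> gs (idt G m) (ws ! k # take k ws @ drop (Suc k) ws)"
        by (simp only:)
    qed
    also have "\<dots> = (\<Sum>k<Suc q. ((-1) ^ p * c / real (Suc q)) *\<^sub>R \<psi> gs (idt G m) ws)"
    proof (rule sum.cong[OF refl])
      fix k assume "k \<in> {..<Suc q}"
      then have "k < Suc q" by simp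
      from alt_form_front[OF f m ws this]
      show "(-1) ^ k *\<^sub>R ((-1) ^ p * c / real (Suc q)) *\<^sub>R \<psi> gs (idt G m) (ws ! k # take k ws @ drop (Suc k) ws) =
        ((-1) ^ p * c / real (Suc q)) *\<^sub>R \<psi> gs (idt G m) ws" by simp
    qed
    \<comment> \<open>There are \<open>Suc q\<close> equal terms, which cancels the factor
      \<open>1 / Suc q\<close> from the integral of \<open>t ^ q\<close>.\<close>
    also have "\<dots> = (-1) ^ p *\<^sub>R c *\<^sub>R \<psi> gs (idt G m) ws"
      by (simp add: sum_constant_scaleR del: of_nat_Suc)
    \<comment> \<open>The sign of the vertical differential meets the equal sign built into
      \<open>k\<close>.\<close>
    finally have d: "(-1) ^ p *\<^sub>R d_Rh G (to_form G V \<phi> gs) (idt G m) ws = c *\<^sub>R \<psi> gs (idt G m) ws" by simp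
    have "map (push G (mlt G (idt G m)) (idt G m)) ws = ws"
      by (rule map_idI) (use push_left_idt[OF m] ws in auto)
    then have "op_d G V \<phi> gs (idt G m) ws = act V (idt G m) (c *\<^sub>R \<psi> gs (idt G m) ws)"
      unfolding op_d_def from_form_def using m len d by simp
    then show ?thesis using act_idt[OF m fibre_scale[OF m alt_form_mem[OF f ws]]] by simp
  qed
  then show ?thesis using Po by blast
qed

text \<open>The zigzag of \<open>VE\<close> cut after an \<open>h\<close> rather than after a
  \<open>d\<close>: at these places it can be compared with \<open>k\<close> applied to the zigzag
  of \<open>RG\<close>, on a full neighbourhood.\<close>

definition descent :: "('g list \<Rightarrow> 'm \<Rightarrow> 'v) \<Rightarrow> nat \<Rightarrow> ('g, 'v) dcochain" where
  "descent \<sigma> n = op_h G (((op_d G V \<circ> op_h G) ^^ n) (op_j G V \<sigma>))"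

lemma descent_Suc: "descent \<sigma> (Suc n) = op_h G (op_d G V (descent \<sigma> n))"
  by (simp add: descent_def)

lemma h_zig_Suc:
  assumes \<alpha>: "\<alpha> \<in> algebroid_cochains G V q" and n: "n < q"
  shows "agree n (q - Suc n) (op_h G (zig \<alpha> (Suc n))) (op_k G V W \<tau> (zig \<alpha> n))"
proof -
  have "smooth_dc n (Suc (q - Suc n)) (zig \<alpha> n)" using smooth_dc_zig[OF \<alpha>, of n] n by (simp add: Suc_diff_Suc)
  then show ?thesis unfolding zig_Suc by (rule h_delta_k)
qed

text \<open>Both operators \<open>j q\<close> and \<open>d k\<close> become the identity when followed by \<open>h\<close>, because \<open>h\<close> restricts the last
  argument to the units; this is what makes the two zigzags cancel step by step.\<close>

lemma descent_agree_zig: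
  assumes \<alpha>: "\<alpha> \<in> algebroid_cochains G V q"
    and \<sigma>: "\<sigma> \<in> germ G q (\<lambda>gs m. (-1) ^ q *\<^sub>R op_q G V (zig \<alpha> q) gs m)"
  shows "n < q \<Longrightarrow> agree (q - Suc n) n (descent \<sigma> n) (\<lambda>gs g as. (-1) ^ q *\<^sub>R op_k G V W \<tau> (zig \<alpha> (q - Suc n)) gs g as)"
proof (induction n)
  case 0
  show ?case unfolding agree_def
  proof
    fix x assume x: "x \<in> Obj G"
    obtain p where q: "q = Suc p" using 0 by (cases q) auto
    obtain R where R: "openin (mtop (arrows G)) R" "idt G x \<in> R"
      "\<And>gs m. (gs, m) \<in> near_units G q R \<Longrightarrow> \<sigma> gs m = (-1) ^ q *\<^sub>R op_q G V (zig \<alpha> q) gs m"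
      by (rule germE[OF \<sigma> x]) (rule that)
    have "smooth_dc q 0 (zig \<alpha> q)" using smooth_dc_zig[OF \<alpha>, of q] by simp
    then obtain Q where Q: "openin (mtop (arrows G)) Q" "idt G x \<in> Q" "smooth_on q 0 (zig \<alpha> q) Q"
      using x by (auto simp: smooth_dc_def)
    have ag: "agree p 0 (op_h G (zig \<alpha> q)) (op_k G V W \<tau> (zig \<alpha> p))" using h_zig_Suc[OF \<alpha>, of p] q by simp
    obtain T where T: "openin (mtop (arrows G)) T" "idt G x \<in> T"
      "\<And>gs g as. (gs, g) \<in> epts p T \<Longrightarrow> length as = 0 \<Longrightarrow> set as \<subseteq> algebroid G (src G g) \<Longrightarrow>
        op_h G (zig \<alpha> q) gs g as = op_k G V W \<tau> (zig \<alpha> p) gs g as"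
      by (rule agreeE[OF ag x]) (rule that)
    \<comment> \<open>On \<open>R\<close> the representative \<sigma> is known, on \<open>Q\<close>
      the zigzag takes values in \<open>V\<close>, on \<open>T\<close> the identity
      \<open>h \<delta> k = k\<close> holds.\<close>
    have "openin (mtop (arrows G)) (R \<inter> Q)" "idt G x \<in> R \<inter> Q" using R Q by auto
    from idt_map_near_unit[OF x this] obtain P where P: "openin (mtop (arrows G)) P" "idt G x \<in> P" "P \<subseteq> R \<inter> Q"
      "\<And>g. g \<in> P \<Longrightarrow> idt G (src G g) \<in> R \<inter> Q" by blast
    have RA: "R \<subseteq> Arr G" using openin_subset[OF R(1)] .
    have "descent \<sigma> 0 gs g as = (-1) ^ q *\<^sub>R op_k G V W \<tau> (zig \<alpha> p) gs g as"
      if e: "(gs, g) \<in> epts p (P \<inter> T)" and as: "length as = 0" "set as \<subseteq> algebroid G (src G g)" for gs g as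
    proof -
      let ?m = "src G g" let ?l = "gs @ [g]"
      have gP: "g \<in> P" "length gs = p" using e by (auto simp: epts_def)
      then have m: "?m \<in> Obj G" using P(3) RA by auto
      have "(gs, g) \<in> epts p P" using e epts_mono[of "P \<inter> T" P] by auto
      then have e': "(?l, idt G ?m) \<in> epts q (R \<inter> Q)"
        unfolding q by (rule epts_snoc[OF _ P(3) P(4)[OF gP(1)]]) (use P(3) RA in auto)
      have eQ: "(?l, idt G ?m) \<in> epts q Q" and eR: "(?l, idt G ?m) \<in> epts q R"
        using e' epts_mono[of "R \<inter> Q"] by auto
      have z: "zig \<alpha> q ?l (idt G ?m) [] \<in> fibre V ?m"
        using alt_form_mem[OF smooth_on_alt[OF Q(3) eQ], of "[]"] m by simp
      have "\<sigma> ?l ?m = (-1) ^ q *\<^sub>R op_q G V (zig \<alpha> q) ?l ?m" by (rule R(3)[OF epts_near_units[OF eR m RA]])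
      also have "op_q G V (zig \<alpha> q) ?l ?m = zig \<alpha> q ?l (idt G ?m) []"
        using act_idt[OF m z] by (simp add: op_q_def to_form_def)
      finally have s: "\<sigma> ?l ?m = (-1) ^ q *\<^sub>R zig \<alpha> q ?l (idt G ?m) []" .
      \<comment> \<open>The sign is that of \<open>h\<close> on bidegree \<open>(q, 0)\<close>. The
        operator \<open>j\<close>, taken at a unit, acts on \<open>V\<close> through that unit, i.e.
        trivially.\<close>
      have "descent \<sigma> 0 gs g as = (-1) ^ q *\<^sub>R act V (idt G ?m) (\<sigma> ?l ?m)"
        using as m gP(2) by (simp add: descent_def op_h_def op_j_def q)
      also have "\<dots> = (-1) ^ q *\<^sub>R op_h G (zig \<alpha> q) gs g as"
        unfolding s act_idt[OF m fibre_scale[OF m z]] using as gP(2) by (simp add: op_h_def q)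
      also have "op_h G (zig \<alpha> q) gs g as = op_k G V W \<tau> (zig \<alpha> p) gs g as"
        using T(3)[OF _ as] e epts_mono[of "P \<inter> T" T] by auto
      finally show ?thesis .
    qed
    then show "\<exists>Q. openin (mtop (arrows G)) Q \<and> idt G x \<in> Q \<and>
      (\<forall>gs g as. (gs, g) \<in> epts (q - Suc 0) Q \<and> length as = 0 \<and> set as \<subseteq> algebroid G (src G g) \<longrightarrow>
        descent \<sigma> 0 gs g as = (-1) ^ q *\<^sub>R op_k G V W \<tau> (zig \<alpha> (q - Suc 0)) gs g as)"
      using P T q by (intro exI[of _ "P \<inter> T"]) auto
  qed
next
  case (Suc n)
  show ?case unfolding agree_def
  proof
    fix x assume x: "x \<in> Obj G"
    define p where "p = q - Suc (Suc n)"
    have p: "q - Suc n = Suc p" "p < q" "q - Suc p = Suc n" "Suc p \<le> q" using Suc.prems by (auto simp: p_def)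
    have IH: "agree (Suc p) n (descent \<sigma> n) (\<lambda>gs g as. (-1) ^ q *\<^sub>R op_k G V W \<tau> (zig \<alpha> (Suc p)) gs g as)"
      using Suc p by simp
    have "smooth_dc (Suc p) (Suc n) (zig \<alpha> (Suc p))" using smooth_dc_zig[OF \<alpha>, of "Suc p"] p by simp
    \<comment> \<open>The constant is \<open>c = (-1) ^ q\<close>. The identity thus obtained holds
      at units in the last argument, and \<open>h\<close> in \<open>descent_Suc\<close> reads no
      other values.\<close>
    from op_d_at_units[OF this IH x] obtain R where R: "openin (mtop (arrows G)) R" "idt G x \<in> R"
      "\<And>gs m ws. m \<in> Obj G \<Longrightarrow> (gs, idt G m) \<in> epts (Suc p) R \<Longrightarrow> length ws = Suc n \<Longrightarrow> set ws \<subseteq> algebroid G m \<Longrightarrow>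
        op_d G V (descent \<sigma> n) gs (idt G m) ws = (-1) ^ q *\<^sub>R zig \<alpha> (Suc p) gs (idt G m) ws" by blast
    have ag: "agree p (Suc n) (op_h G (zig \<alpha> (Suc p))) (op_k G V W \<tau> (zig \<alpha> p))"
      using h_zig_Suc[OF \<alpha> p(2)] p by simp
    obtain T where T: "openin (mtop (arrows G)) T" "idt G x \<in> T"
      "\<And>gs g as. (gs, g) \<in> epts p T \<Longrightarrow> length as = Suc n \<Longrightarrow> set as \<subseteq> algebroid G (src G g) \<Longrightarrow>
        op_h G (zig \<alpha> (Suc p)) gs g as = op_k G V W \<tau> (zig \<alpha> p) gs g as"
      by (rule agreeE[OF ag x]) (rule that)
    from idt_map_near_unit[OF x R(1,2)] obtain P where P: "openin (mtop (arrows G)) P" "idt G x \<in> P" "P \<subseteq> R"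
      "\<And>g. g \<in> P \<Longrightarrow> idt G (src G g) \<in> R" by blast
    have RA: "R \<subseteq> Arr G" using openin_subset[OF R(1)] .
    have "descent \<sigma> (Suc n) gs g as = (-1) ^ q *\<^sub>R op_k G V W \<tau> (zig \<alpha> p) gs g as"
      if e: "(gs, g) \<in> epts p (P \<inter> T)" and as: "length as = Suc n" "set as \<subseteq> algebroid G (src G g)" for gs g as
    proof -
      let ?m = "src G g" let ?l = "gs @ [g]"
      have gP: "g \<in> P" "length gs = p" using e by (auto simp: epts_def)
      then have m: "?m \<in> Obj G" using P(3) RA by auto
      have "(gs, g) \<in> epts p P" using e epts_mono[of "P \<inter> T" P] by auto
      then have e': "(?l, idt G ?m) \<in> epts (Suc p) R"
        by (rule epts_snoc[OF _ P(3) P(4)[OF gP(1)]]) (use P(3) RA in auto)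
      have "descent \<sigma> (Suc n) gs g as = (-1) ^ q *\<^sub>R op_h G (zig \<alpha> (Suc p)) gs g as"
        unfolding descent_Suc op_h_def R(3)[OF m e' as] by (simp add: mult.commute)
      also have "op_h G (zig \<alpha> (Suc p)) gs g as = op_k G V W \<tau> (zig \<alpha> p) gs g as"
        using T(3)[OF _ as] e epts_mono[of "P \<inter> T" T] by auto
      finally show ?thesis .
    qed
    then show "\<exists>Q. openin (mtop (arrows G)) Q \<and> idt G x \<in> Q \<and>
      (\<forall>gs g as. (gs, g) \<in> epts (q - Suc (Suc n)) Q \<and> length as = Suc n \<and> set as \<subseteq> algebroid G (src G g) \<longrightarrow>
        descent \<sigma> (Suc n) gs g as = (-1) ^ q *\<^sub>R op_k G V W \<tau> (zig \<alpha> (q - Suc (Suc n))) gs g as)"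
      unfolding p_def[symmetric] using P T by (intro exI[of _ "P \<inter> T"]) auto
  qed
qed

section \<open>The composite is the identity\<close>

lemma VE_RG:
  assumes \<alpha>: "\<alpha> \<in> algebroid_cochains G V q"
  shows "VE G V q (RG G V W \<tau> q \<alpha>) = \<alpha>"
proof (intro ext)
  fix m as
  define \<sigma> where "\<sigma> = (SOME \<sigma>. \<sigma> \<in> RG G V W \<tau> q \<alpha>)"
  have RG: "RG G V W \<tau> q \<alpha> = germ G q (\<lambda>gs m. (-1) ^ q *\<^sub>R op_q G V (zig \<alpha> q) gs m)"
    by (simp add: RG_def zig_def)
  \<comment> \<open>The germ is nonempty, so \<open>VE\<close> really works with one of its
    elements; which one is left open.\<close>
  have "(\<lambda>gs m. (-1) ^ q *\<^sub>R op_q G V (zig \<alpha> q) gs m) \<in> RG G V W \<tau> q \<alpha>"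
    unfolding RG germ_def by (auto intro!: exI[of _ "Arr G"])
  then have \<sigma>: "\<sigma> \<in> germ G q (\<lambda>gs m. (-1) ^ q *\<^sub>R op_q G V (zig \<alpha> q) gs m)"
    unfolding \<sigma>_def RG[symmetric] by (rule someI[of "\<lambda>\<sigma>. \<sigma> \<in> RG G V W \<tau> q \<alpha>"])
  show "VE G V q (RG G V W \<tau> q \<alpha>) m as = \<alpha> m as"
  proof (cases "m \<in> Obj G \<and> length as = q \<and> set as \<subseteq> algebroid G m")
    case False
    then have "\<alpha> m as = 0" using \<alpha> by (simp add: algebroid_cochains_def)
    then show ?thesis using False unfolding VE_def by (simp only: Let_def if_False)
  next
    case True
    then have m: "m \<in> Obj G" and as: "length as = q" "set as \<subseteq> algebroid G m" by auto
    have mem: "\<alpha> m as \<in> fibre V m" by (rule alt_form_mem[OF algebroid_cochain_alt_form[OF \<alpha> m] as])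
    have VE: "VE G V q (RG G V W \<tau> q \<alpha>) m as =
        (-1) ^ q *\<^sub>R op_p G (((op_d G V \<circ> op_h G) ^^ q) (op_j G V \<sigma>)) m as"
      using True by (simp add: VE_def \<sigma>_def[symmetric] Let_def)
    \<comment> \<open>The sign inherited from \<open>RG\<close> remains here and cancels against the
      one in \<open>VE\<close>.\<close>
    have "op_p G (((op_d G V \<circ> op_h G) ^^ q) (op_j G V \<sigma>)) m as = (-1) ^ q *\<^sub>R \<alpha> m as"
    proof (cases q)
      \<comment> \<open>In degree 0 neither \<open>h\<close> nor \<open>k\<close> is applied, so no
        homotopy is involved and \<open>p j q i \<alpha> = \<alpha>\<close> is checked
        directly.\<close>
      case 0
      obtain Q where Q: "openin (mtop (arrows G)) Q" "idt G m \<in> Q"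
        "\<And>gs m. (gs, m) \<in> near_units G 0 Q \<Longrightarrow> \<sigma> gs m = (-1) ^ 0 *\<^sub>R op_q G V (zig \<alpha> 0) gs m"
        by (rule germE[OF \<sigma>[unfolded 0] m]) (rule that)
      have "([], m) \<in> near_units G 0 Q" using m Q(2) by (simp add: near_units_def composable_def)
      from Q(3)[OF this] have "\<sigma> [] m = op_q G V (zig \<alpha> 0) [] m" by simp
      also have "\<dots> = \<alpha> m as"
        using as 0 m mem act_idt[OF m] by (simp add: op_q_def to_form_def zig_0 op_i_def)
      finally show ?thesis using as 0 m mem act_idt[OF m] by (simp add: op_p_def op_j_def)
    next
      case (Suc n)
      \<comment> \<open>With \<open>q = Suc n\<close> the descent has reached bidegree
        \<open>(0, n)\<close>. One more \<open>d\<close> remains, and \<open>p\<close> evaluates it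
        at a unit, so \<open>op_d_at_units\<close> applies a last time.\<close>
      have IH: "agree 0 n (descent \<sigma> n) (\<lambda>gs g as. (-1) ^ q *\<^sub>R op_k G V W \<tau> (zig \<alpha> 0) gs g as)"
        using descent_agree_zig[OF \<alpha> \<sigma>, of n] Suc by simp
      have "smooth_dc 0 (Suc n) (zig \<alpha> 0)" using smooth_dc_zig[OF \<alpha>, of 0] Suc by simp
      from op_d_at_units[OF this IH m] obtain P where P: "idt G m \<in> P"
        "\<And>gs ws. (gs, idt G m) \<in> epts 0 P \<Longrightarrow> length ws = Suc n \<Longrightarrow> set ws \<subseteq> algebroid G m \<Longrightarrow>
          op_d G V (descent \<sigma> n) gs (idt G m) ws = (-1) ^ q *\<^sub>R zig \<alpha> 0 gs (idt G m) ws"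
        using m by blast
      have "op_d G V (descent \<sigma> n) [] (idt G m) as = (-1) ^ q *\<^sub>R zig \<alpha> 0 [] (idt G m) as"
        by (rule P(2)) (use P(1) as Suc in \<open>auto simp: epts_def\<close>)
      then show ?thesis using m by (simp add: op_p_def Suc descent_def zig_0 op_i_def)
    qed
    then show ?thesis by (simp add: VE)
  qed
qed

end

theorem proposition4p7:
  fixes G :: "('g, 'm) groupoid"
    and V :: "('g, 'm, 'v::banach) rep_bundle"
    and W :: "('m \<times> 'g tvec) set"
    and \<tau> :: "'m \<times> 'g tvec \<Rightarrow> 'g"
  assumes "lie_groupoid G"
    and "lie_representation G V"
    and "tubular_structure G W \<tau>"
  shows "\<forall>q. \<forall>\<alpha>\<in>algebroid_cochains G V q.
    RG G V W \<tau> q \<alpha> \<in> groupoid_cochains G V q \<and> VE G V q (RG G V W \<tau> q \<alpha>) = \<alpha>"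
proof -
  interpret tubular_rep G W \<tau> V
    using assms by unfold_locales
  show ?thesis using RG_groupoid_cochain VE_RG by blast
qed

end
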